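(* Let $\mathscr{V}_{n+1,3}$ be the typical cell of the spherical Voronoi tessellation generated by $n+1$ independent uniformly distributed random points on the unit sphere $\mathbb{S}^3\subset\mathbb{R}^{4}$. For all $n\geq 4$ we have \begin{align*} \mathbb{E} f_0(\mathscr{V}_{n+1,3})&=\frac{256}{35\pi}\Big(\frac{1}{2\pi}\Big)^{n-3}\binom n3\int_{-\pi/2}^{+\pi/2}(\cos x)^8\,(2x+\sin(2x)+\pi)^{n-3}\,dx,\\ \mathbb{E} f_1(\mathscr{V}_{n+1,3})&=\frac32\,\mathbb{E} f_0(\mathscr{V}_{n+1,3}),\\ \mathbb{E} f_2(\mathscr{V}_{n+1,3})&=\frac12\,\mathbb{E} f_0(\mathscr{V}_{n+1,3})+2. \end{align*}
   Context: In the following $d=3$. Let $\mathbb{S}^d$ be the unit sphere in $\mathbb{R}^{d+1}$ centred at the origin, $\sigma_d$ the normalized (probability) spherical Lebesgue measure on it, $\rho$ the geodesic distance on $\mathbb{S}^d$, and $e=(1,0,\ldots,0)\in\mathbb{S}^d$ the north pole. Spherical Voronoi tessellation: for $m\in\mathbb{N}$ let $X_1,\ldots,X_m$ be independent random points on $\mathbb{S}^d$ with distribution $\sigma_d$. The Voronoi cells are $C_{i,m}:=\{z\in\mathbb{S}^d:\rho(X_i,z)\leq\rho(X_j,z)\text{ for all }j\in\{1,\ldots,m\}\}$, $i\in\{1,\ldots,m\}$. Typical cell: for every $v\in\mathbb{S}^d$ fix an orthogonal transformation $O_v:\mathbb{R}^{d+1}\to\mathbb{R}^{d+1}$ with $O_v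 v=e$ whose matrix entries are Borel functions of $v$. Let $N$ be uniformly distributed on $\{1,\ldots,m\}$, independent of $X_1,\ldots,X_m$. The typical cell is the random spherical polytope $\mathscr{V}_{m,d}:=O_{X_N}C_{N,m}$. Faces: a spherical polytope $P$ is the intersection of $\mathbb{S}^d$ with a polyhedral convex cone $C\subset\mathbb{R}^{d+1}$ (a finite intersection of closed half-spaces whose bounding hyperplanes contain the origin). The $k$-dimensional faces of $P$ are the intersections of the $(k+1)$-dimensional faces of $C$ with $\mathbb{S}^d$, $k\in\{0,\ldots,d\}$; $f_k(P)$ is their number. *)

theory Defs
  imports "HOL-Probability.Probability"
begin

section \<open>Spherical Lebesgue measure\<close>

abbreviation sphere_borel :: "'a::euclidean_space measure" where
  "sphere_borel \<equiv> restrict_space borel (sphere 0 1)"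

text \<open>
  Polar coordinates: on the unit sphere of a \<open>D\<close>-dimensional space, the surface measure of \<open>A\<close>
  is \<open>D\<close> times the volume of the cone \<open>{r *\<^sub>R x | 0 < r < 1, x \<in> A}\<close>, which is the preimage
  of \<open>A\<close> under \<^term>\<open>sgn\<close> (\<open>x \<mapsto> x /\<^sub>R norm x\<close>) in the punctured unit ball.
\<close>

definition spherical_lebesgue :: "'a::euclidean_space measure" where
  "spherical_lebesgue =
     scale_measure (of_nat DIM('a))
       (distr (restrict_space lborel (ball 0 1 - {0})) sphere_borel sgn)"

definition sphere_unif :: "'a::euclidean_space measure" where
  "sphere_unif = uniform_measure spherical_lebesgue (sphere 0 1)"

lemma space_spherical_lebesgue [simp]:
  "space (spherical_lebesgue :: 'a::euclidean_space measure) = sphere 0 1"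
  by (simp add: spherical_lebesgue_def space_scale_measure space_restrict_space)

lemma sets_spherical_lebesgue [simp, measurable_cong]: "sets spherical_lebesgue = sets sphere_borel"
  by (simp add: spherical_lebesgue_def)

lemma space_sphere_unif [simp]:
  "space (sphere_unif :: 'a::euclidean_space measure) = sphere 0 1"
  by (simp add: sphere_unif_def)

lemma sets_sphere_unif [simp, measurable_cong]: "sets sphere_unif = sets sphere_borel"
  by (simp add: sphere_unif_def)

lemma measurable_sgn_punctured_ball:
  "sgn \<in> restrict_space lborel (ball 0 1 - {0}) \<rightarrow>\<^sub>M (sphere_borel :: 'a::euclidean_space measure)"
proof (rule measurable_restrict_space2)
  show "sgn \<in> space (restrict_space lborel (ball (0::'a) 1 - {0})) \<rightarrow> sphere 0 1"
    by (auto simp: space_restrict_space norm_sgn)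
  show "sgn \<in> restrict_space lborel (ball (0::'a) 1 - {0}) \<rightarrow>\<^sub>M borel"
    by (rule measurable_restrict_space1) (simp add: sgn_div_norm)
qed

lemma emeasure_spherical_lebesgue_sphere:
  "emeasure spherical_lebesgue (sphere (0::'a::euclidean_space) 1) =
     of_nat DIM('a) * emeasure lborel (ball (0::'a) 1)"
proof -
  have "sphere (0::'a) 1 \<in> sets sphere_borel"
    by (metis sets.top space_restrict_space2 space_borel borel_closed closed_sphere sets_restrict_space_iff
        Int_UNIV_right space_restrict_space inf_commute inf_top.left_neutral)
  moreover have "sgn -` sphere 0 1 \<inter> (ball (0::'a) 1 - {0}) = ball 0 1 - {0}"
    by (auto simp: norm_sgn)
  moreover have "emeasure lborel (ball (0::'a) 1 - {0}) = emeasure lborel (ball (0::'a) 1)"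
    by (simp add: emeasure_Diff_null_set null_setsI)
  ultimately show ?thesis
    by (simp add: spherical_lebesgue_def emeasure_distr[OF measurable_sgn_punctured_ball]
        space_restrict_space emeasure_restrict_space)
qed

lemma prob_space_sphere_unif: "prob_space (sphere_unif :: 'a::euclidean_space measure)"
  unfolding sphere_unif_def
proof (rule prob_space_uniform_measure)
  have "emeasure lborel (ball (0::'a) 1) \<noteq> 0" 
    by (simp add: emeasure_lborel_ball_finite emeasure_ball unit_ball_vol_pos less_imp_neq
        ennreal_eq_0_iff not_le)
  then show "emeasure spherical_lebesgue (sphere (0::'a) 1) \<noteq> 0"
    by (simp add: emeasure_spherical_lebesgue_sphere)
  show "emeasure spherical_lebesgue (sphere (0::'a) 1) \<noteq> \<infinity>"
    using emeasure_lborel_ball_finite[of "0::'a" 1]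
    by (simp add: emeasure_spherical_lebesgue_sphere ennreal_mult_eq_top_iff less_top)
qed


section \<open>Spherical Voronoi tessellations and their typical cell\<close>

text \<open>The angle formula gives the geodesic distance only for unit vectors.\<close>

definition geodesic_dist :: "'a::real_inner \<Rightarrow> 'a \<Rightarrow> real" where
  "geodesic_dist x y = arccos (x \<bullet> y)"

definition voronoi_cell :: "nat \<Rightarrow> (nat \<Rightarrow> 'a::real_inner) \<Rightarrow> nat \<Rightarrow> 'a set" where
  "voronoi_cell m x i =
     {z \<in> sphere 0 1. \<forall>j\<in>{1..m}. geodesic_dist (x i) z \<le> geodesic_dist (x j) z}"

definition north_pole :: "real^4" where
  "north_pole = axis 1 1"

definition pole_rotation :: "(real^4 \<Rightarrow> real^4 \<Rightarrow> real^4) \<Rightarrow> bool" where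
  "pole_rotation R \<longleftrightarrow>
     (\<forall>v\<in>sphere 0 1. orthogonal_transformation (R v) \<and> R v v = north_pole) \<and>
     (\<forall>i j. (\<lambda>v. matrix (R v) $ i $ j) \<in> borel_measurable sphere_borel)"

definition typical_cell ::
    "nat \<Rightarrow> (real^4 \<Rightarrow> real^4 \<Rightarrow> real^4) \<Rightarrow> (nat \<Rightarrow> 'w \<Rightarrow> real^4) \<Rightarrow> ('w \<Rightarrow> nat) \<Rightarrow> 'w \<Rightarrow> (real^4) set" where
  "typical_cell m R X N \<omega> =
     R (X (N \<omega>) \<omega>) ` voronoi_cell m (\<lambda>i. X i \<omega>) (N \<omega>)"


section \<open>Faces of spherical polytopes\<close>

definition polyhedral_cone :: "'a::euclidean_space set \<Rightarrow> bool" where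
  "polyhedral_cone C \<longleftrightarrow>
     (\<exists>H. finite H \<and> C = \<Inter>H \<and> (\<forall>h\<in>H. \<exists>a. a \<noteq> 0 \<and> h = {x. a \<bullet> x \<le> 0}))"

text \<open>
  The cone \<open>C\<close> with \<open>P = C \<inter> sphere 0 1\<close> is unique, see \<open>sphere_faces_eq\<close> below.
  \<^term>\<open>F face_of C\<close> allows \<open>F = C\<close>, so a full-dimensional \<open>P\<close> is a face of itself.
\<close>

definition sphere_faces :: "nat \<Rightarrow> 'a::euclidean_space set \<Rightarrow> 'a set set" where
  "sphere_faces k P =
     {F \<inter> sphere 0 1 | F. \<exists>C. polyhedral_cone C \<and> P = C \<inter> sphere 0 1 \<and>
        F face_of C \<and> aff_dim F = int (k + 1)}"

definition f_num :: "nat \<Rightarrow> 'a::euclidean_space set \<Rightarrow> nat" where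
  "f_num k P = card (sphere_faces k P)"

lemma polyhedral_cone_scaleR:
  assumes "polyhedral_cone C" "x \<in> C" "0 \<le> c"
  shows "c *\<^sub>R x \<in> C"
proof -
  obtain H where H: "C = \<Inter>H" "\<forall>h\<in>H. \<exists>a. a \<noteq> 0 \<and> h = {x. a \<bullet> x \<le> 0}"
    using assms(1) unfolding polyhedral_cone_def by blast
  have "c *\<^sub>R x \<in> h" if h: "h \<in> H" for h
  proof -
    obtain a where "h = {x. a \<bullet> x \<le> 0}" using H(2) h by blast
    moreover have "x \<in> h" using assms(2) H(1) h by blast
    ultimately show ?thesis using assms(3) by (simp add: mult_nonneg_nonpos)
  qed
  then show ?thesis using H(1) by blast
qed

lemma polyhedral_cone_zero: "polyhedral_cone C \<Longrightarrow> 0 \<in> C"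
  by (force simp: polyhedral_cone_def)

lemma polyhedral_cone_subset:
  assumes "polyhedral_cone C" "polyhedral_cone D" "C \<inter> sphere 0 1 \<subseteq> D"
  shows "C \<subseteq> D"
proof
  fix x assume x: "x \<in> C"
  show "x \<in> D"
  proof (cases "x = 0")
    case True
    then show ?thesis using assms(2) polyhedral_cone_zero by blast
  next
    case False
    have "inverse (norm x) *\<^sub>R x \<in> C"
      using x assms(1) polyhedral_cone_scaleR by force
    then have "inverse (norm x) *\<^sub>R x \<in> D" using assms(3) False by auto
    then have "norm x *\<^sub>R (inverse (norm x) *\<^sub>R x) \<in> D"
      using assms(2) polyhedral_cone_scaleR norm_ge_zero by blast
    then show ?thesis using False by simp
  qed
qed

lemma sphere_faces_eq:
  assumes "polyhedral_cone C"
  shows "sphere_faces k (C \<inter> sphere 0 1) =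
           {F \<inter> sphere 0 1 | F. F face_of C \<and> aff_dim F = int (k + 1)}"
proof -
  have "D = C" if "polyhedral_cone D" "C \<inter> sphere 0 1 = D \<inter> sphere 0 1" for D
    using that assms polyhedral_cone_subset[of C D] polyhedral_cone_subset[of D C] by blast
  then show ?thesis using assms unfolding sphere_faces_def by blast
qed

end

theory Submission
  imports Defs
begin

text \<open>
  The Voronoi cell of \<open>X\<^sub>i\<close> is the trace on the sphere of the cone cut out by the half-spaces
  \<open>(X\<^sub>j - X\<^sub>i) \<bullet> z \<le> 0\<close>, \<open>j \<noteq> i\<close>, and almost surely the normals of these half-spaces are in general
  position. The faces of such a cone of dimension \<open>k + 1\<close> correspond to the sets of \<open>3 - k\<close>
  constraints that can be tight while all the others are slack. Every vertex lies on three edges, every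
  edge has two end points, and sweeping a slice of the cone with a generic linear functional gives
  Euler's relation; hence \<open>f\<^sub>1\<close> and \<open>f\<^sub>2\<close> are affine functions of \<open>f\<^sub>0\<close>.

  A triple \<open>{a, b, c}\<close> of neighbours yields a vertex of the cell of \<open>X\<^sub>i\<close> exactly if all other points lie on the same
  side of the affine hyperplane through \<open>X\<^sub>i, X\<^sub>a, X\<^sub>b, X\<^sub>c\<close>. If \<open>h\<close> is its signed distance from the
  origin, this has conditional probability \<open>F(h)\<^sup>m + (1 - F(h))\<^sup>m\<close>, where \<open>F\<close> is the normalized area
  of a spherical cap and \<open>m = n - 3\<close>.

  The law of \<open>h\<close> is found by approximating the uniform distribution on the sphere by the densities
  proportional to \<open>(1 - |y|\<^sup>2)\<^bsup>1/k - 1\<^esup>\<close> on the ball, \<open>k \<rightarrow> \<infinity>\<close>. For a density, the affine Blaschke-Petkantschin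
  formula is a linear change of variables in the last coordinates of the four points: the hyperplane is
  the graph of \<open>p \<mapsto> x \<bullet> p + s\<close>, and the Jacobian is the volume of the projected simplex. A ball section
  at height \<open>h\<close> is a scaled copy of the central one, so all powers of \<open>1 - h\<^sup>2\<close> factor out
  and \<open>h\<close> has a density proportional to \<open>(1 - h\<^sup>2)\<^bsup>7/2 + 4/k\<^esup>\<close>. In the limit the exponent is \<open>7/2\<close>, and \<open>h = sin x\<close>
  gives the stated integral.
\<close>

section \<open>Faces of polyhedral cones\<close>

text \<open>The uniform distribution on the sphere has no Lebesgue density, so the change of
  variables from four points to their hyperplane cannot be applied to it directly; this is why
  densities on the ball are interposed. Their exponents tend to -1 while the factor
  \<open>1/k\<close> keeps the total mass bounded, hence all mass moves to the boundary. No
  normalizing constant of the hyperplane step is evaluated: every limit is taken twice, for the test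
  function of interest and for the constant 1, and the unknown factor cancels. The price is that
  test functions have to be continuous and bounded, and that the height of the hyperplane is
  continuous only off a null set. The same argument for one point gives the cap function, with limit
  exponent 1/2 in place of 7/2. The constant 256/(35 pi) is 2 divided by the integral of cos^8 over
  [-pi/2, pi/2], which is 35 pi/128; the 2 appears because the two sides of the hyperplane
  contribute equally under x -> -x. The binomial coefficient counts the triples of neighbours of one
  nucleus, and the average over the n + 1 nuclei has equal terms.\<close>

definition normal_cone :: "'i set \<Rightarrow> ('i \<Rightarrow> 'a::euclidean_space) \<Rightarrow> 'a set" where
  "normal_cone J a = {z. \<forall>j\<in>J. a j \<bullet> z \<le> 0}"

definition tight_flat :: "('i \<Rightarrow> 'a::euclidean_space) \<Rightarrow> 'i set \<Rightarrow> 'a set" where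
  "tight_flat a U = {z. \<forall>j\<in>U. a j \<bullet> z = 0}"

text \<open>Each point of the cone lies in exactly one of these sets, the one whose \<open>U\<close>
  is its set of tight constraints. The nonempty ones are the relative interiors of the nonempty
  faces, so that counting faces becomes counting index sets.\<close>

definition open_face :: "'i set \<Rightarrow> ('i \<Rightarrow> 'a::euclidean_space) \<Rightarrow> 'i set \<Rightarrow> 'a set" where
  "open_face J a U = {z \<in> tight_flat a U. \<forall>j\<in>J - U. a j \<bullet> z < 0}"

lemma subspace_tight_flat: "subspace (tight_flat a U)"
  by (auto simp: tight_flat_def subspace_def inner_add_right)

lemma polyhedral_cone_normal_cone:
  assumes "finite J"
  shows "polyhedral_cone (normal_cone J a)"
  unfolding polyhedral_cone_def
proof (intro exI conjI)
  \<comment> \<open>Zero normals impose no constraint and are dropped, because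
    \<open>polyhedral_cone\<close> only admits half-spaces with nonzero normals.\<close>
  let ?H = "(\<lambda>j. {x. a j \<bullet> x \<le> 0}) ` {j\<in>J. a j \<noteq> 0}"
  show "finite ?H" using assms by simp
  show "normal_cone J a = \<Inter>?H" by (force simp: normal_cone_def)
  show "\<forall>h\<in>?H. \<exists>a. a \<noteq> 0 \<and> h = {x. a \<bullet> x \<le> 0}" by blast
qed

text \<open>A functional that is nonpositive at both ends of a segment and zero at an interior point
  is zero at both ends.\<close>

lemma face_of_normal_cone_flat:
  assumes "U \<subseteq> J"
  shows "normal_cone J a \<inter> tight_flat a U face_of normal_cone J a"
  unfolding face_of_def
proof (intro conjI ballI impI)
  show "convex (normal_cone J a \<inter> tight_flat a U)"
  proof (rule convexI)
    fix x y u v assume "x \<in> normal_cone J a \<inter> tight_flat a U" "y \<in> normal_cone J a \<inter> tight_flat a U" "0 \<le> u" "0 \<le> v" "u + v = (1::real)"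
    then show "u *\<^sub>R x + v *\<^sub>R y \<in> normal_cone J a \<inter> tight_flat a U"
      by (auto simp: normal_cone_def tight_flat_def inner_add_right intro!: add_nonpos_nonpos mult_nonneg_nonpos)
  qed
  fix p q x
  assume p: "p \<in> normal_cone J a" and q: "q \<in> normal_cone J a" and x: "x \<in> normal_cone J a \<inter> tight_flat a U"
    and s: "x \<in> open_segment p q"
  obtain u where u: "0 < u" "u < 1" "x = (1 - u) *\<^sub>R p + u *\<^sub>R q"
    using s by (auto simp: in_segment)
  have "a j \<bullet> p = 0 \<and> a j \<bullet> q = 0" if "j \<in> U" for j
  proof -
    have 1: "(1 - u) * (a j \<bullet> p) + u * (a j \<bullet> q) = 0"
      using x that u by (auto simp: tight_flat_def inner_add_right)
    have 2: "a j \<bullet> p \<le> 0" "a j \<bullet> q \<le> 0" using p q that assms by (auto simp: normal_cone_def)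
    then have "(1 - u) * (a j \<bullet> p) \<le> 0" "u * (a j \<bullet> q) \<le> 0"
      using u by (auto intro!: mult_nonneg_nonpos)
    with 1 have "(1 - u) * (a j \<bullet> p) = 0" "u * (a j \<bullet> q) = 0" by linarith+
    then show ?thesis using u by auto
  qed
  then show "p \<in> normal_cone J a \<inter> tight_flat a U" "q \<in> normal_cone J a \<inter> tight_flat a U"
    using p q by (auto simp: tight_flat_def)
qed auto

lemma open_face_open_flat:
  assumes "finite J"
  shows "open_face J a U = tight_flat a U \<inter> (\<Inter>j\<in>J - U. {z. a j \<bullet> z < 0})" "open (\<Inter>j\<in>J - U. {z. a j \<bullet> z < 0})"
  using assms by (auto simp: open_face_def open_halfspace_lt)

lemma open_face_subset: "U \<subseteq> J \<Longrightarrow> open_face J a U \<subseteq> normal_cone J a \<inter> tight_flat a U"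
  by (force simp: open_face_def normal_cone_def tight_flat_def)

text \<open>The nonempty open face is a relatively open subset of the flat, and such a subset
  already spans it.\<close>

lemma affine_hull_normal_cone_flat:
  assumes "finite J" "U \<subseteq> J" "open_face J a U \<noteq> {}"
  shows "affine hull (normal_cone J a \<inter> tight_flat a U) = tight_flat a U"
proof (rule antisym)
  show "affine hull (normal_cone J a \<inter> tight_flat a U) \<subseteq> tight_flat a U"
    by (rule hull_minimal) (auto intro: subspace_imp_affine subspace_tight_flat)
  have "affine hull (tight_flat a U \<inter> (\<Inter>j\<in>J - U. {z. a j \<bullet> z < 0})) = tight_flat a U"
    using assms open_face_open_flat[OF assms(1), of a U]
      affine_hull_affine_Int_open[OF subspace_imp_affine[OF subspace_tight_flat],
        of "\<Inter>j\<in>J - U. {z. a j \<bullet> z < 0}" a U]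
      affine_hull_eq[of "tight_flat a U"] subspace_imp_affine[OF subspace_tight_flat, of a U]
    by simp
  then show "tight_flat a U \<subseteq> affine hull (normal_cone J a \<inter> tight_flat a U)"
    using open_face_subset[OF assms(2), of a] open_face_open_flat(1)[OF assms(1), of a U]
    by (metis hull_mono)
qed

lemma open_face_rel_interior:
  assumes "finite J" "U \<subseteq> J" "z \<in> open_face J a U"
  shows "z \<in> rel_interior (normal_cone J a \<inter> tight_flat a U)"
  unfolding mem_rel_interior
proof (intro exI conjI)
  let ?T = "\<Inter>j\<in>J - U. {z. a j \<bullet> z < 0}"
  show "open ?T" by (rule open_face_open_flat[OF assms(1)])
  show "z \<in> ?T \<inter> (normal_cone J a \<inter> tight_flat a U)"
    using assms(3) open_face_subset[OF assms(2), of a] by (auto simp: open_face_def)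
  have "affine hull (normal_cone J a \<inter> tight_flat a U) = tight_flat a U"
    using assms affine_hull_normal_cone_flat by blast
  then show "?T \<inter> affine hull (normal_cone J a \<inter> tight_flat a U) \<subseteq> normal_cone J a \<inter> tight_flat a U"
    using open_face_subset[OF assms(2), of a] open_face_open_flat(1)[OF assms(1), of a U] by auto
qed

text \<open>Two faces whose relative interiors meet are equal. Hence a face is recovered from any
  one of its relative interior points, with \<open>U\<close> the constraints tight there.\<close>

lemma face_of_normal_coneE:
  assumes "finite J" "F face_of normal_cone J a" "F \<noteq> {}"
  obtains U where "U \<subseteq> J" "open_face J a U \<noteq> {}" "F = normal_cone J a \<inter> tight_flat a U"
proof -
  have "convex F" using assms(2) by (auto simp: face_of_def)
  then obtain z where z: "z \<in> rel_interior F" using assms(3) rel_interior_eq_empty by blast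
  let ?U = "{j\<in>J. a j \<bullet> z = 0}"
  have zc: "z \<in> normal_cone J a"
    using z rel_interior_subset face_of_imp_subset[OF assms(2)] by blast
  have zo: "z \<in> open_face J a ?U"
    using zc by (force simp: open_face_def tight_flat_def normal_cone_def)
  have "F = normal_cone J a \<inter> tight_flat a ?U"
    using face_of_eq[OF assms(2) face_of_normal_cone_flat, of ?U] z
      open_face_rel_interior[OF assms(1) _ zo] by blast
  then show ?thesis using that[of ?U] zo by blast
qed

text \<open>Recovers \<open>U\<close> from the closed face alone, which makes the map from index
  sets to faces injective.\<close>

lemma open_face_tight:
  assumes "U \<subseteq> J" "open_face J a U \<noteq> {}"
  shows "U = {j\<in>J. \<forall>z \<in> normal_cone J a \<inter> tight_flat a U. a j \<bullet> z = 0}"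
proof -
  obtain z where z: "z \<in> open_face J a U" using assms(2) by blast
  have "z \<in> normal_cone J a \<inter> tight_flat a U" using z open_face_subset[OF assms(1), of a] by blast
  moreover have "a j \<bullet> z \<noteq> 0" if "j \<in> J - U" for j using z that by (force simp: open_face_def)
  ultimately show ?thesis using assms(1) by (auto simp: tight_flat_def)
qed

lemma sphere_faces_normal_cone:
  assumes "finite J"
  shows "sphere_faces k (normal_cone J a \<inter> sphere 0 1) =
    (\<lambda>U. normal_cone J a \<inter> tight_flat a U \<inter> sphere 0 1) `
      {U. U \<subseteq> J \<and> open_face J a U \<noteq> {} \<and> dim (tight_flat a U) = k + 1}" (is "?A = ?f ` ?B")
proof -
  have ad: "aff_dim (normal_cone J a \<inter> tight_flat a U) = int (dim (tight_flat a U))" if "U \<subseteq> J" "open_face J a U \<noteq> {}" for U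
    using affine_hull_normal_cone_flat[OF assms that] aff_dim_affine_hull[of "normal_cone J a \<inter> tight_flat a U"]
      aff_dim_subspace[OF subspace_tight_flat, of a U] by simp
  have "?A \<subseteq> ?f ` ?B"
  proof
    fix G assume "G \<in> ?A"
    then obtain F where F: "F face_of normal_cone J a" "aff_dim F = int (k + 1)" "G = F \<inter> sphere 0 1"
      unfolding sphere_faces_eq[OF polyhedral_cone_normal_cone[OF assms]] by blast
    then have "F \<noteq> {}" by auto
    then obtain U where U: "U \<subseteq> J" "open_face J a U \<noteq> {}" "F = normal_cone J a \<inter> tight_flat a U"
      using face_of_normal_coneE[OF assms F(1)] by blast
    then have "U \<in> ?B" using F(2) ad by simp
    then show "G \<in> ?f ` ?B" using F U by blast
  qed
  moreover have "?f ` ?B \<subseteq> ?A"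
    unfolding sphere_faces_eq[OF polyhedral_cone_normal_cone[OF assms]]
  proof (rule image_subsetI)
    fix U assume "U \<in> ?B"
    then have "normal_cone J a \<inter> tight_flat a U face_of normal_cone J a"
        "aff_dim (normal_cone J a \<inter> tight_flat a U) = int (k + 1)"
      using face_of_normal_cone_flat[of U J a] ad[of U] by simp_all
    then show "?f U \<in> {F \<inter> sphere 0 1 |F. F face_of normal_cone J a \<and> aff_dim F = int (k + 1)}"
      by blast
  qed
  ultimately show ?thesis by blast
qed

text \<open>Passing to the trace on the sphere loses nothing: every nonzero point can be normalized
  without changing the signs of the constraints, and the origin lies in all closed faces. The index
  set is then recovered by \<open>open_face_tight\<close>.\<close>

lemma f_num_normal_cone:
  assumes "finite J"
  shows "f_num k (normal_cone J a \<inter> sphere 0 1) =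
    card {U. U \<subseteq> J \<and> open_face J a U \<noteq> {} \<and> dim (tight_flat a U) = k + 1}"
proof -
  have "inj_on (\<lambda>U. normal_cone J a \<inter> tight_flat a U \<inter> sphere 0 1) {U. U \<subseteq> J \<and> open_face J a U \<noteq> {}}"
  proof (rule inj_onI, goal_cases)
    case (1 U V)
    have *: "normal_cone J a \<inter> tight_flat a U \<subseteq> normal_cone J a \<inter> tight_flat a V"
      if "normal_cone J a \<inter> tight_flat a U \<inter> sphere 0 1 = normal_cone J a \<inter> tight_flat a V \<inter> sphere 0 1" for U V
    proof
      fix z assume z: "z \<in> normal_cone J a \<inter> tight_flat a U"
      show "z \<in> normal_cone J a \<inter> tight_flat a V"
      proof (cases "z = 0")
        case False
        have "inverse (norm z) *\<^sub>R z \<in> normal_cone J a \<inter> tight_flat a U \<inter> sphere 0 1"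
          using z False by (auto simp: normal_cone_def tight_flat_def mult_le_0_iff)
        then have "inverse (norm z) *\<^sub>R z \<in> normal_cone J a \<inter> tight_flat a V" using that by blast
        then show ?thesis using False by (auto simp: normal_cone_def tight_flat_def mult_le_0_iff)
      qed (auto simp: normal_cone_def tight_flat_def)
    qed
    have "normal_cone J a \<inter> tight_flat a U = normal_cone J a \<inter> tight_flat a V"
      using *[of U V] *[of V U] 1 by blast
    then show ?case using open_face_tight[of U J a] open_face_tight[of V J a] 1 by simp
  qed
  then show ?thesis
    unfolding f_num_def sphere_faces_normal_cone[OF assms]
    by (intro card_image) (erule inj_on_subset, blast)
qed

text \<open>The image is the cone with normals \<open>f \<circ> a\<close>, and \<open>f\<close>
  carries flats and open faces along bijectively with their dimensions. This disposes of the
  rotation in the typical cell.\<close>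

lemma f_num_orthogonal_image:
  fixes f :: "'a::euclidean_space \<Rightarrow> 'a"
  assumes "finite J" "orthogonal_transformation f"
  shows "f_num k (f ` (normal_cone J a \<inter> sphere 0 1)) = f_num k (normal_cone J a \<inter> sphere 0 1)"
proof -
  have lin: "linear f" and inj: "inj f" and surj: "surj f"
    using assms(2) orthogonal_transformation_linear orthogonal_transformation_inj
      orthogonal_transformation_surj by blast+
  have inner: "f x \<bullet> f y = x \<bullet> y" for x y using assms(2) by (simp add: orthogonal_transformation_def)
  have nrm: "norm (f x) = norm x" for x using assms(2) by (simp add: orthogonal_transformation_norm)
  have im: "{y. P y} = f ` {x. P (f x)}" for P
    using surj by (auto simp: image_iff surj_def)
  have "f ` (normal_cone J a \<inter> sphere 0 1) = normal_cone J (f \<circ> a) \<inter> sphere 0 1"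
  proof -
    have "normal_cone J (f \<circ> a) \<inter> sphere 0 1 = {y. (\<forall>j\<in>J. f (a j) \<bullet> y \<le> 0) \<and> norm y = 1}"
      by (auto simp: normal_cone_def)
    also have "\<dots> = f ` (normal_cone J a \<inter> sphere 0 1)"
      by (subst im) (auto simp: inner nrm normal_cone_def)
    finally show ?thesis by simp
  qed
  moreover have "tight_flat (f \<circ> a) U = f ` tight_flat a U" for U
    unfolding tight_flat_def by (subst im) (simp only: inner o_apply)
  moreover have "open_face J (f \<circ> a) U = f ` open_face J a U" for U
    unfolding open_face_def tight_flat_def mem_Collect_eq by (subst im) (simp only: inner o_apply)
  moreover have "dim (f ` tight_flat a U) = dim (tight_flat a U)" for U
    using dim_image_eq[OF lin, of "tight_flat a U"] inj by (metis inj_on_subset subset_UNIV)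
  ultimately show ?thesis by (simp add: f_num_normal_cone[OF assms(1)])
qed

section \<open>Normals in general position\<close>

lemma exists_inner_prescribed:
  fixes B :: "'a::euclidean_space set"
  assumes "independent B"
  obtains d where "\<And>b. b \<in> B \<Longrightarrow> b \<bullet> d = g b"
proof -
  obtain f where f: "linear f" "\<forall>x\<in>B. f x = g x"
    using linear_independent_extend[OF assms] by blast
  have "b \<bullet> (\<Sum>i\<in>Basis. f i *\<^sub>R i) = f b" for b
  proof -
    have "f b = f (\<Sum>i\<in>Basis. (b \<bullet> i) *\<^sub>R i)" by (simp add: euclidean_representation)
    also have "\<dots> = (\<Sum>i\<in>Basis. (b \<bullet> i) * f i)"
      using f(1) by (simp add: linear_sum linear_cmul)
    finally show ?thesis by (simp add: inner_sum_right mult.commute)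
  qed
  then show ?thesis using f(2) that by metis
qed

text \<open>The flat is the orthogonal complement of the span of the normals.\<close>

lemma dim_tight_flat:
  fixes a :: "'i \<Rightarrow> 'a::euclidean_space"
  shows "dim (tight_flat a U) + dim (a ` U) = DIM('a)"
proof -
  have "tight_flat a U = {y \<in> UNIV. \<forall>x\<in>span (a ` U). orthogonal x y}"
  proof -
    have "(\<forall>j\<in>U. a j \<bullet> y = 0) \<longleftrightarrow> (\<forall>x\<in>span (a ` U). orthogonal x y)" for y
    proof
      assume "\<forall>j\<in>U. a j \<bullet> y = 0"
      then have "\<And>x. x \<in> a ` U \<Longrightarrow> orthogonal y x"
        by (auto simp: orthogonal_def inner_commute)
      then have "x \<in> span (a ` U) \<Longrightarrow> orthogonal y x" for x
        using orthogonal_to_span[of x "a ` U" y] by blast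
      then show "\<forall>x\<in>span (a ` U). orthogonal x y" using orthogonal_commute by blast
    qed (auto simp: orthogonal_def span_base)
    then show ?thesis by (auto simp: tight_flat_def)
  qed
  then show ?thesis
    using dim_subspace_orthogonal_to_vectors[of "span (a ` U)" UNIV] by simp
qed

definition in_general_position :: "'i set \<Rightarrow> ('i \<Rightarrow> 'a::euclidean_space) \<Rightarrow> bool" where
  "in_general_position J a \<longleftrightarrow>
     (\<forall>T\<subseteq>J. finite T \<longrightarrow> card T \<le> DIM('a) \<longrightarrow> inj_on a T \<and> independent (a ` T))"

lemma general_position_dim:
  fixes a :: "'i \<Rightarrow> 'a::euclidean_space"
  assumes "in_general_position J a" "U \<subseteq> J" "finite J"
  shows "dim (a ` U) = min (card U) DIM('a)"
proof (cases "card U \<le> DIM('a)")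
  case True
  then have "inj_on a U" "independent (a ` U)"
    using assms finite_subset unfolding in_general_position_def by blast+
  then show ?thesis using True by (simp add: dim_eq_card_independent card_image)
next
  case False
  then obtain T where T: "T \<subseteq> U" "card T = DIM('a)" "finite T"
    by (metis nat_le_linear obtain_subset_with_card_n)
  then have "inj_on a T" "independent (a ` T)"
    using assms unfolding in_general_position_def by auto
  then have "dim (a ` T) = DIM('a)" using T by (simp add: dim_eq_card_independent card_image)
  moreover have "dim (a ` T) \<le> dim (a ` U)" using T by (intro dim_subset) auto
  moreover have "dim (a ` U) \<le> DIM('a)" by (rule dim_subset_UNIV)
  ultimately show ?thesis using False by simp
qed

text \<open>In general position each of the first \<open>DIM('a)\<close> tight constraints lowers
  the dimension of the flat by one, and a spherical face of dimension \<open>k\<close> belongs to a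
  cone face of dimension \<open>k + 1\<close>.\<close>

lemma f_num_general_position:
  fixes a :: "'i \<Rightarrow> 'a::euclidean_space"
  assumes "finite J" "in_general_position J a" "k + 1 \<le> DIM('a)"
  shows "f_num k (normal_cone J a \<inter> sphere 0 1) =
    card {U. U \<subseteq> J \<and> card U = DIM('a) - (k + 1) \<and> open_face J a U \<noteq> {}}"
proof -
  have "dim (tight_flat a U) = k + 1 \<longleftrightarrow> card U = DIM('a) - (k + 1)" if "U \<subseteq> J" for U
    using dim_tight_flat[of a U] general_position_dim[OF assms(2) that assms(1)] assms(3) by auto
  then show ?thesis unfolding f_num_normal_cone[OF assms(1)]
    by (intro arg_cong[where f = card]) auto
qed

section \<open>Face numbers of simple cones\<close>

text \<open>\<open>x0\<close> is an interior point of the cone. The functional \<open>u\<close> is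
  positive on the cone away from the origin, so that the affine hyperplane where \<open>u\<close>
  equals 1 cuts out a bounded polytope with the same combinatorics as the trace on the
  sphere.\<close>

locale simple_cone =
  fixes J :: "'i set" and a :: "'i \<Rightarrow> 'a::euclidean_space" and u :: 'a and x0 :: 'a
  assumes finJ: "finite J"
    and genpos: "in_general_position J a"
    and cardJ: "DIM('a) \<le> card J"
    and dim4: "DIM('a) = 4"
    and x0: "\<And>j. j \<in> J \<Longrightarrow> a j \<bullet> x0 < 0"
    and u_def: "u = - (\<Sum>j\<in>J. a j)"
begin

text \<open>The bound on \<open>card T\<close> removes the apex: four tight constraints leave only
  the origin, which does not meet the sphere although \<open>open_face J a J\<close> contains
  it.\<close>

definition nonvoid :: "'i set \<Rightarrow> bool" where
  "nonvoid T \<longleftrightarrow> T \<subseteq> J \<and> card T \<le> 3 \<and> open_face J a T \<noteq> {}"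

definition verts :: "'i set set" where
  "verts = {S. nonvoid S \<and> card S = 3}"

lemma indep4:
  assumes "T \<subseteq> J" "card T \<le> 4"
  shows "inj_on a T" "independent (a ` T)" "finite T"
  using assms genpos finJ finite_subset unfolding in_general_position_def dim4 by blast+

lemma orth_zero:
  assumes "T \<subseteq> J" "card T \<ge> 4" "\<And>j. j \<in> T \<Longrightarrow> a j \<bullet> z = 0"
  shows "z = 0"
proof -
  have "dim (a ` T) = 4"
    using general_position_dim[OF genpos assms(1) finJ] assms(2) dim4 by simp
  then have "dim (tight_flat a T) = 0" using dim_tight_flat[of a T] dim4 by simp
  moreover have "z \<in> tight_flat a T" using assms by (simp add: tight_flat_def)
  ultimately show ?thesis by auto
qed

text \<open>\<open>u \<bullet> z\<close> is a sum of nonnegative terms, and they cannot all vanish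
  because at least four normals in general position span the space.\<close>

lemma u_pos:
  assumes "z \<in> normal_cone J a" "z \<noteq> 0"
  shows "u \<bullet> z > 0"
proof -
  have le: "\<And>j. j \<in> J \<Longrightarrow> a j \<bullet> z \<le> 0" using assms(1) by (simp add: normal_cone_def)
  obtain j where "j \<in> J" "a j \<bullet> z \<noteq> 0" using orth_zero[of J z] assms cardJ dim4 by auto
  then have "(\<Sum>j\<in>J. - (a j \<bullet> z)) > 0"
    using le finJ by (intro sum_pos2[of J j]) (auto simp: less_le)
  then show ?thesis by (simp add: u_def inner_sum_left sum_negf)
qed

lemma ex_normalized_point:
  assumes "nonvoid S"
  shows "\<exists>v. v \<in> open_face J a S \<and> u \<bullet> v = 1"
proof -
  obtain z where z: "z \<in> open_face J a S" and S: "S \<subseteq> J" "card S \<le> 3"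
    using assms by (auto simp: nonvoid_def)
  \<comment> \<open>Some constraint outside \<open>S\<close> exists and is slack at
    \<open>z\<close>, which rules out \<open>z = 0\<close>.\<close>
  have "card S < card J" using S cardJ dim4 by simp
  then have "J - S \<noteq> {}" using card_mono[of S J] finite_subset[OF S(1) finJ] by auto
  then obtain j where "j \<in> J - S" by blast
  then have "a j \<bullet> z < 0" using z by (simp add: open_face_def)
  then have "z \<noteq> 0" by auto
  moreover have "z \<in> normal_cone J a" using z open_face_subset[OF S(1), of a] by blast
  ultimately have p: "u \<bullet> z > 0" by (rule u_pos[rotated])
  have "(1 / (u \<bullet> z)) *\<^sub>R z \<in> open_face J a S"
    using z p by (auto simp: open_face_def tight_flat_def divide_neg_pos)
  then show ?thesis using p by (intro exI[of _ "(1 / (u \<bullet> z)) *\<^sub>R z"]) simp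
qed

definition vertex :: "'i set \<Rightarrow> 'a" where
  "vertex S = (SOME v. v \<in> open_face J a S \<and> u \<bullet> v = 1)"

lemma vertex: "S \<in> verts \<Longrightarrow> vertex S \<in> open_face J a S" "S \<in> verts \<Longrightarrow> u \<bullet> vertex S = 1"
  using someI_ex[OF ex_normalized_point, of S] unfolding vertex_def verts_def by blast+

lemma vertex_tight: "S \<in> verts \<Longrightarrow> j \<in> S \<Longrightarrow> a j \<bullet> vertex S = 0"
  using vertex(1) by (auto simp: open_face_def tight_flat_def)

text \<open>The vertex is orthogonal to all tight normals but not to \<open>u\<close>. Thus
  \<open>u\<close> and the three normals form a basis of the four-dimensional space.\<close>

lemma u_indep:
  assumes S: "S \<in> verts"
  shows "u \<notin> span (a ` S)" "independent (insert u (a ` S))"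
proof -
  show 1: "u \<notin> span (a ` S)"
  proof
    assume "u \<in> span (a ` S)"
    then have "orthogonal (vertex S) u"
      using vertex_tight[OF S] by (intro orthogonal_to_span[of u "a ` S"]) (auto simp: orthogonal_def inner_commute)
    then show False using vertex(2)[OF S] by (simp add: orthogonal_def inner_commute)
  qed
  show "independent (insert u (a ` S))"
    using 1 indep4(2)[of S] S by (auto simp: verts_def nonvoid_def independent_insert)
qed

text \<open>Up to sign the edge vectors belong to the basis dual to \<open>u\<close> and the three
  tight normals; the zero product with \<open>u\<close> keeps them parallel to the slice.\<close>

lemma ex_edge:
  assumes S: "S \<in> verts"
  shows "\<exists>d. u \<bullet> d = 0 \<and> (\<forall>t\<in>S. a t \<bullet> d = (if t = s then -1 else 0))"
proof -
  have S': "S \<subseteq> J" "card S = 3" using S by (auto simp: verts_def nonvoid_def)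
  then have inj: "inj_on a S" using indep4[of S] by simp
  \<comment> \<open>\<open>exists_inner_prescribed\<close> prescribes values on vectors, so the
    index is read back from the normal by \<open>the_inv_into\<close>.\<close>
  obtain d where d: "\<And>b. b \<in> insert u (a ` S) \<Longrightarrow> b \<bullet> d = (if b = u then 0 else if the_inv_into S a b = s then -1 else 0)"
    using exists_inner_prescribed[OF u_indep(2)[OF S],
        of "\<lambda>b. if b = u then 0 else if the_inv_into S a b = s then -1 else 0"] by blast
  have "a t \<bullet> d = (if t = s then -1 else 0)" if t: "t \<in> S" for t
  proof -
    have at: "a t \<in> a ` S" using t by (rule imageI)
    then have "a t \<noteq> u" using u_indep(1)[OF S] span_base by metis
    moreover have "a t \<bullet> d = (if a t = u then 0 else if the_inv_into S a (a t) = s then -1 else 0)"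
      using at by (intro d insertI2)
    ultimately show ?thesis unfolding the_inv_into_f_f[OF inj t] by presburger
  qed
  moreover have "u \<bullet> d = 0" using d[of u] by simp
  ultimately show ?thesis by blast
qed

text \<open>
  The edge direction at the vertex \<open>S\<close> along which constraint \<open>s\<close> becomes slack while the other
  two constraints of \<open>S\<close> stay tight.
\<close>

definition edge :: "'i set \<Rightarrow> 'i \<Rightarrow> 'a" where
  "edge S s = (SOME d. u \<bullet> d = 0 \<and> (\<forall>t\<in>S. a t \<bullet> d = (if t = s then -1 else 0)))"

lemma edge: "S \<in> verts \<Longrightarrow> u \<bullet> edge S s = 0" "S \<in> verts \<Longrightarrow> t \<in> S \<Longrightarrow> a t \<bullet> edge S s = (if t = s then -1 else 0)"
  using someI_ex[OF ex_edge] unfolding edge_def by blast+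

lemma edge_nonzero: "S \<in> verts \<Longrightarrow> s \<in> S \<Longrightarrow> edge S s \<noteq> 0"
  using edge(2)[of S s s] by auto

text \<open>Coordinates in the dual basis. On the cone the coefficients
  \<open>- (a s \<bullet> z)\<close> are nonnegative, so the slice lies in the cone of edges
  emanating from any of its vertices.\<close>

lemma expand_at_vertex:
  assumes S: "S \<in> verts" and z: "u \<bullet> z = 1"
  shows "z = vertex S + (\<Sum>s\<in>S. (- (a s \<bullet> z)) *\<^sub>R edge S s)"
proof -
  have S': "S \<subseteq> J" "card S = 3" "finite S" using S indep4[of S] by (auto simp: verts_def nonvoid_def)
  let ?e = "z - vertex S - (\<Sum>s\<in>S. (- (a s \<bullet> z)) *\<^sub>R edge S s)"
  have 1: "u \<bullet> ?e = 0"
    using z vertex(2)[OF S] edge(1)[OF S] by (simp add: inner_diff_right inner_sum_right)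
  have 2: "a t \<bullet> ?e = 0" if "t \<in> S" for t
  proof -
    have "(\<Sum>s\<in>S. - (a s \<bullet> z) * (a t \<bullet> edge S s)) = (\<Sum>s\<in>S. if t = s then a s \<bullet> z else 0)"
      using edge(2)[OF S that] by (intro sum.cong) auto
    also have "\<dots> = a t \<bullet> z" using that S'(3) by (simp add: sum.delta')
    finally show ?thesis using vertex_tight[OF S that]
      by (simp add: inner_diff_right inner_sum_right)
  qed
  have "dim (insert u (a ` S)) = 4"
    using u_indep[OF S] indep4[of S] S' span_base[of u]
    by (subst dim_eq_card_independent) (auto simp: card_image card_insert_if)
  then have "dim (tight_flat id (insert u (a ` S))) = 0" using dim_tight_flat[of id "insert u (a ` S)"] dim4 by simp
  moreover have "?e \<in> tight_flat id (insert u (a ` S))" using 1 2 by (auto simp: tight_flat_def)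
  ultimately have "?e = 0" by auto
  then show ?thesis by (simp add: algebra_simps)
qed

text \<open>This is the simplicity of the vertices. A small move from the vertex along the sum of
  the edges belonging to \<open>S - T\<close> loosens exactly these constraints, and the constraints
  outside \<open>S\<close> stay slack by continuity.\<close>

lemma subset_vertex_nonvoid:
  assumes S: "S \<in> verts" and T: "T \<subseteq> S"
  shows "nonvoid T"
proof -
  have S': "S \<subseteq> J" "card S = 3" "finite S" using S indep4[of S] by (auto simp: verts_def nonvoid_def)
  let ?d = "\<Sum>s\<in>S - T. edge S s"
  have d: "a t \<bullet> ?d = (if t \<in> T then 0 else -1)" if t: "t \<in> S" for t
  proof -
    have "a t \<bullet> ?d = (\<Sum>s\<in>S - T. if s = t then -1 else 0)"
      using edge(2)[OF S t] by (simp add: inner_sum_right) (intro sum.cong, auto)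
    then show ?thesis using t S' by (simp add: sum.delta)
  qed
  have "\<exists>e>0. \<forall>j\<in>J - S. a j \<bullet> (vertex S + e *\<^sub>R ?d) < 0"
  proof -
    have "eventually (\<lambda>e. a j \<bullet> (vertex S + e *\<^sub>R ?d) < 0) (at_right 0)" if "j \<in> J - S" for j
    proof -
      have "((\<lambda>e. a j \<bullet> (vertex S + e *\<^sub>R ?d)) \<longlongrightarrow> a j \<bullet> (vertex S + 0 *\<^sub>R ?d)) (at_right 0)"
        by (intro tendsto_intros)
      moreover have "a j \<bullet> (vertex S + 0 *\<^sub>R ?d) < 0" using vertex(1)[OF S] that by (simp add: open_face_def)
      ultimately show ?thesis by (rule order_tendstoD)
    qed
    then have "eventually (\<lambda>e. \<forall>j\<in>J - S. a j \<bullet> (vertex S + e *\<^sub>R ?d) < 0) (at_right 0)"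
      using finJ by (simp add: eventually_ball_finite_distrib)
    then have "eventually (\<lambda>e. e > 0 \<and> (\<forall>j\<in>J - S. a j \<bullet> (vertex S + e *\<^sub>R ?d) < 0)) (at_right 0)"
      using eventually_at_right_less by (rule eventually_conj[rotated])
    then show ?thesis by (rule eventually_happens'[OF trivial_limit_at_right_real])
  qed
  then obtain e where e: "e > 0" "\<And>j. j \<in> J - S \<Longrightarrow> a j \<bullet> (vertex S + e *\<^sub>R ?d) < 0" by blast
  have "vertex S + e *\<^sub>R ?d \<in> open_face J a T"
    unfolding open_face_def tight_flat_def
  proof (intro CollectI conjI ballI)
    fix j assume j: "j \<in> T"
    then have "j \<in> S" using T by blast
    then show "a j \<bullet> (vertex S + e *\<^sub>R ?d) = 0"
      using d[of j] vertex_tight[OF S, of j] j by (simp add: inner_add_right)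
  next
    fix j assume j: "j \<in> J - T"
    show "a j \<bullet> (vertex S + e *\<^sub>R ?d) < 0"
    proof (cases "j \<in> S")
      case True
      then show ?thesis using d[of j] vertex_tight[OF S, of j] j e(1) by (simp add: inner_add_right)
    qed (use e j in auto)
  qed
  then show ?thesis using S' T card_mono[OF S'(3) T] by (auto simp: nonvoid_def)
qed

end

section \<open>Sweep of the slice by a generic linear functional\<close>

lemma ex_not_orthogonal:
  fixes E :: "'a::euclidean_space set"
  assumes "finite E" "0 \<notin> E"
  shows "\<exists>w. \<forall>e\<in>E. w \<bullet> e \<noteq> 0"
proof -
  have "negligible (\<Union>e\<in>E. {w. e \<bullet> w = 0})"
    using assms by (intro negligible_Union) (auto intro!: negligible_hyperplane)
  then have "(\<Union>e\<in>E. {w. e \<bullet> w = 0}) \<noteq> UNIV" by (metis non_negligible_UNIV)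
  then show ?thesis by (auto simp: inner_commute)
qed

text \<open>The sum over the Boolean interval factors as a product of terms \<open>-1 + 1\<close>
  over \<open>S - N\<close>, up to the sign of \<open>N\<close>, and vanishes unless this product is
  empty.\<close>

lemma sum_minus_one_power_interval:
  assumes "finite S" "N \<subseteq> S"
  shows "(\<Sum>T | N \<subseteq> T \<and> T \<subseteq> S. (-1) ^ card T) = (if N = S then (-1) ^ card S else (0::int))"
proof -
  have fN: "finite N" using assms finite_subset by blast
  have img: "{T. N \<subseteq> T \<and> T \<subseteq> S} = (\<lambda>X. N \<union> X) ` Pow (S - N)"
  proof (intro equalityI subsetI)
    fix T assume "T \<in> {T. N \<subseteq> T \<and> T \<subseteq> S}"
    then have "T = N \<union> (T - N)" "T - N \<in> Pow (S - N)" by auto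
    then show "T \<in> (\<lambda>X. N \<union> X) ` Pow (S - N)" by (rule image_eqI)
  qed (use assms in auto)
  have "(\<Sum>T | N \<subseteq> T \<and> T \<subseteq> S. (-1) ^ card T) = (\<Sum>X\<in>Pow (S - N). (-1) ^ card (N \<union> X) :: int)"
    unfolding img by (subst sum.reindex) (auto simp: inj_on_def)
  also have "\<dots> = (\<Sum>X\<in>Pow (S - N). (-1) ^ card N * (\<Prod>x\<in>X. - 1) * (\<Prod>x\<in>S - N - X. 1))"
  proof (rule sum.cong[OF refl])
    fix X assume "X \<in> Pow (S - N)"
    then have "N \<inter> X = {}" "finite X" using assms finite_subset[of X S] by auto
    then show "(-1) ^ card (N \<union> X) = (-1) ^ card N * (\<Prod>x\<in>X. - 1 :: int) * (\<Prod>x\<in>S - N - X. 1)"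
      using fN by (simp add: card_Un_disjoint power_add)
  qed
  also have "\<dots> = (-1) ^ card N * (\<Prod>x\<in>S - N. - 1 + 1)"
    using assms by (subst prod_add) (simp_all add: sum_distrib_left mult.assoc)
  also have "\<dots> = (if N = S then (-1) ^ card S else 0)"
  proof (cases "N = S")
    case False
    then have "S - N \<noteq> {}" using assms by blast
    then show ?thesis using False assms by (auto simp: power_0_left)
  qed simp
  finally show ?thesis .
qed

context simple_cone
begin

definition slice :: "'i set \<Rightarrow> 'a set" where
  "slice T = {z \<in> normal_cone J a \<inter> tight_flat a T. u \<bullet> z = 1}"

lemma inner_cont: "continuous_on A (\<lambda>z. w \<bullet> z)" for w :: 'a
  by (intro continuous_intros)

text \<open>For boundedness, \<open>u\<close> attains a positive minimum on the compact trace of the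
  cone on the sphere. Normalizing a point \<open>z\<close> of the slice bounds \<open>norm z\<close>
  by the reciprocal of this minimum.\<close>

lemma compact_slice: "compact (slice T)"
proof -
  have cl: "closed (normal_cone J a)"
  proof -
    have "normal_cone J a = (\<Inter>j\<in>J. {z. a j \<bullet> z \<le> 0})" by (auto simp: normal_cone_def)
    then show ?thesis by (auto intro!: closed_INT closed_halfspace_le)
  qed
  have "slice T = normal_cone J a \<inter> tight_flat a T \<inter> {z. u \<bullet> z = 1}" by (auto simp: slice_def)
  then have closed: "closed (slice T)"
    using cl closed_subspace[OF subspace_tight_flat, of a T] by (auto intro: closed_hyperplane)
  have "bounded (slice T)"
  proof (cases "normal_cone J a \<inter> sphere 0 1 = {}")
    case True
    have "slice T = {}"
    proof (rule equals0I)
      fix z assume z: "z \<in> slice T"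
      then have "z \<noteq> 0" by (auto simp: slice_def)
      then have "inverse (norm z) *\<^sub>R z \<in> normal_cone J a \<inter> sphere 0 1"
        using z by (auto simp: slice_def normal_cone_def mult_le_0_iff)
      then show False using True by blast
    qed
    then show ?thesis by simp
  next
    case False
    have "compact (normal_cone J a \<inter> sphere 0 1)" using cl by (auto intro: closed_Int_compact)
    then obtain m where m: "m \<in> normal_cone J a \<inter> sphere 0 1" "\<And>z. z \<in> normal_cone J a \<inter> sphere 0 1 \<Longrightarrow> u \<bullet> m \<le> u \<bullet> z"
      using continuous_attains_inf[OF _ False, of "\<lambda>z. u \<bullet> z"] inner_cont by blast
    have um: "u \<bullet> m > 0" using m(1) by (intro u_pos) auto
    have "norm z \<le> 1 / (u \<bullet> m)" if z: "z \<in> slice T" for z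
    proof -
      have nz: "z \<noteq> 0" using z by (auto simp: slice_def)
      then have "inverse (norm z) *\<^sub>R z \<in> normal_cone J a \<inter> sphere 0 1"
        using z by (auto simp: slice_def normal_cone_def mult_le_0_iff)
      then have "u \<bullet> m \<le> u \<bullet> (inverse (norm z) *\<^sub>R z)" by (rule m(2))
      also have "\<dots> = 1 / norm z" using z by (simp add: slice_def divide_inverse)
      finally show ?thesis using um nz by (simp add: field_simps)
    qed
    then show ?thesis by (auto simp: bounded_iff)
  qed
  with closed show ?thesis by (simp add: compact_eq_bounded_closed)
qed

lemma convex_slice: "convex (slice T)"
proof (rule convexI)
  fix x y p q assume "x \<in> slice T" "y \<in> slice T" and pq: "0 \<le> p" "0 \<le> q" "p + q = (1::real)"
  then show "p *\<^sub>R x + q *\<^sub>R y \<in> slice T"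
    by (auto simp: slice_def normal_cone_def tight_flat_def inner_add_right intro!: add_nonpos_nonpos mult_nonneg_nonpos)
qed

lemma slice_nonempty:
  assumes "nonvoid T" shows "slice T \<noteq> {}"
proof -
  obtain v where v: "v \<in> open_face J a T" "u \<bullet> v = 1" using ex_normalized_point[OF assms] by blast
  then have "v \<in> slice T" using open_face_subset[of T J a] assms by (auto simp: slice_def nonvoid_def)
  then show ?thesis by blast
qed

text \<open>Only the constraints tight at \<open>z\<close> restrict the direction \<open>d\<close>;
  the finitely many slack ones survive a small step.\<close>

lemma perturb_in_normal_cone:
  assumes z: "z \<in> normal_cone J a" and d: "\<And>j. j \<in> J \<Longrightarrow> a j \<bullet> z = 0 \<Longrightarrow> a j \<bullet> d \<le> 0"
  shows "eventually (\<lambda>e. z + e *\<^sub>R d \<in> normal_cone J a) (at_right 0)"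
proof -
  have "eventually (\<lambda>e. a j \<bullet> (z + e *\<^sub>R d) \<le> 0) (at_right 0)" if j: "j \<in> J" for j
  proof (cases "a j \<bullet> z = 0")
    case True
    have "eventually (\<lambda>e::real. e > 0) (at_right 0)" by (rule eventually_at_right_less)
    then show ?thesis
      by eventually_elim (use True d[OF j] in \<open>simp add: inner_add_right mult_nonneg_nonpos\<close>)
  next
    case False
    have "((\<lambda>e. a j \<bullet> (z + e *\<^sub>R d)) \<longlongrightarrow> a j \<bullet> (z + 0 *\<^sub>R d)) (at_right 0)"
      by (intro tendsto_intros)
    moreover have "a j \<bullet> (z + 0 *\<^sub>R d) < 0" using False z j by (auto simp: normal_cone_def less_le)
    ultimately have "eventually (\<lambda>e. a j \<bullet> (z + e *\<^sub>R d) < 0) (at_right 0)" by (rule order_tendstoD)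
    then show ?thesis by eventually_elim simp
  qed
  then show ?thesis using finJ unfolding normal_cone_def mem_Collect_eq
    by (simp add: eventually_ball_finite_distrib)
qed

lemma vertex_in_slice: "S \<in> verts \<Longrightarrow> T \<subseteq> S \<Longrightarrow> vertex S \<in> slice T"
  using vertex[of S] vertex_tight[of S] open_face_subset[of S J a]
  unfolding slice_def verts_def nonvoid_def tight_flat_def by blast

lemma slice_eq_vertex:
  assumes S: "S \<in> verts" and z: "z \<in> slice S"
  shows "z = vertex S"
proof -
  have "u \<bullet> z = 1" and t: "\<And>s. s \<in> S \<Longrightarrow> a s \<bullet> z = 0" using z by (auto simp: slice_def tight_flat_def)
  then show ?thesis using expand_at_vertex[OF S, of z] by simp
qed

lemma vertex_inj: "S \<in> verts \<Longrightarrow> S' \<in> verts \<Longrightarrow> vertex S = vertex S' \<Longrightarrow> S = S'"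
proof -
  have "S = {j\<in>J. a j \<bullet> vertex S = 0}" if "S \<in> verts" for S
  proof
    show "S \<subseteq> {j\<in>J. a j \<bullet> vertex S = 0}"
      using that vertex_tight[OF that] by (auto simp: verts_def nonvoid_def)
    show "{j\<in>J. a j \<bullet> vertex S = 0} \<subseteq> S"
    proof
      fix j assume j: "j \<in> {j\<in>J. a j \<bullet> vertex S = 0}"
      then show "j \<in> S" using vertex(1)[OF that] by (rule_tac ccontr) (force simp: open_face_def)
    qed
  qed
  then show "S \<in> verts \<Longrightarrow> S' \<in> verts \<Longrightarrow> vertex S = vertex S' \<Longrightarrow> S = S'" by metis
qed

definition generic :: "'a \<Rightarrow> bool" where
  "generic w \<longleftrightarrow> (\<forall>S\<in>verts. \<forall>s\<in>S. w \<bullet> edge S s \<noteq> 0)"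

lemma finite_verts: "finite verts"
  by (rule finite_subset[of _ "Pow J"]) (auto simp: verts_def nonvoid_def finJ)

lemma finite_nonvoid: "finite {T. nonvoid T \<and> P T}"
  by (rule finite_subset[of _ "Pow J"]) (auto simp: nonvoid_def finJ)

lemma ex_generic: "\<exists>w. generic w"
proof -
  let ?E = "\<Union>S\<in>verts. edge S ` S"
  have "finite ?E" using finite_verts finJ finite_subset by (auto simp: verts_def nonvoid_def)
  moreover have "0 \<notin> ?E" using edge_nonzero by force
  ultimately obtain w where "\<forall>e\<in>?E. w \<bullet> e \<noteq> 0" using ex_not_orthogonal by blast
  then show ?thesis by (auto simp: generic_def)
qed

text \<open>
  The vertex \<open>S\<close> minimizes \<open>w\<close> on the face \<open>T\<close>. For generic \<open>w\<close> every face has exactly one such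
  vertex, so Euler's relation follows by summing over the vertices.
\<close>

definition lowest :: "'a \<Rightarrow> 'i set \<Rightarrow> 'i set \<Rightarrow> bool" where
  "lowest w T S \<longleftrightarrow> S \<in> verts \<and> T \<subseteq> S \<and> (\<forall>s\<in>S - T. w \<bullet> edge S s > 0)"

text \<open>In the expansion of \<open>z\<close> at the vertex the constraints of \<open>T\<close>
  contribute nothing, the others contribute nonnegative multiples of ascending edges, and at least
  one multiple is positive since \<open>z\<close> is another point.\<close>

lemma lowest_less:
  assumes "lowest w T S" "z \<in> slice T" "z \<noteq> vertex S"
  shows "w \<bullet> vertex S < w \<bullet> z"
proof -
  have S: "S \<in> verts" "T \<subseteq> S" and pos: "\<And>s. s \<in> S - T \<Longrightarrow> w \<bullet> edge S s > 0" using assms(1) by (auto simp: lowest_def)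
  have fin: "finite S" using S finJ finite_subset by (auto simp: verts_def nonvoid_def)
  have SJ: "S \<subseteq> J" using S by (auto simp: verts_def nonvoid_def)
  have uz: "u \<bullet> z = 1" and tz: "\<And>s. s \<in> T \<Longrightarrow> a s \<bullet> z = 0" and nz: "\<And>s. s \<in> S \<Longrightarrow> a s \<bullet> z \<le> 0"
    using assms(2) SJ by (auto simp: slice_def tight_flat_def normal_cone_def)
  have "\<exists>s\<in>S. a s \<bullet> z \<noteq> 0"
  proof (rule ccontr)
    assume "\<not> ?thesis"
    then have "z \<in> slice S" using assms(2) by (auto simp: slice_def tight_flat_def)
    then show False using slice_eq_vertex[OF S(1)] assms(3) by blast
  qed
  then obtain s where s: "s \<in> S" "a s \<bullet> z \<noteq> 0" by blast
  have nn: "- (a t \<bullet> z) * (w \<bullet> edge S t) \<ge> 0" if "t \<in> S" for t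
    using nz[OF that] tz[of t] pos[of t] that by (cases "t \<in> T") (auto intro: mult_nonpos_nonneg)
  have "s \<notin> T" using tz s by blast
  then have "- (a s \<bullet> z) * (w \<bullet> edge S s) > 0"
    using nz[OF s(1)] s pos[of s] by (intro mult_pos_pos) auto
  then have "(\<Sum>t\<in>S. - (a t \<bullet> z) * (w \<bullet> edge S t)) > 0"
    using fin s nn by (intro sum_pos2[of S s]) auto
  moreover have "w \<bullet> z = w \<bullet> vertex S + (\<Sum>t\<in>S. - (a t \<bullet> z) * (w \<bullet> edge S t))"
    by (subst expand_at_vertex[OF S(1) uz]) (simp add: inner_add_right inner_sum_right)
  ultimately show ?thesis by simp
qed

text \<open>Four tight constraints would force \<open>z = 0\<close>. With at most two, these and
  \<open>u\<close> impose at most three linear conditions, so some direction \<open>d\<close>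
  satisfies them all; both \<open>z + e *\<^sub>R d\<close> and \<open>z - e *\<^sub>R d\<close>
  stay in the slice, minimality makes \<open>w\<close> constant along \<open>d\<close>, and
  \<open>z\<close> is a midpoint, against extremality.\<close>

lemma extreme_point_minimizer_tight:
  assumes TJ: "T \<subseteq> J" and z: "z extreme_point_of {x \<in> slice T. w \<bullet> x = m}" and m: "\<And>x. x \<in> slice T \<Longrightarrow> m \<le> w \<bullet> x"
  defines "U \<equiv> {j\<in>J. a j \<bullet> z = 0}"
  shows "card U = 3"
proof (rule ccontr)
  assume "card U \<noteq> 3"
  have zs: "z \<in> slice T" "w \<bullet> z = m" using z by (auto simp: extreme_point_of_def)
  have zc: "z \<in> normal_cone J a" and uz: "u \<bullet> z = 1" and zT: "z \<in> tight_flat a T" using zs by (auto simp: slice_def)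
  have UJ: "U \<subseteq> J" by (auto simp: U_def)
  have "card U < 4"
  proof (rule ccontr)
    assume "\<not> card U < 4"
    then have "4 \<le> card U" by simp
    then have "z = 0" by (rule orth_zero[OF UJ]) (simp add: U_def)
    then show False using uz by simp
  qed
  then have c: "card U \<le> 2" using \<open>card U \<noteq> 3\<close> by simp
  have finU: "finite U" using UJ finJ finite_subset by blast
  have "dim (insert u (a ` U)) \<le> card (insert u (a ` U))"
    using finU by (intro dim_le_card) (auto intro: span_base)
  also have "\<dots> \<le> Suc (card U)"
    using card_image_le[OF finU, of a] finU by (simp add: card_insert_if)
  also have "\<dots> < DIM('a)" using c dim4 by simp
  finally obtain d where d: "d \<noteq> 0" "span (insert u (a ` U)) \<subseteq> {x. d \<bullet> x = 0}"
    using lowdim_subset_hyperplane by blast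
  have ud: "u \<bullet> d = 0" using d(2) span_base[of u "insert u (a ` U)"] by (auto simp: inner_commute)
  have Ud: "a j \<bullet> d = 0" if "j \<in> U" for j using d(2) span_base[of "a j" "insert u (a ` U)"] that by (auto simp: inner_commute)
  have TU: "a j \<bullet> d = 0" if "j \<in> T \<inter> J" for j using Ud zT that by (auto simp: U_def tight_flat_def)
  have "eventually (\<lambda>e. z + e *\<^sub>R d \<in> normal_cone J a) (at_right 0)"
    by (rule perturb_in_normal_cone[OF zc]) (use Ud in \<open>auto simp: U_def\<close>)
  moreover have "eventually (\<lambda>e. z + e *\<^sub>R (- d) \<in> normal_cone J a) (at_right 0)"
    by (rule perturb_in_normal_cone[OF zc]) (use Ud in \<open>auto simp: U_def\<close>)
  moreover have "eventually (\<lambda>e::real. e > 0) (at_right 0)" by (rule eventually_at_right_less)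
  ultimately have "eventually (\<lambda>e. e > 0 \<and> z + e *\<^sub>R d \<in> normal_cone J a \<and> z + e *\<^sub>R (- d) \<in> normal_cone J a) (at_right 0)"
    by eventually_elim simp
  then obtain e where e: "e > 0" "z + e *\<^sub>R d \<in> normal_cone J a" "z + e *\<^sub>R (- d) \<in> normal_cone J a"
    using eventually_happens'[OF trivial_limit_at_right_real] by blast
  have sl: "z + e *\<^sub>R d \<in> slice T" "z + e *\<^sub>R (- d) \<in> slice T"
    using e uz ud TU zT TJ by (auto simp: slice_def tight_flat_def inner_diff_right inner_add_right)
  then have "m \<le> w \<bullet> (z + e *\<^sub>R d)" "m \<le> w \<bullet> (z + e *\<^sub>R (- d))" using m by blast+
  then have "e * (w \<bullet> d) = 0" using zs(2) by (simp add: inner_add_right inner_diff_right)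
  then have "w \<bullet> d = 0" using e(1) by simp
  then have "z + e *\<^sub>R d \<in> {x \<in> slice T. w \<bullet> x = m}" "z + e *\<^sub>R (- d) \<in> {x \<in> slice T. w \<bullet> x = m}"
    using sl zs(2) by (simp_all add: inner_add_right inner_diff_right)
  moreover have "z \<in> open_segment (z + e *\<^sub>R d) (z + e *\<^sub>R (- d))"
  proof -
    have "z = (1 - 1/2) *\<^sub>R (z + e *\<^sub>R d) + (1/2) *\<^sub>R (z + e *\<^sub>R (- d))"
      by (simp add: algebra_simps flip: scaleR_add_left)
    moreover have "z + e *\<^sub>R d \<noteq> z + e *\<^sub>R (- d)"
    proof
      assume "z + e *\<^sub>R d = z + e *\<^sub>R (- d)"
      then have "(2 * e) *\<^sub>R d = 0" by (simp add: algebra_simps scaleR_2 flip: scaleR_add_left)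
      then show False using e(1) d(1) by simp
    qed
    ultimately show ?thesis unfolding in_segment by (intro conjI exI[of _ "1/2"]) auto
  qed
  ultimately show False using z unfolding extreme_point_of_def by blast
qed

text \<open>A minimizer that is an extreme point of the set of minimizers is a vertex. The edges at
  it that remain in the face are feasible directions, hence not descending, and genericity makes
  them strictly ascending.\<close>

lemma ex_lowest:
  assumes w: "generic w" and T: "nonvoid T"
  shows "\<exists>S. lowest w T S"
proof -
  obtain z0 where z0: "z0 \<in> slice T" "\<And>x. x \<in> slice T \<Longrightarrow> w \<bullet> z0 \<le> w \<bullet> x"
    using continuous_attains_inf[OF compact_slice slice_nonempty[OF T] inner_cont] by blast
  \<comment> \<open>Uniqueness of the minimizer is not known at this stage, so an extreme point of
    the whole set of minimizers is taken.\<close>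
  let ?M = "{x \<in> slice T. w \<bullet> x = w \<bullet> z0}"
  have M: "?M = slice T \<inter> {x. w \<bullet> x = w \<bullet> z0}" by auto
  have "compact ?M" unfolding M by (intro compact_Int_closed compact_slice closed_hyperplane)
  moreover have "convex ?M" unfolding M by (intro convex_Int convex_slice convex_hyperplane)
  moreover have "?M \<noteq> {}" using z0 by blast
  ultimately obtain z where z: "z extreme_point_of ?M" by (rule extreme_point_exists_convex)
  define S where "S = {j\<in>J. a j \<bullet> z = 0}"
  have TJ: "T \<subseteq> J" using T by (simp add: nonvoid_def)
  have cS: "card S = 3"
    unfolding S_def by (rule extreme_point_minimizer_tight[OF TJ z z0(2)])
  have zs: "z \<in> slice T" "w \<bullet> z = w \<bullet> z0" using z by (auto simp: extreme_point_of_def)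
  have "z \<in> open_face J a S"
    using zs(1) by (force simp: S_def open_face_def tight_flat_def slice_def normal_cone_def)
  then have S: "S \<in> verts" using cS by (auto simp: verts_def nonvoid_def S_def)
  have TS: "T \<subseteq> S" using zs(1) TJ by (auto simp: S_def slice_def tight_flat_def)
  have "z \<in> slice S" using zs(1) by (auto simp: slice_def S_def tight_flat_def)
  then have zv: "z = vertex S" by (rule slice_eq_vertex[OF S])
  have "w \<bullet> edge S s > 0" if s: "s \<in> S - T" for s
  proof -
    have "eventually (\<lambda>e. z + e *\<^sub>R edge S s \<in> normal_cone J a) (at_right 0)"
      by (rule perturb_in_normal_cone) (use zs(1) edge(2)[OF S] in \<open>auto simp: S_def slice_def\<close>)
    moreover have "eventually (\<lambda>e::real. e > 0) (at_right 0)" by (rule eventually_at_right_less)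
    ultimately have "eventually (\<lambda>e. e > 0 \<and> z + e *\<^sub>R edge S s \<in> normal_cone J a) (at_right 0)"
      by eventually_elim simp
    then obtain e where e: "e > 0" "z + e *\<^sub>R edge S s \<in> normal_cone J a"
      using eventually_happens'[OF trivial_limit_at_right_real] by blast
    have "a t \<bullet> edge S s = 0" if "t \<in> T" for t using edge(2)[OF S, of t s] that TS s by auto
    then have "z + e *\<^sub>R edge S s \<in> slice T"
      using e zs(1) edge(1)[OF S] by (auto simp: slice_def tight_flat_def inner_add_right)
    then have "w \<bullet> z0 \<le> w \<bullet> (z + e *\<^sub>R edge S s)" by (rule z0(2))
    then have "w \<bullet> edge S s \<ge> 0" using zs(2) e(1) by (simp add: inner_add_right zero_le_mult_iff)
    moreover have "w \<bullet> edge S s \<noteq> 0" using w S s by (auto simp: generic_def)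
    ultimately show ?thesis by simp
  qed
  then show ?thesis using S TS by (auto simp: lowest_def)
qed

lemma lowest_unique:
  assumes "lowest w T S" "lowest w T S'"
  shows "S = S'"
proof (rule ccontr)
  assume "S \<noteq> S'"
  then have "vertex S \<noteq> vertex S'" using vertex_inj assms by (auto simp: lowest_def)
  moreover have "vertex S \<in> slice T" "vertex S' \<in> slice T"
    using vertex_in_slice assms by (auto simp: lowest_def)
  ultimately show False using lowest_less[OF assms(1), of "vertex S'"] lowest_less[OF assms(2), of "vertex S"] by simp
qed

lemma card_lowest:
  assumes "generic w" "nonvoid T"
  shows "card {S. lowest w T S} = 1"
  using ex_lowest[OF assms] lowest_unique[of w T] by (auto simp: card_1_singleton_iff)

lemma generic_uminus: "generic w \<Longrightarrow> generic (- w)"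
  by (simp add: generic_def)

lemma nonvoid_empty: "nonvoid {}"
  using x0 by (auto simp: nonvoid_def open_face_def tight_flat_def)

text \<open>Indexed by the number of tight constraints: \<open>nfaces c\<close> counts the faces of
  spherical dimension \<open>3 - c\<close>, so \<open>nfaces 3\<close> counts vertices and
  \<open>nfaces 0\<close> the cell itself.\<close>

definition nfaces :: "nat \<Rightarrow> nat" where
  "nfaces c = card {T. nonvoid T \<and> card T = c}"

lemma nfaces_0: "nfaces 0 = 1"
proof -
  have "{T. nonvoid T \<and> card T = 0} = {{}}"
    using nonvoid_empty finJ finite_subset by (auto simp: nonvoid_def)
  then show ?thesis by (simp add: nfaces_def)
qed

text \<open>The alternating sum over all faces is regrouped by lowest vertex. The faces with lowest
  vertex \<open>S\<close> form the Boolean interval from the descending edges of \<open>S\<close> to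
  \<open>S\<close>, whose alternating sum is zero except at the single vertex with no ascending
  edge.\<close>

lemma euler: "int (nfaces 0) - int (nfaces 1) + int (nfaces 2) - int (nfaces 3) = - 1"
proof -
  obtain w where w: "generic w" using ex_generic by blast
  define Neg where "Neg S = {s\<in>S. w \<bullet> edge S s < 0}" for S
  \<comment> \<open>An edge of \<open>S\<close> belonging to \<open>s\<close> stays in the face
    \<open>T\<close> exactly if \<open>s\<close> is not in \<open>T\<close>; so \<open>S\<close> is
    lowest on \<open>T\<close> iff every descending edge leaves \<open>T\<close>.\<close>
  have low: "lowest w T S \<longleftrightarrow> S \<in> verts \<and> Neg S \<subseteq> T \<and> T \<subseteq> S" for T S
  proof (cases "S \<in> verts")
    case True
    then have "w \<bullet> edge S s > 0 \<longleftrightarrow> \<not> w \<bullet> edge S s < 0" if "s \<in> S" for s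
      using w that unfolding generic_def by (metis linorder_neqE_linordered_idom order_less_asym)
    then show ?thesis using True unfolding lowest_def Neg_def by blast
  qed (simp add: lowest_def)
  have fin: "finite {T. nonvoid T}" using finite_nonvoid[of "\<lambda>_. True"] by simp
  have "{T. nonvoid T} = (\<Union>c\<in>{0..3}. {T. nonvoid T \<and> card T = c})" by (auto simp: nonvoid_def)
  then have "(\<Sum>T | nonvoid T. (-1) ^ card T) = (\<Sum>c\<in>{0..3}. \<Sum>T | nonvoid T \<and> card T = c. (-1::int) ^ card T)"
    using finite_nonvoid by (simp only:) (rule sum.UNION_disjoint, auto)
  also have "\<dots> = (\<Sum>c\<in>{0..3}. (-1) ^ c * int (nfaces c))" by (simp add: nfaces_def mult.commute)
  also have "\<dots> = int (nfaces 0) - int (nfaces 1) + int (nfaces 2) - int (nfaces 3)"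
    by (simp add: numeral_3_eq_3 numeral_2_eq_2)
  finally have 1: "(\<Sum>T | nonvoid T. (-1) ^ card T) = int (nfaces 0) - int (nfaces 1) + int (nfaces 2) - int (nfaces 3)" .
  have "(\<Sum>T | nonvoid T. (-1) ^ card T) = (\<Sum>T | nonvoid T. \<Sum>S | S \<in> verts \<and> (Neg S \<subseteq> T \<and> T \<subseteq> S). (-1::int) ^ card T)"
  proof (rule sum.cong[OF refl])
    fix T assume "T \<in> {T. nonvoid T}"
    then have "card {S. S \<in> verts \<and> (Neg S \<subseteq> T \<and> T \<subseteq> S)} = 1" using card_lowest[OF w, of T] by (simp add: low)
    then show "(-1::int) ^ card T = (\<Sum>S | S \<in> verts \<and> (Neg S \<subseteq> T \<and> T \<subseteq> S). (-1) ^ card T)" by simp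
  qed
  also have "\<dots> = (\<Sum>S\<in>verts. \<Sum>T | T \<in> {T. nonvoid T} \<and> (Neg S \<subseteq> T \<and> T \<subseteq> S). (-1) ^ card T)"
    by (rule sum.swap_restrict[OF fin finite_verts])
  also have "\<dots> = (\<Sum>S\<in>verts. if Neg S = S then -1 else 0)"
  proof (rule sum.cong[OF refl])
    fix S assume S: "S \<in> verts"
    then have fS: "finite S" "card S = 3" using finJ finite_subset by (auto simp: verts_def nonvoid_def)
    have "{T. T \<in> {T. nonvoid T} \<and> (Neg S \<subseteq> T \<and> T \<subseteq> S)} = {T. Neg S \<subseteq> T \<and> T \<subseteq> S}"
      using subset_vertex_nonvoid[OF S] by blast
    then show "(\<Sum>T | T \<in> {T. nonvoid T} \<and> (Neg S \<subseteq> T \<and> T \<subseteq> S). (-1) ^ card T) = (if Neg S = S then -1 else (0::int))"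
      using sum_minus_one_power_interval[OF fS(1), of "Neg S"] fS(2) by (simp add: Neg_def)
  qed
  also have "\<dots> = - int (card {S\<in>verts. Neg S = S})"
    using finite_verts by (simp add: sum.If_cases Int_def)
  \<comment> \<open>A vertex with only descending edges is the highest point of the whole slice,
    that is, the lowest one for \<open>- w\<close>.\<close>
  also have "{S\<in>verts. Neg S = S} = {S. lowest (- w) {} S}"
    by (auto simp: lowest_def Neg_def)
  also have "card \<dots> = 1" by (rule card_lowest[OF generic_uminus[OF w] nonvoid_empty])
  finally show ?thesis using 1 by simp
qed

text \<open>At a vertex containing \<open>T\<close> just one edge direction stays inside
  \<open>T\<close>, and the sign of \<open>w\<close> on it decides whether the vertex is lowest for
  \<open>w\<close> or for \<open>- w\<close>. Each case occurs exactly once.\<close>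

lemma card_verts_on_edge:
  assumes T: "nonvoid T" "card T = 2"
  shows "card {S\<in>verts. T \<subseteq> S} = 2"
proof -
  obtain w where w: "generic w" using ex_generic by blast
  have ex1: "\<exists>s. S - T = {s}" if "S \<in> verts" "T \<subseteq> S" for S
  proof -
    have "finite S" "finite T" using that T finJ finite_subset by (auto simp: verts_def nonvoid_def)
    then have "card (S - T) = 1" using that T by (simp add: card_Diff_subset verts_def)
    then show ?thesis by (simp add: card_1_singleton_iff)
  qed
  have "{S\<in>verts. T \<subseteq> S} = {S. lowest w T S} \<union> {S. lowest (- w) T S}"
  proof (intro equalityI subsetI)
    fix S assume S: "S \<in> {S\<in>verts. T \<subseteq> S}"
    then obtain s where s: "S - T = {s}" using ex1 by blast
    then have "w \<bullet> edge S s \<noteq> 0" using w S by (auto simp: generic_def)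
    then show "S \<in> {S. lowest w T S} \<union> {S. lowest (- w) T S}" using S s by (auto simp: lowest_def)
  qed (auto simp: lowest_def)
  moreover have "{S. lowest w T S} \<inter> {S. lowest (- w) T S} = {}"
  proof (rule equals0I)
    fix S assume S: "S \<in> {S. lowest w T S} \<inter> {S. lowest (- w) T S}"
    then obtain s where "S - T = {s}" using ex1[of S] by (auto simp: lowest_def)
    then show False using S by (auto simp: lowest_def)
  qed
  moreover have "finite {S. lowest w T S}" "finite {S. lowest (- w) T S}"
    by (rule finite_subset[OF _ finite_verts]; auto simp: lowest_def)+
  ultimately show ?thesis
    using card_lowest[OF w T(1)] card_lowest[OF generic_uminus[OF w] T(1)] by (simp add: card_Un_disjoint)
qed

text \<open>Double counting of incidences: two vertices on each edge, three edges at each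
  vertex.\<close>

lemma edge_vertex_count: "2 * nfaces 2 = 3 * nfaces 3"
proof -
  have "2 * nfaces 2 = (\<Sum>T | nonvoid T \<and> card T = 2. \<Sum>S | S \<in> verts \<and> T \<subseteq> S. 1)"
    using card_verts_on_edge by (simp add: nfaces_def)
  also have "\<dots> = (\<Sum>S\<in>verts. \<Sum>T | T \<in> {T. nonvoid T \<and> card T = 2} \<and> T \<subseteq> S. 1)"
    by (rule sum.swap_restrict[OF finite_nonvoid finite_verts])
  also have "\<dots> = (\<Sum>S\<in>verts. 3)"
  proof (rule sum.cong[OF refl])
    fix S assume S: "S \<in> verts"
    then have fS: "finite S" "card S = 3" using finJ finite_subset by (auto simp: verts_def nonvoid_def)
    have "{T. T \<in> {T. nonvoid T \<and> card T = 2} \<and> T \<subseteq> S} = {T. T \<subseteq> S \<and> card T = 2}"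
      using subset_vertex_nonvoid[OF S] by blast
    then show "(\<Sum>T | T \<in> {T. nonvoid T \<and> card T = 2} \<and> T \<subseteq> S. 1) = (3::nat)"
      using n_subsets[OF fS(1), of 2] fS(2) by (simp add: numeral_3_eq_3 numeral_2_eq_2)
  qed
  also have "\<dots> = 3 * nfaces 3" by (simp add: nfaces_def verts_def)
  finally show ?thesis .
qed

end

text \<open>With \<open>nfaces 0 = 1\<close> Euler's relation reads 1 - f2 + f1 - f0 = -1; together
  with 2 f1 = 3 f0 it determines f1 and f2.\<close>

lemma f_num_relations:
  fixes a :: "'i \<Rightarrow> 'a::euclidean_space"
  assumes "DIM('a) = 4" "finite J" "4 \<le> card J" "in_general_position J a" "\<And>j. j \<in> J \<Longrightarrow> a j \<bullet> x0 < 0"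
  defines "P \<equiv> normal_cone J a \<inter> sphere 0 1"
  shows "2 * f_num 1 P = 3 * f_num 0 P" "2 * f_num 2 P = f_num 0 P + 4"
    "f_num 0 P = card {U. U \<subseteq> J \<and> card U = 3 \<and> open_face J a U \<noteq> {}}"
proof -
  interpret simple_cone J a "- (\<Sum>j\<in>J. a j)" x0
    using assms by unfold_locales auto
  have f: "f_num k P = card {U. U \<subseteq> J \<and> card U = 3 - k \<and> open_face J a U \<noteq> {}}" if "k \<le> 2" for k
    unfolding P_def using f_num_general_position[OF assms(2,4), of k] that assms(1) by simp
  have "f_num k P = nfaces (3 - k)" if "k \<le> 2" for k
    unfolding f[OF that] nfaces_def nonvoid_def by (intro arg_cong[where f = card]) auto
  from this[of 0] this[of 1] this[of 2] have "f_num 0 P = nfaces 3" "f_num 1 P = nfaces 2" "f_num 2 P = nfaces 1"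
    by (simp_all add: numeral_2_eq_2 numeral_3_eq_3)
  then show "2 * f_num 1 P = 3 * f_num 0 P" "2 * f_num 2 P = f_num 0 P + 4"
    using euler nfaces_0 edge_vertex_count by linarith+
  show "f_num 0 P = card {U. U \<subseteq> J \<and> card U = 3 \<and> open_face J a U \<noteq> {}}" using f[of 0] by simp
qed

section \<open>The uniform distribution on the sphere in polar coordinates\<close>

text \<open>It suffices to test boxes. The preimage of a box under \<open>f\<close> is its image
  under the inverse map, whose volume carries the reciprocal determinant.\<close>

lemma lborel_linear:
  fixes f :: "real^'n::{finite,wellorder} \<Rightarrow> real^'n::_"
  assumes lin: "linear f" and det: "det (matrix f) \<noteq> 0"
  shows "lborel = density (distr lborel borel f) (\<lambda>_. ennreal \<bar>det (matrix f)\<bar>)"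
proof (rule lborel_eqI)
  have [measurable]: "f \<in> borel_measurable borel"
    using lin by (intro borel_measurable_continuous_onI linear_continuous_on) (simp add: linear_linear)
  have "invertible (matrix f)" using det by (simp add: invertible_det_nz)
  then obtain g where g: "linear g" "\<And>x. g (f x) = x" "\<And>x. f (g x) = x"
    using lin matrix_invertible[OF lin] by (auto simp: fun_eq_iff)
  have dd: "\<bar>det (matrix f)\<bar> * \<bar>det (matrix g)\<bar> = 1"
  proof -
    have "matrix f ** matrix g = matrix (f \<circ> g)" using matrix_compose[OF g(1) lin] by simp
    also have "f \<circ> g = id" using g(3) by auto
    finally have "det (matrix f) * det (matrix g) = 1"
      by (metis det_mul det_I matrix_id_mat_1 id_def)
    then show ?thesis by (metis abs_mult abs_one)
  qed
  fix l u :: "real^'n::_" assume lu: "\<And>b. b \<in> Basis \<Longrightarrow> l \<bullet> b \<le> u \<bullet> b"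
  have vim: "f -` box l u = g ` box l u" 
  proof (intro equalityI subsetI)
    fix x assume "x \<in> f -` box l u"
    then have "x = g (f x)" "f x \<in> box l u" using g(2) by simp_all
    then show "x \<in> g ` box l u" by (rule image_eqI)
  qed (use g(3) in auto)
  have 1: "measure lebesgue (g ` box l u) = \<bar>det (matrix g)\<bar> * measure lebesgue (box l u)"
    by (rule measure_linear_image[OF g(1) lmeasurable_box])
  have 2: "g ` box l u \<in> lmeasurable" by (rule measurable_linear_image[OF g(1) lmeasurable_box])
  have "f -` box l u \<in> sets borel" using measurable_sets_borel[of f borel "box l u"] by simp
  then have "emeasure lborel (f -` box l u) = emeasure lebesgue (g ` box l u)"
    unfolding vim by simp
  also have "\<dots> = ennreal (measure lebesgue (g ` box l u))" by (rule emeasure_eq_measure2[OF 2])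
  also have "\<dots> = ennreal (\<bar>det (matrix g)\<bar> * measure lborel (box l u))"
    unfolding 1 by simp
  finally have em: "emeasure lborel (f -` box l u) = ennreal (\<bar>det (matrix g)\<bar> * measure lborel (box l u))" .
  have "emeasure (density (distr lborel borel f) (\<lambda>_. ennreal \<bar>det (matrix f)\<bar>)) (box l u)
      = ennreal \<bar>det (matrix f)\<bar> * emeasure lborel (f -` box l u)"
    by (simp add: emeasure_density nn_integral_cmult emeasure_distr)
  also have "\<dots> = ennreal (\<bar>det (matrix f)\<bar> * \<bar>det (matrix g)\<bar> * measure lborel (box l u))"
    unfolding em by (simp add: ennreal_mult' mult.assoc)
  also have "\<dots> = ennreal (\<Prod>b\<in>Basis. (u - l) \<bullet> b)"
    unfolding dd using lu by (simp add: measure_lborel_box_eq)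
  finally show "emeasure (density (distr lborel borel f) (\<lambda>_. ennreal \<bar>det (matrix f)\<bar>)) (box l u) =
    ennreal (\<Prod>b\<in>Basis. (u - l) \<bullet> b)" .
qed simp

lemma nn_integral_lborel_linear:
  fixes f :: "real^'n::{finite,wellorder} \<Rightarrow> real^'n::_"
  assumes lin: "linear f" and det: "det (matrix f) \<noteq> 0" and g[measurable]: "g \<in> borel_measurable borel"
  shows "(\<integral>\<^sup>+x. g x \<partial>lborel) = ennreal \<bar>det (matrix f)\<bar> * (\<integral>\<^sup>+x. g (f x) \<partial>lborel)"
proof -
  have [measurable]: "f \<in> borel_measurable borel"
    using lin by (intro borel_measurable_continuous_onI linear_continuous_on) (simp add: linear_linear)
  show ?thesis
    by (subst lborel_linear[OF lin det]) (simp add: nn_integral_density nn_integral_distr nn_integral_cmult)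
qed

lemma lborel_distr_orthogonal:
  fixes f :: "real^'n::{finite,wellorder} \<Rightarrow> real^'n::_"
  assumes "orthogonal_transformation f"
  shows "distr lborel borel f = lborel"
proof -
  have "\<bar>det (matrix f)\<bar> = 1" using assms orthogonal_transformation_det by blast
  then show ?thesis
    using lborel_linear[of f] orthogonal_transformation_linear[OF assms] by (auto simp: density_1)
qed

text \<open>Preimages of boxes are boxes with relabelled sides. The lemma serves to identify
  Euclidean spaces of different types, where no determinant is available.\<close>

lemma lborel_distr_Basis:
  fixes f :: "'a::euclidean_space \<Rightarrow> 'b::euclidean_space"
  assumes lin: "linear f" and inner: "\<And>x y. f x \<bullet> f y = x \<bullet> y" and Bas: "f ` Basis = Basis"
  shows "distr lborel borel f = lborel"
proof (rule lborel_eqI[symmetric])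
  have [measurable]: "f \<in> borel_measurable borel"
    using lin by (intro borel_measurable_continuous_onI linear_continuous_on) (simp add: linear_linear)
  have inj: "inj_on f Basis"
    by (rule inj_onI) (metis inner inner_same_Basis inner_not_same_Basis zero_neq_one)
  fix l u :: 'b assume lu: "\<And>b. b \<in> Basis \<Longrightarrow> l \<bullet> b \<le> u \<bullet> b"
  define h where "h y = (\<Sum>b\<in>Basis. (y \<bullet> f b) *\<^sub>R b)" for y
  have hb: "h y \<bullet> b = y \<bullet> f b" if "b \<in> Basis" for y b
    using that by (simp add: h_def inner_sum_left_Basis)
  have "f -` box l u = box (h l) (h u)"
  proof -
    have "f x \<in> box l u \<longleftrightarrow> (\<forall>b\<in>Basis. l \<bullet> f b < f x \<bullet> f b \<and> f x \<bullet> f b < u \<bullet> f b)" for x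
      unfolding box_def mem_Collect_eq Bas[symmetric] by blast
    then show ?thesis by (auto simp: box_def hb inner)
  qed
  moreover have "h l \<bullet> b \<le> h u \<bullet> b" if "b \<in> Basis" for b using lu Bas that by (auto simp: hb)
  ultimately have "emeasure (distr lborel borel f) (box l u) = ennreal (\<Prod>b\<in>Basis. (h u - h l) \<bullet> b)"
    by (simp add: emeasure_distr emeasure_lborel_box_eq)
  also have "(\<Prod>b\<in>Basis. (h u - h l) \<bullet> b) = (\<Prod>b\<in>Basis. (u - l) \<bullet> f b)"
    by (simp add: inner_diff_left hb)
  also have "\<dots> = (\<Prod>b\<in>Basis. (u - l) \<bullet> b)"
    using prod.reindex[OF inj, of "\<lambda>b. (u - l) \<bullet> b"] Bas by simp
  finally show "emeasure (distr lborel borel f) (box l u) = ennreal (\<Prod>b\<in>Basis. (u - l) \<bullet> b)" .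
qed simp

lemma emeasure_sphere_unif:
  fixes A :: "'a::euclidean_space set"
  assumes "A \<in> sets sphere_borel"
  shows "emeasure sphere_unif A = emeasure lborel {y \<in> ball 0 1 - {0}. sgn y \<in> A} / emeasure lborel (ball (0::'a) 1)"
proof -
  let ?D = "of_nat DIM('a) :: ennreal"
  have A: "A \<subseteq> sphere 0 1" using sets.sets_into_space[OF assms] by (simp add: space_restrict_space)
  have S: "sphere (0::'a) 1 \<in> sets sphere_borel"
    using sets.top[of "sphere_borel :: 'a measure"] by (simp add: space_restrict_space)
  have mA: "{y \<in> ball 0 1 - {0}. sgn y \<in> A} \<in> sets (restrict_space lborel (ball 0 1 - {0}))"
    using measurable_sets[OF measurable_sgn_punctured_ball assms]
    by (simp add: space_restrict_space vimage_def Int_def conj_commute cong: conj_cong)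
  have "emeasure sphere_unif A = emeasure spherical_lebesgue A / emeasure spherical_lebesgue (sphere (0::'a) 1)"
    unfolding sphere_unif_def using A assms S by (subst emeasure_uniform_measure) (auto simp: Int_absorb1)
  also have "emeasure spherical_lebesgue A = ?D * emeasure lborel {y \<in> ball 0 1 - {0}. sgn y \<in> A}"
  proof -
    have "emeasure (restrict_space lborel (ball 0 1 - {0})) {y \<in> ball 0 1 - {0}. sgn y \<in> A}
        = emeasure lborel {y \<in> ball 0 1 - {0}. sgn y \<in> A}"
      by (rule emeasure_restrict_space) auto
    moreover have "sgn -` A \<inter> (ball 0 1 - {0}) = {y \<in> ball 0 1 - {0}. sgn y \<in> A}" by auto
    ultimately show ?thesis unfolding spherical_lebesgue_def
      by (simp add: emeasure_distr[OF measurable_sgn_punctured_ball assms] space_restrict_space)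
  qed
  also have "emeasure spherical_lebesgue (sphere (0::'a) 1) = ?D * emeasure lborel (ball (0::'a) 1)"
    by (rule emeasure_spherical_lebesgue_sphere)
  also have "?D * emeasure lborel {y \<in> ball 0 1 - {0}. sgn y \<in> A} / (?D * emeasure lborel (ball (0::'a) 1))
     = emeasure lborel {y \<in> ball 0 1 - {0}. sgn y \<in> A} / emeasure lborel (ball (0::'a) 1)"
    by (subst (1 2) mult.commute, intro divide_mult_eq) (auto simp: ennreal_of_nat_eq_real_of_nat)
  finally show ?thesis .
qed

text \<open>\<open>sgn\<close> commutes with a linear map that preserves norms, so cones over sets
  are mapped to cones over their images.\<close>

lemma sphere_unif_isometry:
  fixes f :: "'a::euclidean_space \<Rightarrow> 'b::euclidean_space"
  assumes lin: "linear f" and nrm: "\<And>x. norm (f x) = norm x" and leb: "distr lborel borel f = lborel"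
  shows "f \<in> sphere_borel \<rightarrow>\<^sub>M sphere_borel" "distr sphere_unif sphere_borel f = sphere_unif"
proof -
  have [measurable]: "f \<in> borel_measurable borel"
    using lin by (intro borel_measurable_continuous_onI linear_continuous_on) (simp add: linear_linear)
  show f: "f \<in> sphere_borel \<rightarrow>\<^sub>M sphere_borel"
    by (intro measurable_restrict_space2 measurable_restrict_space1) (auto simp: space_restrict_space nrm)
  have f': "f \<in> sphere_unif \<rightarrow>\<^sub>M sphere_borel" using f by (simp cong: measurable_cong_sets)
  have sgnf: "sgn (f x) = f (sgn x)" for x using lin nrm by (simp add: sgn_div_norm linear_cmul)
  have f0: "f x = 0 \<longleftrightarrow> x = 0" for x using nrm by (metis norm_eq_zero)
  have vol: "emeasure lborel (f -` A) = emeasure lborel A" if "A \<in> sets borel" for A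
    using that leb emeasure_distr[of f lborel borel A] by simp
  show "distr sphere_unif sphere_borel f = sphere_unif"
  proof (rule measure_eqI)
    fix A assume "A \<in> sets (distr sphere_unif sphere_borel f)"
    then have A: "A \<in> sets sphere_borel" by simp
    have fA: "f -` A \<inter> sphere 0 1 \<in> sets sphere_borel"
      using measurable_sets[OF f A] by (simp add: space_restrict_space)
    have mA: "{y \<in> ball 0 1 - {0}. sgn y \<in> A} \<in> sets borel"
    proof -
      have "{y \<in> ball 0 1 - {0}. sgn y \<in> A} \<in> sets (restrict_space lborel (ball 0 1 - {0}))"
        using measurable_sets[OF measurable_sgn_punctured_ball A]
        by (simp add: space_restrict_space vimage_def Int_def conj_commute cong: conj_cong)
      then show ?thesis by (subst (asm) sets_restrict_space_iff) auto
    qed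
    have "f -` ball 0 1 = ball 0 1" using nrm by auto
    then have "emeasure lborel (ball (0::'a) 1) = emeasure lborel (ball (0::'b) 1)"
      using vol[of "ball 0 1"] by simp
    moreover have "{y \<in> ball 0 1 - {0}. sgn y \<in> f -` A \<inter> sphere 0 1} = f -` {y \<in> ball 0 1 - {0}. sgn y \<in> A}"
      by (auto simp: nrm sgnf f0 norm_sgn)
    ultimately show "emeasure (distr sphere_unif sphere_borel f) A = emeasure sphere_unif A"
      using vol[OF mA] by (simp add: emeasure_distr[OF f' A] emeasure_sphere_unif[OF A] emeasure_sphere_unif[OF fA])
  qed simp
qed

text \<open>Identifies \<open>(real^3) \<times> real\<close> with \<open>real^4\<close>. Pairs
  single out the axis over which hyperplanes are graphs, and leave a \<open>real^3\<close> in which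
  the cross product is at hand; the real component becomes coordinate 1.\<close>

definition join_last :: "(real^3) \<times> real \<Rightarrow> real^4" where
  "join_last z = (\<chi> i. if i = 1 then snd z else fst z $ (if i = 2 then 1 else if i = 3 then 2 else 3))"

lemma linear_join_last: "linear join_last"
  by (rule linearI) (auto simp: join_last_def vec_eq_iff)

lemma inner_join_last: "join_last x \<bullet> join_last y = x \<bullet> y"
  by (cases x, cases y) (simp add: join_last_def inner_vec_def sum_3 sum_4)

lemma join_last_Basis: "join_last ` Basis = Basis"
proof -
  have "join_last ` Basis \<subseteq> Basis"
  proof
    fix z assume "z \<in> join_last ` Basis"
    then obtain b :: "(real^3) \<times> real" where b: "b \<in> Basis" "z = join_last b" by blast
    consider i where "b = (axis i 1, 0)" | "b = (0, 1)"
      using b(1) by (auto simp: Basis_prod_def Basis_vec_def)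
    then show "z \<in> Basis"
    proof cases
      case (1 i)
      have "i = 1 \<or> i = 2 \<or> i = 3" by (rule exhaust_3)
      then have "z = axis (if i = 1 then 2 else if i = 2 then 3 else 4) 1"
        using 1 b(2) by (auto simp: join_last_def vec_eq_iff axis_def forall_4)
      then show ?thesis by (simp add: axis_in_Basis_iff)
    next
      case 2
      then have "z = axis 1 1" using b(2) by (auto simp: join_last_def vec_eq_iff axis_def)
      then show ?thesis by (simp add: axis_in_Basis_iff)
    qed
  qed
  moreover have "inj_on join_last Basis"
    by (rule inj_onI) (metis inner_join_last inner_same_Basis inner_not_same_Basis zero_neq_one)
  then have "card (join_last ` Basis) = card (Basis :: (real^4) set)" by (simp add: card_image)
  ultimately show ?thesis by (intro card_subset_eq) auto
qed

lemma norm_join_last: "norm (join_last x) = norm x"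
  by (simp add: norm_eq_sqrt_inner inner_join_last)

lemma lborel_distr_join_last: "distr lborel borel join_last = lborel"
  by (rule lborel_distr_Basis[OF linear_join_last inner_join_last join_last_Basis])

section \<open>Polar coordinates on the unit ball\<close>

definition dir :: "'a::euclidean_space \<Rightarrow> 'a" where
  "dir y = (if y = 0 then SOME b. b \<in> Basis else sgn y)"

lemma norm_dir: "norm (dir y) = 1"
  by (simp add: dir_def norm_sgn)

lemma measurable_dir [measurable]: "dir \<in> borel \<rightarrow>\<^sub>M (sphere_borel :: 'a::euclidean_space measure)"
proof (rule measurable_restrict_space2)
  show "dir \<in> space borel \<rightarrow> sphere (0::'a) 1" by (auto simp: norm_dir)
  show "dir \<in> borel_measurable (borel :: 'a measure)" unfolding dir_def[abs_def] sgn_div_norm by measurable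
qed

lemma norm_scaleR_dir: "norm y *\<^sub>R dir y = y"
  by (simp add: dir_def sgn_div_norm)

lemma dir_scaleR: "0 < r \<Longrightarrow> y \<noteq> 0 \<Longrightarrow> dir (r *\<^sub>R y) = dir y"
  by (simp add: dir_def sgn_div_norm)

lemma ennreal_mult_cancel:
  fixes a c :: ennreal
  assumes "c \<noteq> 0" "c \<noteq> \<top>"
  shows "c * (a / c) = a" "c * a / c = a"
  using assms mult_divide_eq_ennreal[of c a] by (simp_all add: ennreal_times_divide mult.commute[of c a])

abbreviation unit_vol :: "'a::euclidean_space itself \<Rightarrow> ennreal" where
  "unit_vol _ \<equiv> emeasure lborel (ball (0::'a) 1)"

lemma unit_vol_pos: "unit_vol TYPE('a::euclidean_space) \<noteq> 0" "unit_vol TYPE('a) \<noteq> \<top>"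
  using emeasure_lborel_ball_finite[of "0::'a" 1]
  by (auto simp: emeasure_ball unit_ball_vol_pos less_imp_neq ennreal_eq_0_iff not_le less_top)

lemma emeasure_ball_dir:
  fixes A :: "'a::euclidean_space set"
  assumes A: "A \<in> sets sphere_borel"
  shows "emeasure lborel {y \<in> ball 0 1. dir y \<in> A} = unit_vol TYPE('a) * emeasure sphere_unif A"
proof -
  have [measurable]: "{y. dir y \<in> A} \<in> sets borel"
    using measurable_sets[OF measurable_dir A] by (simp add: vimage_def)
  have m: "{y \<in> ball 0 1. dir y \<in> A} \<in> sets borel"
    using sets.Int[of "ball 0 1" borel "{y. dir y \<in> A}"] by (simp add: Int_def)
  have "emeasure lborel ({y \<in> ball 0 1. dir y \<in> A} - {0}) = emeasure lborel {y \<in> ball 0 1. dir y \<in> A}"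
    using m by (intro emeasure_Diff_null_set) auto
  also have "{y \<in> ball 0 1. dir y \<in> A} - {0} = {y \<in> ball 0 1 - {0}. sgn y \<in> A}"
    by (auto simp: dir_def)
  finally show ?thesis
    by (simp only: emeasure_sphere_unif[OF A] ennreal_mult_cancel[OF unit_vol_pos])
qed

lemma emeasure_cball_dir:
  fixes A :: "'a::euclidean_space set"
  assumes A: "A \<in> sets sphere_borel" and r: "0 \<le> r" and dim: "DIM('a) = 4"
  shows "emeasure lborel {y \<in> cball 0 r. dir y \<in> A} = ennreal (r ^ 4) * emeasure lborel {y \<in> ball 0 1. dir y \<in> A}"
proof (cases "r = 0")
  case True
  have "{y \<in> cball 0 r. dir y \<in> A} \<subseteq> {0}" using True by auto
  moreover have "emeasure lborel {0::'a} = 0" by simp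
  ultimately have "emeasure lborel {y \<in> cball 0 r. dir y \<in> A} = 0"
    by (metis emeasure_eq_0 sets_lborel borel_singleton sets.empty_sets)
  then show ?thesis using True by simp
next
  case False
  then have r0: "r > 0" using r by simp
  have [measurable]: "{y. dir y \<in> A} \<in> sets borel"
    using measurable_sets[OF measurable_dir A] by (simp add: vimage_def)
  have m: "{y \<in> ball 0 1. dir y \<in> A} \<in> sets borel" "{y \<in> cball 0 s. dir y \<in> A} \<in> sets borel" for s
    using sets.Int[of "ball 0 1" borel "{y. dir y \<in> A}"] sets.Int[of "cball 0 s" borel "{y. dir y \<in> A}"] by (simp_all add: Int_def)
  \<comment> \<open>The rescaled closed ball and the open unit ball differ only by the sphere, and
    \<open>dir_scaleR\<close> fails only at the origin.\<close>
  have null: "sphere (0::'a) 1 \<union> {0} \<in> null_sets lborel"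
  proof -
    have "negligible (sphere (0::'a) 1)" by (rule negligible_sphere)
    then have "sphere (0::'a) 1 \<in> null_sets lborel"
      by (auto simp: negligible_iff_null_sets null_sets_def)
    then show ?thesis by (intro null_sets.Un) auto
  qed
  have "emeasure lborel {y \<in> cball 0 r. dir y \<in> A}
    = emeasure (density (distr lborel borel (\<lambda>x. 0 + r *\<^sub>R x)) (\<lambda>_. ennreal (\<bar>r\<bar> ^ DIM('a)))) {y \<in> cball 0 r. dir y \<in> A}"
    using lborel_affine[of r "0::'a"] r0 by (simp add: ennreal_power)
  also have "\<dots> = ennreal (r ^ 4) * emeasure lborel ((\<lambda>x. r *\<^sub>R x) -` {y \<in> cball 0 r. dir y \<in> A})"
    using m r0 by (simp add: emeasure_density nn_integral_cmult emeasure_distr dim)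
  also have "emeasure lborel ((\<lambda>x. r *\<^sub>R x) -` {y \<in> cball 0 r. dir y \<in> A})
     = emeasure lborel ((\<lambda>x. r *\<^sub>R x) -` {y \<in> cball 0 r. dir y \<in> A} - (sphere 0 1 \<union> {0}))"
    using measurable_sets_borel[of "\<lambda>x. r *\<^sub>R x" borel "{y \<in> cball 0 r. dir y \<in> A}"] m
    by (intro emeasure_Diff_null_set[symmetric] null) auto
  also have "(\<lambda>x. r *\<^sub>R x) -` {y \<in> cball 0 r. dir y \<in> A} - (sphere 0 1 \<union> {0}) = {y \<in> ball 0 1. dir y \<in> A} - (sphere 0 1 \<union> {0})"
    using r0 by (auto simp: dir_scaleR)
  also have "emeasure lborel \<dots> = emeasure lborel {y \<in> ball 0 1. dir y \<in> A}"
    using m by (intro emeasure_Diff_null_set null) auto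
  finally show ?thesis .
qed

text \<open>The law of the squared norm of a uniform point of the four-dimensional unit ball: the
  squared norm is at most \<open>x\<close> with probability \<open>x\<^sup>2\<close> for
  \<open>x\<close> in [0, 1].\<close>

abbreviation radial_sq :: "real measure" where
  "radial_sq \<equiv> density lborel (\<lambda>s. ennreal (2 * s) * indicator {0..1} s)"

lemma emeasure_radial_sq:
  "emeasure radial_sq {x<..} = ennreal (if x < 0 then 1 else if x < 1 then 1 - x\<^sup>2 else 0)"
proof -
  have "emeasure radial_sq {x<..} = (\<integral>\<^sup>+s. ennreal (2 * s) * indicator {0..1} s * indicator {x<..} s \<partial>lborel)"
    by (simp add: emeasure_density)
  also have "\<dots> = (\<integral>\<^sup>+s. ennreal (2 * s) * indicator {max 0 x..1} s \<partial>lborel)"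
  proof (rule nn_integral_cong_AE)
    have "AE s in lborel. s \<noteq> x" by (rule AE_lborel_singleton)
    then show "AE s in lborel. ennreal (2 * s) * indicator {0..1} s * indicator {x<..} s = ennreal (2 * s) * indicator {max 0 x..1} s"
      by eventually_elim (auto split: split_indicator)
  qed
  also have "\<dots> = ennreal (if x < 0 then 1 else if x < 1 then 1 - x\<^sup>2 else 0)"
  proof (cases "x < 1")
    case True
    have "(\<integral>\<^sup>+s. ennreal (2 * s) * indicator {max 0 x..1} s \<partial>lborel) = ennreal (1\<^sup>2 - (max 0 x)\<^sup>2)"
      using True by (intro nn_integral_FTC_Icc) (auto intro!: derivative_eq_intros)
    then show ?thesis using True by auto
  next
    case False
    have "(\<integral>\<^sup>+s. ennreal (2 * s) * indicator {max 0 x..1} s \<partial>lborel) = (\<integral>\<^sup>+s. 0 \<partial>(lborel :: real measure))"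
    proof (rule nn_integral_cong_AE)
      have "AE s in lborel. s \<noteq> (1::real)" by (rule AE_lborel_singleton)
      then show "AE s in lborel. ennreal (2 * s) * indicator {max 0 x..1} s = 0"
        by eventually_elim (use False in \<open>auto split: split_indicator\<close>)
    qed
    then show ?thesis using False by simp
  qed
  finally show ?thesis .
qed

text \<open>Direction and squared norm of a uniform point of the ball are independent. For fixed
  \<open>A\<close> both sides are finite measures in \<open>B\<close>, compared on the rays
  \<open>{x<..}\<close>; there the claim is the scaling of a cone by \<open>sqrt x\<close>, whose
  volume factor is \<open>sqrt x ^ 4 = x\<^sup>2\<close>.\<close>

lemma radial_law:
  fixes A :: "'a::euclidean_space set"
  assumes A: "A \<in> sets sphere_borel" and dim: "DIM('a) = 4" and B: "B \<in> sets borel"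
  shows "emeasure lborel {y \<in> ball 0 1. dir y \<in> A \<and> (norm y)\<^sup>2 \<in> B}
    = unit_vol TYPE('a) * emeasure sphere_unif A * emeasure radial_sq B"
proof -
  let ?c = "unit_vol TYPE('a) * emeasure sphere_unif A"
  let ?K = "{y \<in> ball 0 1. dir y \<in> A}"
  have [measurable]: "{y. dir y \<in> A} \<in> sets borel"
    using measurable_sets[OF measurable_dir A] by (simp add: vimage_def)
  have Kb[measurable]: "?K \<in> sets borel"
    using sets.Int[of "ball 0 1" borel "{y. dir y \<in> A}"] by (simp add: Int_def)
  have cfin: "?c < \<top>"
  proof -
    have "emeasure sphere_unif A < \<top>"
      using prob_space.emeasure_le_1[OF prob_space_sphere_unif, of A] ennreal_one_less_top by (rule le_less_trans)
    then show ?thesis using unit_vol_pos(2)[where 'a='a] by (simp add: ennreal_mult_less_top less_top)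
  qed
  have D: "emeasure (distr (density lborel (indicator ?K)) borel (\<lambda>y. (norm y)\<^sup>2)) B
      = emeasure lborel (?K \<inter> (\<lambda>y. (norm y)\<^sup>2) -` B)" if B: "B \<in> sets borel" for B
  proof -
    have m: "(\<lambda>y::'a. (norm y)\<^sup>2) -` B \<in> sets borel"
      using measurable_sets_borel[of "\<lambda>y::'a. (norm y)\<^sup>2" borel B] B by simp
    have iK: "(indicator ?K :: 'a \<Rightarrow> ennreal) \<in> borel_measurable lborel" by measurable
    have "emeasure (density lborel (indicator ?K)) ((\<lambda>y. (norm y)\<^sup>2) -` B)
        = (\<integral>\<^sup>+y. indicator ?K y * indicator ((\<lambda>y. (norm y)\<^sup>2) -` B) y \<partial>lborel)"
      by (rule emeasure_density[OF iK]) (use m in simp)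
    also have "\<dots> = (\<integral>\<^sup>+y. indicator (?K \<inter> (\<lambda>y. (norm y)\<^sup>2) -` B) y \<partial>lborel)"
      by (simp only: indicator_inter_arith)
    also have "\<dots> = emeasure lborel (?K \<inter> (\<lambda>y. (norm y)\<^sup>2) -` B)"
      using sets.Int[OF Kb m] by (intro nn_integral_indicator) (simp only: sets_lborel)
    finally show ?thesis using B by (simp add: emeasure_distr)
  qed
  have "distr (density lborel (indicator ?K)) borel (\<lambda>y. (norm y)\<^sup>2) = density radial_sq (\<lambda>_. ?c)"
  proof (rule measure_eqI_lessThan)
    fix x :: real
    have L: "emeasure (distr (density lborel (indicator ?K)) borel (\<lambda>y. (norm y)\<^sup>2)) {x<..}
        = emeasure lborel (?K \<inter> (\<lambda>y. (norm y)\<^sup>2) -` {x<..})"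
      by (rule D) simp
    show "emeasure (distr (density lborel (indicator ?K)) borel (\<lambda>y. (norm y)\<^sup>2)) {x<..} < \<infinity>"
    proof -
      have "emeasure lborel (?K \<inter> (\<lambda>y. (norm y)\<^sup>2) -` {x<..}) \<le> emeasure lborel (ball (0::'a) 1)"
        by (intro emeasure_mono) auto
      then show ?thesis unfolding L using unit_vol_pos(2)[where 'a='a] by (simp add: less_top le_less_trans)
    qed
    have R: "emeasure (density radial_sq (\<lambda>_. ?c)) {x<..} = ?c * emeasure radial_sq {x<..}"
      by (simp add: emeasure_density nn_integral_cmult)
    show "emeasure (distr (density lborel (indicator ?K)) borel (\<lambda>y. (norm y)\<^sup>2)) {x<..} = emeasure (density radial_sq (\<lambda>_. ?c)) {x<..}"
    proof -
      consider "x < 0" | "0 \<le> x" "x < 1" | "x \<ge> 1" by linarith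
      then show ?thesis
      proof cases
        case 1
        have "?K \<inter> (\<lambda>y. (norm y)\<^sup>2) -` {x<..} = ?K"
          using 1 by (auto intro: less_le_trans[OF 1 zero_le_power2])
        then show ?thesis unfolding L R using 1 emeasure_ball_dir[OF A] by (simp add: emeasure_radial_sq)
      next
        case 2
        let ?S = "{y \<in> cball 0 (sqrt x). dir y \<in> A}"
        have iff: "(norm y)\<^sup>2 \<le> x \<longleftrightarrow> norm y \<le> sqrt x" for y :: 'a
          using 2 by (metis norm_ge_zero real_le_rsqrt real_sqrt_le_iff real_sqrt_abs abs_norm_cancel)
        have sq: "?K \<inter> (\<lambda>y. (norm y)\<^sup>2) -` {x<..} = ?K - ?S"
          using iff by (auto simp: not_le[symmetric])
        have sub: "?S \<subseteq> ?K" using 2 by (auto intro: le_less_trans)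
        have S: "?S \<in> sets lborel"
          using sets.Int[of "cball 0 (sqrt x)" borel "{y. dir y \<in> A}"] by (simp add: Int_def)
        have eS: "emeasure lborel ?S = ennreal (x\<^sup>2) * ?c"
        proof -
          have "sqrt x ^ 4 = x\<^sup>2"
            using 2 power_mult[of "sqrt x" 2 2] by simp
          then show ?thesis
            using emeasure_cball_dir[OF A _ dim, of "sqrt x"] 2 by (simp only: emeasure_ball_dir[OF A] real_sqrt_ge_zero)
        qed
        have "emeasure lborel (?K - ?S) = ?c - ennreal (x\<^sup>2) * ?c"
        proof -
          have "emeasure lborel ?S \<noteq> \<infinity>"
            using emeasure_mono[OF sub, of lborel] cfin by (simp only: emeasure_ball_dir[OF A] infinity_ennreal_def sets_lborel Kb) (metis leD)
          from emeasure_Diff[OF this _ S sub] Kb have "emeasure lborel (?K - ?S) = emeasure lborel ?K - emeasure lborel ?S"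
            by (simp only: sets_lborel)
          then show ?thesis by (simp only: eS emeasure_ball_dir[OF A])
        qed
        also have "\<dots> = ?c * ennreal (1 - x\<^sup>2)"
        proof -
          obtain c where c: "?c = ennreal c" "c \<ge> 0" using cfin by (metis ennreal_cases top.not_eq_extremum)
          show ?thesis unfolding c(1) using c(2) 2
            by (simp add: ennreal_mult[symmetric] ennreal_minus power_le_one algebra_simps)
        qed
        finally show ?thesis unfolding L R sq using 2 by (simp add: emeasure_radial_sq)
      next
        case 3
        have "norm y < 1 \<Longrightarrow> (norm y)\<^sup>2 \<le> x" for y :: 'a
          using 3 power_le_one[of "norm y" 2] by simp
        then have "?K \<inter> (\<lambda>y. (norm y)\<^sup>2) -` {x<..} = {}" by (force simp: not_le[symmetric])
        then show ?thesis unfolding L R using 3 by (simp add: emeasure_radial_sq)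
      qed
    qed
  qed simp_all
  then have "emeasure (distr (density lborel (indicator ?K)) borel (\<lambda>y. (norm y)\<^sup>2)) B = emeasure (density radial_sq (\<lambda>_. ?c)) B"
    by simp
  moreover have "emeasure (distr (density lborel (indicator ?K)) borel (\<lambda>y. (norm y)\<^sup>2)) B
      = emeasure lborel (?K \<inter> (\<lambda>y. (norm y)\<^sup>2) -` B)"
    by (rule D[OF B])
  moreover have "?K \<inter> (\<lambda>y. (norm y)\<^sup>2) -` B = {y \<in> ball 0 1. dir y \<in> A \<and> (norm y)\<^sup>2 \<in> B}" by auto
  moreover have "emeasure (density radial_sq (\<lambda>_. ?c)) B = ?c * emeasure radial_sq B"
    using B by (simp add: emeasure_density nn_integral_cmult)
  ultimately show ?thesis by simp
qed

text \<open>By \<open>radial_law\<close> the product measure is the image of the uniform measure on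
  the ball under \<open>y \<mapsto> (dir y, (norm y)\<^sup>2)\<close>, and \<open>y\<close> is
  recovered from these data.\<close>

lemma nn_integral_polar:
  fixes f :: "'a::euclidean_space \<Rightarrow> ennreal"
  assumes dim: "DIM('a) = 4" and f[measurable]: "f \<in> borel_measurable borel"
  shows "(\<integral>\<^sup>+y. f y * indicator (ball 0 1) y \<partial>lborel)
    = unit_vol TYPE('a) * (\<integral>\<^sup>+x. \<integral>\<^sup>+s. f (sqrt s *\<^sub>R x) \<partial>radial_sq \<partial>sphere_unif)"
proof -
  let ?U = "uniform_measure lborel (ball (0::'a) 1)"
  let ?T = "\<lambda>y::'a. (dir y, (norm y)\<^sup>2)"
  interpret S: prob_space "sphere_unif :: 'a measure" by (rule prob_space_sphere_unif)
  interpret R: prob_space radial_sq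
  proof
    have "emeasure radial_sq (space radial_sq) = (\<integral>\<^sup>+s. ennreal (2 * s) * indicator {0..1} s \<partial>lborel)"
      by (simp add: emeasure_density)
    also have "\<dots> = ennreal (1\<^sup>2 - 0\<^sup>2)"
      by (intro nn_integral_FTC_Icc) (auto intro!: derivative_eq_intros)
    finally show "emeasure radial_sq (space radial_sq) = 1" by simp
  qed
  have T[measurable]: "?T \<in> borel \<rightarrow>\<^sub>M sphere_borel \<Otimes>\<^sub>M borel" by measurable
  have TU: "?T \<in> ?U \<rightarrow>\<^sub>M sphere_borel \<Otimes>\<^sub>M borel" using T by (simp cong: measurable_cong_sets)
  have eq: "sphere_unif \<Otimes>\<^sub>M radial_sq = distr ?U (sphere_borel \<Otimes>\<^sub>M borel) ?T"
  proof (rule pair_measure_eqI)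
    show "sets (sphere_unif \<Otimes>\<^sub>M radial_sq) = sets (distr ?U (sphere_borel \<Otimes>\<^sub>M borel) ?T)"
      by (simp cong: sets_pair_measure_cong)
    fix A :: "'a set" and B assume "A \<in> sets sphere_unif" "B \<in> sets radial_sq"
    then have A: "A \<in> sets sphere_borel" and B: "B \<in> sets borel" by simp_all
    have "emeasure (distr ?U (sphere_borel \<Otimes>\<^sub>M borel) ?T) (A \<times> B) = emeasure ?U (?T -` (A \<times> B))"
      using A B by (subst emeasure_distr[OF TU]) auto
    also have "\<dots> = emeasure lborel (ball 0 1 \<inter> ?T -` (A \<times> B)) / unit_vol TYPE('a)"
      using A B measurable_sets[OF T, of "A \<times> B"] by (intro emeasure_uniform_measure) auto
    also have "ball 0 1 \<inter> ?T -` (A \<times> B) = {y \<in> ball 0 1. dir y \<in> A \<and> (norm y)\<^sup>2 \<in> B}" by auto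
    also have "emeasure lborel \<dots> / unit_vol TYPE('a) = emeasure sphere_unif A * emeasure radial_sq B"
      by (simp only: radial_law[OF A dim B] mult.assoc ennreal_mult_cancel[OF unit_vol_pos])
    finally show "emeasure sphere_unif A * emeasure radial_sq B = emeasure (distr ?U (sphere_borel \<Otimes>\<^sub>M borel) ?T) (A \<times> B)" ..
  qed (rule S.sigma_finite_measure_axioms R.sigma_finite_measure_axioms)+
  have id[measurable]: "(\<lambda>x. x) \<in> sphere_borel \<rightarrow>\<^sub>M (borel :: 'a measure)" by (rule measurable_restrict_space1) simp
  have F: "(\<lambda>(x, s). f (sqrt s *\<^sub>R x)) \<in> borel_measurable (sphere_borel \<Otimes>\<^sub>M borel)" by measurable
  then have F': "(\<lambda>(x, s). f (sqrt s *\<^sub>R x)) \<in> borel_measurable (sphere_unif \<Otimes>\<^sub>M radial_sq)"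
    by (simp cong: measurable_cong_sets sets_pair_measure_cong)
  have "(\<integral>\<^sup>+x. \<integral>\<^sup>+s. f (sqrt s *\<^sub>R x) \<partial>radial_sq \<partial>sphere_unif) = (\<integral>\<^sup>+z. (case z of (x, s) \<Rightarrow> f (sqrt s *\<^sub>R x)) \<partial>(sphere_unif \<Otimes>\<^sub>M radial_sq))"
    using R.nn_integral_fst[OF F'] by simp
  also have "\<dots> = (\<integral>\<^sup>+y. f y \<partial>?U)"
    unfolding eq using F by (subst nn_integral_distr[OF TU]) (simp_all add: norm_scaleR_dir cong: measurable_cong_sets)
  also have "\<dots> = (\<integral>\<^sup>+y. f y * indicator (ball 0 1) y \<partial>lborel) / unit_vol TYPE('a)"
    using unit_vol_pos[where 'a='a] by (intro nn_integral_uniform_measure) auto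
  finally show ?thesis by (simp only: ennreal_mult_cancel[OF unit_vol_pos])
qed

section \<open>Approximation of the sphere by densities on the ball\<close>

text \<open>Left unnormalized. The exponent is greater than -1, so the weight is integrable in
  dimension four, and with the factor \<open>1 / k\<close> its mass converges to twice the volume of
  the unit ball.\<close>

definition beta_weight :: "nat \<Rightarrow> 'a::euclidean_space \<Rightarrow> real" where
  "beta_weight k y = (if norm y < 1 then (1 / k) * (1 - (norm y)\<^sup>2) powr (1 / k - 1) else 0)"

lemma measurable_beta_weight [measurable]: "beta_weight k \<in> borel_measurable (borel :: 'a::euclidean_space measure)"
  unfolding beta_weight_def[abs_def] by measurable

text \<open>
  If \<open>v\<close> is uniform on \<open>[0, 1]\<close>, then \<open>radius_sq k v\<close> has density
  \<open>(1 / k) * (1 - s) powr (1 / k - 1)\<close> and tends to 1 as \<open>k\<close> grows, so that \<open>polar_point k\<close> below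
  realizes the approximations on one probability space.
\<close>

definition radius_sq :: "nat \<Rightarrow> real \<Rightarrow> real" where
  "radius_sq k v = 1 - (1 - v) ^ k"

text \<open>In the variable \<open>v\<close> the weight becomes
  \<open>(1/k) * (1 - v) powr (1 - k)\<close>, which is the reciprocal of the derivative
  \<open>k * (1 - v) ^ (k - 1)\<close>. Only the factor \<open>2 * s\<close> of
  \<open>radial_sq\<close> survives.\<close>

lemma radius_sq_substitution:
  assumes k: "k \<ge> 1"
  shows "density lborel (\<lambda>s. ennreal (2 * s * (if s < 1 then (1 / k) * (1 - s) powr (1 / k - 1) else 0)) * indicator {0..1} s)
    = distr (density lborel (\<lambda>v. ennreal (2 * radius_sq k v) * indicator {0..1} v)) borel (radius_sq k)"
    (is "density lborel (\<lambda>s. ennreal (?w s) * indicator {0..1} s) = distr ?V borel _")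
proof (rule measure_eqI)
  have [measurable]: "radius_sq k \<in> borel_measurable borel" unfolding radius_sq_def[abs_def] by measurable
  fix B assume "B \<in> sets (density lborel (\<lambda>s. ennreal (?w s) * indicator {0..1} s))"
  then have B[measurable]: "B \<in> sets borel" by simp
  have [measurable]: "?w \<in> borel_measurable borel" by measurable
  let ?f = "\<lambda>s. ?w s * indicator B s"
  have ends: "radius_sq k 0 = 0" "radius_sq k 1 = 1" using k by (simp_all add: radius_sq_def power_0_left)
  have "emeasure (density lborel (\<lambda>s. ennreal (?w s) * indicator {0..1} s)) B
      = (\<integral>\<^sup>+s. ennreal (?f s * indicator {radius_sq k 0..radius_sq k 1} s) \<partial>lborel)"
    unfolding ends by (subst emeasure_density) (auto intro!: nn_integral_cong split: split_indicator)
  also have "\<dots> = (\<integral>\<^sup>+v. ennreal (?f (radius_sq k v) * (real k * (1 - v) ^ (k - 1)) * indicator {0..1} v) \<partial>lborel)"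
  proof (rule nn_integral_substitution)
    show "set_borel_measurable borel {radius_sq k 0..radius_sq k 1} ?f"
      unfolding set_borel_measurable_def by measurable
    show "(radius_sq k has_real_derivative real k * (1 - x) ^ (k - 1)) (at x)" for x
      unfolding radius_sq_def[abs_def] by (auto intro!: derivative_eq_intros)
    show "continuous_on {0..1} (\<lambda>x. real k * (1 - x) ^ (k - 1))" by (intro continuous_intros)
  qed auto
  also have "\<dots> = (\<integral>\<^sup>+v. ennreal (2 * radius_sq k v) * indicator {0..1} v * indicator (radius_sq k -` B) v \<partial>lborel)"
  proof (rule nn_integral_cong_AE)
    \<comment> \<open>At \<open>v = 1\<close> the weight takes its default value 0 and the
      cancellation breaks down.\<close>
    have "AE v in lborel. v \<noteq> (1::real)" by (rule AE_lborel_singleton)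
    then show "AE v in lborel. ennreal (?f (radius_sq k v) * (real k * (1 - v) ^ (k - 1)) * indicator {0..1} v)
        = ennreal (2 * radius_sq k v) * indicator {0..1} v * indicator (radius_sq k -` B) v"
    proof eventually_elim
      case (elim v)
      have swap: "(a * b) * c = d * b" if "a * c = d" for a b c d :: real using that by (metis mult.assoc mult.commute)
      show ?case
      proof (cases "v \<in> {0..1}")
        case True
        then have v: "0 < 1 - v" "1 - v \<le> 1" using elim by auto
        have p: "0 < (1 - v) ^ k" "(1 - v) ^ k \<le> 1" using v by (auto intro: power_le_one)
        have "((1 - v) ^ k) powr (1 / k - 1) = (1 - v) powr (1 - real k)"
          using v k by (simp add: powr_realpow[symmetric] powr_powr algebra_simps)
        moreover have "(1 - v) ^ (k - 1) = (1 - v) powr (real k - 1)"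
          using v k by (simp add: powr_realpow[symmetric] of_nat_diff)
        ultimately have "((1 - v) ^ k) powr (1 / k - 1) * (1 - v) ^ (k - 1) = 1"
          using v by (simp add: powr_add[symmetric])
        then have "?w (radius_sq k v) * (real k * (1 - v) ^ (k - 1)) = 2 * radius_sq k v"
          using p k by (simp add: radius_sq_def field_simps)
        then have e: "?f (radius_sq k v) * (real k * (1 - v) ^ (k - 1)) = 2 * radius_sq k v * indicator B (radius_sq k v)"
          by (rule swap)
        show ?thesis unfolding e using True by (cases "radius_sq k v \<in> B") simp_all
      qed simp
    qed
  qed
  also have "\<dots> = emeasure (distr ?V borel (radius_sq k)) B"
    using measurable_sets_borel[of "radius_sq k" borel B] by (simp add: emeasure_distr emeasure_density)
  finally show "emeasure (density lborel (\<lambda>s. ennreal (?w s) * indicator {0..1} s)) B = emeasure (distr ?V borel (radius_sq k)) B" .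
qed simp

abbreviation polar_space :: "('a::euclidean_space \<times> real) measure" where
  "polar_space \<equiv> sphere_unif \<Otimes>\<^sub>M uniform_measure lborel {0..1}"

definition polar_point :: "nat \<Rightarrow> 'a::euclidean_space \<times> real \<Rightarrow> 'a" where
  "polar_point k p = sqrt (radius_sq k (snd p)) *\<^sub>R fst p"

lemma prob_space_unif01: "prob_space (uniform_measure lborel {0..1::real})"
  by (rule prob_space_uniform_measure) auto

lemma prob_space_polar: "prob_space (polar_space :: ('a::euclidean_space \<times> real) measure)"
  by (intro prob_space_pair prob_space_sphere_unif prob_space_unif01)

lemma measurable_sphere_id: "(\<lambda>x. x) \<in> sphere_unif \<rightarrow>\<^sub>M (borel :: 'a::euclidean_space measure)"
  by (simp cong: measurable_cong_sets) (rule measurable_restrict_space1, simp)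

lemma measurable_polar_fst [measurable]: "fst \<in> polar_space \<rightarrow>\<^sub>M (borel :: 'a::euclidean_space measure)"
  by (rule measurable_compose[OF measurable_fst measurable_sphere_id])

lemma measurable_polar_point [measurable]: "polar_point k \<in> polar_space \<rightarrow>\<^sub>M (borel :: 'a::euclidean_space measure)"
  unfolding polar_point_def[abs_def] radius_sq_def by measurable

text \<open>Moves the singular weight into the law of the radius. What remains is the bounded factor
  \<open>2 * radius_sq k\<close>, on a probability space that is the same for all \<open>k\<close>,
  as dominated convergence requires.\<close>

lemma nn_integral_beta_weight:
  fixes f :: "'a::euclidean_space \<Rightarrow> ennreal"
  assumes dim: "DIM('a) = 4" and k: "k \<ge> 1" and f[measurable]: "f \<in> borel_measurable borel"
  shows "(\<integral>\<^sup>+y. ennreal (beta_weight k y) * f y \<partial>lborel)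
    = unit_vol TYPE('a) * (\<integral>\<^sup>+p. ennreal (2 * radius_sq k (snd p)) * f (polar_point k p) \<partial>polar_space)"
proof -
  interpret U: prob_space "uniform_measure lborel {0..1::real}" by (rule prob_space_unif01)
  have [measurable]: "radius_sq k \<in> borel_measurable borel" unfolding radius_sq_def[abs_def] by measurable
  let ?w = "\<lambda>s. if s < 1 then (1 / k) * (1 - s) powr (1 / k - 1) else 0"
  have inner: "(\<integral>\<^sup>+s. ennreal (beta_weight k (sqrt s *\<^sub>R x)) * f (sqrt s *\<^sub>R x) \<partial>radial_sq)
      = (\<integral>\<^sup>+v. ennreal (2 * radius_sq k v) * f (sqrt (radius_sq k v) *\<^sub>R x) \<partial>uniform_measure lborel {0..1})"
    if x: "norm x = 1" for x
  proof -
    have "(\<integral>\<^sup>+s. ennreal (beta_weight k (sqrt s *\<^sub>R x)) * f (sqrt s *\<^sub>R x) \<partial>radial_sq)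
      = (\<integral>\<^sup>+s. ennreal (2 * s) * indicator {0..1} s * (ennreal (beta_weight k (sqrt s *\<^sub>R x)) * f (sqrt s *\<^sub>R x)) \<partial>lborel)"
      by (rule nn_integral_density) measurable
    also have "\<dots> = (\<integral>\<^sup>+s. (ennreal (2 * s * ?w s) * indicator {0..1} s) * f (sqrt s *\<^sub>R x) \<partial>lborel)"
    proof (rule nn_integral_cong)
      fix s :: real
      have "ennreal (2 * s) * ennreal (beta_weight k (sqrt s *\<^sub>R x)) = ennreal (2 * s * ?w s)" if "s \<in> {0..1}"
      proof -
        have "beta_weight k (sqrt s *\<^sub>R x) = ?w s"
          using that x by (simp add: beta_weight_def)
        then show ?thesis using that by (simp add: ennreal_mult' )
      qed
      then show "ennreal (2 * s) * indicator {0..1} s * (ennreal (beta_weight k (sqrt s *\<^sub>R x)) * f (sqrt s *\<^sub>R x))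
        = (ennreal (2 * s * ?w s) * indicator {0..1} s) * f (sqrt s *\<^sub>R x)"
        by (cases "s \<in> {0..1}") (simp_all add: mult.assoc[symmetric])
    qed
    also have "\<dots> = (\<integral>\<^sup>+s. f (sqrt s *\<^sub>R x) \<partial>density lborel (\<lambda>s. ennreal (2 * s * ?w s) * indicator {0..1} s))"
      by (rule nn_integral_density[symmetric]) measurable
    also have "\<dots> = (\<integral>\<^sup>+v. f (sqrt (radius_sq k v) *\<^sub>R x) \<partial>density lborel (\<lambda>v. ennreal (2 * radius_sq k v) * indicator {0..1} v))"
      unfolding radius_sq_substitution[OF k] by (rule nn_integral_distr) measurable
    also have "\<dots> = (\<integral>\<^sup>+v. ennreal (2 * radius_sq k v) * indicator {0..1} v * f (sqrt (radius_sq k v) *\<^sub>R x) \<partial>lborel)"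
      by (rule nn_integral_density) measurable
    also have "\<dots> = (\<integral>\<^sup>+v. ennreal (2 * radius_sq k v) * f (sqrt (radius_sq k v) *\<^sub>R x) \<partial>uniform_measure lborel {0..1})"
      by (subst nn_integral_uniform_measure) (auto simp: mult_ac divide_ennreal_def)
    finally show ?thesis .
  qed
  have "(\<integral>\<^sup>+y. ennreal (beta_weight k y) * f y \<partial>lborel) = (\<integral>\<^sup>+y. (ennreal (beta_weight k y) * f y) * indicator (ball 0 1) y \<partial>lborel)"
    by (intro nn_integral_cong) (auto simp: beta_weight_def split: split_indicator)
  also have "\<dots> = unit_vol TYPE('a) * (\<integral>\<^sup>+x. \<integral>\<^sup>+s. ennreal (beta_weight k (sqrt s *\<^sub>R x)) * f (sqrt s *\<^sub>R x) \<partial>radial_sq \<partial>sphere_unif)"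
    by (rule nn_integral_polar[OF dim]) measurable
  also have "(\<integral>\<^sup>+x. \<integral>\<^sup>+s. ennreal (beta_weight k (sqrt s *\<^sub>R x)) * f (sqrt s *\<^sub>R x) \<partial>radial_sq \<partial>sphere_unif)
    = (\<integral>\<^sup>+x. \<integral>\<^sup>+v. ennreal (2 * radius_sq k v) * f (sqrt (radius_sq k v) *\<^sub>R x) \<partial>uniform_measure lborel {0..1} \<partial>sphere_unif)"
    by (intro nn_integral_cong inner) simp
  also have "\<dots> = (\<integral>\<^sup>+p. ennreal (2 * radius_sq k (snd p)) * f (polar_point k p) \<partial>polar_space)"
    using U.nn_integral_fst[of "\<lambda>p. ennreal (2 * radius_sq k (snd p)) * f (polar_point k p)" "sphere_unif"]
    by (simp add: polar_point_def)
  finally show ?thesis .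
qed

lemma radius_sq_bounds: "0 \<le> v \<Longrightarrow> v \<le> 1 \<Longrightarrow> 0 \<le> radius_sq k v" "0 \<le> v \<Longrightarrow> v \<le> 1 \<Longrightarrow> radius_sq k v \<le> 1"
  by (auto simp: radius_sq_def power_le_one)

lemma radius_sq_tendsto:
  assumes "0 < v" "v \<le> 1"
  shows "(\<lambda>k. radius_sq k v) \<longlonglongrightarrow> 1"
proof -
  have "(\<lambda>k. (1 - v) ^ k) \<longlonglongrightarrow> 0" by (rule LIMSEQ_realpow_zero) (use assms in auto)
  then have "(\<lambda>k. 1 - (1 - v) ^ k) \<longlonglongrightarrow> 1 - 0" by (rule tendsto_diff[OF tendsto_const])
  then show ?thesis by (simp add: radius_sq_def)
qed

lemma AE_polar:
  "AE p in (polar_space :: ('a::euclidean_space \<times> real) measure). 0 < snd p \<and> snd p \<le> 1"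
proof -
  interpret S: prob_space "sphere_unif :: 'a measure" by (rule prob_space_sphere_unif)
  interpret U: prob_space "uniform_measure lborel {0..1::real}" by (rule prob_space_unif01)
  interpret P: pair_prob_space "sphere_unif :: 'a measure" "uniform_measure lborel {0..1::real}" ..
  have "AE v in lborel. v \<noteq> (0::real)" by (rule AE_lborel_singleton)
  then have "AE v in uniform_measure lborel {0..1}. 0 < v \<and> v \<le> (1::real)"
    by (subst AE_uniform_measure) (auto elim!: eventually_mono)
  then have "AE x in (sphere_unif :: 'a measure). AE v in uniform_measure lborel {0..1}. 0 < snd (x, v) \<and> snd (x, v) \<le> (1::real)" by simp
  moreover have "{p \<in> space polar_space. 0 < snd p \<and> snd p \<le> 1} \<in> sets (polar_space :: ('a \<times> real) measure)"
    by measurable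
  ultimately show ?thesis by (intro P.AE_pair_measure)
qed

lemma polar_point_tendsto:
  assumes "0 < snd p" "snd p \<le> 1"
  shows "(\<lambda>k. polar_point k p) \<longlonglongrightarrow> fst p"
proof -
  have "(\<lambda>k. sqrt (radius_sq k (snd p)) *\<^sub>R fst p) \<longlonglongrightarrow> sqrt 1 *\<^sub>R fst p"
    by (intro tendsto_intros radius_sq_tendsto assms)
  then show ?thesis by (simp add: polar_point_def)
qed

section \<open>Four weighted points\<close>

type_synonym 'a quad = "'a \<times> 'a \<times> 'a \<times> 'a"

abbreviation nn_integral4 :: "'a measure \<Rightarrow> ('a \<Rightarrow> 'a \<Rightarrow> 'a \<Rightarrow> 'a \<Rightarrow> ennreal) \<Rightarrow> ennreal" where
  "nn_integral4 M f \<equiv> \<integral>\<^sup>+x1. \<integral>\<^sup>+x2. \<integral>\<^sup>+x3. \<integral>\<^sup>+x4. f x1 x2 x3 x4 \<partial>M \<partial>M \<partial>M \<partial>M"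

lemma nn_integral4_cong_AE:
  assumes "AE x1 in M. AE x2 in M. AE x3 in M. AE x4 in M. f x1 x2 x3 x4 = g x1 x2 x3 x4"
  shows "nn_integral4 M f = nn_integral4 M g"
  using assms by (auto elim!: eventually_mono intro!: nn_integral_cong_AE)

definition beta4 :: "nat \<Rightarrow> ('a::euclidean_space quad \<Rightarrow> ennreal) \<Rightarrow> ennreal" where
  "beta4 k f = (\<integral>\<^sup>+y1. ennreal (beta_weight k y1) * (\<integral>\<^sup>+y2. ennreal (beta_weight k y2) *
     (\<integral>\<^sup>+y3. ennreal (beta_weight k y3) * (\<integral>\<^sup>+y4. ennreal (beta_weight k y4) * f (y1, y2, y3, y4)
       \<partial>lborel) \<partial>lborel) \<partial>lborel) \<partial>lborel)"

abbreviation polar_space4 :: "('a::euclidean_space \<times> real) quad measure" where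
  "polar_space4 \<equiv> polar_space \<Otimes>\<^sub>M (polar_space \<Otimes>\<^sub>M (polar_space \<Otimes>\<^sub>M polar_space))"

text \<open>Induction step that adds one point: \<open>N\<close> is the space of the points already
  converted and \<open>c\<close> collects their volume factors.\<close>

lemma nn_integral_beta_weight_pair:
  fixes f :: "'a::euclidean_space \<times> 'b \<Rightarrow> ennreal"
  assumes dim: "DIM('a) = 4" and k: "k \<ge> 1" and N: "sigma_finite_measure N"
    and f[measurable]: "f \<in> borel_measurable (borel \<Otimes>\<^sub>M N)"
  shows "(\<integral>\<^sup>+y. ennreal (beta_weight k y) * (c * (\<integral>\<^sup>+q. f (y, q) \<partial>N)) \<partial>lborel)
    = unit_vol TYPE('a) * c * (\<integral>\<^sup>+z. ennreal (2 * radius_sq k (snd (fst z))) * f (polar_point k (fst z), snd z) \<partial>(polar_space \<Otimes>\<^sub>M N))"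
proof -
  interpret N: sigma_finite_measure N by (rule N)
  have [measurable]: "radius_sq k \<in> borel_measurable borel" unfolding radius_sq_def[abs_def] by measurable
  have "(\<integral>\<^sup>+y. ennreal (beta_weight k y) * (c * (\<integral>\<^sup>+q. f (y, q) \<partial>N)) \<partial>lborel)
    = (\<integral>\<^sup>+y. c * (ennreal (beta_weight k y) * (\<integral>\<^sup>+q. f (y, q) \<partial>N)) \<partial>lborel)"
    by (simp add: mult_ac)
  also have "\<dots> = c * (\<integral>\<^sup>+y. ennreal (beta_weight k y) * (\<integral>\<^sup>+q. f (y, q) \<partial>N) \<partial>lborel)"
    by (rule nn_integral_cmult) measurable
  also have "(\<integral>\<^sup>+y. ennreal (beta_weight k y) * (\<integral>\<^sup>+q. f (y, q) \<partial>N) \<partial>lborel)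
    = unit_vol TYPE('a) * (\<integral>\<^sup>+p. ennreal (2 * radius_sq k (snd p)) * (\<integral>\<^sup>+q. f (polar_point k p, q) \<partial>N) \<partial>polar_space)"
    by (rule nn_integral_beta_weight[OF dim k]) measurable
  also have "(\<integral>\<^sup>+p. ennreal (2 * radius_sq k (snd p)) * (\<integral>\<^sup>+q. f (polar_point k p, q) \<partial>N) \<partial>(polar_space :: ('a \<times> real) measure))
    = (\<integral>\<^sup>+p. \<integral>\<^sup>+q. ennreal (2 * radius_sq k (snd (fst (p, q)))) * f (polar_point k (fst (p, q)), snd (p, q)) \<partial>N \<partial>polar_space)"
    by (intro nn_integral_cong) (simp add: nn_integral_cmult)
  also have "\<dots> = (\<integral>\<^sup>+z. ennreal (2 * radius_sq k (snd (fst z))) * f (polar_point k (fst z), snd z) \<partial>(polar_space \<Otimes>\<^sub>M N))"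
    by (rule N.nn_integral_fst) measurable
  finally show ?thesis by (simp add: mult_ac)
qed

lemma AE_pair_fstI:
  assumes "prob_space M" "prob_space N" and P: "AE x in M. P x"
  shows "AE z in M \<Otimes>\<^sub>M N. P (fst z)"
  by (rule AE_distrD[OF measurable_fst, where P = P])
    (simp only: prob_space.distr_pair_fst[OF assms(2)] P)

lemma AE_pair_sndI:
  assumes "prob_space M" "prob_space N" and P: "AE x in N. P x"
  shows "AE z in M \<Otimes>\<^sub>M N. P (snd z)"
proof -
  interpret N: prob_space N by fact
  interpret M: prob_space M by fact
  interpret pair_sigma_finite M N ..
  have "distr (M \<Otimes>\<^sub>M N) N snd = distr (distr (N \<Otimes>\<^sub>M M) (M \<Otimes>\<^sub>M N) (\<lambda>(x, y). (y, x))) N snd"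
    by (subst distr_pair_swap) simp
  also have "\<dots> = distr (N \<Otimes>\<^sub>M M) N fst"
    by (subst distr_distr) (auto simp: comp_def case_prod_beta)
  also have "\<dots> = N" by (rule M.distr_pair_fst)
  finally have "distr (M \<Otimes>\<^sub>M N) N snd = N" .
  then show ?thesis by (intro AE_distrD[OF measurable_snd, where P = P]) (simp only: P)
qed

definition polar4 :: "nat \<Rightarrow> ('a::euclidean_space \<times> real) quad \<Rightarrow> 'a quad" where
  "polar4 k = (\<lambda>(p1, p2, p3, p4). (polar_point k p1, polar_point k p2, polar_point k p3, polar_point k p4))"

definition fst4 :: "('a \<times> real) quad \<Rightarrow> 'a quad" where
  "fst4 = (\<lambda>(p1, p2, p3, p4). (fst p1, fst p2, fst p3, fst p4))"

definition density4 :: "nat \<Rightarrow> ('a \<times> real) quad \<Rightarrow> real" where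
  "density4 k = (\<lambda>(p1, p2, p3, p4). 2 * radius_sq k (snd p1) * (2 * radius_sq k (snd p2) *
     (2 * radius_sq k (snd p3) * (2 * radius_sq k (snd p4)))))"

lemma sigma_finite_polar:
  "sigma_finite_measure (polar_space :: ('a::euclidean_space \<times> real) measure)"
  "sigma_finite_measure (polar_space \<Otimes>\<^sub>M polar_space :: (('a::euclidean_space \<times> real) \<times> ('a \<times> real)) measure)"
  "sigma_finite_measure (polar_space \<Otimes>\<^sub>M (polar_space \<Otimes>\<^sub>M polar_space) :: (('a::euclidean_space \<times> real) \<times> ('a \<times> real) \<times> ('a \<times> real)) measure)"
  by (intro prob_space_imp_sigma_finite prob_space_pair prob_space_polar)+

lemma prob_space_polar4: "prob_space (polar_space4 :: ('a::euclidean_space \<times> real) quad measure)"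
  by (intro prob_space_pair prob_space_polar)

lemma measurable_density4 [measurable]:
  "density4 k \<in> borel_measurable (polar_space4 :: ('a::euclidean_space \<times> real) quad measure)"
  unfolding density4_def radius_sq_def by measurable

lemma measurable_polar4 [measurable]: "polar4 k \<in> polar_space4 \<rightarrow>\<^sub>M (borel :: ('a::euclidean_space \<times> 'a \<times> 'a \<times> 'a) measure)"
  unfolding polar4_def borel_prod[symmetric] by measurable

lemma measurable_fst4 [measurable]: "fst4 \<in> polar_space4 \<rightarrow>\<^sub>M (borel :: ('a::euclidean_space \<times> 'a \<times> 'a \<times> 'a) measure)"
  unfolding fst4_def borel_prod[symmetric] by measurable

lemma AE_polar4:
  "AE z in (polar_space4 :: ('a::euclidean_space \<times> real) quad measure).
     (0 < snd (fst z) \<and> snd (fst z) \<le> 1) \<and> (0 < snd (fst (snd z)) \<and> snd (fst (snd z)) \<le> 1) \<and>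
     (0 < snd (fst (snd (snd z))) \<and> snd (fst (snd (snd z))) \<le> 1) \<and>
     (0 < snd (snd (snd (snd z))) \<and> snd (snd (snd (snd z))) \<le> 1)"
proof -
  note P = prob_space_polar[where 'a='a] and A = AE_polar[where 'a='a]
  note P2 = prob_space_pair[OF P P] note P3 = prob_space_pair[OF P P2]
  note B = AE_pair_sndI[OF P P3 AE_pair_sndI[OF P P2 AE_pair_sndI[OF P P A]]]
    AE_pair_sndI[OF P P3 AE_pair_sndI[OF P P2 AE_pair_fstI[OF P P A]]]
    AE_pair_sndI[OF P P3 AE_pair_fstI[OF P P2 A]] AE_pair_fstI[OF P P3 A]
  show ?thesis using B(1) B(2) B(3) B(4) by eventually_elim blast
qed

text \<open>Each of the four points contributes a factor \<open>2 * radius_sq k v\<close> in [0, 2]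
  with limit 2. This is the origin of the 16 in the limit theorem.\<close>

lemma density4_bounds:
  assumes "\<And>v. v \<in> {snd (fst z), snd (fst (snd z)), snd (fst (snd (snd z))), snd (snd (snd (snd z)))} \<Longrightarrow> 0 < v \<and> v \<le> 1"
  shows "0 \<le> density4 k z" "density4 k z \<le> 16" "(\<lambda>k. density4 k z) \<longlonglongrightarrow> 16"
proof -
  obtain x1 v1 x2 v2 x3 v3 x4 v4 where z: "z = ((x1, v1), (x2, v2), (x3, v3), (x4, v4))" by (metis surj_pair)
  have v: "0 < v1 \<and> v1 \<le> 1" "0 < v2 \<and> v2 \<le> 1" "0 < v3 \<and> v3 \<le> 1" "0 < v4 \<and> v4 \<le> 1"
    using assms by (auto simp: z)
  have b: "0 \<le> radius_sq k v1" "0 \<le> radius_sq k v2" "0 \<le> radius_sq k v3" "0 \<le> radius_sq k v4"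
     "radius_sq k v1 \<le> 1" "radius_sq k v2 \<le> 1" "radius_sq k v3 \<le> 1" "radius_sq k v4 \<le> 1"
    using v by (auto intro: radius_sq_bounds)
  have e: "density4 k z = 16 * (radius_sq k v1 * (radius_sq k v2 * (radius_sq k v3 * radius_sq k v4)))" for k
    by (simp add: density4_def z)
  show "0 \<le> density4 k z" using b by (simp add: e)
  have "radius_sq k v1 * (radius_sq k v2 * (radius_sq k v3 * radius_sq k v4)) \<le> 1"
    using b by (intro mult_le_one mult_nonneg_nonneg) auto
  then show "density4 k z \<le> 16" by (simp add: e)
  have "(\<lambda>k. 16 * (radius_sq k v1 * (radius_sq k v2 * (radius_sq k v3 * radius_sq k v4)))) \<longlonglongrightarrow> 16 * (1 * (1 * (1 * 1)))"
    using v by (intro tendsto_mult tendsto_const radius_sq_tendsto) auto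
  then show "(\<lambda>k. density4 k z) \<longlonglongrightarrow> 16" unfolding e by simp
qed

text \<open>The four integrals are converted from the innermost outwards, each conversion enlarging
  the product space by one factor.\<close>

lemma beta4_polar:
  fixes f :: "'a::euclidean_space quad \<Rightarrow> ennreal"
  assumes dim: "DIM('a) = 4" and k: "k \<ge> 1" and f: "f \<in> borel_measurable borel"
  shows "beta4 k f = unit_vol TYPE('a) ^ 4 * (\<integral>\<^sup>+q. ennreal (density4 k q) * f (polar4 k q) \<partial>polar_space4)"
proof -
  let ?v = "unit_vol TYPE('a)"
  let ?g = "\<lambda>p :: 'a \<times> real. ennreal (2 * radius_sq k (snd p))"
  let ?T = "polar_point k :: 'a \<times> real \<Rightarrow> 'a"
  have f'[measurable]: "f \<in> borel_measurable (borel \<Otimes>\<^sub>M (borel \<Otimes>\<^sub>M (borel \<Otimes>\<^sub>M borel)))"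
    using f by (simp add: borel_prod)
  have [measurable]: "radius_sq k \<in> borel_measurable borel" unfolding radius_sq_def[abs_def] by measurable
  have 4: "(\<integral>\<^sup>+y4. ennreal (beta_weight k y4) * f (y1, y2, y3, y4) \<partial>lborel)
      = ?v * (\<integral>\<^sup>+p4. ?g p4 * f (y1, y2, y3, ?T p4) \<partial>polar_space)" for y1 y2 y3
    by (rule nn_integral_beta_weight[OF dim k]) measurable
  have 3: "(\<integral>\<^sup>+y3. ennreal (beta_weight k y3) * (?v * (\<integral>\<^sup>+p4. ?g p4 * f (y1, y2, y3, ?T p4) \<partial>polar_space)) \<partial>lborel)
      = ?v * ?v * (\<integral>\<^sup>+z. ?g (fst z) * (?g (snd z) * f (y1, y2, ?T (fst z), ?T (snd z))) \<partial>(polar_space \<Otimes>\<^sub>M polar_space))" for y1 y2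
    using nn_integral_beta_weight_pair[OF dim k sigma_finite_polar(1), of "\<lambda>z. ?g (snd z) * f (y1, y2, fst z, ?T (snd z))" ?v] by simp
  have 2: "(\<integral>\<^sup>+y2. ennreal (beta_weight k y2) * (?v * ?v * (\<integral>\<^sup>+z. ?g (fst z) * (?g (snd z) * f (y1, y2, ?T (fst z), ?T (snd z))) \<partial>(polar_space \<Otimes>\<^sub>M polar_space))) \<partial>lborel)
      = ?v * (?v * ?v) * (\<integral>\<^sup>+z. ?g (fst z) * (?g (fst (snd z)) * (?g (snd (snd z)) * f (y1, ?T (fst z), ?T (fst (snd z)), ?T (snd (snd z))))) \<partial>(polar_space \<Otimes>\<^sub>M (polar_space \<Otimes>\<^sub>M polar_space)))" for y1
    using nn_integral_beta_weight_pair[OF dim k sigma_finite_polar(2), of "\<lambda>z. ?g (fst (snd z)) * (?g (snd (snd z)) * f (y1, fst z, ?T (fst (snd z)), ?T (snd (snd z))))" "?v * ?v"] by simp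
  have 1: "(\<integral>\<^sup>+y1. ennreal (beta_weight k y1) * (?v * (?v * ?v) * (\<integral>\<^sup>+z. ?g (fst z) * (?g (fst (snd z)) * (?g (snd (snd z)) * f (y1, ?T (fst z), ?T (fst (snd z)), ?T (snd (snd z))))) \<partial>(polar_space \<Otimes>\<^sub>M (polar_space \<Otimes>\<^sub>M polar_space)))) \<partial>lborel)
      = ?v * (?v * (?v * ?v)) * (\<integral>\<^sup>+z. ?g (fst z) * (?g (fst (snd z)) * (?g (fst (snd (snd z))) * (?g (snd (snd (snd z))) * f (?T (fst z), ?T (fst (snd z)), ?T (fst (snd (snd z))), ?T (snd (snd (snd z))))))) \<partial>polar_space4)"
    using nn_integral_beta_weight_pair[OF dim k sigma_finite_polar(3), of "\<lambda>z. ?g (fst (snd z)) * (?g (fst (snd (snd z))) * (?g (snd (snd (snd z))) * f (fst z, ?T (fst (snd z)), ?T (fst (snd (snd z))), ?T (snd (snd (snd z))))))" "?v * (?v * ?v)"] by simp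
  have "beta4 k f = ?v * (?v * (?v * ?v)) * (\<integral>\<^sup>+z. ?g (fst z) * (?g (fst (snd z)) * (?g (fst (snd (snd z))) * (?g (snd (snd (snd z))) * f (?T (fst z), ?T (fst (snd z)), ?T (fst (snd (snd z))), ?T (snd (snd (snd z))))))) \<partial>polar_space4)"
    unfolding beta4_def 4 3 2 1 ..
  also have "(\<integral>\<^sup>+z. ?g (fst z) * (?g (fst (snd z)) * (?g (fst (snd (snd z))) * (?g (snd (snd (snd z))) * f (?T (fst z), ?T (fst (snd z)), ?T (fst (snd (snd z))), ?T (snd (snd (snd z))))))) \<partial>polar_space4)
     = (\<integral>\<^sup>+q. ennreal (density4 k q) * f (polar4 k q) \<partial>polar_space4)"
  proof (rule nn_integral_cong_AE)
    show "AE z in polar_space4. ?g (fst z) * (?g (fst (snd z)) * (?g (fst (snd (snd z))) * (?g (snd (snd (snd z))) * f (?T (fst z), ?T (fst (snd z)), ?T (fst (snd (snd z))), ?T (snd (snd (snd z)))))))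
        = ennreal (density4 k z) * f (polar4 k z)"
      using AE_polar4
    proof eventually_elim
      case (elim z)
      then have "0 \<le> radius_sq k (snd (fst z))" "0 \<le> radius_sq k (snd (fst (snd z)))"
        "0 \<le> radius_sq k (snd (fst (snd (snd z))))" "0 \<le> radius_sq k (snd (snd (snd (snd z))))"
        by (auto intro: radius_sq_bounds)
      then have "ennreal (density4 k z) = ?g (fst z) * (?g (fst (snd z)) * (?g (fst (snd (snd z))) * ?g (snd (snd (snd z)))))"
        by (simp add: density4_def case_prod_beta ennreal_mult del: ennreal_mult' flip: ennreal_mult)
      then show ?case by (simp add: polar4_def case_prod_beta mult.assoc)
    qed
  qed
  finally show ?thesis by (simp add: power4_eq_xxxx mult_ac)
qed

text \<open>The uniform distribution on the sphere as a Borel measure on the ambient space, so that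
  linear maps and hyperplanes can be used without restricting sigma-algebras.\<close>

definition sphere_law :: "'a::euclidean_space measure" where
  "sphere_law = distr sphere_unif borel (\<lambda>x. x)"

lemma sets_sphere_law [simp, measurable_cong]: "sets sphere_law = sets borel"
  by (simp add: sphere_law_def)

lemma space_sphere_law [simp]: "space sphere_law = UNIV"
  by (simp add: sphere_law_def)

lemma prob_space_sphere_law: "prob_space (sphere_law :: 'a::euclidean_space measure)"
  unfolding sphere_law_def by (intro prob_space.prob_space_distr prob_space_sphere_unif measurable_sphere_id)

section \<open>Limit as the weights concentrate on the sphere\<close>

lemma distr_polar_fst: "distr polar_space borel fst = (sphere_law :: 'a::euclidean_space measure)"
proof -
  have "distr polar_space sphere_unif fst = (sphere_unif :: 'a measure)"
    by (rule prob_space.distr_pair_fst[OF prob_space_unif01])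
  then have "sphere_law = distr (distr polar_space sphere_unif fst) borel (\<lambda>x::'a. x)" by (simp add: sphere_law_def)
  also have "\<dots> = distr polar_space borel fst"
    by (subst distr_distr[OF measurable_sphere_id measurable_fst]) (simp add: comp_def)
  finally show ?thesis ..
qed

lemma nn_integral_polar_fst:
  fixes f :: "'a::euclidean_space \<Rightarrow> ennreal"
  assumes f: "f \<in> borel_measurable borel"
  shows "(\<integral>\<^sup>+p. f (fst p) \<partial>polar_space) = (\<integral>\<^sup>+x. f x \<partial>sphere_law)"
  using f unfolding distr_polar_fst[symmetric] by (intro nn_integral_distr[symmetric]) simp_all

lemma nn_integral_polar_fst4:
  fixes f :: "'a::euclidean_space quad \<Rightarrow> ennreal"
  assumes f: "f \<in> borel_measurable borel"
  shows "(\<integral>\<^sup>+q. f (fst4 q) \<partial>polar_space4) = nn_integral4 sphere_law (\<lambda>x1 x2 x3 x4. f (x1, x2, x3, x4))"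
proof -
  have f'[measurable]: "f \<in> borel_measurable (borel \<Otimes>\<^sub>M (borel \<Otimes>\<^sub>M (borel \<Otimes>\<^sub>M borel)))"
    using f by (simp add: borel_prod)
  interpret S: prob_space "sphere_law :: 'a measure" by (rule prob_space_sphere_law)
  interpret P: prob_space "polar_space :: ('a \<times> real) measure" by (rule prob_space_polar)
  interpret P2: sigma_finite_measure "polar_space \<Otimes>\<^sub>M polar_space :: (('a \<times> real) \<times> ('a \<times> real)) measure" by (rule sigma_finite_polar)
  interpret P3: sigma_finite_measure "polar_space \<Otimes>\<^sub>M (polar_space \<Otimes>\<^sub>M polar_space) :: (('a \<times> real) \<times> ('a \<times> real) \<times> ('a \<times> real)) measure" by (rule sigma_finite_polar)
  have "(\<integral>\<^sup>+q. f (fst4 q) \<partial>polar_space4) = (\<integral>\<^sup>+p1. \<integral>\<^sup>+z. f (fst4 (p1, z)) \<partial>(polar_space \<Otimes>\<^sub>M (polar_space \<Otimes>\<^sub>M polar_space)) \<partial>polar_space)"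
    by (rule P3.nn_integral_fst[symmetric]) (use f in measurable)
  also have "\<dots> = (\<integral>\<^sup>+p1. \<integral>\<^sup>+p2. \<integral>\<^sup>+z. f (fst4 (p1, p2, z)) \<partial>(polar_space \<Otimes>\<^sub>M polar_space) \<partial>polar_space \<partial>polar_space)"
  proof (rule nn_integral_cong)
    fix p1 :: "'a \<times> real" assume [simp]: "p1 \<in> space polar_space"
    show "(\<integral>\<^sup>+z. f (fst4 (p1, z)) \<partial>(polar_space \<Otimes>\<^sub>M (polar_space \<Otimes>\<^sub>M polar_space))) = (\<integral>\<^sup>+p2. \<integral>\<^sup>+z. f (fst4 (p1, p2, z)) \<partial>(polar_space \<Otimes>\<^sub>M polar_space) \<partial>polar_space)"
      using P2.nn_integral_fst[of "\<lambda>z. f (fst4 (p1, z))" polar_space] unfolding fst4_def by simp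
  qed
  also have "\<dots> = nn_integral4 polar_space (\<lambda>p1 p2 p3 p4. f (fst4 (p1, p2, p3, p4)))"
  proof (intro nn_integral_cong)
    fix p1 p2 :: "'a \<times> real"
    show "(\<integral>\<^sup>+z. f (fst4 (p1, p2, z)) \<partial>(polar_space \<Otimes>\<^sub>M polar_space)) = (\<integral>\<^sup>+p3. \<integral>\<^sup>+p4. f (fst4 (p1, p2, p3, p4)) \<partial>polar_space \<partial>polar_space)"
      using P.nn_integral_fst[of "\<lambda>z. f (fst4 (p1, p2, z))" polar_space] unfolding fst4_def by simp
  qed
  also have "\<dots> = (\<integral>\<^sup>+p1. \<integral>\<^sup>+p2. \<integral>\<^sup>+p3. (\<integral>\<^sup>+x4. f (fst p1, fst p2, fst p3, x4) \<partial>sphere_law) \<partial>polar_space \<partial>polar_space \<partial>polar_space)"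
    unfolding fst4_def prod.case by (intro nn_integral_cong nn_integral_polar_fst) measurable
  also have "\<dots> = (\<integral>\<^sup>+p1. \<integral>\<^sup>+p2. (\<integral>\<^sup>+x3. \<integral>\<^sup>+x4. f (fst p1, fst p2, x3, x4) \<partial>sphere_law \<partial>sphere_law) \<partial>polar_space \<partial>polar_space)"
    by (intro nn_integral_cong nn_integral_polar_fst) measurable
  also have "\<dots> = (\<integral>\<^sup>+p1. (\<integral>\<^sup>+x2. \<integral>\<^sup>+x3. \<integral>\<^sup>+x4. f (fst p1, x2, x3, x4) \<partial>sphere_law \<partial>sphere_law \<partial>sphere_law) \<partial>polar_space)"
    by (intro nn_integral_cong nn_integral_polar_fst) measurable
  also have "\<dots> = nn_integral4 sphere_law (\<lambda>x1 x2 x3 x4. f (x1, x2, x3, x4))"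
    by (intro nn_integral_polar_fst) measurable
  finally show ?thesis .
qed

text \<open>Nested almost-everywhere statements become one on the product space, because the
  iterated integral of the indicator of the exceptional set is zero.\<close>

lemma AE_polar_fst4:
  fixes P :: "'a::euclidean_space quad \<Rightarrow> bool"
  assumes S: "{x. P x} \<in> sets borel"
    and ae: "AE x1 in sphere_law. AE x2 in sphere_law. AE x3 in sphere_law. AE x4 in sphere_law. P (x1, x2, x3, x4)"
  shows "AE q in polar_space4. P (fst4 q)"
proof -
  have 1: "nn_integral4 sphere_law (\<lambda>x1 x2 x3 x4. indicator {x. \<not> P x} (x1, x2, x3, x4)) = 0"
    (is "?I = 0")
  proof -
    let ?N = "indicator {x. \<not> P x} :: _ \<Rightarrow> ennreal"
    have z: "(\<integral>\<^sup>+x. g x \<partial>M) = 0" if "AE x in M. g x = 0" for g :: "'a \<Rightarrow> ennreal" and M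
      using nn_integral_cong_AE[OF that] by simp
    have z4: "(\<integral>\<^sup>+x4. ?N (x1, x2, x3, x4) \<partial>sphere_law) = 0"
      if "AE x4 in sphere_law. P (x1, x2, x3, x4)" for x1 x2 x3
      by (rule z, rule eventually_mono[OF that]) simp
    have z3: "(\<integral>\<^sup>+x3. \<integral>\<^sup>+x4. ?N (x1, x2, x3, x4) \<partial>sphere_law \<partial>sphere_law) = 0"
      if "AE x3 in sphere_law. AE x4 in sphere_law. P (x1, x2, x3, x4)" for x1 x2
      by (rule z, rule eventually_mono[OF that]) (rule z4)
    have z2: "(\<integral>\<^sup>+x2. \<integral>\<^sup>+x3. \<integral>\<^sup>+x4. ?N (x1, x2, x3, x4) \<partial>sphere_law \<partial>sphere_law \<partial>sphere_law) = 0"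
      if "AE x2 in sphere_law. AE x3 in sphere_law. AE x4 in sphere_law. P (x1, x2, x3, x4)" for x1
      by (rule z, rule eventually_mono[OF that]) (rule z3)
    show ?thesis by (rule z, rule eventually_mono[OF ae]) (rule z2)
  qed
  have C: "{x. \<not> P x} \<in> sets borel" using borel_comp[OF S] by (simp add: Collect_neg_eq)
  then have "(\<integral>\<^sup>+q. indicator {x. \<not> P x} (fst4 q) \<partial>(polar_space4 :: ('a \<times> real) quad measure)) = 0"
    using 1 nn_integral_polar_fst4[of "indicator {x. \<not> P x}"] by simp
  moreover have "(\<lambda>q. indicator {x. \<not> P x} (fst4 q) :: ennreal) \<in> borel_measurable (polar_space4 :: ('a \<times> real) quad measure)"
    using C by measurable
  ultimately have "AE q in polar_space4. indicator {x. \<not> P x} (fst4 q :: 'a \<times> 'a \<times> 'a \<times> 'a) = (0::ennreal)"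
    by (subst (asm) nn_integral_0_iff_AE) auto
  then show ?thesis by eventually_elim (auto split: split_indicator_asm)
qed

text \<open>Dominated convergence with the constant 16. The function need only be continuous at the
  points of \<open>P\<close>, which almost every quadruple of limit points satisfies.\<close>

lemma beta4_limit:
  fixes f :: "'a::euclidean_space quad \<Rightarrow> real"
  assumes dim: "DIM('a) = 4" and f[measurable]: "f \<in> borel_measurable borel"
    and bounds: "\<And>x. 0 \<le> f x" "\<And>x. f x \<le> 1"
    and S: "{x. P x} \<in> sets borel" "\<And>x. P x \<Longrightarrow> isCont f x"
    and ae: "AE x1 in sphere_law. AE x2 in sphere_law. AE x3 in sphere_law. AE x4 in sphere_law. P (x1, x2, x3, x4)"
  shows "(\<lambda>k. beta4 (Suc k) (\<lambda>x. ennreal (f x))) \<longlonglongrightarrow> unit_vol TYPE('a) ^ 4 * (16 *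
    nn_integral4 sphere_law (\<lambda>x1 x2 x3 x4. ennreal (f (x1, x2, x3, x4))))"
proof -
  interpret P4: prob_space "polar_space4 :: ('a \<times> real) quad measure"
    by (rule prob_space_polar4)
  have "(\<lambda>k. \<integral>\<^sup>+q. ennreal (density4 (Suc k) q * f (polar4 (Suc k) q)) \<partial>polar_space4) \<longlonglongrightarrow> (\<integral>\<^sup>+q. ennreal (16 * f (fst4 q)) \<partial>polar_space4)"
  proof (rule nn_integral_dominated_convergence[where w = "\<lambda>_. 16"])
    show "AE q in polar_space4. ennreal (density4 (Suc k) q * f (polar4 (Suc k) q)) \<le> 16" for k
      using AE_polar4
    proof eventually_elim
      case (elim q)
      have "density4 (Suc k) q * f (polar4 (Suc k) q) \<le> 16 * 1"
        using density4_bounds(1,2)[where z = q and k = "Suc k"] elim bounds by (intro mult_mono) auto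
      then have "ennreal (density4 (Suc k) q * f (polar4 (Suc k) q)) \<le> ennreal 16" by (intro ennreal_leI) simp
      then show ?case by simp
    qed
    show "(\<integral>\<^sup>+x. 16 \<partial>(polar_space4 :: ('a \<times> real) quad measure)) < \<infinity>" using P4.emeasure_space_1 by simp
    show "AE q in polar_space4. (\<lambda>k. ennreal (density4 (Suc k) q * f (polar4 (Suc k) q))) \<longlonglongrightarrow> ennreal (16 * f (fst4 q))"
      using AE_polar4 AE_polar_fst4[OF S(1) ae]
    proof eventually_elim
      case (elim q)
      have "(\<lambda>k. polar4 k q) \<longlonglongrightarrow> fst4 q"
        unfolding polar4_def fst4_def case_prod_beta
        using elim(1) by (intro tendsto_Pair polar_point_tendsto) auto
      then have "(\<lambda>k. f (polar4 k q)) \<longlonglongrightarrow> f (fst4 q)"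
        using S(2)[OF elim(2)] isCont_tendsto_compose by blast
      then have "(\<lambda>k. density4 k q * f (polar4 k q)) \<longlonglongrightarrow> 16 * f (fst4 q)"
        using elim(1) by (intro tendsto_mult density4_bounds(3)) auto
      then show ?case by (intro tendsto_ennrealI LIMSEQ_Suc)
    qed
  qed measurable
  moreover have "beta4 (Suc k) (\<lambda>x. ennreal (f x)) = unit_vol TYPE('a) ^ 4 * (\<integral>\<^sup>+q. ennreal (density4 (Suc k) q * f (polar4 (Suc k) q)) \<partial>polar_space4)" for k
  proof -
    have "(\<integral>\<^sup>+q. ennreal (density4 (Suc k) q) * ennreal (f (polar4 (Suc k) q)) \<partial>polar_space4) = (\<integral>\<^sup>+q. ennreal (density4 (Suc k) q * f (polar4 (Suc k) q)) \<partial>polar_space4)"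
    proof (rule nn_integral_cong_AE)
      show "AE q in polar_space4. ennreal (density4 (Suc k) q) * ennreal (f (polar4 (Suc k) q)) = ennreal (density4 (Suc k) q * f (polar4 (Suc k) q))"
        using AE_polar4
      proof eventually_elim
        case (elim q)
        then have "0 \<le> density4 (Suc k) q" by (intro density4_bounds(1)) auto
        then show ?case using bounds by (simp add: ennreal_mult)
      qed
    qed
    then show ?thesis by (subst beta4_polar[OF dim]) auto
  qed
  moreover have "(\<integral>\<^sup>+q. ennreal (16 * f (fst4 q)) \<partial>polar_space4) = 16 *
    nn_integral4 sphere_law (\<lambda>x1 x2 x3 x4. ennreal (f (x1, x2, x3, x4)))"
    using nn_integral_polar_fst4[of "\<lambda>x. ennreal (f x)"] bounds
    by (simp add: ennreal_mult nn_integral_cmult)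
  ultimately show ?thesis
    using unit_vol_pos[where 'a='a] by (auto intro!: tendsto_mult_ennreal simp: power_eq_top_ennreal)
qed

lemma beta_limit:
  fixes f :: "'a::euclidean_space \<Rightarrow> real"
  assumes dim: "DIM('a) = 4" and f[measurable]: "f \<in> borel_measurable borel"
    and bounds: "\<And>x. 0 \<le> f x" "\<And>x. f x \<le> 1" and cont: "\<And>x. isCont f x"
  shows "(\<lambda>k. \<integral>\<^sup>+y. ennreal (beta_weight (Suc k) y) * ennreal (f y) \<partial>lborel) \<longlonglongrightarrow>
    unit_vol TYPE('a) * (2 * (\<integral>\<^sup>+x. ennreal (f x) \<partial>sphere_law))"
proof -
  interpret P: prob_space "polar_space :: ('a \<times> real) measure" by (rule prob_space_polar)
  have [measurable]: "radius_sq k \<in> borel_measurable borel" for k unfolding radius_sq_def[abs_def] by measurable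
  have "(\<lambda>k. \<integral>\<^sup>+q. ennreal (2 * radius_sq (Suc k) (snd q) * f (polar_point (Suc k) q)) \<partial>polar_space) \<longlonglongrightarrow> (\<integral>\<^sup>+q. ennreal (2 * f (fst q)) \<partial>polar_space)"
  proof (rule nn_integral_dominated_convergence[where w = "\<lambda>_. 2"])
    show "AE q in polar_space. ennreal (2 * radius_sq (Suc k) (snd q) * f (polar_point (Suc k) q)) \<le> 2" for k
      using AE_polar
    proof eventually_elim
      case (elim q)
      have "2 * radius_sq (Suc k) (snd q) * f (polar_point (Suc k) q) \<le> 2 * 1"
        using radius_sq_bounds[of "snd q" "Suc k"] elim bounds by (subst mult.assoc, intro mult_left_mono mult_le_one) auto
      then have "ennreal (2 * radius_sq (Suc k) (snd q) * f (polar_point (Suc k) q)) \<le> ennreal 2" by (intro ennreal_leI) simp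
      then show ?case by simp
    qed
    show "(\<integral>\<^sup>+x. 2 \<partial>(polar_space :: ('a \<times> real) measure)) < \<infinity>" using P.emeasure_space_1 by simp
    show "AE q in polar_space. (\<lambda>k. ennreal (2 * radius_sq (Suc k) (snd q) * f (polar_point (Suc k) q))) \<longlonglongrightarrow> ennreal (2 * f (fst q))"
      using AE_polar
    proof eventually_elim
      case (elim q)
      then have "(\<lambda>k. f (polar_point k q)) \<longlonglongrightarrow> f (fst q)"
        using cont isCont_tendsto_compose polar_point_tendsto by blast
      then have "(\<lambda>k. 2 * radius_sq k (snd q) * f (polar_point k q)) \<longlonglongrightarrow> 2 * 1 * f (fst q)"
        using elim by (intro tendsto_mult radius_sq_tendsto tendsto_const) auto
      then show ?case using LIMSEQ_Suc by (intro tendsto_ennrealI) fastforce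
    qed
  qed measurable
  moreover have "(\<integral>\<^sup>+y. ennreal (beta_weight (Suc k) y) * ennreal (f y) \<partial>lborel)
      = unit_vol TYPE('a) * (\<integral>\<^sup>+q. ennreal (2 * radius_sq (Suc k) (snd q) * f (polar_point (Suc k) q)) \<partial>polar_space)" for k
  proof -
    have "(\<integral>\<^sup>+q. ennreal (2 * radius_sq (Suc k) (snd q)) * ennreal (f (polar_point (Suc k) q)) \<partial>polar_space) = (\<integral>\<^sup>+q. ennreal (2 * radius_sq (Suc k) (snd q) * f (polar_point (Suc k) q)) \<partial>polar_space)"
    proof (rule nn_integral_cong_AE)
      show "AE q in polar_space. ennreal (2 * radius_sq (Suc k) (snd q)) * ennreal (f (polar_point (Suc k) q)) = ennreal (2 * radius_sq (Suc k) (snd q) * f (polar_point (Suc k) q))"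
        using AE_polar
        by eventually_elim (subst ennreal_mult, use radius_sq_bounds bounds in auto)
    qed
    then show ?thesis by (subst nn_integral_beta_weight[OF dim]) auto
  qed
  moreover have "(\<integral>\<^sup>+q. ennreal (2 * f (fst q)) \<partial>polar_space) = 2 * (\<integral>\<^sup>+x. ennreal (f x) \<partial>sphere_law)"
    using nn_integral_polar_fst[of "\<lambda>x. ennreal (f x)"] bounds by (simp add: ennreal_mult nn_integral_cmult)
  ultimately show ?thesis
    using unit_vol_pos[where 'a='a] by (auto intro!: tendsto_mult_ennreal)
qed

section \<open>The hyperplane through four points\<close>

lemma nn_integral_lborel_translate:
  fixes f :: "real \<Rightarrow> ennreal"
  assumes "f \<in> borel_measurable borel"
  shows "(\<integral>\<^sup>+x. f x \<partial>lborel) = (\<integral>\<^sup>+x. f (t + x) \<partial>lborel)"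
  using nn_integral_real_affine[OF assms, of 1 t] by simp

lemma nn_integral_lborel_affine:
  fixes f :: "'a::euclidean_space \<Rightarrow> ennreal"
  assumes [measurable]: "f \<in> borel_measurable borel" and r: "r > 0"
  shows "(\<integral>\<^sup>+x. f x \<partial>lborel) = ennreal (r ^ DIM('a)) * (\<integral>\<^sup>+x. f (t + r *\<^sub>R x) \<partial>lborel)"
  using r by (subst lborel_affine[of r t])
    (simp_all add: nn_integral_density nn_integral_distr nn_integral_cmult ennreal_power)

lemma nn_integral_lborel_pair:
  fixes f :: "'a::euclidean_space \<times> 'b::euclidean_space \<Rightarrow> ennreal"
  assumes f: "f \<in> borel_measurable borel"
  shows "(\<integral>\<^sup>+y. f y \<partial>lborel) = (\<integral>\<^sup>+p. \<integral>\<^sup>+t. f (p, t) \<partial>lborel \<partial>lborel)"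
  using lborel.nn_integral_fst[of f lborel] f by (simp add: lborel_prod)

definition vec3 :: "real \<times> real \<times> real \<Rightarrow> real^3" where
  "vec3 z = vector [fst z, fst (snd z), snd (snd z)]"

lemma vec3_nth [simp]: "vec3 z $ 1 = fst z" "vec3 z $ 2 = fst (snd z)" "vec3 z $ 3 = snd (snd z)"
  by (simp_all add: vec3_def)

lemma lborel_distr_vec3: "distr lborel borel vec3 = lborel"
proof (rule lborel_distr_Basis)
  show "linear vec3" by (rule linearI) (simp_all add: vec_eq_iff forall_3)
  show inner: "vec3 x \<bullet> vec3 y = x \<bullet> y" for x y
    by (cases x, cases y) (simp add: inner_vec_def sum_3)
  have "vec3 ` Basis \<subseteq> Basis"
  proof
    fix v assume "v \<in> vec3 ` Basis"
    then obtain b :: "real \<times> real \<times> real" where b: "b \<in> Basis" "v = vec3 b" by blast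
    then have "v = axis 1 1 \<or> v = axis 2 1 \<or> v = axis 3 1"
      by (auto simp: Basis_prod_def vec_eq_iff forall_3 axis_def)
    then show "v \<in> Basis" by (auto simp: axis_in_Basis_iff)
  qed
  moreover have "inj_on vec3 Basis"
    by (rule inj_onI) (metis inner inner_same_Basis inner_not_same_Basis zero_neq_one)
  then have "card (vec3 ` Basis) = card (Basis :: (real^3) set)" by (simp add: card_image)
  ultimately show "vec3 ` Basis = Basis" by (intro card_subset_eq) auto
qed

text \<open>The linear map with rows \<open>a\<close>, \<open>b\<close>, \<open>c\<close> has the
  triple product as its determinant.\<close>

lemma nn_integral_linear3:
  fixes g :: "real \<times> real \<times> real \<Rightarrow> ennreal" and a b c :: "real^3"
  assumes g: "g \<in> borel_measurable borel" and D: "a \<bullet> cross3 b c \<noteq> 0"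
  shows "(\<integral>\<^sup>+s2. \<integral>\<^sup>+s3. \<integral>\<^sup>+s4. g (s2, s3, s4) \<partial>lborel \<partial>lborel \<partial>lborel)
    = ennreal \<bar>a \<bullet> cross3 b c\<bar> * (\<integral>\<^sup>+x. g (a \<bullet> x, b \<bullet> x, c \<bullet> x) \<partial>lborel)"
proof -
  have g3[measurable]: "g \<in> borel_measurable (borel \<Otimes>\<^sub>M (borel \<Otimes>\<^sub>M borel))" using g by (simp add: borel_prod)
  let ?G = "\<lambda>v :: real^3. g (v $ 1, v $ 2, v $ 3)"
  have G[measurable]: "?G \<in> borel_measurable borel"
    by (rule measurable_compose[OF _ g]) (intro borel_measurable_Pair borel_measurable_continuous_onI continuous_intros)
  have [measurable]: "vec3 \<in> borel_measurable borel"
    by (intro borel_measurable_continuous_onI linear_continuous_on)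
       (simp add: linear_conv_bounded_linear[symmetric] linearI vec_eq_iff forall_3)
  let ?f = "\<lambda>x. vector [a \<bullet> x, b \<bullet> x, c \<bullet> x] :: real^3"
  have f: "?f = (\<lambda>x. vector [a, b, c] *v x)"
    by (auto simp: vec_eq_iff forall_3 matrix_vector_mul_component)
  have lin: "linear ?f" unfolding f by (rule matrix_vector_mul_linear)
  have det: "det (matrix ?f) = a \<bullet> cross3 b c" unfolding f by (simp add: dot_cross_det)
  have "(\<integral>\<^sup>+s2. \<integral>\<^sup>+s3. \<integral>\<^sup>+s4. g (s2, s3, s4) \<partial>lborel \<partial>lborel \<partial>lborel) = (\<integral>\<^sup>+s2. \<integral>\<^sup>+z. g (s2, z) \<partial>lborel \<partial>lborel)"
  proof (rule nn_integral_cong)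
    fix s2 :: real
    have "(\<lambda>z. g (s2, z)) \<in> borel_measurable borel" by (simp add: borel_prod[symmetric])
    then show "(\<integral>\<^sup>+s3. \<integral>\<^sup>+s4. g (s2, s3, s4) \<partial>lborel \<partial>lborel) = (\<integral>\<^sup>+z. g (s2, z) \<partial>lborel)"
      by (rule nn_integral_lborel_pair[symmetric])
  qed
  also have "\<dots> = (\<integral>\<^sup>+z. g z \<partial>lborel)" by (rule nn_integral_lborel_pair[OF g, symmetric])
  also have "\<dots> = (\<integral>\<^sup>+z. ?G (vec3 z) \<partial>lborel)" by simp
  also have "\<dots> = (\<integral>\<^sup>+v. ?G v \<partial>distr lborel borel vec3)" by (rule nn_integral_distr[symmetric]) measurable
  also have "\<dots> = (\<integral>\<^sup>+v. ?G v \<partial>lborel)" by (simp add: lborel_distr_vec3)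
  also have "\<dots> = ennreal \<bar>a \<bullet> cross3 b c\<bar> * (\<integral>\<^sup>+x. ?G (?f x) \<partial>lborel)"
    using nn_integral_lborel_linear[OF lin _ G] D unfolding det by simp
  finally show ?thesis by simp
qed

text \<open>Six times the signed volume of the simplex with these vertices.\<close>

definition vol3 :: "real^3 \<Rightarrow> real^3 \<Rightarrow> real^3 \<Rightarrow> real^3 \<Rightarrow> real" where
  "vol3 p1 p2 p3 p4 = (p2 - p1) \<bullet> cross3 (p3 - p1) (p4 - p1)"

lemma continuous_on_cross3 [continuous_intros]:
  fixes f g :: "'a::t2_space \<Rightarrow> real^3"
  shows "continuous_on S f \<Longrightarrow> continuous_on S g \<Longrightarrow> continuous_on S (\<lambda>x. cross3 (f x) (g x))"
  by (rule continuous_on_cross)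

lemma borel_measurable_cross3 [measurable (raw)]:
  assumes "f \<in> borel_measurable M" "g \<in> borel_measurable M"
  shows "(\<lambda>x. cross3 (f x) (g x)) \<in> borel_measurable M"
proof -
  have "continuous_on UNIV (\<lambda>z. cross3 (fst z) (snd z))" by (intro continuous_intros)
  then show ?thesis using borel_measurable_continuous_Pair[OF assms, of cross3] by simp
qed

text \<open>The heights over four fixed base points determine the hyperplane that interpolates them,
  and conversely. With the first height fixed, the differences of the others are a linear image of
  the slope \<open>x\<close>, with determinant \<open>vol3\<close>; the intercept then differs from
  the first height by a translation.\<close>

lemma nn_integral_graph_hyperplane:
  fixes F :: "real \<Rightarrow> real \<Rightarrow> real \<Rightarrow> real \<Rightarrow> ennreal"
  assumes F: "(\<lambda>(t1, t2, t3, t4). F t1 t2 t3 t4) \<in> borel_measurable (borel \<Otimes>\<^sub>M (borel \<Otimes>\<^sub>M (borel \<Otimes>\<^sub>M borel)))"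
    and D: "vol3 p1 p2 p3 p4 \<noteq> 0"
  shows "nn_integral4 lborel F
    = ennreal \<bar>vol3 p1 p2 p3 p4\<bar> * (\<integral>\<^sup>+x. \<integral>\<^sup>+s. F (x \<bullet> p1 + s) (x \<bullet> p2 + s) (x \<bullet> p3 + s) (x \<bullet> p4 + s) \<partial>lborel \<partial>lborel)"
proof -
  let ?D = "ennreal \<bar>vol3 p1 p2 p3 p4\<bar>"
  have Fm[measurable (raw)]: "(\<lambda>x. F (a x) (b x) (c x) (d x)) \<in> borel_measurable M"
    if "a \<in> borel_measurable M" "b \<in> borel_measurable M" "c \<in> borel_measurable M" "d \<in> borel_measurable M"
    for M :: "'z measure" and a b c d
  proof -
    have "(\<lambda>x. (a x, b x, c x, d x)) \<in> M \<rightarrow>\<^sub>M borel \<Otimes>\<^sub>M (borel \<Otimes>\<^sub>M (borel \<Otimes>\<^sub>M borel))" using that by measurable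
    from measurable_compose[OF this F] show ?thesis by simp
  qed
  have "nn_integral4 lborel F
      = (\<integral>\<^sup>+t1. ?D * (\<integral>\<^sup>+x. F t1 (t1 + (p2 - p1) \<bullet> x) (t1 + (p3 - p1) \<bullet> x) (t1 + (p4 - p1) \<bullet> x) \<partial>lborel) \<partial>lborel)"
  proof (rule nn_integral_cong)
    fix t1 :: real
    have "(\<integral>\<^sup>+t2. \<integral>\<^sup>+t3. \<integral>\<^sup>+t4. F t1 t2 t3 t4 \<partial>lborel \<partial>lborel \<partial>lborel) = (\<integral>\<^sup>+t2. \<integral>\<^sup>+t3. \<integral>\<^sup>+t4. F t1 t2 t3 (t1 + t4) \<partial>lborel \<partial>lborel \<partial>lborel)"
      by (intro nn_integral_cong nn_integral_lborel_translate) measurable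
    also have "\<dots> = (\<integral>\<^sup>+t2. \<integral>\<^sup>+t3. \<integral>\<^sup>+t4. F t1 t2 (t1 + t3) (t1 + t4) \<partial>lborel \<partial>lborel \<partial>lborel)"
      by (intro nn_integral_cong nn_integral_lborel_translate) measurable
    also have "\<dots> = (\<integral>\<^sup>+t2. \<integral>\<^sup>+t3. \<integral>\<^sup>+t4. F t1 (t1 + t2) (t1 + t3) (t1 + t4) \<partial>lborel \<partial>lborel \<partial>lborel)"
      by (intro nn_integral_lborel_translate) measurable
    also have "\<dots> = ?D * (\<integral>\<^sup>+x. F t1 (t1 + (p2 - p1) \<bullet> x) (t1 + (p3 - p1) \<bullet> x) (t1 + (p4 - p1) \<bullet> x) \<partial>lborel)"
      using nn_integral_linear3[of "\<lambda>(s2, s3, s4). F t1 (t1 + s2) (t1 + s3) (t1 + s4)" "p2 - p1" "p3 - p1" "p4 - p1"] D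
      by (simp add: vol3_def borel_prod[symmetric])
    finally show "(\<integral>\<^sup>+t2. \<integral>\<^sup>+t3. \<integral>\<^sup>+t4. F t1 t2 t3 t4 \<partial>lborel \<partial>lborel \<partial>lborel)
      = ?D * (\<integral>\<^sup>+x. F t1 (t1 + (p2 - p1) \<bullet> x) (t1 + (p3 - p1) \<bullet> x) (t1 + (p4 - p1) \<bullet> x) \<partial>lborel)" .
  qed
  also have "\<dots> = ?D * (\<integral>\<^sup>+t1. \<integral>\<^sup>+x. F t1 (t1 + (p2 - p1) \<bullet> x) (t1 + (p3 - p1) \<bullet> x) (t1 + (p4 - p1) \<bullet> x) \<partial>lborel \<partial>lborel)"
    by (rule nn_integral_cmult) measurable
  also have "(\<integral>\<^sup>+t1. \<integral>\<^sup>+x. F t1 (t1 + (p2 - p1) \<bullet> x) (t1 + (p3 - p1) \<bullet> x) (t1 + (p4 - p1) \<bullet> x) \<partial>lborel \<partial>lborel)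
    = (\<integral>\<^sup>+x. \<integral>\<^sup>+t1. F t1 (t1 + (p2 - p1) \<bullet> x) (t1 + (p3 - p1) \<bullet> x) (t1 + (p4 - p1) \<bullet> x) \<partial>lborel \<partial>lborel)"
    by (rule lborel_pair.Fubini') measurable
  \<comment> \<open>For fixed slope the first height is replaced by the intercept,
    \<open>t1 = x \<bullet> p1 + s\<close>.\<close>
  also have "\<dots> = (\<integral>\<^sup>+x. \<integral>\<^sup>+s. F (x \<bullet> p1 + s) (x \<bullet> p1 + s + (p2 - p1) \<bullet> x) (x \<bullet> p1 + s + (p3 - p1) \<bullet> x) (x \<bullet> p1 + s + (p4 - p1) \<bullet> x) \<partial>lborel \<partial>lborel)"
    by (intro nn_integral_cong nn_integral_lborel_translate) measurable
  also have "\<dots> = (\<integral>\<^sup>+x. \<integral>\<^sup>+s. F (x \<bullet> p1 + s) (x \<bullet> p2 + s) (x \<bullet> p3 + s) (x \<bullet> p4 + s) \<partial>lborel \<partial>lborel)"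
  proof -
    have "x \<bullet> p1 + s + (q - p1) \<bullet> x = x \<bullet> q + s" for x q s
      by (simp add: inner_commute[of _ x] inner_diff_right)
    then show ?thesis by (simp only:)
  qed
  finally show ?thesis .
qed

text \<open>Brings all base points outside and all heights inside, so that the hyperplane
  substitution can be made with the base points fixed.\<close>

lemma nn_integral_split4:
  fixes G :: "((real^3) \<times> real) \<Rightarrow> ((real^3) \<times> real) \<Rightarrow> ((real^3) \<times> real) \<Rightarrow> ((real^3) \<times> real) \<Rightarrow> ennreal"
  assumes G: "(\<lambda>(y1, y2, y3, y4). G y1 y2 y3 y4) \<in> borel_measurable (borel \<Otimes>\<^sub>M (borel \<Otimes>\<^sub>M (borel \<Otimes>\<^sub>M borel)))"
  shows "nn_integral4 lborel G
    = nn_integral4 lborel (\<lambda>p1 p2 p3 p4. nn_integral4 lborel (\<lambda>t1 t2 t3 t4. G (p1, t1) (p2, t2) (p3, t3) (p4, t4)))"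
proof -
  note s = nn_integral_lborel_pair
  have Gm[measurable (raw)]: "(\<lambda>x. G (a x) (b x) (c x) (d x)) \<in> borel_measurable M"
    if "a \<in> borel_measurable M" "b \<in> borel_measurable M" "c \<in> borel_measurable M" "d \<in> borel_measurable M"
    for M :: "'z measure" and a b c d
  proof -
    have "(\<lambda>x. (a x, b x, c x, d x)) \<in> M \<rightarrow>\<^sub>M borel \<Otimes>\<^sub>M (borel \<Otimes>\<^sub>M (borel \<Otimes>\<^sub>M borel))" using that by measurable
    from measurable_compose[OF this G] show ?thesis by simp
  qed
  have "nn_integral4 lborel G
    = (\<integral>\<^sup>+y1. \<integral>\<^sup>+y2. \<integral>\<^sup>+y3. \<integral>\<^sup>+p4. \<integral>\<^sup>+t4. G y1 y2 y3 (p4, t4) \<partial>lborel \<partial>lborel \<partial>lborel \<partial>lborel \<partial>lborel)"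
    by (intro nn_integral_cong s) measurable
  also have "\<dots> = (\<integral>\<^sup>+y1. \<integral>\<^sup>+y2. \<integral>\<^sup>+p3. \<integral>\<^sup>+t3. \<integral>\<^sup>+p4. \<integral>\<^sup>+t4. G y1 y2 (p3, t3) (p4, t4) \<partial>lborel \<partial>lborel \<partial>lborel \<partial>lborel \<partial>lborel \<partial>lborel)"
    by (intro nn_integral_cong s) measurable
  also have "\<dots> = (\<integral>\<^sup>+y1. \<integral>\<^sup>+y2. \<integral>\<^sup>+p3. \<integral>\<^sup>+p4. \<integral>\<^sup>+t3. \<integral>\<^sup>+t4. G y1 y2 (p3, t3) (p4, t4) \<partial>lborel \<partial>lborel \<partial>lborel \<partial>lborel \<partial>lborel \<partial>lborel)"
    by (intro nn_integral_cong lborel_pair.Fubini') measurable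
  also have "\<dots> = (\<integral>\<^sup>+y1. \<integral>\<^sup>+p2. \<integral>\<^sup>+t2. \<integral>\<^sup>+p3. \<integral>\<^sup>+p4. \<integral>\<^sup>+t3. \<integral>\<^sup>+t4. G y1 (p2, t2) (p3, t3) (p4, t4) \<partial>lborel \<partial>lborel \<partial>lborel \<partial>lborel \<partial>lborel \<partial>lborel \<partial>lborel)"
    by (intro nn_integral_cong s) measurable
  also have "\<dots> = (\<integral>\<^sup>+y1. \<integral>\<^sup>+p2. \<integral>\<^sup>+p3. \<integral>\<^sup>+t2. \<integral>\<^sup>+p4. \<integral>\<^sup>+t3. \<integral>\<^sup>+t4. G y1 (p2, t2) (p3, t3) (p4, t4) \<partial>lborel \<partial>lborel \<partial>lborel \<partial>lborel \<partial>lborel \<partial>lborel \<partial>lborel)"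
    by (intro nn_integral_cong lborel_pair.Fubini') measurable
  also have "\<dots> = (\<integral>\<^sup>+y1. \<integral>\<^sup>+p2. \<integral>\<^sup>+p3. \<integral>\<^sup>+p4. \<integral>\<^sup>+t2. \<integral>\<^sup>+t3. \<integral>\<^sup>+t4. G y1 (p2, t2) (p3, t3) (p4, t4) \<partial>lborel \<partial>lborel \<partial>lborel \<partial>lborel \<partial>lborel \<partial>lborel \<partial>lborel)"
    by (intro nn_integral_cong lborel_pair.Fubini') measurable
  also have "\<dots> = (\<integral>\<^sup>+p1. \<integral>\<^sup>+t1. \<integral>\<^sup>+p2. \<integral>\<^sup>+p3. \<integral>\<^sup>+p4. \<integral>\<^sup>+t2. \<integral>\<^sup>+t3. \<integral>\<^sup>+t4. G (p1, t1) (p2, t2) (p3, t3) (p4, t4) \<partial>lborel \<partial>lborel \<partial>lborel \<partial>lborel \<partial>lborel \<partial>lborel \<partial>lborel \<partial>lborel)"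
    by (intro s) measurable
  also have "\<dots> = (\<integral>\<^sup>+p1. \<integral>\<^sup>+p2. \<integral>\<^sup>+t1. \<integral>\<^sup>+p3. \<integral>\<^sup>+p4. \<integral>\<^sup>+t2. \<integral>\<^sup>+t3. \<integral>\<^sup>+t4. G (p1, t1) (p2, t2) (p3, t3) (p4, t4) \<partial>lborel \<partial>lborel \<partial>lborel \<partial>lborel \<partial>lborel \<partial>lborel \<partial>lborel \<partial>lborel)"
    by (intro nn_integral_cong lborel_pair.Fubini') measurable
  also have "\<dots> = (\<integral>\<^sup>+p1. \<integral>\<^sup>+p2. \<integral>\<^sup>+p3. \<integral>\<^sup>+t1. \<integral>\<^sup>+p4. \<integral>\<^sup>+t2. \<integral>\<^sup>+t3. \<integral>\<^sup>+t4. G (p1, t1) (p2, t2) (p3, t3) (p4, t4) \<partial>lborel \<partial>lborel \<partial>lborel \<partial>lborel \<partial>lborel \<partial>lborel \<partial>lborel \<partial>lborel)"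
    by (intro nn_integral_cong lborel_pair.Fubini') measurable
  also have "\<dots> = nn_integral4 lborel (\<lambda>p1 p2 p3 p4. nn_integral4 lborel (\<lambda>t1 t2 t3 t4. G (p1, t1) (p2, t2) (p3, t3) (p4, t4)))"
    by (intro nn_integral_cong lborel_pair.Fubini') measurable
  finally show ?thesis .
qed

lemma AE_lborel_hyperplane:
  fixes n :: "'a::euclidean_space"
  assumes "n \<noteq> 0"
  shows "AE x in lborel. n \<bullet> x \<noteq> r"
proof -
  have "negligible {x. n \<bullet> x = r}" using assms by (simp add: negligible_hyperplane)
  then have "{x. n \<bullet> x = r} \<in> null_sets lborel"
    by (auto simp: negligible_iff_null_sets null_sets_def)
  then show ?thesis by (rule AE_I') auto
qed

lemma vol3_cyclic: "vol3 p1 p2 p3 p4 = cross3 (p2 - p1) (p3 - p1) \<bullet> p4 - cross3 (p2 - p1) (p3 - p1) \<bullet> p1"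
  unfolding vol3_def by (simp add: cross3_simps)

text \<open>The points are chosen in turn: \<open>p2\<close> differs from \<open>p1\<close>,
  \<open>p3\<close> avoids a plane on which a cross product could vanish, and \<open>p4\<close>
  avoids the plane through the first three.\<close>

lemma AE_vol3: "AE p1 in lborel. AE p2 in lborel. AE p3 in lborel. AE p4 in lborel. vol3 p1 p2 p3 p4 \<noteq> 0"
proof (rule AE_I2)
  fix p1 :: "real^3"
  have "AE p3 in lborel. AE p4 in lborel. vol3 p1 p2 p3 p4 \<noteq> 0" if p2: "p2 \<noteq> p1" for p2
  proof -
    obtain v where v: "cross3 v (p2 - p1) \<noteq> 0"
    proof -
      have "\<exists>v. cross3 v (p2 - p1) \<noteq> 0"
      proof (rule ccontr)
        assume "\<nexists>v. cross3 v (p2 - p1) \<noteq> 0"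
        \<comment> \<open>Two axes suffice: a vector whose cross products with both vanish is
          parallel to both.\<close>
        then have "cross3 (axis 1 1) (p2 - p1) = 0" "cross3 (axis 2 1) (p2 - p1) = 0" by auto
        then have "p2 - p1 = 0" by (auto simp: cross3_def vec_eq_iff forall_3 axis_def)
        then show False using p2 by simp
      qed
      then show ?thesis using that by blast
    qed
    have "AE p3 in lborel. cross3 v (p2 - p1) \<bullet> p3 \<noteq> cross3 v (p2 - p1) \<bullet> p1"
      by (rule AE_lborel_hyperplane[OF v])
    then show ?thesis
    proof eventually_elim
      case (elim p3)
      have "v \<bullet> cross3 (p2 - p1) (p3 - p1) = cross3 v (p2 - p1) \<bullet> p3 - cross3 v (p2 - p1) \<bullet> p1"
        by (simp add: cross3_simps)
      then have "cross3 (p2 - p1) (p3 - p1) \<noteq> 0" using elim by auto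
      then have "AE p4 in lborel. cross3 (p2 - p1) (p3 - p1) \<bullet> p4 \<noteq> cross3 (p2 - p1) (p3 - p1) \<bullet> p1"
        by (rule AE_lborel_hyperplane)
      then show ?case by eventually_elim (simp add: vol3_cyclic)
    qed
  qed
  moreover have "AE p2 in lborel. p2 \<noteq> p1" by (rule AE_lborel_singleton)
  ultimately show "AE p2 in lborel. AE p3 in lborel. AE p4 in lborel. vol3 p1 p2 p3 p4 \<noteq> 0"
    by (auto elim: eventually_mono)
qed

section \<open>Slope and height of the hyperplane\<close>

type_synonym pt = "(real^3) \<times> real"

text \<open>
  The hyperplane through the four points is the graph of \<open>p \<mapsto> slope y \<bullet> p + s\<close>, by Cramer's rule;
  if the projected simplex is degenerate, \<open>slope y\<close> has the junk value 0.
\<close>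

definition slope :: "pt quad \<Rightarrow> real^3" where
  "slope y =
     (let p1 = fst (fst y); p2 = fst (fst (snd y)); p3 = fst (fst (snd (snd y))); p4 = fst (snd (snd (snd y)));
          t1 = snd (fst y); t2 = snd (fst (snd y)); t3 = snd (fst (snd (snd y))); t4 = snd (snd (snd (snd y)))
      in ((t2 - t1) *\<^sub>R cross3 (p3 - p1) (p4 - p1) + (t3 - t1) *\<^sub>R cross3 (p4 - p1) (p2 - p1) +
          (t4 - t1) *\<^sub>R cross3 (p2 - p1) (p3 - p1)) /\<^sub>R vol3 p1 p2 p3 p4)"

definition proj_vol :: "pt quad \<Rightarrow> real" where
  "proj_vol y = vol3 (fst (fst y)) (fst (fst (snd y))) (fst (fst (snd (snd y)))) (fst (snd (snd (snd y))))"

text \<open>The signed distance is taken with respect to the upward normal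
  \<open>(- slope y, 1)\<close>; the quotient is the product of the first point with its
  normalization.\<close>

definition plane_height :: "pt quad \<Rightarrow> real" where
  "plane_height y = (snd (fst y) - slope y \<bullet> fst (fst y)) / sqrt (1 + (norm (slope y))\<^sup>2)"

lemma slope_eq:
  assumes "vol3 p1 p2 p3 p4 \<noteq> 0"
  shows "slope ((p1, x \<bullet> p1 + s), (p2, x \<bullet> p2 + s), (p3, x \<bullet> p3 + s), (p4, x \<bullet> p4 + s)) = x"
proof -
  \<comment> \<open>Cramer's rule in vector form: up to the determinant, the three cross products
    are the basis dual to \<open>a\<close>, \<open>b\<close>, \<open>c\<close>.\<close>
  have "(x \<bullet> a) *\<^sub>R cross3 b c + (x \<bullet> b) *\<^sub>R cross3 c a + (x \<bullet> c) *\<^sub>R cross3 a b = (a \<bullet> cross3 b c) *\<^sub>R x" for a b c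
    by (simp add: cross3_simps forall_3)
  from this[of "p2 - p1" "p3 - p1" "p4 - p1"]
  have "((x \<bullet> p2 + s) - (x \<bullet> p1 + s)) *\<^sub>R cross3 (p3 - p1) (p4 - p1) + ((x \<bullet> p3 + s) - (x \<bullet> p1 + s)) *\<^sub>R cross3 (p4 - p1) (p2 - p1) +
      ((x \<bullet> p4 + s) - (x \<bullet> p1 + s)) *\<^sub>R cross3 (p2 - p1) (p3 - p1) = vol3 p1 p2 p3 p4 *\<^sub>R x"
    by (simp add: vol3_def inner_diff_right)
  then show ?thesis using assms by (simp add: slope_def)
qed

lemma plane_height_eq:
  assumes "vol3 p1 p2 p3 p4 \<noteq> 0"
  shows "plane_height ((p1, x \<bullet> p1 + s), (p2, x \<bullet> p2 + s), (p3, x \<bullet> p3 + s), (p4, x \<bullet> p4 + s)) = s / sqrt (1 + (norm x)\<^sup>2)"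
  by (simp add: plane_height_def slope_eq[OF assms])

lemma continuous_on_proj_vol: "continuous_on A proj_vol"
  unfolding proj_vol_def[abs_def] vol3_def by (intro continuous_intros)

lemma continuous_on_plane_height: "continuous_on {y. proj_vol y \<noteq> 0} plane_height"
proof -
  have s: "continuous_on {y. proj_vol y \<noteq> 0} slope"
    unfolding slope_def[abs_def] Let_def proj_vol_def vol3_def by (intro continuous_intros) auto
  have p: "sqrt (1 + (norm x)\<^sup>2) \<noteq> 0" for x :: "real^3"
    by (metis add_pos_nonneg less_numeral_extra(3) real_sqrt_gt_zero zero_le_power2 zero_less_one)
  show ?thesis unfolding plane_height_def[abs_def] using p by (intro continuous_intros s) auto
qed

lemma open_proj_vol: "open {y. proj_vol y \<noteq> 0}"
proof -
  have "{y. proj_vol y \<noteq> 0} = proj_vol -` (- {0})" by auto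
  then show ?thesis using continuous_on_proj_vol by (metis open_Compl closed_singleton open_vimage)
qed

lemma isCont_plane_height: "proj_vol y \<noteq> 0 \<Longrightarrow> isCont plane_height y"
  using continuous_on_plane_height open_proj_vol continuous_on_eq_continuous_at by blast

lemma measurable_vol3 [measurable (raw)]:
  assumes "a \<in> borel_measurable M" "b \<in> borel_measurable M" "c \<in> borel_measurable M" "d \<in> borel_measurable M"
  shows "(\<lambda>x. vol3 (a x) (b x) (c x) (d x)) \<in> borel_measurable M"
  unfolding vol3_def by (intro borel_measurable_inner borel_measurable_cross3 borel_measurable_diff assms)

lemma measurable_plane_height [measurable]: "plane_height \<in> borel_measurable borel"
  unfolding plane_height_def[abs_def] slope_def Let_def borel_prod[symmetric] by measurable

text \<open>The foot of the perpendicular from the origin to the hyperplane of signed height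
  \<open>h\<close> is \<open>(h / \<sigma>)\<close> times the vector \<open>(- x, 1)\<close>.
  Centred at this foot, the section is a copy, scaled by \<open>r\<close>, of the parallel central
  section, and Pythagoras splits the squared norm.\<close>

lemma beta_weight_scale:
  fixes p x :: "real^3" and h r :: real
  assumes k: "k \<ge> 1" and r: "r > 0"
  defines "\<sigma> \<equiv> sqrt (1 + (norm x)\<^sup>2)"
  defines "q \<equiv> - (h / \<sigma>) *\<^sub>R x + r *\<^sub>R p"
  shows "(norm (q, x \<bullet> q + \<sigma> * h))\<^sup>2 = h\<^sup>2 + r\<^sup>2 * (norm (p, x \<bullet> p))\<^sup>2"
    "r\<^sup>2 = 1 - h\<^sup>2 \<Longrightarrow> beta_weight k (q, x \<bullet> q + \<sigma> * h) = (1 - h\<^sup>2) powr (1 / k - 1) * beta_weight k (p, x \<bullet> p)"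
proof -
  have \<sigma>: "\<sigma> > 0" "\<sigma>\<^sup>2 = 1 + x \<bullet> x" unfolding \<sigma>_def by (simp_all add: add_pos_nonneg power2_norm_eq_inner)
  have 1: "x \<bullet> q + \<sigma> * h = h / \<sigma> + r * (x \<bullet> p)"
  proof -
    have "x \<bullet> q = - (h / \<sigma>) * (x \<bullet> x) + r * (x \<bullet> p)" by (simp add: q_def inner_add_right inner_diff_right)
    then have "x \<bullet> q + \<sigma> * h = (h * (\<sigma>\<^sup>2 - x \<bullet> x)) / \<sigma> + r * (x \<bullet> p)"
      using \<sigma>(1) by (simp add: field_simps power2_eq_square)
    then show ?thesis using \<sigma>(2) by simp
  qed
  have 2: "q \<bullet> q = (h / \<sigma>)\<^sup>2 * (x \<bullet> x) - 2 * (h / \<sigma>) * r * (x \<bullet> p) + r\<^sup>2 * (p \<bullet> p)"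
    by (simp add: q_def inner_add_left inner_add_right inner_minus_left inner_minus_right inner_commute power2_eq_square algebra_simps)
  have "(norm (q, x \<bullet> q + \<sigma> * h))\<^sup>2 = q \<bullet> q + (x \<bullet> q + \<sigma> * h)\<^sup>2"
    by (simp add: norm_Pair power2_norm_eq_inner)
  also have "\<dots> = (h / \<sigma>)\<^sup>2 * (1 + x \<bullet> x) + r\<^sup>2 * (p \<bullet> p + (x \<bullet> p)\<^sup>2)"
    unfolding 1 2 by (simp add: power2_eq_square algebra_simps add_divide_distrib)
  also have "(h / \<sigma>)\<^sup>2 * (1 + x \<bullet> x) = h\<^sup>2"
  proof -
    have "1 + x \<bullet> x \<noteq> 0" using inner_ge_zero[of x] by linarith
    then show ?thesis using \<sigma> by (simp add: power_divide)
  qed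
  also have "p \<bullet> p + (x \<bullet> p)\<^sup>2 = (norm (p, x \<bullet> p))\<^sup>2"
    by (simp add: norm_Pair power2_norm_eq_inner)
  finally show N: "(norm (q, x \<bullet> q + \<sigma> * h))\<^sup>2 = h\<^sup>2 + r\<^sup>2 * (norm (p, x \<bullet> p))\<^sup>2" .
  assume rh: "r\<^sup>2 = 1 - h\<^sup>2"
  have lt: "norm z < 1 \<longleftrightarrow> (norm z)\<^sup>2 < 1" for z :: pt
    using abs_square_less_1[of "norm z"] by simp
  have N': "1 - (norm (q, x \<bullet> q + \<sigma> * h))\<^sup>2 = (1 - h\<^sup>2) * (1 - (norm (p, x \<bullet> p))\<^sup>2)"
    unfolding N by (simp add: algebra_simps rh flip: rh)
  have pos: "1 - h\<^sup>2 > 0" using r rh by (metis zero_less_power)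
  have "(norm (q, x \<bullet> q + \<sigma> * h))\<^sup>2 < 1 \<longleftrightarrow> (norm (p, x \<bullet> p))\<^sup>2 < 1"
    using N' pos by (metis diff_gt_0_iff_gt zero_less_mult_pos zero_less_mult_pos2 mult_pos_pos)
  then show "beta_weight k (q, x \<bullet> q + \<sigma> * h) = (1 - h\<^sup>2) powr (1 / k - 1) * beta_weight k (p, x \<bullet> p)"
    unfolding beta_weight_def lt N' using pos by (auto simp: powr_mult)
qed

lemma vol3_scale: "vol3 (y + r *\<^sub>R p1) (y + r *\<^sub>R p2) (y + r *\<^sub>R p3) (y + r *\<^sub>R p4) = r ^ 3 * vol3 p1 p2 p3 p4"
proof -
  have "(y + r *\<^sub>R a) - (y + r *\<^sub>R b) = r *\<^sub>R (a - b)" for a b by (simp add: scaleR_diff_right)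
  then show ?thesis by (simp add: vol3_def cross_mult_left cross_mult_right power3_eq_cube)
qed

text \<open>An unnormalized density of the pair of slope \<open>x\<close> and intercept
  \<open>s\<close>: what remains of the four weights after the positions within the hyperplane are
  integrated out against the Jacobian.\<close>

definition plane_density :: "nat \<Rightarrow> real^3 \<Rightarrow> real \<Rightarrow> ennreal" where
  "plane_density k x s = nn_integral4 lborel (\<lambda>p1 p2 p3 p4. ennreal \<bar>vol3 p1 p2 p3 p4\<bar> *
     (ennreal (beta_weight k (p1, x \<bullet> p1 + s)) * (ennreal (beta_weight k (p2, x \<bullet> p2 + s)) *
     (ennreal (beta_weight k (p3, x \<bullet> p3 + s)) * ennreal (beta_weight k (p4, x \<bullet> p4 + s))))))"

definition ball_power :: "real \<Rightarrow> real \<Rightarrow> real" where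
  "ball_power e h = (if \<bar>h\<bar> < 1 then (1 - h\<^sup>2) powr e else 0)"

lemma measurable_ball_power [measurable]: "ball_power e \<in> borel_measurable borel"
  unfolding ball_power_def[abs_def] by measurable

text \<open>
  The exponent collects \<open>3\<close> powers of \<open>r = sqrt (1 - h\<^sup>2)\<close> from each of the four volume elements, \<open>3\<close> from
  the volume of the simplex and \<open>2 * (1 / k - 1)\<close> from each of the four weights.
\<close>

lemma plane_density_scale:
  assumes k: "k \<ge> 1"
  shows "plane_density k x (sqrt (1 + (norm x)\<^sup>2) * h) = ennreal (ball_power (7 / 2 + 4 / k) h) * plane_density k x 0"
proof (cases "\<bar>h\<bar> < 1")
  case True
  define r where "r = sqrt (1 - h\<^sup>2)"
  have hp: "1 - h\<^sup>2 > 0" using True by (simp add: abs_square_less_1)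
  then have r: "r > 0" "r\<^sup>2 = 1 - h\<^sup>2" unfolding r_def by simp_all
  let ?\<sigma> = "sqrt (1 + (norm x)\<^sup>2)"
  let ?T = "\<lambda>p. - (h / ?\<sigma>) *\<^sub>R x + r *\<^sub>R p"
  let ?c = "(1 - h\<^sup>2) powr (1 / k - 1)"
  let ?w = "\<lambda>p. ennreal (beta_weight k (p, x \<bullet> p + 0))"
  let ?v = "\<lambda>p. ennreal (beta_weight k (p, x \<bullet> p + ?\<sigma> * h))"
  let ?r3 = "ennreal (r ^ 3)"
  have w: "?v (?T p) = ennreal ?c * ?w p" for p
    using beta_weight_scale(2)[OF k r(1) r(2), of x p] by (simp add: ennreal_mult' )
  have [measurable]: "(\<lambda>p. (f p, g p)) \<in> borel_measurable M" if "f \<in> borel_measurable M" "g \<in> borel_measurable M" for f :: "'z \<Rightarrow> real^3" and g :: "'z \<Rightarrow> real" and M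
    using that by (rule borel_measurable_Pair)
  let ?I = "\<lambda>p1 p2 p3 p4. ennreal \<bar>vol3 p1 p2 p3 p4\<bar> * (?v p1 * (?v p2 * (?v p3 * ?v p4)))"
  let ?J = "\<lambda>p1 p2 p3 p4. ennreal \<bar>vol3 p1 p2 p3 p4\<bar> * (?w p1 * (?w p2 * (?w p3 * ?w p4)))"
  have sub: "(\<integral>\<^sup>+p. f p \<partial>lborel) = ?r3 * (\<integral>\<^sup>+p. f (?T p) \<partial>lborel)" if "f \<in> borel_measurable borel" for f :: "real^3 \<Rightarrow> ennreal"
    using nn_integral_lborel_affine[OF that r(1), of "- (h / ?\<sigma>) *\<^sub>R x"] by simp
  have "plane_density k x (?\<sigma> * h) = (\<integral>\<^sup>+p1. \<integral>\<^sup>+p2. \<integral>\<^sup>+p3. ?r3 * (\<integral>\<^sup>+p4. ?I p1 p2 p3 (?T p4) \<partial>lborel) \<partial>lborel \<partial>lborel \<partial>lborel)"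
    unfolding plane_density_def by (intro nn_integral_cong sub) measurable
  also have "\<dots> = (\<integral>\<^sup>+p1. \<integral>\<^sup>+p2. ?r3 * (\<integral>\<^sup>+p3. ?r3 * (\<integral>\<^sup>+p4. ?I p1 p2 (?T p3) (?T p4) \<partial>lborel) \<partial>lborel) \<partial>lborel \<partial>lborel)"
    by (intro nn_integral_cong sub) measurable
  also have "\<dots> = (\<integral>\<^sup>+p1. ?r3 * (\<integral>\<^sup>+p2. ?r3 * (\<integral>\<^sup>+p3. ?r3 * (\<integral>\<^sup>+p4. ?I p1 (?T p2) (?T p3) (?T p4) \<partial>lborel) \<partial>lborel) \<partial>lborel) \<partial>lborel)"
    by (intro nn_integral_cong sub) measurable
  also have "\<dots> = ?r3 * (\<integral>\<^sup>+p1. ?r3 * (\<integral>\<^sup>+p2. ?r3 * (\<integral>\<^sup>+p3. ?r3 * (\<integral>\<^sup>+p4. ?I (?T p1) (?T p2) (?T p3) (?T p4) \<partial>lborel) \<partial>lborel) \<partial>lborel) \<partial>lborel)"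
    by (intro sub) measurable
  also have "\<dots> = ?r3 * (\<integral>\<^sup>+p1. ?r3 * (\<integral>\<^sup>+p2. ?r3 * (\<integral>\<^sup>+p3. ?r3 * (\<integral>\<^sup>+p4. (?r3 * ennreal ?c ^ 4) * ?J p1 p2 p3 p4 \<partial>lborel) \<partial>lborel) \<partial>lborel) \<partial>lborel)"
  proof -
    have "?I (?T p1) (?T p2) (?T p3) (?T p4) = (?r3 * ennreal ?c ^ 4) * ?J p1 p2 p3 p4" for p1 p2 p3 p4
    proof -
      have "ennreal \<bar>vol3 (?T p1) (?T p2) (?T p3) (?T p4)\<bar> = ?r3 * ennreal \<bar>vol3 p1 p2 p3 p4\<bar>"
        using r(1) unfolding vol3_scale by (simp add: abs_mult ennreal_mult')
      then show ?thesis unfolding w by (simp add: power4_eq_xxxx mult_ac)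
    qed
    then show ?thesis by (simp only:)
  qed
  also have "\<dots> = (?r3 ^ 4 * (?r3 * ennreal ?c ^ 4)) * nn_integral4 lborel ?J"
  proof -
    have "(\<integral>\<^sup>+p4. K * ?J p1 p2 p3 p4 \<partial>lborel) = K * (\<integral>\<^sup>+p4. ?J p1 p2 p3 p4 \<partial>lborel)" for K p1 p2 p3
      by (rule nn_integral_cmult) measurable
    moreover have "(\<integral>\<^sup>+p3. K * (\<integral>\<^sup>+p4. ?J p1 p2 p3 p4 \<partial>lborel) \<partial>lborel) = K * (\<integral>\<^sup>+p3. \<integral>\<^sup>+p4. ?J p1 p2 p3 p4 \<partial>lborel \<partial>lborel)" for K p1 p2
      by (rule nn_integral_cmult) measurable
    moreover have "(\<integral>\<^sup>+p2. K * (\<integral>\<^sup>+p3. \<integral>\<^sup>+p4. ?J p1 p2 p3 p4 \<partial>lborel \<partial>lborel) \<partial>lborel) = K * (\<integral>\<^sup>+p2. \<integral>\<^sup>+p3. \<integral>\<^sup>+p4. ?J p1 p2 p3 p4 \<partial>lborel \<partial>lborel \<partial>lborel)" for K p1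
      by (rule nn_integral_cmult) measurable
    moreover have "(\<integral>\<^sup>+p1. K * (\<integral>\<^sup>+p2. \<integral>\<^sup>+p3. \<integral>\<^sup>+p4. ?J p1 p2 p3 p4 \<partial>lborel \<partial>lborel \<partial>lborel) \<partial>lborel) = K * nn_integral4 lborel ?J" for K
      by (rule nn_integral_cmult) measurable
    ultimately show ?thesis by (simp only: mult.assoc[symmetric] power4_eq_xxxx)
  qed
  also have "?r3 ^ 4 * (?r3 * ennreal ?c ^ 4) = ennreal (ball_power (7 / 2 + 4 / k) h)"
  proof -
    have "r = (1 - h\<^sup>2) powr (1 / 2)" using hp by (simp add: r_def powr_half_sqrt)
    then have "r ^ 3 = (1 - h\<^sup>2) powr (3 / 2)" using hp by (simp add: powr_power)
    moreover from this have "(r ^ 3) ^ 4 = (1 - h\<^sup>2) powr 6" using hp by (simp add: powr_power)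
    moreover have "?c ^ 4 = (1 - h\<^sup>2) powr (4 * (1 / k - 1))" using hp by (simp add: powr_power mult.commute)
    ultimately have "(r ^ 3) ^ 4 * (r ^ 3 * ?c ^ 4) = (1 - h\<^sup>2) powr (6 + (3 / 2 + 4 * (1 / k - 1)))"
      by (simp only: powr_add)
    also have "6 + (3 / 2 + 4 * (1 / k - 1)) = 7 / 2 + 4 / real k" by (simp add: algebra_simps)
    finally have "(r ^ 3) ^ 4 * (r ^ 3 * ?c ^ 4) = (1 - h\<^sup>2) powr (7 / 2 + 4 / k)" .
    then show ?thesis using r(1) True
      by (simp add: ball_power_def ennreal_power ennreal_mult'[symmetric])
  qed
  also have "nn_integral4 lborel ?J = plane_density k x 0"
    by (simp only: plane_density_def)
  finally show ?thesis .
next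
  case False
  \<comment> \<open>The hyperplane has distance at least 1 from the origin and so misses the open
    unit ball. With scale 1, the shifted point \<open>?q\<close> makes the substitution of
    \<open>beta_weight_scale\<close> return \<open>p\<close>.\<close>
  have "beta_weight k (p, x \<bullet> p + sqrt (1 + (norm x)\<^sup>2) * h) = 0" for p
  proof -
    let ?q = "p + (h / sqrt (1 + (norm x)\<^sup>2)) *\<^sub>R x"
    have "(norm (p, x \<bullet> p + sqrt (1 + (norm x)\<^sup>2) * h))\<^sup>2 = h\<^sup>2 + (norm (?q, x \<bullet> ?q))\<^sup>2"
      using beta_weight_scale(1)[OF k zero_less_one, of h x ?q] by simp
    moreover have "h\<^sup>2 \<ge> 1" using False abs_square_less_1[of h] by simp
    ultimately have "(norm (p, x \<bullet> p + sqrt (1 + (norm x)\<^sup>2) * h))\<^sup>2 \<ge> 1" by (metis add_increasing2 zero_le_power2)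
    then have "\<not> norm (p, x \<bullet> p + sqrt (1 + (norm x)\<^sup>2) * h) < 1"
      using abs_square_less_1[of "norm (p, x \<bullet> p + sqrt (1 + (norm x)\<^sup>2) * h)"] by simp
    then show ?thesis by (simp add: beta_weight_def)
  qed
  then show ?thesis using False by (simp add: plane_density_def ball_power_def)
qed

lemma nn_integral_swap_pt:
  fixes H :: "real^3 \<Rightarrow> real^3 \<Rightarrow> real^3 \<Rightarrow> real^3 \<Rightarrow> pt \<Rightarrow> ennreal"
  assumes H: "(\<lambda>(p1, p2, p3, p4, z). H p1 p2 p3 p4 z) \<in> borel_measurable (borel \<Otimes>\<^sub>M (borel \<Otimes>\<^sub>M (borel \<Otimes>\<^sub>M (borel \<Otimes>\<^sub>M borel))))"
  shows "nn_integral4 lborel (\<lambda>p1 p2 p3 p4. \<integral>\<^sup>+z. H p1 p2 p3 p4 z \<partial>lborel)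
    = (\<integral>\<^sup>+z. nn_integral4 lborel (\<lambda>p1 p2 p3 p4. H p1 p2 p3 p4 z) \<partial>lborel)"
proof -
  have Hm[measurable (raw)]: "(\<lambda>x. H (a x) (b x) (c x) (d x) (e x)) \<in> borel_measurable M"
    if "a \<in> borel_measurable M" "b \<in> borel_measurable M" "c \<in> borel_measurable M" "d \<in> borel_measurable M" "e \<in> borel_measurable M"
    for M :: "'z measure" and a b c d e
  proof -
    have "(\<lambda>x. (a x, b x, c x, d x, e x)) \<in> M \<rightarrow>\<^sub>M borel \<Otimes>\<^sub>M (borel \<Otimes>\<^sub>M (borel \<Otimes>\<^sub>M (borel \<Otimes>\<^sub>M borel)))" using that by measurable
    from measurable_compose[OF this H] show ?thesis by simp
  qed
  have "nn_integral4 lborel (\<lambda>p1 p2 p3 p4. \<integral>\<^sup>+z. H p1 p2 p3 p4 z \<partial>lborel)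
    = (\<integral>\<^sup>+p1. \<integral>\<^sup>+p2. \<integral>\<^sup>+p3. \<integral>\<^sup>+z. \<integral>\<^sup>+p4. H p1 p2 p3 p4 z \<partial>lborel \<partial>lborel \<partial>lborel \<partial>lborel \<partial>lborel)"
    by (intro nn_integral_cong lborel_pair.Fubini') measurable
  also have "\<dots> = (\<integral>\<^sup>+p1. \<integral>\<^sup>+p2. \<integral>\<^sup>+z. \<integral>\<^sup>+p3. \<integral>\<^sup>+p4. H p1 p2 p3 p4 z \<partial>lborel \<partial>lborel \<partial>lborel \<partial>lborel \<partial>lborel)"
    by (intro nn_integral_cong lborel_pair.Fubini') measurable
  also have "\<dots> = (\<integral>\<^sup>+p1. \<integral>\<^sup>+z. \<integral>\<^sup>+p2. \<integral>\<^sup>+p3. \<integral>\<^sup>+p4. H p1 p2 p3 p4 z \<partial>lborel \<partial>lborel \<partial>lborel \<partial>lborel \<partial>lborel)"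
    by (intro nn_integral_cong lborel_pair.Fubini') measurable
  also have "\<dots> = (\<integral>\<^sup>+z. nn_integral4 lborel (\<lambda>p1 p2 p3 p4. H p1 p2 p3 p4 z) \<partial>lborel)"
    by (intro lborel_pair.Fubini') measurable
  finally show ?thesis .
qed

definition weight4 :: "nat \<Rightarrow> pt \<Rightarrow> pt \<Rightarrow> pt \<Rightarrow> pt \<Rightarrow> ennreal" where
  "weight4 k y1 y2 y3 y4 = ennreal (beta_weight k y1) * (ennreal (beta_weight k y2) * (ennreal (beta_weight k y3) * ennreal (beta_weight k y4)))"

lemma measurable_weight4 [measurable (raw)]:
  assumes [measurable]: "a \<in> borel_measurable M" "b \<in> borel_measurable M" "c \<in> borel_measurable M" "d \<in> borel_measurable M"
  shows "(\<lambda>x. weight4 k (a x) (b x) (c x) (d x)) \<in> borel_measurable M"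
  unfolding weight4_def by measurable

lemma beta4_weight4:
  assumes f: "f \<in> borel_measurable borel"
  shows "beta4 k f = nn_integral4 lborel (\<lambda>y1 y2 y3 y4. weight4 k y1 y2 y3 y4 * f (y1, y2, y3, y4))"
proof -
  have fm[measurable (raw)]: "(\<lambda>x. f (a x, b x, c x, d x)) \<in> borel_measurable M"
    if "a \<in> borel_measurable M" "b \<in> borel_measurable M" "c \<in> borel_measurable M" "d \<in> borel_measurable M"
    for M :: "'z measure" and a b c d
    by (rule measurable_compose[OF _ f]) (intro borel_measurable_Pair that)
  let ?w = "\<lambda>y :: pt. ennreal (beta_weight k y)"
  have "beta4 k f = (\<integral>\<^sup>+y1. ?w y1 * (\<integral>\<^sup>+y2. ?w y2 * (\<integral>\<^sup>+y3. \<integral>\<^sup>+y4. ?w y3 * (?w y4 * f (y1, y2, y3, y4)) \<partial>lborel \<partial>lborel) \<partial>lborel) \<partial>lborel)"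
    unfolding beta4_def by (simp add: nn_integral_cmult)
  also have "\<dots> = (\<integral>\<^sup>+y1. ?w y1 * (\<integral>\<^sup>+y2. \<integral>\<^sup>+y3. \<integral>\<^sup>+y4. ?w y2 * (?w y3 * (?w y4 * f (y1, y2, y3, y4))) \<partial>lborel \<partial>lborel \<partial>lborel) \<partial>lborel)"
    by (simp add: nn_integral_cmult)
  also have "\<dots> = nn_integral4 lborel (\<lambda>y1 y2 y3 y4. ?w y1 * (?w y2 * (?w y3 * (?w y4 * f (y1, y2, y3, y4)))))"
    by (simp add: nn_integral_cmult)
  finally show ?thesis by (simp add: weight4_def mult.assoc)
qed

text \<open>Collects everything that does not depend on the height. It is never computed, since it
  cancels in \<open>law_from_limits\<close>.\<close>

definition plane_const :: "nat \<Rightarrow> ennreal" where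
  "plane_const k = (\<integral>\<^sup>+x. ennreal (sqrt (1 + (norm x)\<^sup>2)) * plane_density k x 0 \<partial>lborel)"

lemma measurable_plane_density [measurable]:
  "(\<lambda>(x, s). plane_density k x s) \<in> borel_measurable (borel \<Otimes>\<^sub>M borel)"
  unfolding plane_density_def by measurable

text \<open>After the substitution the test function depends on slope and intercept only. By
  \<open>plane_density_scale\<close> the height enters through a factor that is the same for all
  slopes, hence the integrals over slope and height separate.\<close>

lemma beta4_plane_height:
  assumes k: "k \<ge> 1" and \<phi>[measurable]: "\<phi> \<in> borel_measurable borel"
  shows "beta4 k (\<lambda>y. \<phi> (plane_height y)) = plane_const k * (\<integral>\<^sup>+h. \<phi> h * ennreal (ball_power (7 / 2 + 4 / k) h) \<partial>lborel)"
proof -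
  let ?\<sigma> = "\<lambda>x :: real^3. sqrt (1 + (norm x)\<^sup>2)"
  let ?G = "\<lambda>y1 y2 y3 y4. weight4 k y1 y2 y3 y4 * \<phi> (plane_height (y1, y2, y3, y4))"
  let ?D = "\<lambda>p1 p2 p3 p4. ennreal \<bar>vol3 p1 p2 p3 p4\<bar>"
  let ?W = "\<lambda>p1 p2 p3 p4 x s. weight4 k (p1, x \<bullet> p1 + s) (p2, x \<bullet> p2 + s) (p3, x \<bullet> p3 + s) (p4, x \<bullet> p4 + s)"
  have \<sigma>: "?\<sigma> x > 0" for x by (simp add: add_pos_nonneg)
  have "beta4 k (\<lambda>y. \<phi> (plane_height y)) = nn_integral4 lborel ?G"
    by (rule beta4_weight4) measurable
  also have "\<dots> = nn_integral4 lborel (\<lambda>p1 p2 p3 p4. nn_integral4 lborel (\<lambda>t1 t2 t3 t4. ?G (p1, t1) (p2, t2) (p3, t3) (p4, t4)))"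
    by (rule nn_integral_split4) measurable
  also have "\<dots> = nn_integral4 lborel (\<lambda>p1 p2 p3 p4. \<integral>\<^sup>+z. ?D p1 p2 p3 p4 * (?W p1 p2 p3 p4 (fst z) (snd z) * \<phi> (snd z / ?\<sigma> (fst z))) \<partial>lborel)"
  proof -
    have main: "nn_integral4 lborel (\<lambda>t1 t2 t3 t4. ?G (p1, t1) (p2, t2) (p3, t3) (p4, t4))
      = (\<integral>\<^sup>+z. ?D p1 p2 p3 p4 * (?W p1 p2 p3 p4 (fst z) (snd z) * \<phi> (snd z / ?\<sigma> (fst z))) \<partial>lborel)"
      if v: "vol3 p1 p2 p3 p4 \<noteq> 0" for p1 p2 p3 p4
    proof -
      have "nn_integral4 lborel (\<lambda>t1 t2 t3 t4. ?G (p1, t1) (p2, t2) (p3, t3) (p4, t4))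
        = ?D p1 p2 p3 p4 * (\<integral>\<^sup>+x. \<integral>\<^sup>+s. ?G (p1, x \<bullet> p1 + s) (p2, x \<bullet> p2 + s) (p3, x \<bullet> p3 + s) (p4, x \<bullet> p4 + s) \<partial>lborel \<partial>lborel)"
        by (rule nn_integral_graph_hyperplane[OF _ v]) measurable
      also have "\<dots> = ?D p1 p2 p3 p4 * (\<integral>\<^sup>+x. \<integral>\<^sup>+s. ?W p1 p2 p3 p4 x s * \<phi> (s / ?\<sigma> x) \<partial>lborel \<partial>lborel)"
        by (simp only: plane_height_eq[OF v])
      also have "(\<integral>\<^sup>+x. \<integral>\<^sup>+s. ?W p1 p2 p3 p4 x s * \<phi> (s / ?\<sigma> x) \<partial>lborel \<partial>lborel) = (\<integral>\<^sup>+z. ?W p1 p2 p3 p4 (fst z) (snd z) * \<phi> (snd z / ?\<sigma> (fst z)) \<partial>lborel)"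
        by (subst nn_integral_lborel_pair) (simp_all add: borel_prod[symmetric])
      also have "?D p1 p2 p3 p4 * \<dots> = (\<integral>\<^sup>+z. ?D p1 p2 p3 p4 * (?W p1 p2 p3 p4 (fst z) (snd z) * \<phi> (snd z / ?\<sigma> (fst z))) \<partial>lborel)"
        by (rule nn_integral_cmult[symmetric]) (simp add: borel_prod[symmetric])
      finally show ?thesis .
    qed
    show ?thesis
      by (rule nn_integral4_cong_AE) (use AE_vol3 main in \<open>auto elim!: eventually_mono\<close>)
  qed
  also have "\<dots> = (\<integral>\<^sup>+z. nn_integral4 lborel (\<lambda>p1 p2 p3 p4. ?D p1 p2 p3 p4 * (?W p1 p2 p3 p4 (fst z) (snd z) * \<phi> (snd z / ?\<sigma> (fst z)))) \<partial>lborel)"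
    by (rule nn_integral_swap_pt) (simp add: borel_prod[symmetric])
  also have "\<dots> = (\<integral>\<^sup>+z. \<phi> (snd z / ?\<sigma> (fst z)) * plane_density k (fst z) (snd z) \<partial>lborel)"
  proof (rule nn_integral_cong)
    fix z :: pt
    let ?J = "\<lambda>p1 p2 p3 p4. ?D p1 p2 p3 p4 * ?W p1 p2 p3 p4 (fst z) (snd z)" and ?K = "\<phi> (snd z / ?\<sigma> (fst z))"
    have "(\<integral>\<^sup>+p4. ?K * ?J p1 p2 p3 p4 \<partial>lborel) = ?K * (\<integral>\<^sup>+p4. ?J p1 p2 p3 p4 \<partial>lborel)" for p1 p2 p3
      by (rule nn_integral_cmult) measurable
    moreover have "(\<integral>\<^sup>+p3. ?K * (\<integral>\<^sup>+p4. ?J p1 p2 p3 p4 \<partial>lborel) \<partial>lborel) = ?K * (\<integral>\<^sup>+p3. \<integral>\<^sup>+p4. ?J p1 p2 p3 p4 \<partial>lborel \<partial>lborel)" for p1 p2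
      by (rule nn_integral_cmult) measurable
    moreover have "(\<integral>\<^sup>+p2. ?K * (\<integral>\<^sup>+p3. \<integral>\<^sup>+p4. ?J p1 p2 p3 p4 \<partial>lborel \<partial>lborel) \<partial>lborel) = ?K * (\<integral>\<^sup>+p2. \<integral>\<^sup>+p3. \<integral>\<^sup>+p4. ?J p1 p2 p3 p4 \<partial>lborel \<partial>lborel \<partial>lborel)" for p1
      by (rule nn_integral_cmult) measurable
    moreover have "(\<integral>\<^sup>+p1. ?K * (\<integral>\<^sup>+p2. \<integral>\<^sup>+p3. \<integral>\<^sup>+p4. ?J p1 p2 p3 p4 \<partial>lborel \<partial>lborel \<partial>lborel) \<partial>lborel) = ?K * nn_integral4 lborel ?J"
      by (rule nn_integral_cmult) measurable
    moreover have "?D p1 p2 p3 p4 * (?W p1 p2 p3 p4 (fst z) (snd z) * ?K) = ?K * ?J p1 p2 p3 p4" for p1 p2 p3 p4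
      by (simp only: mult_ac)
    ultimately show "nn_integral4 lborel (\<lambda>p1 p2 p3 p4. ?D p1 p2 p3 p4 * (?W p1 p2 p3 p4 (fst z) (snd z) * ?K))
      = ?K * plane_density k (fst z) (snd z)"
      by (simp only: plane_density_def weight4_def)
  qed
  also have "\<dots> = (\<integral>\<^sup>+x. \<integral>\<^sup>+s. \<phi> (s / ?\<sigma> x) * plane_density k x s \<partial>lborel \<partial>lborel)"
    by (subst nn_integral_lborel_pair) (simp_all add: borel_prod[symmetric])
  also have "\<dots> = (\<integral>\<^sup>+x. ennreal (?\<sigma> x) * (\<integral>\<^sup>+h. \<phi> h * (ennreal (ball_power (7 / 2 + 4 / k) h) * plane_density k x 0) \<partial>lborel) \<partial>lborel)"
  proof (rule nn_integral_cong)
    fix x :: "real^3"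
    \<comment> \<open>The intercept is replaced by the height, \<open>s = ?\<sigma> x * h\<close>;
      the resulting factor \<open>?\<sigma> x\<close> ends up in \<open>plane_const\<close>.\<close>
    have "(\<integral>\<^sup>+s. \<phi> (s / ?\<sigma> x) * plane_density k x s \<partial>lborel) = ennreal \<bar>?\<sigma> x\<bar> * (\<integral>\<^sup>+h. \<phi> ((0 + ?\<sigma> x * h) / ?\<sigma> x) * plane_density k x (0 + ?\<sigma> x * h) \<partial>lborel)"
      using \<sigma>[of x] by (intro nn_integral_real_affine) auto
    also have "\<dots> = ennreal (?\<sigma> x) * (\<integral>\<^sup>+h. \<phi> h * plane_density k x (?\<sigma> x * h) \<partial>lborel)"
      using \<sigma>[of x] by (simp add: abs_of_pos)
    finally show "(\<integral>\<^sup>+s. \<phi> (s / ?\<sigma> x) * plane_density k x s \<partial>lborel) = ennreal (?\<sigma> x) * (\<integral>\<^sup>+h. \<phi> h * (ennreal (ball_power (7 / 2 + 4 / k) h) * plane_density k x 0) \<partial>lborel)"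
      by (simp only: plane_density_scale[OF k])
  qed
  also have "\<dots> = (\<integral>\<^sup>+x. (ennreal (?\<sigma> x) * plane_density k x 0) * (\<integral>\<^sup>+h. \<phi> h * ennreal (ball_power (7 / 2 + 4 / k) h) \<partial>lborel) \<partial>lborel)"
  proof (rule nn_integral_cong)
    fix x :: "real^3"
    have "(\<integral>\<^sup>+h. (\<phi> h * ennreal (ball_power (7 / 2 + 4 / k) h)) * plane_density k x 0 \<partial>lborel) = (\<integral>\<^sup>+h. \<phi> h * ennreal (ball_power (7 / 2 + 4 / k) h) \<partial>lborel) * plane_density k x 0"
      by (rule nn_integral_multc) measurable
    then show "ennreal (?\<sigma> x) * (\<integral>\<^sup>+h. \<phi> h * (ennreal (ball_power (7 / 2 + 4 / k) h) * plane_density k x 0) \<partial>lborel)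
      = (ennreal (?\<sigma> x) * plane_density k x 0) * (\<integral>\<^sup>+h. \<phi> h * ennreal (ball_power (7 / 2 + 4 / k) h) \<partial>lborel)"
      by (simp only: mult.assoc) (simp only: mult.commute)
  qed
  also have "\<dots> = plane_const k * (\<integral>\<^sup>+h. \<phi> h * ennreal (ball_power (7 / 2 + 4 / k) h) \<partial>lborel)"
    unfolding plane_const_def by (rule nn_integral_multc) measurable
  finally show ?thesis .
qed

lemma ball_power_le1: "e \<ge> 0 \<Longrightarrow> 0 \<le> ball_power e h" "e \<ge> 0 \<Longrightarrow> ball_power e h \<le> indicator {-1..1} h"
proof -
  assume e: "e \<ge> 0"
  show "0 \<le> ball_power e h" by (simp add: ball_power_def)
  have "(1 - h\<^sup>2) powr e \<le> 1" if "\<bar>h\<bar> < 1"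
  proof -
    have "(1 - h\<^sup>2) powr e \<le> 1 powr e" using that e by (intro powr_mono2) (auto simp: abs_square_less_1 less_imp_le)
    then show ?thesis by simp
  qed
  then show "ball_power e h \<le> indicator {-1..1} h" by (auto simp: ball_power_def split: split_indicator)
qed

definition power_integral :: "real \<Rightarrow> (real \<Rightarrow> real) \<Rightarrow> ennreal" where
  "power_integral e \<phi> = (\<integral>\<^sup>+h. ennreal (\<phi> h) * ennreal (ball_power e h) \<partial>lborel)"

lemma power_integral_bound:
  assumes "e \<ge> 0" "\<And>h. \<phi> h \<le> 1"
  shows "power_integral e \<phi> \<le> 2"
proof -
  have "power_integral e \<phi> \<le> (\<integral>\<^sup>+h. indicator {-1..1} h \<partial>(lborel :: real measure))"
    unfolding power_integral_def
  proof (rule nn_integral_mono)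
    fix h
    have "ennreal (\<phi> h) * ennreal (ball_power e h) \<le> ennreal 1 * ennreal (indicator {-1..1} h)"
      using ball_power_le1[OF assms(1)] assms(2) by (intro mult_mono ennreal_leI) auto
    then show "ennreal (\<phi> h) * ennreal (ball_power e h) \<le> indicator {-1..1} h" by (simp add: ennreal_indicator)
  qed
  also have "\<dots> = 2" by simp
  finally show ?thesis .
qed

lemma power_integral_tendsto:
  assumes [measurable]: "\<phi> \<in> borel_measurable borel" and \<phi>: "\<And>h. 0 \<le> \<phi> h" "\<And>h. \<phi> h \<le> 1"
    and e: "e \<ge> 0" and c: "c \<ge> 0"
  shows "(\<lambda>k. power_integral (e + c / real (Suc k)) \<phi>) \<longlonglongrightarrow> power_integral e \<phi>"
  unfolding power_integral_def
proof (rule nn_integral_dominated_convergence[where w = "indicator {-1..1}"])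
  show "AE x in lborel. ennreal (\<phi> x) * ennreal (ball_power (e + c / real (Suc j)) x) \<le> indicator {- 1..1} x" for j
  proof (rule AE_I2)
    fix h
    have "ennreal (\<phi> h) * ennreal (ball_power (e + c / real (Suc j)) h) \<le> ennreal 1 * ennreal (indicator {-1..1} h)"
      using ball_power_le1[of "e + c / real (Suc j)" h] e c \<phi>(2) by (intro mult_mono ennreal_leI) auto
    then show "ennreal (\<phi> h) * ennreal (ball_power (e + c / real (Suc j)) h) \<le> indicator {-1..1} h" by (simp add: ennreal_indicator)
  qed
  show "AE x in lborel. (\<lambda>k. ennreal (\<phi> x) * ennreal (ball_power (e + c / real (Suc k)) x)) \<longlonglongrightarrow> ennreal (\<phi> x) * ennreal (ball_power e x)"
  proof (rule AE_I2)
    fix h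
    have "(\<lambda>k. ball_power (e + c / real (Suc k)) h) \<longlonglongrightarrow> ball_power e h"
    proof (cases "\<bar>h\<bar> < 1")
      case True
      then have pos: "1 - h\<^sup>2 > 0" by (simp add: abs_square_less_1)
      have "(\<lambda>k. c / real (Suc k)) \<longlonglongrightarrow> 0"
        using LIMSEQ_Suc[OF lim_const_over_n[of c]] by simp
      then have "(\<lambda>k. e + c / real (Suc k)) \<longlonglongrightarrow> e + 0" by (intro tendsto_intros)
      then have "(\<lambda>k. (1 - h\<^sup>2) powr (e + c / real (Suc k))) \<longlonglongrightarrow> (1 - h\<^sup>2) powr (e + 0)"
        using pos by (intro tendsto_powr tendsto_const) auto
      then show ?thesis using True by (simp add: ball_power_def)
    qed (simp add: ball_power_def)
    then have "(\<lambda>k. ennreal (\<phi> h * ball_power (e + c / real (Suc k)) h)) \<longlonglongrightarrow> ennreal (\<phi> h * ball_power e h)"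
      by (intro tendsto_ennrealI tendsto_mult tendsto_const)
    then show "(\<lambda>k. ennreal (\<phi> h) * ennreal (ball_power (e + c / real (Suc k)) h)) \<longlonglongrightarrow> ennreal (\<phi> h) * ennreal (ball_power e h)"
      using \<phi>(1) by (simp add: ennreal_mult')
  qed
qed (auto simp: e c)

section \<open>Laws of a coordinate and of the hyperplane height\<close>

text \<open>Cross-multiplication eliminates the unknown \<open>K\<close>: the sequences
  \<open>(K I) J\<close> and \<open>(K J) I\<close> coincide, and their limits are
  \<open>V E J'\<close> and \<open>V I'\<close>. Since \<open>V\<close> is neither zero nor
  infinite, it cancels.\<close>

lemma law_from_limits:
  fixes V E :: ennreal
  assumes a: "(\<lambda>k. K k * I k) \<longlonglongrightarrow> V * E" and b: "(\<lambda>k. K k * J k) \<longlonglongrightarrow> V"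
    and I: "I \<longlonglongrightarrow> I'" and J: "J \<longlonglongrightarrow> J'"
    and fin: "V \<noteq> 0" "V \<noteq> \<top>" "E \<noteq> \<top>" "I' \<noteq> \<top>" "J' \<noteq> \<top>"
  shows "E * J' = I'"
proof -
  have "(\<lambda>k. (K k * I k) * J k) \<longlonglongrightarrow> (V * E) * J'"
    using fin by (intro tendsto_mult_ennreal a J) (auto simp: ennreal_mult_eq_top_iff)
  moreover have "(\<lambda>k. (K k * J k) * I k) \<longlonglongrightarrow> V * I'"
    using fin by (intro tendsto_mult_ennreal b I) auto
  moreover have "(K k * J k) * I k = (K k * I k) * J k" for k by (simp add: mult_ac)
  ultimately have "V * (E * J') = V * I'" by (simp add: mult.assoc LIMSEQ_unique)
  then show ?thesis using fin by (simp add: ennreal_mult_cancel_left)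
qed

lemma DIM_pt: "DIM((real^3) \<times> real) = 4"
  by simp

text \<open>The ball section at height \<open>h\<close> is scaled as for hyperplanes, here with
  slope 0. Its volume element contributes exponent 3/2 and the weight
  \<open>1/k - 1\<close>.\<close>

lemma beta_weight_last:
  assumes k: "k \<ge> 1" and \<phi>[measurable]: "\<phi> \<in> borel_measurable borel"
  shows "(\<integral>\<^sup>+y. ennreal (beta_weight k (y :: pt)) * \<phi> (snd y) \<partial>lborel)
    = (\<integral>\<^sup>+p. ennreal (beta_weight k (p :: real^3, 0 :: real)) \<partial>lborel) * (\<integral>\<^sup>+h. \<phi> h * ennreal (ball_power (1 / 2 + 1 / k) h) \<partial>lborel)"
proof -
  let ?c = "\<integral>\<^sup>+p. ennreal (beta_weight k (p :: real^3, 0 :: real)) \<partial>lborel"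
  have inner: "(\<integral>\<^sup>+p. ennreal (beta_weight k (p :: real^3, h)) \<partial>lborel) = ennreal (ball_power (1 / 2 + 1 / k) h) * ?c" for h
  proof (cases "\<bar>h\<bar> < 1")
    case True
    define r where "r = sqrt (1 - h\<^sup>2)"
    have hp: "1 - h\<^sup>2 > 0" using True by (simp add: abs_square_less_1)
    then have r: "r > 0" "r\<^sup>2 = 1 - h\<^sup>2" unfolding r_def by simp_all
    have "(\<integral>\<^sup>+p. ennreal (beta_weight k (p :: real^3, h)) \<partial>lborel) = ennreal (r ^ 3) * (\<integral>\<^sup>+p. ennreal (beta_weight k (0 + r *\<^sub>R p :: real^3, h)) \<partial>lborel)"
      using nn_integral_lborel_affine[of "\<lambda>p. ennreal (beta_weight k (p :: real^3, h))" r 0] r by simp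
    also have "\<dots> = ennreal (r ^ 3) * (\<integral>\<^sup>+p. ennreal ((1 - h\<^sup>2) powr (1 / k - 1)) * ennreal (beta_weight k (p :: real^3, 0 :: real)) \<partial>lborel)"
      using beta_weight_scale(2)[OF k r(1) r(2), of 0] by (simp add: ennreal_mult')
    also have "\<dots> = ennreal (r ^ 3) * (ennreal ((1 - h\<^sup>2) powr (1 / k - 1)) * ?c)"
      by (subst nn_integral_cmult) auto
    also have "\<dots> = ennreal (r ^ 3 * (1 - h\<^sup>2) powr (1 / k - 1)) * ?c"
      using r by (simp add: ennreal_mult' mult.assoc)
    also have "r ^ 3 * (1 - h\<^sup>2) powr (1 / k - 1) = ball_power (1 / 2 + 1 / k) h"
    proof -
      have "r = (1 - h\<^sup>2) powr (1 / 2)" using hp by (simp add: r_def powr_half_sqrt)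
      then have "r ^ 3 = (1 - h\<^sup>2) powr (3 / 2)" using hp by (simp add: powr_power)
      then have "r ^ 3 * (1 - h\<^sup>2) powr (1 / k - 1) = (1 - h\<^sup>2) powr (3 / 2 + (1 / k - 1))" by (simp only: powr_add)
      also have "3 / 2 + (1 / k - 1) = 1 / 2 + 1 / real k" by simp
      finally show ?thesis using True by (simp add: ball_power_def)
    qed
    finally show ?thesis .
  next
    case False
    have "beta_weight k (p, h) = 0" for p :: "real^3"
    proof -
      have "\<bar>h\<bar> \<le> norm (p, h)" using norm_snd_le[of h p] by simp
      then have "\<not> norm (p, h) < 1" using False by linarith
      then show ?thesis unfolding beta_weight_def by (rule if_not_P)
    qed
    then show ?thesis using False by (simp add: ball_power_def)
  qed
  have "(\<lambda>y :: pt. \<phi> (snd y)) \<in> borel_measurable borel"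
    by (rule measurable_compose[OF _ \<phi>]) (intro borel_measurable_continuous_onI continuous_intros)
  then have s: "(\<lambda>y :: pt. ennreal (beta_weight k y) * \<phi> (snd y)) \<in> borel_measurable borel"
    by (intro borel_measurable_times_ennreal[OF measurable_compose[OF measurable_beta_weight measurable_ennreal]])
  have "(\<integral>\<^sup>+y. ennreal (beta_weight k (y :: pt)) * \<phi> (snd y) \<partial>lborel) = (\<integral>\<^sup>+p. \<integral>\<^sup>+h. ennreal (beta_weight k (p :: real^3, h)) * \<phi> h \<partial>lborel \<partial>lborel)"
    using nn_integral_lborel_pair[OF s] by simp
  also have "\<dots> = (\<integral>\<^sup>+h. \<integral>\<^sup>+p. ennreal (beta_weight k (p :: real^3, h)) * \<phi> h \<partial>lborel \<partial>lborel)"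
    by (rule lborel_pair.Fubini'[symmetric]) measurable
  also have "\<dots> = (\<integral>\<^sup>+h. (\<phi> h * ennreal (ball_power (1 / 2 + 1 / k) h)) * ?c \<partial>lborel)"
  proof (rule nn_integral_cong)
    fix h
    have "(\<integral>\<^sup>+p. ennreal (beta_weight k (p :: real^3, h)) * \<phi> h \<partial>lborel) = (\<integral>\<^sup>+p. ennreal (beta_weight k (p :: real^3, h)) \<partial>lborel) * \<phi> h"
      by (rule nn_integral_multc) measurable
    then show "(\<integral>\<^sup>+p. ennreal (beta_weight k (p :: real^3, h)) * \<phi> h \<partial>lborel) = (\<phi> h * ennreal (ball_power (1 / 2 + 1 / k) h)) * ?c"
      unfolding inner[of h] by (simp only: mult.assoc mult.commute mult.left_commute)
  qed
  also have "\<dots> = (\<integral>\<^sup>+h. \<phi> h * ennreal (ball_power (1 / 2 + 1 / k) h) \<partial>lborel) * ?c"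
    by (rule nn_integral_multc) measurable
  finally show ?thesis by (simp add: mult.commute)
qed

text \<open>One coordinate of a uniform point of the sphere has density proportional to the square
  root of \<open>1 - h\<^sup>2\<close>; the normalizing integral stays on the left-hand
  side.\<close>

lemma law_last_continuous:
  fixes \<phi> :: "real \<Rightarrow> real"
  assumes cont: "continuous_on UNIV \<phi>" and \<phi>: "\<And>h. 0 \<le> \<phi> h" "\<And>h. \<phi> h \<le> 1"
  shows "(\<integral>\<^sup>+y. ennreal (\<phi> (snd (y :: pt))) \<partial>sphere_law) * power_integral (1 / 2) (\<lambda>_. 1) = power_integral (1 / 2) \<phi>"
proof -
  interpret S: prob_space "sphere_law :: pt measure" by (rule prob_space_sphere_law)
  have m[measurable]: "\<phi> \<in> borel_measurable borel" using cont by (rule borel_measurable_continuous_onI)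
  let ?V = "unit_vol TYPE(pt) * 2"
  let ?K = "\<lambda>k. \<integral>\<^sup>+p. ennreal (beta_weight (Suc k) (p :: real^3, 0 :: real)) \<partial>lborel"
  have lim: "(\<lambda>k. ?K k * power_integral (1 / 2 + 1 / real (Suc k)) \<psi>) \<longlonglongrightarrow> ?V * (\<integral>\<^sup>+y. ennreal (\<psi> (snd (y :: pt))) \<partial>sphere_law)"
    if c: "continuous_on UNIV \<psi>" and p: "\<And>h. 0 \<le> \<psi> h" "\<And>h. \<psi> h \<le> 1" for \<psi> :: "real \<Rightarrow> real"
  proof -
    have [measurable]: "\<psi> \<in> borel_measurable borel" using c by (rule borel_measurable_continuous_onI)
    have cs: "continuous_on UNIV (\<lambda>y :: pt. \<psi> (snd y))"
      by (rule continuous_on_compose2[OF c]) (auto intro: continuous_intros)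
    have "(\<lambda>k. \<integral>\<^sup>+y. ennreal (beta_weight (Suc k) (y :: pt)) * ennreal (\<psi> (snd y)) \<partial>lborel) \<longlonglongrightarrow> unit_vol TYPE(pt) * (2 * (\<integral>\<^sup>+y. ennreal (\<psi> (snd (y :: pt))) \<partial>sphere_law))"
    proof (rule beta_limit[OF DIM_pt, where f = "\<lambda>y. \<psi> (snd y)"])
      show "isCont (\<lambda>y :: pt. \<psi> (snd y)) x" for x
        using continuous_on_eq_continuous_at[OF open_UNIV, THEN iffD1, OF cs] by blast
    qed (auto simp: p intro: borel_measurable_continuous_onI[OF cs])
    moreover have "(\<integral>\<^sup>+y. ennreal (beta_weight (Suc k) (y :: pt)) * ennreal (\<psi> (snd y)) \<partial>lborel) = ?K k * power_integral (1 / 2 + 1 / real (Suc k)) \<psi>" for k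
      unfolding power_integral_def by (rule beta_weight_last) auto
    ultimately show ?thesis by (simp only: mult.assoc)
  qed
  show ?thesis
  proof (rule law_from_limits)
    show "(\<lambda>k. ?K k * power_integral (1 / 2 + 1 / real (Suc k)) \<phi>) \<longlonglongrightarrow> ?V * (\<integral>\<^sup>+y. ennreal (\<phi> (snd (y :: pt))) \<partial>sphere_law)"
      by (rule lim[OF cont \<phi>])
    show "(\<lambda>k. ?K k * power_integral (1 / 2 + 1 / real (Suc k)) (\<lambda>_. 1)) \<longlonglongrightarrow> ?V"
      using lim[of "\<lambda>_. 1"] S.emeasure_space_1 by simp
    show "(\<lambda>k. power_integral (1 / 2 + 1 / real (Suc k)) \<phi>) \<longlonglongrightarrow> power_integral (1 / 2) \<phi>"
      "(\<lambda>k. power_integral (1 / 2 + 1 / real (Suc k)) (\<lambda>_. 1)) \<longlonglongrightarrow> power_integral (1 / 2) (\<lambda>_. 1)"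
      using \<phi> by (intro power_integral_tendsto; simp)+
    show "?V \<noteq> 0" "?V \<noteq> \<top>" using unit_vol_pos[where 'a=pt] by (auto simp: ennreal_mult_eq_top_iff)
    have "(\<integral>\<^sup>+y. ennreal (\<phi> (snd (y :: pt))) \<partial>sphere_law) \<le> (\<integral>\<^sup>+y. 1 \<partial>(sphere_law :: pt measure))"
      using \<phi> by (intro nn_integral_mono) (simp add: ennreal_le_1)
    then show "(\<integral>\<^sup>+y. ennreal (\<phi> (snd (y :: pt))) \<partial>sphere_law) \<noteq> \<top>"
      using S.emeasure_space_1 by (auto simp: top_unique)
    show "power_integral (1 / 2) \<phi> \<noteq> \<top>" "power_integral (1 / 2) (\<lambda>_. 1) \<noteq> \<top>"
      using power_integral_bound[of "1/2" \<phi>] power_integral_bound[of "1/2" "\<lambda>_. 1"] \<phi> by (auto simp: top_unique)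
  qed
qed

text \<open>Extends the law to pointwise limits of continuous functions with values in [0, 1], which
  covers the indicators of half-lines and of points.\<close>

lemma law_last_limit:
  fixes \<psi> :: "real \<Rightarrow> real"
  assumes cont: "\<And>m. continuous_on UNIV (\<phi> m)" and \<phi>: "\<And>m h. 0 \<le> \<phi> m h" "\<And>m h. \<phi> m h \<le> 1"
    and lim: "\<And>h. (\<lambda>m. \<phi> m h) \<longlonglongrightarrow> \<psi> h"
  shows "(\<integral>\<^sup>+y. ennreal (\<psi> (snd (y :: pt))) \<partial>sphere_law) * power_integral (1 / 2) (\<lambda>_. 1) = power_integral (1 / 2) \<psi>"
proof -
  interpret S: prob_space "sphere_law :: pt measure" by (rule prob_space_sphere_law)
  have m[measurable]: "\<phi> n \<in> borel_measurable borel" for n using cont by (rule borel_measurable_continuous_onI)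
  have [measurable]: "\<psi> \<in> borel_measurable borel"
    by (rule borel_measurable_LIMSEQ_real[OF lim]) auto
  have sm: "(\<lambda>y :: pt. f (snd y)) \<in> borel_measurable borel" if "f \<in> borel_measurable borel" for f :: "real \<Rightarrow> real"
    by (rule measurable_compose[OF _ that]) (intro borel_measurable_continuous_onI continuous_intros)
  have 1: "(\<lambda>m. \<integral>\<^sup>+y. ennreal (\<phi> m (snd (y :: pt))) \<partial>sphere_law) \<longlonglongrightarrow> (\<integral>\<^sup>+y. ennreal (\<psi> (snd (y :: pt))) \<partial>sphere_law)"
    using \<phi> lim S.emeasure_space_1 sm
    by (intro nn_integral_dominated_convergence[where w = "\<lambda>_. 1"])
      (auto intro!: tendsto_ennrealI simp: ennreal_le_1 measurable_compose[OF sm measurable_ennreal])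
  have 2: "(\<lambda>m. power_integral (1 / 2) (\<phi> m)) \<longlonglongrightarrow> power_integral (1 / 2) \<psi>"
    unfolding power_integral_def
  proof (rule nn_integral_dominated_convergence[where w = "\<lambda>h. ennreal (ball_power (1 / 2) h)"])
    show "AE x in lborel. ennreal (\<phi> j x) * ennreal (ball_power (1 / 2) x) \<le> ennreal (ball_power (1 / 2) x)" for j
    proof (rule AE_I2)
      fix x show "ennreal (\<phi> j x) * ennreal (ball_power (1 / 2) x) \<le> ennreal (ball_power (1 / 2) x)"
        using mult_mono[of "ennreal (\<phi> j x)" 1 "ennreal (ball_power (1 / 2) x)" "ennreal (ball_power (1 / 2) x)"] \<phi>
        by (simp add: ennreal_le_1)
    qed
    show "(\<integral>\<^sup>+ x. ennreal (ball_power (1 / 2) x) \<partial>lborel) < \<infinity>"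
      using power_integral_bound[of "1/2" "\<lambda>_. 1"] by (simp add: power_integral_def less_top[symmetric] top_unique) (auto simp: top_unique)
    show "AE x in lborel. (\<lambda>i. ennreal (\<phi> i x) * ennreal (ball_power (1 / 2) x)) \<longlonglongrightarrow> ennreal (\<psi> x) * ennreal (ball_power (1 / 2) x)"
      using lim by (intro AE_I2 tendsto_mult_ennreal tendsto_ennrealI tendsto_const) auto
  qed auto
  have "(\<lambda>m. (\<integral>\<^sup>+y. ennreal (\<phi> m (snd (y :: pt))) \<partial>sphere_law) * power_integral (1 / 2) (\<lambda>_. 1)) \<longlonglongrightarrow> (\<integral>\<^sup>+y. ennreal (\<psi> (snd (y :: pt))) \<partial>sphere_law) * power_integral (1 / 2) (\<lambda>_. 1)"
  proof -
    have "power_integral (1 / 2) (\<lambda>_. 1) \<noteq> \<top>" using power_integral_bound[of "1/2" "\<lambda>_. 1"] by (auto simp: top_unique)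
    moreover have "(\<integral>\<^sup>+y. ennreal (\<psi> (snd (y :: pt))) \<partial>sphere_law) \<le> (\<integral>\<^sup>+y. 1 \<partial>(sphere_law :: pt measure))"
      using LIMSEQ_le_const2[OF lim] \<phi> by (intro nn_integral_mono) (auto simp: ennreal_le_1)
    then have "(\<integral>\<^sup>+y. ennreal (\<psi> (snd (y :: pt))) \<partial>sphere_law) \<noteq> \<top>" using S.emeasure_space_1 by (auto simp: top_unique)
    ultimately show ?thesis by (intro tendsto_mult_ennreal 1 tendsto_const) auto
  qed
  then show ?thesis
    unfolding law_last_continuous[OF cont \<phi>] using 2 LIMSEQ_unique by blast
qed

lemma nn_integral_sphere_law_indicator:
  "(\<integral>\<^sup>+y. ennreal (indicator A (snd (y :: pt))) \<partial>sphere_law) = emeasure sphere_law {y :: pt. snd y \<in> A}"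
  if "A \<in> sets borel"
proof -
  have "snd \<in> borel_measurable (borel :: pt measure)" by (intro borel_measurable_continuous_onI continuous_intros)
  then have "{y :: pt. snd y \<in> A} \<in> sets borel"
    using that measurable_sets_borel[of snd borel A] by (simp add: vimage_def)
  then have "(\<integral>\<^sup>+y. indicator {y :: pt. snd y \<in> A} y \<partial>sphere_law) = emeasure sphere_law {y :: pt. snd y \<in> A}"
    by (intro nn_integral_indicator) simp
  moreover have "ennreal (indicator A (snd y)) = indicator {y :: pt. snd y \<in> A} y" for y
    by (auto split: split_indicator)
  ultimately show ?thesis by simp
qed

lemma law_last_lessThan:
  "emeasure sphere_law {y :: pt. snd y < h} * power_integral (1 / 2) (\<lambda>_. 1) = power_integral (1 / 2) (indicator {..<h})"
proof -
  have "(\<integral>\<^sup>+y. ennreal (indicator {..<h} (snd (y :: pt))) \<partial>sphere_law) * power_integral (1 / 2) (\<lambda>_. 1) = power_integral (1 / 2) (indicator {..<h})"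
  proof (rule law_last_limit)
    \<comment> \<open>Ramps that vanish from \<open>h\<close> on and reach 1 at distance
      \<open>1 / m\<close> to the left of \<open>h\<close>.\<close>
    let ?\<phi> = "\<lambda>m t. max 0 (min 1 (real m * (h - t)))"
    show "continuous_on UNIV (?\<phi> m)" for m by (intro continuous_intros)
    show "(\<lambda>m. ?\<phi> m t) \<longlonglongrightarrow> indicator {..<h} t" for t
    proof (cases "t < h")
      case True
      have "eventually (\<lambda>m. ?\<phi> m t = 1) sequentially"
      proof -
        obtain M :: nat where M: "1 / (h - t) < M" using reals_Archimedean2 by blast
        have "?\<phi> m t = 1" if "m \<ge> M" for m
        proof -
          have "1 / (h - t) \<le> real m" using M that by linarith
          then have "1 \<le> real m * (h - t)" using True by (simp add: field_simps)
          then show ?thesis by simp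
        qed
        then show ?thesis by (auto simp: eventually_sequentially)
      qed
      then show ?thesis using True by (simp add: tendsto_eventually)
    next
      case False
      then have "real m * (h - t) \<le> 0" for m by (intro mult_nonneg_nonpos) auto
      then have "?\<phi> m t = 0" for m by (metis max.absorb1 min.coboundedI2)
      then show ?thesis using False by simp
    qed
  qed auto
  then show ?thesis by (simp add: nn_integral_sphere_law_indicator)
qed

lemma power_integral_cong_AE:
  "AE h in lborel. \<phi> h = \<psi> h \<Longrightarrow> power_integral e \<phi> = power_integral e \<psi>"
  unfolding power_integral_def by (intro nn_integral_cong_AE) (auto elim!: eventually_mono)

lemma law_last_singleton: "emeasure sphere_law {y :: pt. snd y = h} = 0" if "power_integral (1 / 2) (\<lambda>_. 1) \<noteq> 0"
proof -
  have "(\<integral>\<^sup>+y. ennreal (indicator {h} (snd (y :: pt))) \<partial>sphere_law) * power_integral (1 / 2) (\<lambda>_. 1) = power_integral (1 / 2) (indicator {h})"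
  proof (rule law_last_limit)
    \<comment> \<open>Tents of height 1 over \<open>h\<close> whose width shrinks with
      \<open>m\<close>.\<close>
    let ?\<phi> = "\<lambda>m t. max 0 (1 - real m * \<bar>t - h\<bar>)"
    show "continuous_on UNIV (?\<phi> m)" for m by (intro continuous_intros)
    show "(\<lambda>m. ?\<phi> m t) \<longlonglongrightarrow> indicator {h} t" for t
    proof (cases "t = h")
      case False
      have "eventually (\<lambda>m. ?\<phi> m t = 0) sequentially"
      proof -
        obtain M :: nat where M: "1 / \<bar>t - h\<bar> < M" using reals_Archimedean2 by blast
        have "?\<phi> m t = 0" if "m \<ge> M" for m
        proof -
          have "1 / \<bar>t - h\<bar> \<le> real m" using M that by linarith
          then have "1 \<le> real m * \<bar>t - h\<bar>" using False by (simp add: field_simps)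
          then show ?thesis by simp
        qed
        then show ?thesis by (auto simp: eventually_sequentially)
      qed
      then show ?thesis using False by (simp add: tendsto_eventually)
    qed simp
  qed auto
  moreover have "power_integral (1 / 2) (indicator {h}) = power_integral (1 / 2) (\<lambda>_. 0)"
    by (rule power_integral_cong_AE, rule eventually_mono[OF AE_lborel_singleton[of h]]) simp
  moreover have "power_integral (1 / 2) (\<lambda>_. 0) = 0" by (simp add: power_integral_def)
  ultimately show ?thesis using that by (simp add: nn_integral_sphere_law_indicator)
qed

text \<open>Substituting \<open>h = sin x\<close> turns \<open>(1 - h\<^sup>2) powr (j / 2)\<close>
  into \<open>cos x ^ j\<close>, and the derivative adds one more cosine. The cases used are
  \<open>j = 1\<close> for a cap and \<open>j = 7\<close> for the height.\<close>

lemma power_integral_sin: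
  fixes \<phi> :: "real \<Rightarrow> real"
  assumes [measurable]: "\<phi> \<in> borel_measurable borel" and nn: "\<And>h. 0 \<le> \<phi> h"
  shows "power_integral (real j / 2) \<phi> = (\<integral>\<^sup>+x. ennreal (\<phi> (sin x) * cos x ^ Suc j) * indicator {- pi / 2..pi / 2} x \<partial>lborel)"
proof -
  have "power_integral (real j / 2) \<phi> = (\<integral>\<^sup>+h. ennreal ((\<phi> h * ball_power (real j / 2) h) * indicator {sin (- pi / 2)..sin (pi / 2)} h) \<partial>lborel)"
    unfolding power_integral_def
  proof (rule nn_integral_cong)
    fix h :: real
    show "ennreal (\<phi> h) * ennreal (ball_power (real j / 2) h) = ennreal ((\<phi> h * ball_power (real j / 2) h) * indicator {sin (- pi / 2)..sin (pi / 2)} h)"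
      using nn by (auto simp: ball_power_def ennreal_mult' split: split_indicator)
  qed
  also have "\<dots> = (\<integral>\<^sup>+x. ennreal ((\<phi> (sin x) * ball_power (real j / 2) (sin x)) * cos x * indicator {- pi / 2..pi / 2} x) \<partial>lborel)"
  proof (rule nn_integral_substitution)
    show "set_borel_measurable borel {sin (- pi / 2)..sin (pi / 2)} (\<lambda>h. \<phi> h * ball_power (real j / 2) h)"
      unfolding set_borel_measurable_def by measurable
    show "(sin has_real_derivative cos x) (at x)" for x by (rule DERIV_sin)
    show "continuous_on {- pi / 2..pi / 2} cos" by (intro continuous_intros)
    show "0 \<le> cos x" if "x \<in> {- pi / 2..pi / 2}" for x using that by (intro cos_ge_zero) auto
  qed simp
  also have "\<dots> = (\<integral>\<^sup>+x. ennreal (\<phi> (sin x) * cos x ^ Suc j) * indicator {- pi / 2..pi / 2} x \<partial>lborel)"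
  proof (rule nn_integral_cong)
    fix x :: real
    show "ennreal ((\<phi> (sin x) * ball_power (real j / 2) (sin x)) * cos x * indicator {- pi / 2..pi / 2} x)
      = ennreal (\<phi> (sin x) * cos x ^ Suc j) * indicator {- pi / 2..pi / 2} x"
    proof (cases "x \<in> {- pi / 2..pi / 2}")
      case True
      have "ball_power (real j / 2) (sin x) * cos x = cos x ^ Suc j"
      proof (cases "cos x = 0")
        case False
        then have c: "cos x > 0" using True cos_ge_zero[of x] by auto
        then have "(sin x)\<^sup>2 < 1" by (simp add: sin_squared_eq)
        then have "\<bar>sin x\<bar> < 1" by (simp add: abs_square_less_1)
        moreover have "(1 - (sin x)\<^sup>2) powr (real j / 2) = cos x ^ j"
        proof -
          have "(1 - (sin x)\<^sup>2) powr (real j / 2) = (cos x powr 2) powr (real j / 2)"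
            using c by (simp add: sin_squared_eq powr_numeral)
          also have "\<dots> = cos x powr real j" by (simp add: powr_powr)
          finally show ?thesis using c by (simp add: powr_realpow)
        qed
        ultimately show ?thesis by (simp add: ball_power_def)
      qed simp
      then have e: "\<phi> (sin x) * ball_power (real j / 2) (sin x) * cos x = \<phi> (sin x) * cos x ^ Suc j"
        by (metis mult.assoc)
      show ?thesis unfolding e using True by simp
    qed simp
  qed
  finally show ?thesis .
qed

section \<open>The cap function in closed form\<close>

lemma cos_sq_antiderivative:
  "((\<lambda>x. (x + sin x * cos x) / 2) has_real_derivative cos x ^ 2) (at x)"
proof -
  have "((\<lambda>x. (x + sin x * cos x) / 2) has_real_derivative (1 + (cos x * cos x + sin x * (- sin x))) / 2) (at x)"
    by (auto intro!: derivative_eq_intros)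
  also have "(1 + (cos x * cos x + sin x * (- sin x))) / 2 = cos x ^ 2"
    using sin_cos_squared_add[of x] by (simp add: power2_eq_square)
  finally show ?thesis .
qed

lemma nn_integral_cos_sq:
  assumes "a \<le> b"
  shows "(\<integral>\<^sup>+x. ennreal (cos x ^ 2) * indicator {a..b} x \<partial>lborel) = ennreal ((b + sin b * cos b) / 2 - (a + sin a * cos a) / 2)"
proof (rule nn_integral_FTC_Icc)
  show "((\<lambda>x. (x + sin x * cos x) / 2) has_real_derivative cos x ^ 2) (at x)" for x
    by (rule cos_sq_antiderivative)
qed (use assms in auto)

lemma power_integral_half: "power_integral (1 / 2) (\<lambda>_. 1) = ennreal (pi / 2)"
  using power_integral_sin[of "\<lambda>_. 1" 1] nn_integral_cos_sq[of "- pi / 2" "pi / 2"]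
  by (simp add: numeral_2_eq_2)

lemma power_integral_lessThan:
  assumes "x \<in> {- pi / 2..pi / 2}"
  shows "power_integral (1 / 2) (indicator {..<sin x}) = ennreal ((2 * x + sin (2 * x) + pi) / 4)"
proof -
  have "power_integral (1 / 2) (indicator {..<sin x}) = (\<integral>\<^sup>+y. ennreal (indicator {..<sin x} (sin y) * cos y ^ 2) * indicator {- pi / 2..pi / 2} y \<partial>lborel)"
    using power_integral_sin[of "indicator {..<sin x}" 1] by (simp add: numeral_2_eq_2)
  also have "\<dots> = (\<integral>\<^sup>+y. ennreal (cos y ^ 2) * indicator {- pi / 2..x} y \<partial>lborel)"
  proof (rule nn_integral_cong_AE, rule eventually_mono[OF AE_lborel_singleton[of x]])
    fix y assume "y \<noteq> x"
    then have "sin y < sin x \<longleftrightarrow> y \<le> x" if "y \<in> {- pi / 2..pi / 2}"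
      using that assms sin_mono_less_eq[of y x] by auto
    then show "ennreal (indicator {..<sin x} (sin y) * cos y ^ 2) * indicator {- pi / 2..pi / 2} y = ennreal (cos y ^ 2) * indicator {- pi / 2..x} y"
      using assms by (auto split: split_indicator)
  qed
  also have "\<dots> = ennreal ((x + sin x * cos x) / 2 - (- pi / 2 + sin (- pi / 2) * cos (- pi / 2)) / 2)"
    using assms by (intro nn_integral_cos_sq) auto
  also have "(x + sin x * cos x) / 2 - (- pi / 2 + sin (- pi / 2) * cos (- pi / 2)) / 2 = (2 * x + sin (2 * x) + pi) / 4"
    unfolding sin_double by (simp add: field_simps)
  finally show ?thesis .
qed

definition cap_fraction :: "real \<Rightarrow> real" where
  "cap_fraction h = measure sphere_law {y :: pt. snd y < h}"

lemma measurable_snd_pt: "snd \<in> borel_measurable (borel :: pt measure)"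
  by (intro borel_measurable_continuous_onI continuous_intros)

lemma sets_snd_pt: "A \<in> sets borel \<Longrightarrow> {y :: pt. snd y \<in> A} \<in> sets borel"
  using measurable_sets_borel[OF measurable_snd_pt, of A] by (simp add: vimage_def)

lemma cap_fraction_sin:
  assumes "x \<in> {- pi / 2..pi / 2}"
  shows "cap_fraction (sin x) = (2 * x + sin (2 * x) + pi) / (2 * pi)"
proof -
  interpret S: prob_space "sphere_law :: pt measure" by (rule prob_space_sphere_law)
  have "ennreal (cap_fraction (sin x)) * ennreal (pi / 2) = ennreal ((2 * x + sin (2 * x) + pi) / 4)"
    using law_last_lessThan[of "sin x"]
    unfolding cap_fraction_def power_integral_half power_integral_lessThan[OF assms] by (simp add: S.emeasure_eq_measure)
  moreover have "ennreal (cap_fraction (sin x) * (pi / 2)) = ennreal (cap_fraction (sin x)) * ennreal (pi / 2)"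
    by (rule ennreal_mult'') simp
  ultimately have "ennreal (cap_fraction (sin x) * (pi / 2)) = ennreal ((2 * x + sin (2 * x) + pi) / 4)" by simp
  moreover have "0 \<le> cap_fraction (sin x) * (pi / 2)" by (simp add: cap_fraction_def)
  \<comment> \<open>Needed before \<open>ennreal\<close> can be removed, as it maps negative numbers
    to 0. The value is an increment of the increasing antiderivative of cos^2.\<close>
  moreover have "0 \<le> (2 * x + sin (2 * x) + pi) / 4"
  proof -
    have "(x + sin x * cos x) / 2 - (- pi / 2 + sin (- pi / 2) * cos (- pi / 2)) / 2 \<ge> 0"
    proof -
      have "(- pi / 2 + sin (- pi / 2) * cos (- pi / 2)) / 2 \<le> (x + sin x * cos x) / 2"
        using assms by (intro deriv_nonneg_imp_mono[OF cos_sq_antiderivative]) auto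
      then show ?thesis by (simp only: diff_ge_0_iff_ge)
    qed
    then show ?thesis unfolding sin_double by (simp add: field_simps)
  qed
  ultimately have "cap_fraction (sin x) * (pi / 2) = (2 * x + sin (2 * x) + pi) / 4" by (simp add: ennreal_inj)
  then show ?thesis by (simp add: field_simps)
qed

lemma AE_last_neq: "AE y in (sphere_law :: pt measure). snd y \<noteq> h"
proof -
  have "{y :: pt. snd y = h} \<in> null_sets sphere_law"
    using law_last_singleton[of h] sets_snd_pt[of "{h}"] by (auto simp: null_sets_def power_integral_half)
  then show ?thesis by (rule AE_I') auto
qed

lemma cap_fraction_greater: "measure sphere_law {y :: pt. snd y > h} = 1 - cap_fraction h"
proof -
  interpret S: prob_space "sphere_law :: pt measure" by (rule prob_space_sphere_law)
  have "measure sphere_law {y :: pt. snd y > h} = measure sphere_law (UNIV - {y :: pt. snd y < h})"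
    using sets_snd_pt[of "{h<..}"] sets_snd_pt[of "{..<h}"] AE_last_neq[of h]
    by (intro S.finite_measure_eq_AE) (auto elim!: eventually_mono simp: Diff_eq)
  also have "\<dots> = 1 - cap_fraction h"
    using S.prob_compl[of "{y :: pt. snd y < h}"] sets_snd_pt[of "{..<h}"] by (simp add: cap_fraction_def)
  finally show ?thesis .
qed

section \<open>Rotation invariance and null hyperplanes\<close>

lemma sphere_law_isometry:
  fixes f :: "'a::euclidean_space \<Rightarrow> 'b::euclidean_space"
  assumes "linear f" "\<And>x. norm (f x) = norm x" "distr lborel borel f = lborel"
  shows "distr sphere_law borel f = sphere_law" "f \<in> borel_measurable borel"
proof -
  show m: "f \<in> borel_measurable borel"
    using assms(1) by (intro borel_measurable_continuous_onI linear_continuous_on) (simp add: linear_linear)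
  note s = sphere_unif_isometry[OF assms]
  have f': "f \<in> sphere_unif \<rightarrow>\<^sub>M sphere_borel" using s(1) by (simp cong: measurable_cong_sets)
  have "distr sphere_law borel f = distr sphere_unif borel f"
    unfolding sphere_law_def by (subst distr_distr[OF m measurable_sphere_id]) (simp add: comp_def)
  also have "\<dots> = distr (distr sphere_unif sphere_borel f) borel (\<lambda>x. x)"
    by (subst distr_distr[OF _ f']) (auto simp: comp_def intro: measurable_restrict_space1)
  finally show "distr sphere_law borel f = sphere_law" by (simp add: s(2) sphere_law_def)
qed

lemma sphere_law_join_last: "distr sphere_law borel join_last = sphere_law" "join_last \<in> borel_measurable borel"
  by (rule sphere_law_isometry[OF linear_join_last norm_join_last lborel_distr_join_last])+

text \<open>An orthogonal map takes \<open>v\<close> to the distinguished axis and preserves the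
  law, so all directions have the law of the last coordinate.\<close>

lemma sphere_law_inner:
  fixes v :: "real^4"
  assumes v: "norm v = 1"
  shows "distr sphere_law borel (\<lambda>x. v \<bullet> x) = distr sphere_law borel (snd :: pt \<Rightarrow> real)"
proof -
  let ?e = "join_last (0, 1)"
  obtain T where T: "orthogonal_transformation T" "T v = ?e"
    using orthogonal_transformation_exists[of v ?e] v by (auto simp: norm_join_last)
  note iso = sphere_law_isometry[OF orthogonal_transformation_linear[OF T(1)] orthogonal_transformation_norm[OF T(1)] lborel_distr_orthogonal[OF T(1)]]
  have ex: "join_last y \<bullet> ?e = snd y" for y by (simp add: inner_join_last inner_prod_def)
  have "v \<bullet> x = T x \<bullet> ?e" for x using T by (metis inner_commute orthogonal_transformation_def)
  then have veq: "(\<lambda>x. v \<bullet> x) = (\<lambda>x. x \<bullet> ?e) \<circ> T" by auto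
  have "distr sphere_law borel (\<lambda>x. v \<bullet> x) = distr (distr sphere_law borel T) borel (\<lambda>x. x \<bullet> ?e)"
    unfolding veq using iso(2) by (intro distr_distr[symmetric]) auto
  also have "\<dots> = distr (distr sphere_law borel join_last) borel (\<lambda>x. x \<bullet> ?e)"
    by (simp add: iso(1) sphere_law_join_last(1))
  also have "\<dots> = distr sphere_law borel (snd :: pt \<Rightarrow> real)"
    using sphere_law_join_last(2) by (subst distr_distr) (auto simp: comp_def ex)
  finally show ?thesis .
qed

lemma measure_cap:
  fixes v :: "real^4"
  assumes v: "norm v = 1"
  shows "emeasure sphere_law {x. v \<bullet> x < h} = ennreal (cap_fraction h)"
    "emeasure sphere_law {x. v \<bullet> x > h} = ennreal (1 - cap_fraction h)"
    "AE x in sphere_law. v \<bullet> x \<noteq> h"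
proof -
  interpret S: prob_space "sphere_law :: pt measure" by (rule prob_space_sphere_law)
  have e: "emeasure sphere_law {x. v \<bullet> x \<in> A} = emeasure sphere_law {y :: pt. snd y \<in> A}" if "A \<in> sets borel" for A
  proof -
    have "emeasure (distr sphere_law borel (\<lambda>x. v \<bullet> x)) A = emeasure (distr sphere_law borel (snd :: pt \<Rightarrow> real)) A"
      by (simp add: sphere_law_inner[OF v])
    then show ?thesis using that measurable_snd_pt by (simp add: emeasure_distr vimage_def)
  qed
  show "emeasure sphere_law {x. v \<bullet> x < h} = ennreal (cap_fraction h)"
    using e[of "{..<h}"] by (simp add: cap_fraction_def S.emeasure_eq_measure)
  show "emeasure sphere_law {x. v \<bullet> x > h} = ennreal (1 - cap_fraction h)"
    using e[of "{h<..}"] cap_fraction_greater[of h] by (simp add: S.emeasure_eq_measure)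
  have "emeasure sphere_law {x. v \<bullet> x = h} = 0"
    using e[of "{h}"] law_last_singleton[of h] by (simp add: power_integral_half)
  then have "{x. v \<bullet> x = h} \<in> null_sets sphere_law" by (simp add: null_sets_def)
  then show "AE x in sphere_law. v \<bullet> x \<noteq> h" by (rule AE_I') auto
qed

lemma AE_sphere_law_hyperplane:
  fixes n :: "real^4"
  assumes "n \<noteq> 0"
  shows "AE x in sphere_law. n \<bullet> x \<noteq> r"
proof -
  have "AE x in sphere_law. (inverse (norm n) *\<^sub>R n) \<bullet> x \<noteq> inverse (norm n) * r"
    using assms by (intro measure_cap) simp
  then show ?thesis using assms by (auto elim!: eventually_mono)
qed

lemma AE_sphere_law_hyperplane_pt:
  fixes n :: pt
  assumes "n \<noteq> 0"
  shows "AE y in sphere_law. n \<bullet> y \<noteq> r"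
proof -
  have "join_last n \<noteq> 0" using assms norm_join_last[of n] by auto
  then have "AE x in distr sphere_law borel join_last. join_last n \<bullet> x \<noteq> r"
    unfolding sphere_law_join_last(1) by (rule AE_sphere_law_hyperplane)
  then have "AE y in sphere_law. join_last n \<bullet> join_last y \<noteq> r"
    by (rule AE_distrD[rotated]) (use sphere_law_join_last(2) in measurable)
  then show ?thesis by (simp add: inner_join_last)
qed

text \<open>The argument of \<open>AE_vol3\<close> for points on the sphere. A plane in the
  projected space is a hyperplane with normal \<open>(n, 0)\<close> in the full space, and
  hyperplanes are null for the spherical law.\<close>

lemma AE_proj_vol:
  "AE y1 in sphere_law. AE y2 in sphere_law. AE y3 in sphere_law. AE y4 in sphere_law. proj_vol (y1, y2, y3, y4) \<noteq> 0"
proof (rule AE_I2)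
  fix y1 :: pt
  let ?p = fst
  have fst_hyper: "AE y in (sphere_law :: pt measure). n \<bullet> fst y \<noteq> r" if "n \<noteq> 0" for n :: "real^3" and r
    using AE_sphere_law_hyperplane_pt[of "(n, 0)" r] that by (simp add: inner_prod_def zero_prod_def)
  have "AE y3 in sphere_law. AE y4 in sphere_law. proj_vol (y1, y2, y3, y4) \<noteq> 0" if y2: "fst y2 \<noteq> fst y1" for y2 :: pt
  proof -
    obtain v where v: "cross3 v (fst y2 - fst y1) \<noteq> 0"
    proof -
      have "\<exists>v. cross3 v (fst y2 - fst y1) \<noteq> 0"
      proof (rule ccontr)
        assume "\<nexists>v. cross3 v (fst y2 - fst y1) \<noteq> 0"
        then have "cross3 (axis 1 1) (fst y2 - fst y1) = 0" "cross3 (axis 2 1) (fst y2 - fst y1) = 0" by auto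
        then have "fst y2 - fst y1 = 0" by (auto simp: cross3_def vec_eq_iff forall_3 axis_def)
        then show False using y2 by simp
      qed
      then show ?thesis using that by blast
    qed
    have "AE y3 in (sphere_law :: pt measure). cross3 v (fst y2 - fst y1) \<bullet> fst y3 \<noteq> cross3 v (fst y2 - fst y1) \<bullet> fst y1"
      by (rule fst_hyper[OF v])
    then show ?thesis
    proof eventually_elim
      case (elim y3)
      have "v \<bullet> cross3 (fst y2 - fst y1) (fst y3 - fst y1) = cross3 v (fst y2 - fst y1) \<bullet> fst y3 - cross3 v (fst y2 - fst y1) \<bullet> fst y1"
        by (simp add: cross3_simps)
      then have "cross3 (fst y2 - fst y1) (fst y3 - fst y1) \<noteq> 0" using elim by auto
      then have "AE y4 in (sphere_law :: pt measure). cross3 (fst y2 - fst y1) (fst y3 - fst y1) \<bullet> fst y4 \<noteq> cross3 (fst y2 - fst y1) (fst y3 - fst y1) \<bullet> fst y1"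
        by (rule fst_hyper)
      then show ?case by eventually_elim (simp add: proj_vol_def vol3_cyclic)
    qed
  qed
  moreover have "AE y2 in (sphere_law :: pt measure). fst y2 \<noteq> fst y1"
    using fst_hyper[of "axis 1 1" "axis 1 1 \<bullet> fst y1"] by (auto elim: eventually_mono)
  ultimately show "AE y2 in sphere_law. AE y3 in sphere_law. AE y4 in sphere_law. proj_vol (y1, y2, y3, y4) \<noteq> 0"
    by (auto elim: eventually_mono)
qed

text \<open>\<open>beta4_limit\<close> applies because the height is continuous wherever
  \<open>proj_vol\<close> is nonzero, which by \<open>AE_proj_vol\<close> is almost everywhere. The
  unknown \<open>plane_const\<close> is removed by comparison with the constant test
  function.\<close>

lemma law_plane_height:
  fixes \<phi> :: "real \<Rightarrow> real"
  assumes cont: "continuous_on UNIV \<phi>" and \<phi>: "\<And>h. 0 \<le> \<phi> h" "\<And>h. \<phi> h \<le> 1"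
  shows "nn_integral4 sphere_law (\<lambda>y1 y2 y3 y4. ennreal (\<phi> (plane_height (y1, y2, y3, y4))))
     * power_integral (7 / 2) (\<lambda>_. 1) = power_integral (7 / 2) \<phi>"
proof -
  interpret S: prob_space "sphere_law :: pt measure" by (rule prob_space_sphere_law)
  let ?V = "unit_vol TYPE(pt) ^ 4 * 16"
  let ?E = "\<lambda>\<psi> :: real \<Rightarrow> real. nn_integral4 sphere_law (\<lambda>y1 y2 y3 y4. ennreal (\<psi> (plane_height (y1, y2, y3, y4))))"
  have U: "emeasure (sphere_law :: pt measure) UNIV = 1" using S.emeasure_space_1 by simp
  have lim: "(\<lambda>k. plane_const (Suc k) * power_integral (7 / 2 + 4 / real (Suc k)) \<psi>) \<longlonglongrightarrow> ?V * ?E \<psi>"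
    if c: "continuous_on UNIV \<psi>" and p: "\<And>h. 0 \<le> \<psi> h" "\<And>h. \<psi> h \<le> 1" for \<psi> :: "real \<Rightarrow> real"
  proof -
    have [measurable]: "\<psi> \<in> borel_measurable borel" using c by (rule borel_measurable_continuous_onI)
    have "(\<lambda>k. beta4 (Suc k) (\<lambda>y. ennreal (\<psi> (plane_height y)))) \<longlonglongrightarrow> unit_vol TYPE(pt) ^ 4 * (16 * ?E \<psi>)"
    proof (rule beta4_limit[OF DIM_pt, where P = "\<lambda>y. proj_vol y \<noteq> 0"])
      show "{y. proj_vol y \<noteq> 0} \<in> sets borel" using open_proj_vol by simp
      fix y assume "proj_vol y \<noteq> 0"
      then have "isCont plane_height y" by (rule isCont_plane_height)
      moreover have "isCont \<psi> (plane_height y)" using c by (simp add: continuous_on_eq_continuous_at)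
      ultimately show "isCont (\<lambda>y. \<psi> (plane_height y)) y" by (rule isCont_o2)
    qed (auto simp: p intro: AE_proj_vol)
    moreover have "beta4 (Suc k) (\<lambda>y. ennreal (\<psi> (plane_height y))) = plane_const (Suc k) * power_integral (7 / 2 + 4 / real (Suc k)) \<psi>" for k
      unfolding power_integral_def by (rule beta4_plane_height) auto
    ultimately show ?thesis by (simp only: mult.assoc)
  qed
  show ?thesis
  proof (rule law_from_limits)
    show "(\<lambda>k. plane_const (Suc k) * power_integral (7 / 2 + 4 / real (Suc k)) \<phi>) \<longlonglongrightarrow> ?V * ?E \<phi>"
      by (rule lim[OF cont \<phi>])
    show "(\<lambda>k. plane_const (Suc k) * power_integral (7 / 2 + 4 / real (Suc k)) (\<lambda>_. 1)) \<longlonglongrightarrow> ?V"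
      using lim[of "\<lambda>_. 1"] by (simp add: U)
    show "(\<lambda>k. power_integral (7 / 2 + 4 / real (Suc k)) \<phi>) \<longlonglongrightarrow> power_integral (7 / 2) \<phi>"
      "(\<lambda>k. power_integral (7 / 2 + 4 / real (Suc k)) (\<lambda>_. 1)) \<longlonglongrightarrow> power_integral (7 / 2) (\<lambda>_. 1)"
      using \<phi> borel_measurable_continuous_onI[OF cont] by (intro power_integral_tendsto; simp)+
    show "?V \<noteq> 0" "?V \<noteq> \<top>" using unit_vol_pos[where 'a=pt] by (auto simp: ennreal_mult_eq_top_iff power_eq_top_ennreal)
    have "?E \<phi> \<le> ?E (\<lambda>_. 1)"
      using \<phi> by (intro nn_integral_mono ennreal_leI) simp
    then show "?E \<phi> \<noteq> \<top>" by (auto simp: U top_unique)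
    show "power_integral (7 / 2) \<phi> \<noteq> \<top>" "power_integral (7 / 2) (\<lambda>_. 1) \<noteq> \<top>"
      using power_integral_bound[of "7/2" \<phi>] power_integral_bound[of "7/2" "\<lambda>_. 1"] \<phi> by (auto simp: top_unique)
  qed
qed

text \<open>It is the distribution function of a law without atoms. Continuity makes the one-sided
  probability admissible as a test function of the height.\<close>

lemma continuous_cap_fraction: "continuous_on UNIV cap_fraction"
proof -
  interpret S: prob_space "sphere_law :: pt measure" by (rule prob_space_sphere_law)
  have m: "snd \<in> borel_measurable (sphere_law :: pt measure)"
    using measurable_snd_pt by (simp cong: measurable_cong_sets)
  let ?M = "distr sphere_law borel (snd :: pt \<Rightarrow> real)"
  interpret M: real_distribution ?M by (rule S.real_distribution_distr[OF m])
  have e: "measure ?M A = measure sphere_law {y :: pt. snd y \<in> A}" if "A \<in> sets borel" for A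
    using that m by (subst measure_distr) (auto simp: vimage_def)
  have "cap_fraction h = cdf ?M h" for h
  proof -
    have "measure sphere_law {y :: pt. snd y < h} = measure sphere_law {y :: pt. snd y \<le> h}"
      using sets_snd_pt[of "{..<h}"] sets_snd_pt[of "{..h}"] AE_last_neq[of h]
      by (intro S.finite_measure_eq_AE) (auto elim!: eventually_mono)
    then show ?thesis by (simp add: cdf_def e cap_fraction_def)
  qed
  moreover have "isCont (cdf ?M) h" for h
  proof -
    have "measure sphere_law {y :: pt. snd y = h} = 0"
      using law_last_singleton[of h] by (simp add: measure_def power_integral_half)
    then show ?thesis by (simp add: M.isCont_cdf e)
  qed
  ultimately show ?thesis by (simp add: continuous_on_eq_continuous_at)
qed

lemma cap_fraction_bounds: "0 \<le> cap_fraction h" "cap_fraction h \<le> 1"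
proof -
  interpret S: prob_space "sphere_law :: pt measure" by (rule prob_space_sphere_law)
  show "0 \<le> cap_fraction h" "cap_fraction h \<le> 1" by (simp_all add: cap_fraction_def)
qed

section \<open>Evaluation of the trigonometric integrals\<close>

lemma power_sum_le_1:
  fixes c :: real
  assumes "0 \<le> c" "c \<le> 1" "m \<ge> 1"
  shows "c ^ m + (1 - c) ^ m \<le> 1"
  using power_decreasing[of 1 m c] power_decreasing[of 1 m "1 - c"] assms by simp

text \<open>The reduction formula for integrals of powers of the cosine, in differentiated
  form.\<close>

lemma sin_cos_power_deriv:
  "((\<lambda>x. sin x * cos x ^ Suc n) has_real_derivative real (n + 2) * cos x ^ (n + 2) - real (n + 1) * cos x ^ n) (at x)"
proof -
  have "((\<lambda>x. sin x * cos x ^ Suc n) has_real_derivative cos x * cos x ^ Suc n + sin x * (real (Suc n) * cos x ^ n * (- sin x))) (at x)"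
    by (rule DERIV_cong[OF DERIV_mult[OF DERIV_sin DERIV_power[OF DERIV_cos, of "Suc n"]]]) (simp add: algebra_simps)
  also have "cos x * cos x ^ Suc n + sin x * (real (Suc n) * cos x ^ n * (- sin x)) = cos x ^ (n + 2) - real (n + 1) * cos x ^ n * (sin x)\<^sup>2"
    by (simp add: power2_eq_square algebra_simps)
  also have "\<dots> = real (n + 2) * cos x ^ (n + 2) - real (n + 1) * cos x ^ n"
    unfolding sin_squared_eq by (simp add: algebra_simps power_add power2_eq_square)
  finally show ?thesis .
qed

lemma nn_integral_cos_8: "power_integral (7 / 2) (\<lambda>_. 1) = ennreal (35 * pi / 128)"
proof -
  \<comment> \<open>The coefficients come from iterating the reduction: 1/8, 7/8 * 1/6 = 7/48, 7/8 *
    5/6 * 1/4 = 35/192 and 7/8 * 5/6 * 3/4 * 1/2 = 35/128. All terms with a cosine vanish at both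
    ends of the interval.\<close>
  let ?F = "\<lambda>x. 35 / 128 * x + (1 / 8 * (sin x * cos x ^ Suc 6) + (7 / 48 * (sin x * cos x ^ Suc 4) +
      (35 / 192 * (sin x * cos x ^ Suc 2) + 35 / 128 * (sin x * cos x ^ Suc 0))))"
  have "power_integral (7 / 2) (\<lambda>_. 1) = (\<integral>\<^sup>+x. ennreal (cos x ^ 8) * indicator {- pi / 2..pi / 2} x \<partial>lborel)"
    using power_integral_sin[of "\<lambda>_. 1" 7] by simp
  also have "\<dots> = ennreal (?F (pi / 2) - ?F (- pi / 2))"
  proof (rule nn_integral_FTC_Icc)
    show "(?F has_real_derivative cos x ^ 8) (at x)" for x
    proof -
      have "(?F has_real_derivative 35 / 128 * 1 + (1 / 8 * (real (6 + 2) * cos x ^ (6 + 2) - real (6 + 1) * cos x ^ 6) +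
        (7 / 48 * (real (4 + 2) * cos x ^ (4 + 2) - real (4 + 1) * cos x ^ 4) +
        (35 / 192 * (real (2 + 2) * cos x ^ (2 + 2) - real (2 + 1) * cos x ^ 2) +
         35 / 128 * (real (0 + 2) * cos x ^ (0 + 2) - real (0 + 1) * cos x ^ 0))))) (at x)"
        by (intro DERIV_add DERIV_cmult DERIV_ident sin_cos_power_deriv)
      also have "35 / 128 * 1 + (1 / 8 * (real (6 + 2) * cos x ^ (6 + 2) - real (6 + 1) * cos x ^ 6) +
        (7 / 48 * (real (4 + 2) * cos x ^ (4 + 2) - real (4 + 1) * cos x ^ 4) +
        (35 / 192 * (real (2 + 2) * cos x ^ (2 + 2) - real (2 + 1) * cos x ^ 2) +
         35 / 128 * (real (0 + 2) * cos x ^ (0 + 2) - real (0 + 1) * cos x ^ 0)))) = cos x ^ 8"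
        by (simp add: algebra_simps add_divide_distrib diff_divide_distrib) (simp add: power2_eq_square)
      finally show ?thesis .
    qed
  qed auto
  also have "?F (pi / 2) - ?F (- pi / 2) = 35 * pi / 128" by simp
  finally show ?thesis .
qed

lemma cap_angle_nonneg: "0 \<le> 2 * x + sin (2 * x) + pi" if "x \<in> {- pi / 2..pi / 2}"
  using cap_fraction_sin[OF that] cap_fraction_bounds(1)[of "sin x"] pi_gt_zero
  by (auto simp: zero_le_divide_iff not_le[symmetric])

definition vertex_integral :: "nat \<Rightarrow> real" where
  "vertex_integral m = integral {- pi / 2..pi / 2} (\<lambda>x. cos x ^ 8 * (2 * x + sin (2 * x) + pi) ^ m)"

lemma nn_integral_vertex:
  "(\<integral>\<^sup>+x. ennreal (((2 * x + sin (2 * x) + pi) / (2 * pi)) ^ m * cos x ^ 8) * indicator {- pi / 2..pi / 2} x \<partial>lborel)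
    = ennreal ((1 / (2 * pi)) ^ m * vertex_integral m)" (is "?L = _")
proof -
  let ?f = "\<lambda>x. cos x ^ 8 * (2 * x + sin (2 * x) + pi) ^ m"
  have "(?f has_integral vertex_integral m) {- pi / 2..pi / 2}"
    unfolding vertex_integral_def
    by (intro integrable_integral integrable_continuous_real continuous_intros)
  then have H: "((\<lambda>x. (1 / (2 * pi)) ^ m * ?f x) has_integral (1 / (2 * pi)) ^ m * vertex_integral m) {- pi / 2..pi / 2}"
    by (rule has_integral_mult_right)
  have "?L = (\<integral>\<^sup>+x. ennreal ((1 / (2 * pi)) ^ m * ?f x) * indicator {- pi / 2..pi / 2} x \<partial>lborel)"
    by (intro nn_integral_cong) (simp add: power_divide mult_ac)
  also have "\<dots> = ennreal ((1 / (2 * pi)) ^ m * vertex_integral m)"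
  proof (rule nn_integral_has_integral_lebesgue'[OF _ H])
    fix x assume "x \<in> {- pi / 2..pi / 2}"
    then have "0 \<le> (2 * x + sin (2 * x) + pi) ^ m" by (intro zero_le_power cap_angle_nonneg)
    then show "0 \<le> (1 / (2 * pi)) ^ m * ?f x" by (intro mult_nonneg_nonneg) simp_all
  qed
  finally show ?thesis .
qed

lemma vertex_integral_nonneg: "0 \<le> vertex_integral m"
  unfolding vertex_integral_def
proof (rule integral_nonneg)
  show "(\<lambda>x. cos x ^ 8 * (2 * x + sin (2 * x) + pi) ^ m) integrable_on {- pi / 2..pi / 2}"
    by (intro integrable_continuous_real continuous_intros)
  show "0 \<le> cos x ^ 8 * (2 * x + sin (2 * x) + pi) ^ m" if "x \<in> {- pi / 2..pi / 2}" for x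
    using zero_le_power[OF cap_angle_nonneg[OF that], of m] by (intro mult_nonneg_nonneg) simp_all
qed

text \<open>The reflection \<open>x \<mapsto> - x\<close> exchanges a cap with the complementary
  one, so both powers have the same integral.\<close>

lemma power_integral_caps:
  "power_integral (7 / 2) (\<lambda>h. cap_fraction h ^ m + (1 - cap_fraction h) ^ m) = ennreal (2 * ((1 / (2 * pi)) ^ m * vertex_integral m))"
proof -
  let ?I = "{- pi / 2..pi / 2}"
  let ?G = "\<lambda>x. (2 * x + sin (2 * x) + pi) / (2 * pi)"
  have [measurable]: "cap_fraction \<in> borel_measurable borel"
    by (rule borel_measurable_continuous_onI[OF continuous_cap_fraction])
  have G: "0 \<le> ?G x" "?G x \<le> 1" if "x \<in> ?I" for x
    using cap_fraction_sin[OF that] cap_fraction_bounds[of "sin x"] by simp_all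
  have "power_integral (7 / 2) (\<lambda>h. cap_fraction h ^ m + (1 - cap_fraction h) ^ m)
    = (\<integral>\<^sup>+x. ennreal ((cap_fraction (sin x) ^ m + (1 - cap_fraction (sin x)) ^ m) * cos x ^ 8) * indicator ?I x \<partial>lborel)"
    using power_integral_sin[of "\<lambda>h. cap_fraction h ^ m + (1 - cap_fraction h) ^ m" 7] cap_fraction_bounds by simp
  also have "\<dots> = (\<integral>\<^sup>+x. ennreal (?G x ^ m * cos x ^ 8) * indicator ?I x + ennreal (?G (- x) ^ m * cos (- x) ^ 8) * indicator ?I (- x) \<partial>lborel)"
  proof (rule nn_integral_cong)
    fix x :: real
    show "ennreal ((cap_fraction (sin x) ^ m + (1 - cap_fraction (sin x)) ^ m) * cos x ^ 8) * indicator ?I x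
      = ennreal (?G x ^ m * cos x ^ 8) * indicator ?I x + ennreal (?G (- x) ^ m * cos (- x) ^ 8) * indicator ?I (- x)"
    proof (cases "x \<in> ?I")
      case True
      then have mx: "- x \<in> ?I" by auto
      have "1 - ?G x = ?G (- x)" by (simp add: field_simps)
      then have "(cap_fraction (sin x) ^ m + (1 - cap_fraction (sin x)) ^ m) * cos x ^ 8 = ?G x ^ m * cos x ^ 8 + ?G (- x) ^ m * cos (- x) ^ 8"
        unfolding cap_fraction_sin[OF True] by (simp add: distrib_right)
      moreover have "ennreal (?G x ^ m * cos x ^ 8 + ?G (- x) ^ m * cos (- x) ^ 8) = ennreal (?G x ^ m * cos x ^ 8) + ennreal (?G (- x) ^ m * cos (- x) ^ 8)"
        using zero_le_power[OF G(1)[OF True], of m] zero_le_power[OF G(1)[OF mx], of m]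
        by (intro ennreal_plus mult_nonneg_nonneg) simp_all
      ultimately show ?thesis using True mx by simp
    next
      case False
      then have "- x \<notin> ?I" by auto
      then show ?thesis using False by simp
    qed
  qed
  also have "\<dots> = (\<integral>\<^sup>+x. ennreal (?G x ^ m * cos x ^ 8) * indicator ?I x \<partial>lborel) + (\<integral>\<^sup>+x. ennreal (?G (- x) ^ m * cos (- x) ^ 8) * indicator ?I (- x) \<partial>lborel)"
    by (rule nn_integral_add) measurable
  also have "(\<integral>\<^sup>+x. ennreal (?G (- x) ^ m * cos (- x) ^ 8) * indicator ?I (- x) \<partial>lborel) = (\<integral>\<^sup>+x. ennreal (?G x ^ m * cos x ^ 8) * indicator ?I x \<partial>lborel)"
    using nn_integral_real_affine[of "\<lambda>x. ennreal (?G x ^ m * cos x ^ 8) * indicator ?I x" "-1" 0] by simp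
  also have "(\<integral>\<^sup>+x. ennreal (?G x ^ m * cos x ^ 8) * indicator ?I x \<partial>lborel) = ennreal ((1 / (2 * pi)) ^ m * vertex_integral m)"
    by (rule nn_integral_vertex)
  also have "ennreal ((1 / (2 * pi)) ^ m * vertex_integral m) + ennreal ((1 / (2 * pi)) ^ m * vertex_integral m) = ennreal (2 * ((1 / (2 * pi)) ^ m * vertex_integral m))"
  proof -
    have "0 \<le> vertex_integral m" by (rule vertex_integral_nonneg)
    then show ?thesis by (simp add: ennreal_plus[symmetric] del: ennreal_plus)
  qed
  finally show ?thesis .
qed

text \<open>Here 256 / (35 pi) arises as 2 times the reciprocal of 35 pi / 128. The condition on
  \<open>m\<close> keeps the test function at most 1; for \<open>m = 0\<close> it would be
  2.\<close>

lemma nn_integral_caps_plane_height: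
  assumes "m \<ge> 1"
  shows "(\<integral>\<^sup>+y1. \<integral>\<^sup>+y2. \<integral>\<^sup>+y3. \<integral>\<^sup>+y4.
      ennreal (cap_fraction (plane_height (y1, y2, y3, y4)) ^ m + (1 - cap_fraction (plane_height (y1, y2, y3, y4))) ^ m)
      \<partial>sphere_law \<partial>sphere_law \<partial>sphere_law \<partial>sphere_law)
    = ennreal (256 / (35 * pi) * (1 / (2 * pi)) ^ m * vertex_integral m)" (is "?E = _")
proof -
  have "?E * ennreal (35 * pi / 128) = ennreal (2 * ((1 / (2 * pi)) ^ m * vertex_integral m))"
    using law_plane_height[of "\<lambda>h. cap_fraction h ^ m + (1 - cap_fraction h) ^ m"] cap_fraction_bounds power_sum_le_1[OF _ _ assms]
      continuous_cap_fraction
    by (simp add: nn_integral_cos_8 power_integral_caps continuous_intros)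
  then have "?E * ennreal (35 * pi / 128) * ennreal (128 / (35 * pi)) = ennreal (2 * ((1 / (2 * pi)) ^ m * vertex_integral m)) * ennreal (128 / (35 * pi))"
    by simp
  moreover have "ennreal (35 * pi / 128) * ennreal (128 / (35 * pi)) = 1"
    by (subst ennreal_mult[symmetric]) auto
  ultimately have "?E = ennreal (2 * ((1 / (2 * pi)) ^ m * vertex_integral m)) * ennreal (128 / (35 * pi))"
    by (simp add: mult.assoc)
  also have "\<dots> = ennreal (2 * ((1 / (2 * pi)) ^ m * vertex_integral m) * (128 / (35 * pi)))"
    by (rule ennreal_mult''[symmetric]) simp
  finally show ?thesis by (simp add: mult_ac)
qed

section \<open>Measurability of face numbers\<close>

text \<open>
  By compactness the quantifier over \<open>K\<close> can be restricted to a countable dense subset at the cost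
  of replacing \<open>\<le> 0\<close> by \<open>< 1 / Suc l\<close> for all \<open>l\<close>.
\<close>

lemma sets_ex_compact:
  fixes K :: "'b::euclidean_space set" and f :: "'w \<Rightarrow> 'b \<Rightarrow> real"
  assumes K: "compact K" and meas: "\<And>z. (\<lambda>\<omega>. f \<omega> z) \<in> borel_measurable M" and cont: "\<And>\<omega>. continuous_on K (f \<omega>)"
  shows "{\<omega> \<in> space M. \<exists>z\<in>K. f \<omega> z \<le> 0} \<in> sets M"
proof -
  obtain D where D: "countable D" "D \<subseteq> K" "K \<subseteq> closure D" using separable[of K] by blast
  have "(\<exists>z\<in>K. f \<omega> z \<le> 0) \<longleftrightarrow> (\<forall>l::nat. \<exists>q\<in>D. f \<omega> q < 1 / Suc l)" for \<omega>
  proof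
    assume "\<exists>z\<in>K. f \<omega> z \<le> 0"
    then obtain z where z: "z \<in> K" "f \<omega> z \<le> 0" by blast
    show "\<forall>l::nat. \<exists>q\<in>D. f \<omega> q < 1 / Suc l"
    proof
      fix l :: nat
      have "0 < 1 / real (Suc l)" by simp
      then obtain d where d: "d > 0" "\<And>y. y \<in> K \<Longrightarrow> dist y z < d \<Longrightarrow> dist (f \<omega> y) (f \<omega> z) < 1 / Suc l"
        using cont[of \<omega>] z(1) unfolding continuous_on_iff by blast
      obtain q where "q \<in> D" "dist q z < d" using D(3) z(1) d(1) by (meson closure_approachable subsetD)
      then show "\<exists>q\<in>D. f \<omega> q < 1 / Suc l" using d(2)[of q] D(2) z(2) by (intro bexI[of _ q]) (auto simp: dist_real_def)
    qed
  next
    assume a: "\<forall>l::nat. \<exists>q\<in>D. f \<omega> q < 1 / Suc l"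
    then have "K \<noteq> {}" using D(2) by blast
    then obtain z where z: "z \<in> K" "\<And>y. y \<in> K \<Longrightarrow> f \<omega> z \<le> f \<omega> y"
      using continuous_attains_inf[OF K _ cont] by blast
    have "f \<omega> z \<le> 0"
    proof (rule ccontr)
      assume "\<not> f \<omega> z \<le> 0"
      then obtain l :: nat where "1 / Suc l < f \<omega> z" using nat_approx_posE by (metis not_le)
      moreover obtain q where "q \<in> D" "f \<omega> q < 1 / Suc l" using a by blast
      ultimately show False using z(2)[of q] D(2) by force
    qed
    then show "\<exists>z\<in>K. f \<omega> z \<le> 0" using z(1) by blast
  qed
  then have "{\<omega> \<in> space M. \<exists>z\<in>K. f \<omega> z \<le> 0} = {\<omega> \<in> space M. \<forall>l::nat. \<exists>q\<in>D. f \<omega> q < 1 / Suc l}" by simp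
  also have "\<dots> \<in> sets M" using D(1) meas by measurable
  finally show ?thesis .
qed

text \<open>Strict inequalities do not define a closed set. A witness can be scaled into the unit
  ball, and finitely many strict inequalities hold with a common margin \<open>1 / Suc m\<close>.
  For fixed \<open>m\<close> the conditions say that a nonnegative continuous function vanishes
  somewhere on a compact set.\<close>

lemma open_face_nonempty_iff:
  assumes fin: "finite J" and U: "U \<subseteq> J"
  shows "open_face J a U \<noteq> {} \<longleftrightarrow>
    (\<exists>m::nat. \<exists>z\<in>cball 0 1. (\<Sum>j\<in>U. \<bar>a j \<bullet> z\<bar>) + (\<Sum>j\<in>J - U. max 0 (a j \<bullet> z + 1 / Suc m)) \<le> 0)"
proof
  assume "open_face J a U \<noteq> {}"
  then obtain z0 where z0: "z0 \<in> open_face J a U" by blast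
  define c where "c = inverse (1 + norm z0)"
  have c: "c > 0" by (simp add: c_def add_pos_nonneg)
  define z where "z = c *\<^sub>R z0"
  have "norm z = norm z0 / (1 + norm z0)" using c by (simp add: z_def c_def divide_inverse)
  also have "\<dots> \<le> 1" by (simp add: add_pos_nonneg)
  finally have nz: "norm z \<le> 1" .
  have zU: "a j \<bullet> z = 0" if "j \<in> U" for j using z0 that by (simp add: open_face_def tight_flat_def z_def)
  have zJ: "a j \<bullet> z < 0" if "j \<in> J - U" for j using z0 that c by (simp add: open_face_def z_def mult_pos_neg)
  have "\<exists>m::nat. \<forall>j\<in>J - U. a j \<bullet> z + 1 / Suc m \<le> 0"
  proof -
    have "\<forall>j\<in>J - U. \<exists>m::nat. 1 / Suc m < - (a j \<bullet> z)" using zJ nat_approx_posE by (metis neg_0_less_iff_less)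
    then obtain g :: "_ \<Rightarrow> nat" where g: "\<And>j. j \<in> J - U \<Longrightarrow> 1 / Suc (g j) < - (a j \<bullet> z)" by metis
    define m where "m = Max (insert 0 (g ` (J - U)))"
    have "a j \<bullet> z + 1 / Suc m \<le> 0" if j: "j \<in> J - U" for j
    proof -
      have "g j \<le> m" unfolding m_def using fin j by (intro Max_ge) auto
      then have "1 / real (Suc m) \<le> 1 / Suc (g j)" by (intro divide_left_mono) auto
      then show ?thesis using g[OF j] by linarith
    qed
    then show ?thesis by blast
  qed
  then obtain m :: nat where m: "\<And>j. j \<in> J - U \<Longrightarrow> a j \<bullet> z + 1 / Suc m \<le> 0" by blast
  have "(\<Sum>j\<in>U. \<bar>a j \<bullet> z\<bar>) = 0" using zU by simp
  moreover have "(\<Sum>j\<in>J - U. max 0 (a j \<bullet> z + 1 / Suc m)) = 0" by (intro sum.neutral ballI max.absorb1 m)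
  ultimately show "\<exists>m::nat. \<exists>z\<in>cball 0 1. (\<Sum>j\<in>U. \<bar>a j \<bullet> z\<bar>) + (\<Sum>j\<in>J - U. max 0 (a j \<bullet> z + 1 / Suc m)) \<le> 0"
    using nz by (intro exI[of _ m] bexI[of _ z]) auto
next
  assume "\<exists>m::nat. \<exists>z\<in>cball 0 1. (\<Sum>j\<in>U. \<bar>a j \<bullet> z\<bar>) + (\<Sum>j\<in>J - U. max 0 (a j \<bullet> z + 1 / Suc m)) \<le> 0"
  then obtain m :: nat and z where z: "(\<Sum>j\<in>U. \<bar>a j \<bullet> z\<bar>) + (\<Sum>j\<in>J - U. max 0 (a j \<bullet> z + 1 / Suc m)) \<le> 0" by blast
  have s: "(\<Sum>j\<in>U. \<bar>a j \<bullet> z\<bar>) \<ge> 0" "(\<Sum>j\<in>J - U. max 0 (a j \<bullet> z + 1 / Suc m)) \<ge> 0"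
    by (intro sum_nonneg; simp)+
  then have "(\<Sum>j\<in>U. \<bar>a j \<bullet> z\<bar>) = 0" "(\<Sum>j\<in>J - U. max 0 (a j \<bullet> z + 1 / Suc m)) = 0" using z by linarith+
  then have U0: "\<forall>j\<in>U. \<bar>a j \<bullet> z\<bar> = 0" and J0: "\<forall>j\<in>J - U. max 0 (a j \<bullet> z + 1 / Suc m) = 0"
    using fin U finite_subset[OF U fin] by (subst (asm) sum_nonneg_eq_0_iff; auto)+
  have "a j \<bullet> z < 0" if "j \<in> J - U" for j
  proof -
    have "a j \<bullet> z + 1 / Suc m \<le> 0" using J0 that by (metis max.cobounded2)
    moreover have "1 / real (Suc m) > 0" by simp
    ultimately show ?thesis by linarith
  qed
  then have "z \<in> open_face J a U" using U0 by (simp add: open_face_def tight_flat_def)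
  then show "open_face J a U \<noteq> {}" by blast
qed

lemma sets_open_face:
  fixes a :: "'i \<Rightarrow> 'w \<Rightarrow> 'a::euclidean_space"
  assumes fin: "finite J" and U: "U \<subseteq> J" and a: "\<And>j. j \<in> J \<Longrightarrow> a j \<in> borel_measurable M"
  shows "{\<omega> \<in> space M. open_face J (\<lambda>j. a j \<omega>) U \<noteq> {}} \<in> sets M"
proof -
  have "{\<omega> \<in> space M. \<exists>z\<in>cball 0 1. (\<Sum>j\<in>U. \<bar>a j \<omega> \<bullet> z\<bar>) + (\<Sum>j\<in>J - U. max 0 (a j \<omega> \<bullet> z + 1 / Suc m)) \<le> 0} \<in> sets M" for m :: nat
  proof (rule sets_ex_compact)
    show "(\<lambda>\<omega>. (\<Sum>j\<in>U. \<bar>a j \<omega> \<bullet> z\<bar>) + (\<Sum>j\<in>J - U. max 0 (a j \<omega> \<bullet> z + 1 / Suc m))) \<in> borel_measurable M" for z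
      using a U by (intro borel_measurable_add borel_measurable_sum borel_measurable_abs borel_measurable_max borel_measurable_inner borel_measurable_const) auto
  qed (auto intro!: continuous_intros)
  then have "(\<Union>m::nat. {\<omega> \<in> space M. \<exists>z\<in>cball 0 1. (\<Sum>j\<in>U. \<bar>a j \<omega> \<bullet> z\<bar>) + (\<Sum>j\<in>J - U. max 0 (a j \<omega> \<bullet> z + 1 / Suc m)) \<le> 0}) \<in> sets M"
    by blast
  also have "(\<Union>m::nat. {\<omega> \<in> space M. \<exists>z\<in>cball 0 1. (\<Sum>j\<in>U. \<bar>a j \<omega> \<bullet> z\<bar>) + (\<Sum>j\<in>J - U. max 0 (a j \<omega> \<bullet> z + 1 / Suc m)) \<le> 0})
     = {\<omega> \<in> space M. open_face J (\<lambda>j. a j \<omega>) U \<noteq> {}}"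
    unfolding open_face_nonempty_iff[OF fin U] by auto
  finally show ?thesis .
qed

text \<open>An orthonormal family indexed by \<open>B\<close>, packed into one vector so that the
  families form a compact subset of a Euclidean space; the entries outside \<open>B\<close> are set
  to zero to keep it bounded.\<close>

definition orthonormal_frames :: "'n set \<Rightarrow> ('a::euclidean_space ^ 'n::finite) set" where
  "orthonormal_frames B = {Z. (\<forall>i\<in>B. \<forall>j\<in>B. Z $ i \<bullet> Z $ j = (if i = j then 1 else 0)) \<and> (\<forall>i. i \<notin> B \<longrightarrow> Z $ i = 0)}"

lemma compact_orthonormal_frames: "compact (orthonormal_frames B :: ('a::euclidean_space ^ 'n::finite) set)"
proof -
  have "orthonormal_frames B = (\<Inter>i\<in>B. \<Inter>j\<in>B. {Z :: 'a ^ 'n. Z $ i \<bullet> Z $ j = (if i = j then 1 else 0)}) \<inter> (\<Inter>i\<in>- B. {Z. Z $ i = 0})"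
    by (auto simp: orthonormal_frames_def)
  then have "closed (orthonormal_frames B :: ('a ^ 'n) set)"
    by (auto intro!: closed_Int closed_INT closed_Collect_eq continuous_intros)
  moreover have "bounded (orthonormal_frames B :: ('a ^ 'n) set)"
  proof -
    have "norm Z \<le> CARD('n)" if "Z \<in> orthonormal_frames B" for Z :: "'a ^ 'n"
    proof -
      have "norm (Z $ i) \<le> 1" for i using that by (cases "i \<in> B") (auto simp: orthonormal_frames_def norm_eq_sqrt_inner)
      then have "(\<Sum>i\<in>UNIV. norm (Z $ i)) \<le> (\<Sum>i\<in>(UNIV :: 'n set). 1)" by (intro sum_mono)
      moreover have "norm Z \<le> (\<Sum>i\<in>UNIV. norm (Z $ i))" unfolding norm_vec_def by (intro L2_set_le_sum) simp
      ultimately show ?thesis by simp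
    qed
    then show ?thesis by (auto simp: bounded_iff)
  qed
  ultimately show ?thesis by (simp add: compact_eq_bounded_closed)
qed

text \<open>A subspace has dimension at least \<open>card B\<close> iff it contains an orthonormal
  family of that size. This expresses dimension by an existential over a compact set.\<close>

lemma dim_tight_flat_ge_iff:
  fixes a :: "'i \<Rightarrow> 'a::euclidean_space" and B :: "'n::finite set"
  assumes fin: "finite U"
  shows "card B \<le> dim (tight_flat a U) \<longleftrightarrow> (\<exists>Z\<in>orthonormal_frames B. (\<Sum>j\<in>U. \<Sum>i\<in>UNIV. \<bar>a j \<bullet> Z $ i\<bar>) \<le> 0)"
proof
  assume le: "card B \<le> dim (tight_flat a U)"
  obtain C where C: "C \<subseteq> tight_flat a U" "pairwise orthogonal C" "\<And>x. x \<in> C \<Longrightarrow> norm x = 1" "independent C" "card C = dim (tight_flat a U)"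
    using orthonormal_basis_subspace[OF subspace_tight_flat, of a U] by metis
  have "finite C" using C(4) independent_imp_finite by blast
  then obtain g where g: "inj_on g B" "g ` B \<subseteq> C" using le C(5) card_le_inj[of B C] by auto
  define Z :: "'a ^ 'n" where "Z = (\<chi> i. if i \<in> B then g i else 0)"
  have "g i \<bullet> g j = (if i = j then 1 else 0)" if "i \<in> B" "j \<in> B" for i j
  proof (cases "i = j")
    case True
    then show ?thesis using C(3)[of "g i"] g(2) that by (auto simp: norm_eq_1)
  next
    case False
    then have "g i \<noteq> g j" using g(1) that by (auto dest: inj_onD)
    moreover have "g i \<in> C" "g j \<in> C" using g(2) that by auto
    ultimately show ?thesis using C(2) False by (auto simp: pairwise_def orthogonal_def)
  qed
  then have "Z \<in> orthonormal_frames B" by (simp add: orthonormal_frames_def Z_def)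
  moreover have "a j \<bullet> Z $ i = 0" if "j \<in> U" for i j
  proof (cases "i \<in> B")
    case True
    then have "g i \<in> tight_flat a U" using C(1) g(2) by auto
    then show ?thesis using True that by (simp add: Z_def tight_flat_def)
  qed (simp add: Z_def)
  then have "(\<Sum>j\<in>U. \<Sum>i\<in>UNIV. \<bar>a j \<bullet> Z $ i\<bar>) \<le> 0" by simp
  ultimately show "\<exists>Z\<in>orthonormal_frames B. (\<Sum>j\<in>U. \<Sum>i\<in>UNIV. \<bar>a j \<bullet> Z $ i\<bar>) \<le> 0" by blast
next
  assume "\<exists>Z\<in>orthonormal_frames B. (\<Sum>j\<in>U. \<Sum>i\<in>UNIV. \<bar>a j \<bullet> Z $ i\<bar>) \<le> 0"
  then obtain Z :: "'a ^ 'n" where Z: "Z \<in> orthonormal_frames B" "(\<Sum>j\<in>U. \<Sum>i\<in>UNIV. \<bar>a j \<bullet> Z $ i\<bar>) \<le> 0" by blast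
  have "(\<Sum>j\<in>U. \<Sum>i\<in>UNIV. \<bar>a j \<bullet> Z $ i\<bar>) \<ge> 0" by (intro sum_nonneg) simp
  then have "(\<Sum>j\<in>U. \<Sum>i\<in>UNIV. \<bar>a j \<bullet> Z $ i\<bar>) = 0" using Z(2) by linarith
  then have "\<forall>j\<in>U. (\<Sum>i\<in>UNIV. \<bar>a j \<bullet> Z $ i\<bar>) = 0" using fin by (subst (asm) sum_nonneg_eq_0_iff) (auto intro: sum_nonneg)
  then have a0: "a j \<bullet> Z $ i = 0" if "j \<in> U" for i j
    using that sum_nonneg_eq_0_iff[of UNIV "\<lambda>i. \<bar>a j \<bullet> Z $ i\<bar>"] by auto
  have ip: "Z $ i \<bullet> Z $ j = (if i = j then 1 else 0)" if "i \<in> B" "j \<in> B" for i j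
    using Z(1) that by (simp add: orthonormal_frames_def)
  have inj: "inj_on (\<lambda>i. Z $ i) B"
  proof (rule inj_onI)
    fix i j assume "i \<in> B" "j \<in> B" "Z $ i = Z $ j"
    then show "i = j" using ip[of i j] ip[of i i] by (metis zero_neq_one)
  qed
  have "independent ((\<lambda>i. Z $ i) ` B)"
  proof (rule pairwise_orthogonal_independent)
    show "pairwise orthogonal ((\<lambda>i. Z $ i) ` B)"
      unfolding pairwise_def orthogonal_def
    proof (intro ballI impI)
      fix x y assume "x \<in> (\<lambda>i. Z $ i) ` B" "y \<in> (\<lambda>i. Z $ i) ` B" "x \<noteq> y"
      then obtain i j where "i \<in> B" "j \<in> B" "i \<noteq> j" "x = Z $ i" "y = Z $ j" by auto
      then show "x \<bullet> y = 0" using ip[of i j] by simp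
    qed
    show "0 \<notin> (\<lambda>i. Z $ i) ` B"
    proof
      assume "0 \<in> (\<lambda>i. Z $ i) ` B"
      then obtain i where "i \<in> B" "Z $ i = 0" by auto
      then show False using ip[of i i] by simp
    qed
  qed
  moreover have "(\<lambda>i. Z $ i) ` B \<subseteq> tight_flat a U" using a0 by (auto simp: tight_flat_def)
  ultimately have "card ((\<lambda>i. Z $ i) ` B) \<le> dim (tight_flat a U)" by (intro independent_card_le_dim) auto
  then show "card B \<le> dim (tight_flat a U)" by (simp add: card_image[OF inj])
qed

lemma sets_dim_tight_flat_ge:
  fixes a :: "'i \<Rightarrow> 'w \<Rightarrow> real^4"
  assumes fin: "finite U" and a: "\<And>j. j \<in> U \<Longrightarrow> a j \<in> borel_measurable M"
  shows "{\<omega> \<in> space M. d \<le> dim (tight_flat (\<lambda>j. a j \<omega>) U)} \<in> sets M"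
proof (cases "d \<le> 4")
  case True
  \<comment> \<open>Only the size of \<open>B\<close> matters; the index type \<open>4\<close> has
    room for every \<open>d\<close> up to the dimension.\<close>
  then obtain B :: "4 set" where B: "card B = d" using obtain_subset_with_card_n[of d "UNIV :: 4 set"] by auto
  have "{\<omega> \<in> space M. \<exists>Z\<in>orthonormal_frames B. (\<Sum>j\<in>U. \<Sum>i\<in>UNIV. \<bar>a j \<omega> \<bullet> Z $ i\<bar>) \<le> 0} \<in> sets M"
  proof (rule sets_ex_compact[OF compact_orthonormal_frames])
    show "(\<lambda>\<omega>. \<Sum>j\<in>U. \<Sum>i\<in>UNIV. \<bar>a j \<omega> \<bullet> Z $ i\<bar>) \<in> borel_measurable M" for Z :: "(real^4)^4"
      using a by (intro borel_measurable_sum borel_measurable_abs borel_measurable_inner borel_measurable_const) auto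
    show "continuous_on (orthonormal_frames B) (\<lambda>Z :: (real^4)^4. \<Sum>j\<in>U. \<Sum>i\<in>UNIV. \<bar>a j \<omega> \<bullet> Z $ i\<bar>)" for \<omega>
      by (intro continuous_intros)
  qed
  then show ?thesis unfolding dim_tight_flat_ge_iff[OF fin, symmetric] B .
next
  case False
  have "dim (tight_flat (\<lambda>j. a j \<omega>) U) \<le> 4" for \<omega> using dim_subset_UNIV[of "tight_flat (\<lambda>j. a j \<omega>) U"] by simp
  then have "{\<omega> \<in> space M. d \<le> dim (tight_flat (\<lambda>j. a j \<omega>) U)} = {}" using False order_trans by fastforce
  then show ?thesis by (simp only: sets.empty_sets)
qed

lemma sets_dim_tight_flat:
  fixes a :: "'i \<Rightarrow> 'w \<Rightarrow> real^4"
  assumes fin: "finite U" and a: "\<And>j. j \<in> U \<Longrightarrow> a j \<in> borel_measurable M"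
  shows "{\<omega> \<in> space M. dim (tight_flat (\<lambda>j. a j \<omega>) U) = d} \<in> sets M"
proof -
  have "{\<omega> \<in> space M. dim (tight_flat (\<lambda>j. a j \<omega>) U) = d} =
    {\<omega> \<in> space M. d \<le> dim (tight_flat (\<lambda>j. a j \<omega>) U)} - {\<omega> \<in> space M. Suc d \<le> dim (tight_flat (\<lambda>j. a j \<omega>) U)}" by auto
  then show ?thesis using sets_dim_tight_flat_ge[OF assms] by auto
qed

text \<open>Face numbers are finite sums of indicators over index sets. The description by open
  faces and dimensions holds for every configuration, degenerate ones included.\<close>

lemma measurable_f_num:
  fixes a :: "'i \<Rightarrow> 'w \<Rightarrow> real^4"
  assumes fin: "finite J" and a: "\<And>j. j \<in> J \<Longrightarrow> a j \<in> borel_measurable M"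
  shows "(\<lambda>\<omega>. real (f_num k (normal_cone J (\<lambda>j. a j \<omega>) \<inter> sphere 0 1))) \<in> borel_measurable M"
proof -
  let ?P = "\<lambda>U. {\<omega> \<in> space M. open_face J (\<lambda>j. a j \<omega>) U \<noteq> {}} \<inter> {\<omega> \<in> space M. dim (tight_flat (\<lambda>j. a j \<omega>) U) = k + 1}"
  have P: "?P U \<in> sets M" if "U \<in> Pow J" for U
    using that a finite_subset[OF _ fin] by (intro sets.Int sets_open_face[OF fin] sets_dim_tight_flat) auto
  have "real (f_num k (normal_cone J (\<lambda>j. a j \<omega>) \<inter> sphere 0 1)) = (\<Sum>U\<in>Pow J. indicator (?P U) \<omega>)" if "\<omega> \<in> space M" for \<omega>
  proof -
    have "(\<Sum>U\<in>Pow J. indicator (?P U) \<omega> :: real) = (\<Sum>U\<in>Pow J. if open_face J (\<lambda>j. a j \<omega>) U \<noteq> {} \<and> dim (tight_flat (\<lambda>j. a j \<omega>) U) = k + 1 then 1 else 0)"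
      using that by (intro sum.cong) (auto simp: indicator_def)
    also have "\<dots> = card {U \<in> Pow J. open_face J (\<lambda>j. a j \<omega>) U \<noteq> {} \<and> dim (tight_flat (\<lambda>j. a j \<omega>) U) = k + 1}"
      using fin by (subst sum.If_cases) (auto simp: Int_def)
    finally show ?thesis unfolding f_num_normal_cone[OF fin] by (simp add: Pow_def)
  qed
  then show ?thesis using P by (subst measurable_cong) (auto intro!: borel_measurable_sum borel_measurable_indicator)
qed

lemma dim_tight_flat_insert:
  fixes a :: "'i \<Rightarrow> 'a::euclidean_space"
  assumes n: "n \<in> tight_flat a T" "a j \<bullet> n \<noteq> 0"
  shows "Suc (dim (tight_flat a (insert j T))) = dim (tight_flat a T)"
proof -
  have "a j \<notin> span (a ` T)"
  proof
    assume "a j \<in> span (a ` T)"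
    then have "orthogonal n (a j)"
      using n(1) by (intro orthogonal_to_span[of "a j" "a ` T"]) (auto simp: tight_flat_def orthogonal_def inner_commute)
    then show False using n(2) by (simp add: orthogonal_def inner_commute)
  qed
  then have "dim (a ` insert j T) = Suc (dim (a ` T))" by (simp add: dim_insert)
  then show ?thesis using dim_tight_flat[of a T] dim_tight_flat[of a "insert j T"] by linarith
qed

text \<open>Replaces independence by dimensions of flats, for which measurability is
  available.\<close>

lemma in_general_position_dim:
  fixes a :: "'i \<Rightarrow> 'a::euclidean_space"
  assumes d: "\<And>T. T \<subseteq> J \<Longrightarrow> finite T \<Longrightarrow> card T \<le> DIM('a) \<Longrightarrow> dim (tight_flat a T) = DIM('a) - card T"
  shows "in_general_position J a"
  unfolding in_general_position_def
proof (intro allI impI)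
  fix T assume T: "T \<subseteq> J" "finite T" "card T \<le> DIM('a)"
  then have dim: "dim (a ` T) = card T" using d[OF T] dim_tight_flat[of a T] by linarith
  have "dim (a ` T) \<le> card (a ` T)" using T(2) by (intro dim_le_card') simp
  then have c: "card (a ` T) = card T" using dim card_image_le[OF T(2), of a] by simp
  then have "inj_on a T" using T(2) by (simp add: eq_card_imp_inj_on)
  moreover have "independent (a ` T)"
    using T(2) dim c by (intro card_le_dim_spanning[of "a ` T" "a ` T"]) (auto intro: span_base)
  ultimately show "inj_on a T \<and> independent (a ` T)" by blast
qed

section \<open>Random configurations on the sphere\<close>

abbreviation config_law :: "'i set \<Rightarrow> ('i \<Rightarrow> real^4) measure" where
  "config_law I \<equiv> PiM I (\<lambda>_. sphere_law)"

lemma product_sigma_finite_sphere_law: "product_sigma_finite (\<lambda>_. sphere_law :: (real^4) measure)"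
  unfolding product_sigma_finite_def by (intro allI prob_space_imp_sigma_finite prob_space_sphere_law)

lemma measurable_config_diff:
  "j \<in> I \<Longrightarrow> i \<in> I \<Longrightarrow> (\<lambda>x. x j - x i) \<in> borel_measurable (config_law I)"
  by (intro borel_measurable_diff; rule measurable_compose[OF measurable_component_singleton]) (auto cong: measurable_cong_sets)

text \<open>Induction on \<open>T\<close>: with all other points fixed, the new point
  \<open>x j\<close> fails to lower the dimension only if it lies on a certain hyperplane through
  \<open>x i\<close>, and hyperplanes are null for the spherical law.\<close>

lemma AE_dim_tight_flat:
  assumes I: "finite I" "i \<in> I"
  shows "finite T \<Longrightarrow> T \<subseteq> I - {i} \<Longrightarrow> card T \<le> 4 \<Longrightarrow> AE x in config_law I. dim (tight_flat (\<lambda>j. x j - x i) T) = 4 - card T"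
proof (induction T rule: finite_induct)
  case empty
  have "tight_flat a {} = (UNIV :: (real^4) set)" for a :: "'a \<Rightarrow> real^4" by (simp add: tight_flat_def)
  then show ?case by simp
next
  case (insert j T)
  interpret P: product_sigma_finite "\<lambda>_ :: 'a. sphere_law :: (real^4) measure" by (rule product_sigma_finite_sphere_law)
  let ?a = "\<lambda>x j. x j - x i :: real^4"
  let ?B = "{x \<in> space (config_law I). dim (tight_flat (?a x) T) = 4 - card T} - {x \<in> space (config_law I). dim (tight_flat (?a x) (insert j T)) = 4 - card (insert j T)}"
  define I' where "I' = I - {j}"
  have j: "j \<in> I" "j \<noteq> i" "j \<notin> T" using insert by auto
  have I': "finite I'" "j \<notin> I'" "I = insert j I'" using I j by (auto simp: I'_def)
  have B: "?B \<in> sets (config_law I)"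
    using insert I measurable_config_diff by (intro sets.Diff sets_dim_tight_flat) auto
  have "emeasure (config_law I) ?B = (\<integral>\<^sup>+x. indicator ?B x \<partial>config_law (insert j I'))"
    using B I'(3) by simp
  also have "\<dots> = (\<integral>\<^sup>+x. \<integral>\<^sup>+v. indicator ?B (x(j := v)) \<partial>sphere_law \<partial>config_law I')"
    using B I' by (intro P.product_nn_integral_insert) auto
  also have "\<dots> = (\<integral>\<^sup>+x. 0 \<partial>config_law I')"
  proof (rule nn_integral_cong)
    fix x :: "'a \<Rightarrow> real^4"
    \<comment> \<open>The resampled index \<open>j\<close> is neither \<open>i\<close> nor in
      \<open>T\<close>, so the flat of \<open>T\<close> does not move with \<open>v\<close>.\<close>
    have t: "tight_flat (?a (x(j := v))) T = tight_flat (?a x) T" for v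
      using j by (auto simp: tight_flat_def)
    have "AE v in sphere_law. (indicator ?B (x(j := v)) :: ennreal) = 0"
    proof (cases "dim (tight_flat (?a x) T) = 4 - card T")
      case True
      \<comment> \<open>Since the enlarged set still has at most four elements, the flat of
        \<open>T\<close> contains a nonzero vector; it serves as the normal of the hyperplane to
        avoid.\<close>
      have "card T \<le> 3" using insert by simp
      then have "dim (tight_flat (?a x) T) \<noteq> 0" using True by simp
      then obtain n where n: "n \<in> tight_flat (?a x) T" "n \<noteq> 0"
        using dim_eq_0[of "tight_flat (?a x) T"] by auto
      have "AE v in sphere_law. n \<bullet> v \<noteq> n \<bullet> x i" by (rule AE_sphere_law_hyperplane[OF n(2)])
      then show ?thesis
      proof eventually_elim
        case (elim v)
        have "?a (x(j := v)) j \<bullet> n \<noteq> 0" using elim j(2) by (simp add: inner_commute[of _ n] inner_diff_right)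
        then have "Suc (dim (tight_flat (?a (x(j := v))) (insert j T))) = 4 - card T"
          using dim_tight_flat_insert[of n "?a (x(j := v))" T j] n(1) True unfolding t by simp
        then have "dim (tight_flat (?a (x(j := v))) (insert j T)) = 4 - card (insert j T)" using insert j by simp
        then show ?case by (auto split: split_indicator)
      qed
    next
      case False
      then have "x(j := v) \<notin> ?B" for v using t by auto
      then show ?thesis by (intro AE_I2) (auto split: split_indicator)
    qed
    then show "(\<integral>\<^sup>+v. indicator ?B (x(j := v)) \<partial>sphere_law) = 0"
      using nn_integral_cong_AE by fastforce
  qed
  finally have "?B \<in> null_sets (config_law I)" using B by (simp add: null_sets_def)
  then have "AE x in config_law I. x \<notin> ?B" by (rule AE_not_in)
  moreover have "AE x in config_law I. dim (tight_flat (?a x) T) = 4 - card T" using insert by simp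
  ultimately show ?case using AE_space by eventually_elim blast
qed

lemma AE_general_position:
  assumes I: "finite I" "i \<in> I"
  shows "AE x in config_law I. in_general_position (I - {i}) (\<lambda>j. x j - x i)"
proof -
  have "AE x in config_law I. \<forall>T\<in>{T. T \<subseteq> I - {i} \<and> card T \<le> 4}. dim (tight_flat (\<lambda>j. x j - x i) T) = 4 - card T"
  proof (rule AE_finite_allI)
    show "finite {T. T \<subseteq> I - {i} \<and> card T \<le> 4}" by (rule finite_subset[of _ "Pow I"]) (use I in auto)
    show "AE x in config_law I. dim (tight_flat (\<lambda>j. x j - x i) T) = 4 - card T" if "T \<in> {T. T \<subseteq> I - {i} \<and> card T \<le> 4}" for T
      using that finite_subset[of T I] I by (intro AE_dim_tight_flat[OF I]) auto
  qed
  then show ?thesis by eventually_elim (auto intro!: in_general_position_dim)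
qed

section \<open>The event that a triple of neighbours yields a vertex\<close>

definition split_last :: "real^4 \<Rightarrow> pt" where
  "split_last v = (vector [v $ 2, v $ 3, v $ 4], v $ 1)"

lemma split_join_last: "split_last (join_last y) = y" "join_last (split_last v) = v"
proof -
  show "split_last (join_last y) = y"
    by (cases y) (simp add: split_last_def join_last_def vec_eq_iff forall_3)
  show "join_last (split_last v) = v"
    by (simp add: split_last_def join_last_def vec_eq_iff forall_4)
qed

lemma measurable_split_last [measurable]: "split_last \<in> borel_measurable borel"
proof -
  have "linear split_last"
    by (rule linearI) (simp_all add: split_last_def vec_eq_iff forall_3)
  then show ?thesis
    by (intro borel_measurable_continuous_onI linear_continuous_on) (simp add: linear_linear)
qed

lemma sphere_law_split_last: "distr sphere_law borel split_last = sphere_law"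
proof -
  have "distr sphere_law borel split_last = distr (distr sphere_law borel join_last) borel split_last"
    by (simp add: sphere_law_join_last(1))
  also have "\<dots> = distr sphere_law borel (split_last \<circ> join_last)"
    using sphere_law_join_last(2) by (intro distr_distr) auto
  also have "split_last \<circ> join_last = (\<lambda>x. x)" by (auto simp: split_join_last)
  also have "distr sphere_law borel (\<lambda>x. x) = sphere_law" by (intro distr_id2) simp
  finally show ?thesis .
qed

lemma AE_split_last: "AE y in sphere_law. P y \<Longrightarrow> AE v in sphere_law. P (split_last v)"
  by (rule AE_distrD[of split_last sphere_law borel], measurable) (subst sphere_law_split_last)

lemma nn_integral_split_last:
  "f \<in> borel_measurable borel \<Longrightarrow> (\<integral>\<^sup>+v. f (split_last v) \<partial>sphere_law) = (\<integral>\<^sup>+y. f y \<partial>sphere_law)"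
  using nn_integral_distr[of split_last sphere_law borel f] by (simp add: sphere_law_split_last)

definition plane_normal :: "pt quad \<Rightarrow> pt" where
  "plane_normal y = inverse (sqrt (1 + (norm (slope y))\<^sup>2)) *\<^sub>R (- slope y, 1)"

lemma norm_plane_normal: "norm (plane_normal y) = 1"
proof -
  have "norm (- slope y, 1 :: real) = sqrt (1 + (norm (slope y))\<^sup>2)" by (simp add: norm_Pair add.commute)
  moreover have "sqrt (1 + (norm (slope y))\<^sup>2) > 0" by (simp add: add_pos_nonneg)
  ultimately show ?thesis unfolding plane_normal_def norm_scaleR by simp
qed

lemma plane_normal_height: "plane_normal y \<bullet> fst y = plane_height y"
  by (simp add: plane_normal_def plane_height_def inner_prod_def divide_inverse left_diff_distrib mult.commute)

text \<open>The product of \<open>z\<close> with a difference of points equals the product of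
  \<open>fst z + snd z *\<^sub>R slope\<close> with the corresponding difference of base points.
  Three independent base differences force this vector to be zero, which leaves a line for
  \<open>z\<close>.\<close>

lemma orthogonal_differences_iff:
  assumes v: "proj_vol (y1, y2, y3, y4) \<noteq> 0"
  shows "(y2 - y1) \<bullet> z = 0 \<and> (y3 - y1) \<bullet> z = 0 \<and> (y4 - y1) \<bullet> z = 0 \<longleftrightarrow> (\<exists>c. z = c *\<^sub>R plane_normal (y1, y2, y3, y4))"
proof -
  obtain p1 t1 p2 t2 p3 t3 p4 t4 where y: "y1 = (p1, t1)" "y2 = (p2, t2)" "y3 = (p3, t3)" "y4 = (p4, t4)" by (metis surj_pair)
  let ?s = "slope (y1, y2, y3, y4)"
  let ?\<sigma> = "sqrt (1 + (norm ?s)\<^sup>2)"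
  have \<sigma>: "?\<sigma> > 0" by (simp add: add_pos_nonneg)
  define a b c where "a = p2 - p1" and "b = p3 - p1" and "c = p4 - p1"
  have D: "a \<bullet> cross3 b c \<noteq> 0" using v by (simp add: proj_vol_def y vol3_def a_def b_def c_def)
  have s: "?s = ((t2 - t1) *\<^sub>R cross3 b c + (t3 - t1) *\<^sub>R cross3 c a + (t4 - t1) *\<^sub>R cross3 a b) /\<^sub>R (a \<bullet> cross3 b c)"
    by (simp add: slope_def y vol3_def a_def b_def c_def)
  have cyc: "b \<bullet> cross3 c a = a \<bullet> cross3 b c" "c \<bullet> cross3 a b = a \<bullet> cross3 b c"
    "a \<bullet> cross3 c a = 0" "a \<bullet> cross3 a b = 0" "b \<bullet> cross3 b c = 0" "b \<bullet> cross3 a b = 0" "c \<bullet> cross3 b c = 0" "c \<bullet> cross3 c a = 0"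
    by (simp_all add: cross3_simps)
  have st: "a \<bullet> ?s = t2 - t1" "b \<bullet> ?s = t3 - t1" "c \<bullet> ?s = t4 - t1"
    unfolding s using D by (simp_all add: inner_add_right cyc)
  have d: "(y2 - y1) \<bullet> z = a \<bullet> (fst z + snd z *\<^sub>R ?s)" "(y3 - y1) \<bullet> z = b \<bullet> (fst z + snd z *\<^sub>R ?s)" "(y4 - y1) \<bullet> z = c \<bullet> (fst z + snd z *\<^sub>R ?s)"
    using st by (simp_all add: y inner_prod_def inner_add_right a_def b_def c_def)
  have zero: "w = 0" if "a \<bullet> w = 0" "b \<bullet> w = 0" "c \<bullet> w = 0" for w
  proof -
    have "(w \<bullet> a) *\<^sub>R cross3 b c + (w \<bullet> b) *\<^sub>R cross3 c a + (w \<bullet> c) *\<^sub>R cross3 a b = (a \<bullet> cross3 b c) *\<^sub>R w"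
      by (simp add: cross3_simps forall_3)
    then show ?thesis using that D by (simp add: inner_commute)
  qed
  have "(y2 - y1) \<bullet> z = 0 \<and> (y3 - y1) \<bullet> z = 0 \<and> (y4 - y1) \<bullet> z = 0 \<longleftrightarrow> fst z + snd z *\<^sub>R ?s = 0"
    unfolding d using zero by auto
  also have "\<dots> \<longleftrightarrow> z = snd z *\<^sub>R (- ?s, 1)"
    by (cases z) (auto simp: eq_neg_iff_add_eq_0)
  also have "\<dots> \<longleftrightarrow> (\<exists>c. z = c *\<^sub>R plane_normal (y1, y2, y3, y4))"
  proof
    assume "z = snd z *\<^sub>R (- ?s, 1)"
    also have "\<dots> = (snd z * ?\<sigma>) *\<^sub>R plane_normal (y1, y2, y3, y4)"
      using \<sigma> by (simp add: plane_normal_def)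
    finally show "\<exists>c. z = c *\<^sub>R plane_normal (y1, y2, y3, y4)" by blast
  next
    assume "\<exists>c. z = c *\<^sub>R plane_normal (y1, y2, y3, y4)"
    then obtain c where "z = (c * inverse ?\<sigma>) *\<^sub>R (- ?s, 1)" by (auto simp: plane_normal_def)
    then show "z = snd z *\<^sub>R (- ?s, 1)" by simp
  qed
  finally show ?thesis .
qed

text \<open>The tight constraints restrict \<open>z\<close> to multiples
  \<open>c *\<^sub>R \<nu>\<close> of the unit normal, and then
  \<open>(x j - v1) \<bullet> z = c * (\<nu> \<bullet> x j - h)\<close>. The sign of
  \<open>c\<close> selects the side on which all remaining points lie.\<close>

lemma vertex_event_iff:
  fixes R :: "'i set"
  assumes v: "proj_vol (split_last v1, split_last v2, split_last v3, split_last v4) \<noteq> 0" and R: "R \<noteq> {}"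
  defines "\<nu> \<equiv> join_last (plane_normal (split_last v1, split_last v2, split_last v3, split_last v4))"
    and "h \<equiv> plane_height (split_last v1, split_last v2, split_last v3, split_last v4)"
  shows "(\<exists>z. (v2 - v1) \<bullet> z = 0 \<and> (v3 - v1) \<bullet> z = 0 \<and> (v4 - v1) \<bullet> z = 0 \<and> (\<forall>j\<in>R. (x j - v1) \<bullet> z < 0))
    \<longleftrightarrow> (\<forall>j\<in>R. \<nu> \<bullet> x j < h) \<or> (\<forall>j\<in>R. \<nu> \<bullet> x j > h)"
proof -
  have lin: "(v - w) \<bullet> z = (split_last v - split_last w) \<bullet> split_last z" for v w z
  proof -
    have "(join_last (split_last v) - join_last (split_last w)) \<bullet> join_last (split_last z) = (split_last v - split_last w) \<bullet> split_last z"
      by (simp add: inner_diff_left inner_join_last)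
    then show ?thesis by (simp add: split_join_last)
  qed
  have "split_last z = c *\<^sub>R plane_normal (split_last v1, split_last v2, split_last v3, split_last v4) \<longleftrightarrow> z = c *\<^sub>R \<nu>" (is "split_last z = c *\<^sub>R ?N \<longleftrightarrow> _") for z c
  proof -
    have c: "join_last (c *\<^sub>R ?N) = c *\<^sub>R \<nu>" unfolding \<nu>_def by (rule linear_cmul[OF linear_join_last])
    show ?thesis
    proof
      assume "split_last z = c *\<^sub>R ?N"
      then have "join_last (split_last z) = c *\<^sub>R \<nu>" using c by simp
      then show "z = c *\<^sub>R \<nu>" by (simp only: split_join_last)
    next
      assume "z = c *\<^sub>R \<nu>"
      then show "split_last z = c *\<^sub>R ?N" by (simp only: c[symmetric] split_join_last)
    qed
  qed
  then have "(\<exists>c. split_last z = c *\<^sub>R plane_normal (split_last v1, split_last v2, split_last v3, split_last v4)) \<longleftrightarrow> (\<exists>c. z = c *\<^sub>R \<nu>)" for z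
    by blast
  then have orth: "(v2 - v1) \<bullet> z = 0 \<and> (v3 - v1) \<bullet> z = 0 \<and> (v4 - v1) \<bullet> z = 0 \<longleftrightarrow> (\<exists>c. z = c *\<^sub>R \<nu>)" for z
    unfolding lin orthogonal_differences_iff[OF v] .
  have h: "\<nu> \<bullet> v1 = h"
  proof -
    have "\<nu> \<bullet> v1 = \<nu> \<bullet> join_last (split_last v1)" by (simp add: split_join_last)
    then show ?thesis
      using plane_normal_height[of "(split_last v1, split_last v2, split_last v3, split_last v4)"]
      by (simp add: \<nu>_def h_def inner_join_last)
  qed
  have e: "(x j - v1) \<bullet> (c *\<^sub>R \<nu>) = c * (\<nu> \<bullet> x j - h)" for c j
    using h by (simp add: inner_commute[of _ \<nu>] inner_diff_right)
  have "(\<exists>z. (v2 - v1) \<bullet> z = 0 \<and> (v3 - v1) \<bullet> z = 0 \<and> (v4 - v1) \<bullet> z = 0 \<and> (\<forall>j\<in>R. (x j - v1) \<bullet> z < 0))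
      \<longleftrightarrow> (\<exists>z. (\<exists>c. z = c *\<^sub>R \<nu>) \<and> (\<forall>j\<in>R. (x j - v1) \<bullet> z < 0))"
    using orth by blast
  also have "\<dots> \<longleftrightarrow> (\<exists>c. \<forall>j\<in>R. c * (\<nu> \<bullet> x j - h) < 0)" 
  proof
    assume "\<exists>z. (\<exists>c. z = c *\<^sub>R \<nu>) \<and> (\<forall>j\<in>R. (x j - v1) \<bullet> z < 0)"
    then obtain c where "\<forall>j\<in>R. (x j - v1) \<bullet> (c *\<^sub>R \<nu>) < 0" by blast
    then show "\<exists>c. \<forall>j\<in>R. c * (\<nu> \<bullet> x j - h) < 0" unfolding e by blast
  next
    assume "\<exists>c. \<forall>j\<in>R. c * (\<nu> \<bullet> x j - h) < 0"
    then obtain c where "\<forall>j\<in>R. (x j - v1) \<bullet> (c *\<^sub>R \<nu>) < 0" unfolding e by blast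
    then show "\<exists>z. (\<exists>c. z = c *\<^sub>R \<nu>) \<and> (\<forall>j\<in>R. (x j - v1) \<bullet> z < 0)" by blast
  qed
  also have "\<dots> \<longleftrightarrow> (\<forall>j\<in>R. \<nu> \<bullet> x j < h) \<or> (\<forall>j\<in>R. \<nu> \<bullet> x j > h)"
  proof
    assume "\<exists>c. \<forall>j\<in>R. c * (\<nu> \<bullet> x j - h) < 0"
    then obtain c where c: "\<And>j. j \<in> R \<Longrightarrow> c * (\<nu> \<bullet> x j - h) < 0" by blast
    show "(\<forall>j\<in>R. \<nu> \<bullet> x j < h) \<or> (\<forall>j\<in>R. \<nu> \<bullet> x j > h)"
    proof (cases "c > 0")
      case True
      then show ?thesis using c by (auto simp: mult_less_0_iff)
    next
      case False
      then show ?thesis using c by (auto simp: mult_less_0_iff)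
    qed
  next
    assume "(\<forall>j\<in>R. \<nu> \<bullet> x j < h) \<or> (\<forall>j\<in>R. \<nu> \<bullet> x j > h)"
    then show "\<exists>c. \<forall>j\<in>R. c * (\<nu> \<bullet> x j - h) < 0"
    proof
      assume "\<forall>j\<in>R. \<nu> \<bullet> x j < h"
      then show ?thesis by (intro exI[of _ 1]) auto
    next
      assume "\<forall>j\<in>R. \<nu> \<bullet> x j > h"
      then show ?thesis by (intro exI[of _ "-1"]) auto
    qed
  qed
  finally show ?thesis .
qed

text \<open>The event is a union of two product sets of caps, disjoint because \<open>R\<close> has
  an element; independence turns each into a power.\<close>

lemma emeasure_one_sided:
  fixes \<nu> :: "real^4" and R :: "'i set"
  assumes R: "finite R" "R \<noteq> {}" and \<nu>: "norm \<nu> = 1"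
  shows "emeasure (config_law R) {x \<in> space (config_law R). (\<forall>j\<in>R. \<nu> \<bullet> x j < h) \<or> (\<forall>j\<in>R. \<nu> \<bullet> x j > h)}
    = ennreal (cap_fraction h ^ card R + (1 - cap_fraction h) ^ card R)"
proof -
  interpret P: product_sigma_finite "\<lambda>_ :: 'i. sphere_law :: (real^4) measure" by (rule product_sigma_finite_sphere_law)
  let ?A = "Pi\<^sub>E R (\<lambda>_. {v. \<nu> \<bullet> v < h})" and ?B = "Pi\<^sub>E R (\<lambda>_. {v. \<nu> \<bullet> v > h})"
  have b: "{v. \<nu> \<bullet> v < h} \<in> sets sphere_law" "{v. \<nu> \<bullet> v > h} \<in> sets sphere_law" by simp_all
  have "{x \<in> space (config_law R). (\<forall>j\<in>R. \<nu> \<bullet> x j < h) \<or> (\<forall>j\<in>R. \<nu> \<bullet> x j > h)} = ?A \<union> ?B"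
    by (auto simp: space_PiM PiE_def)
  moreover have "?A \<inter> ?B = {}"
  proof (rule equals0I)
    obtain j where "j \<in> R" using R by blast
    fix x assume "x \<in> ?A \<inter> ?B"
    then have "\<nu> \<bullet> x j < h" "\<nu> \<bullet> x j > h" using \<open>j \<in> R\<close> by (auto simp: PiE_iff)
    then show False by simp
  qed
  moreover have "?A \<in> sets (config_law R)" "?B \<in> sets (config_law R)" using R b by (auto intro!: sets_PiM_I_finite)
  moreover have "emeasure (config_law R) ?A = ennreal (cap_fraction h) ^ card R" "emeasure (config_law R) ?B = ennreal (1 - cap_fraction h) ^ card R"
    using R b by (simp_all add: P.emeasure_PiM measure_cap[OF \<nu>])
  ultimately show ?thesis
    using cap_fraction_bounds[of h] by (simp add: plus_emeasure[symmetric] ennreal_power flip: ennreal_plus)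
qed

text \<open>The coordinates \<open>i\<close>, \<open>a\<close>, \<open>b\<close>, \<open>c\<close>
  are integrated outermost. For fixed values with nonzero \<open>proj_vol\<close> the inner integral
  over the remaining points is the one-sided probability, which depends on the four points only
  through the height.\<close>

lemma emeasure_vertex_event:
  fixes I :: "'i set"
  assumes I: "finite I" "i \<in> I" and S: "S \<subseteq> I - {i}" "card S = 3" and R: "I - {i} - S \<noteq> {}"
  shows "emeasure (config_law I) {x \<in> space (config_law I). open_face (I - {i}) (\<lambda>j. x j - x i) S \<noteq> {}}
    = ennreal (256 / (35 * pi) * (1 / (2 * pi)) ^ card (I - {i} - S) * vertex_integral (card (I - {i} - S)))"
proof -
  interpret P: product_sigma_finite "\<lambda>_ :: 'i. sphere_law :: (real^4) measure" by (rule product_sigma_finite_sphere_law)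
  obtain a b c where abc: "S = {a, b, c}" "a \<noteq> b" "a \<noteq> c" "b \<noteq> c" using S(2) by (auto simp: card_3_iff)
  define R where "R = I - {i} - S"
  have finR: "finite R" and R0: "R \<noteq> {}" using I R by (auto simp: R_def)
  have ins: "I = insert i (insert a (insert b (insert c R)))" using S I abc by (auto simp: R_def)
  have nin: "i \<notin> insert a (insert b (insert c R))" "a \<notin> insert b (insert c R)" "b \<notin> insert c R" "c \<notin> R"
    using S abc by (auto simp: R_def)
  let ?E = "{x \<in> space (config_law I). open_face (I - {i}) (\<lambda>j. x j - x i) S \<noteq> {}}"
  let ?ind = "indicator ?E :: _ \<Rightarrow> ennreal"
  have E: "?E \<in> sets (config_law I)"
    using I S measurable_config_diff by (intro sets_open_face) auto
  have upd: "(\<lambda>x. x(j := v)) \<in> config_law J \<rightarrow>\<^sub>M config_law (insert j J)" for j :: 'i and v J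
    by (rule measurable_fun_upd[of _ J]) auto
  have m1: "(\<lambda>x. ?ind (x(i := v1))) \<in> borel_measurable (config_law (insert a (insert b (insert c R))))" for v1
    using measurable_compose[OF upd borel_measurable_indicator[OF E[unfolded ins]]] by (simp add: ins)
  have m2: "(\<lambda>x. ?ind (x(a := v2, i := v1))) \<in> borel_measurable (config_law (insert b (insert c R)))" for v1 v2
    using measurable_compose[OF upd m1] by simp
  have m3: "(\<lambda>x. ?ind (x(b := v3, a := v2, i := v1))) \<in> borel_measurable (config_law (insert c R))" for v1 v2 v3
    using measurable_compose[OF upd m2] by simp
  have "emeasure (config_law I) ?E = (\<integral>\<^sup>+x. ?ind x \<partial>config_law I)" using E by simp
  also have "\<dots> = (\<integral>\<^sup>+v1. \<integral>\<^sup>+x. ?ind (x(i := v1)) \<partial>config_law (insert a (insert b (insert c R))) \<partial>sphere_law)"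
    unfolding ins using E finR nin by (intro P.product_nn_integral_insert_rev) (auto simp: ins)
  also have "\<dots> = (\<integral>\<^sup>+v1. \<integral>\<^sup>+v2. \<integral>\<^sup>+x. ?ind (x(a := v2, i := v1)) \<partial>config_law (insert b (insert c R)) \<partial>sphere_law \<partial>sphere_law)"
    using finR nin by (intro nn_integral_cong P.product_nn_integral_insert_rev m1) auto
  also have "\<dots> = (\<integral>\<^sup>+v1. \<integral>\<^sup>+v2. \<integral>\<^sup>+v3. \<integral>\<^sup>+x. ?ind (x(b := v3, a := v2, i := v1)) \<partial>config_law (insert c R) \<partial>sphere_law \<partial>sphere_law \<partial>sphere_law)"
    using finR nin by (intro nn_integral_cong P.product_nn_integral_insert_rev m2) auto
  also have "\<dots> = nn_integral4 sphere_law (\<lambda>v1 v2 v3 v4. \<integral>\<^sup>+x. ?ind (x(c := v4, b := v3, a := v2, i := v1)) \<partial>config_law R)"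
    using finR nin by (intro nn_integral_cong P.product_nn_integral_insert_rev m3) auto
  also have "\<dots> = nn_integral4 sphere_law (\<lambda>v1 v2 v3 v4. ennreal (cap_fraction (plane_height (split_last v1, split_last v2, split_last v3, split_last v4)) ^ card R
      + (1 - cap_fraction (plane_height (split_last v1, split_last v2, split_last v3, split_last v4))) ^ card R))"
    (is "nn_integral4 sphere_law ?A
      = nn_integral4 sphere_law ?B")
  proof -
    have main: "?A v1 v2 v3 v4 = ?B v1 v2 v3 v4"
      if v: "proj_vol (split_last v1, split_last v2, split_last v3, split_last v4) \<noteq> 0" for v1 v2 v3 v4
    proof -
      let ?\<nu> = "join_last (plane_normal (split_last v1, split_last v2, split_last v3, split_last v4))"
      let ?h = "plane_height (split_last v1, split_last v2, split_last v3, split_last v4)"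
      let ?C = "{x \<in> space (config_law R). (\<forall>j\<in>R. ?\<nu> \<bullet> x j < ?h) \<or> (\<forall>j\<in>R. ?\<nu> \<bullet> x j > ?h)}"
      have iff: "x(c := v4, b := v3, a := v2, i := v1) \<in> ?E \<longleftrightarrow> x \<in> ?C" if x: "x \<in> space (config_law R)" for x
      proof -
        let ?x = "x(c := v4, b := v3, a := v2, i := v1)"
        have sp: "?x \<in> space (config_law I)" using x by (auto simp: space_PiM ins PiE_iff extensional_def)
        have val: "?x i = v1" "?x a = v2" "?x b = v3" "?x c = v4" "\<And>j. j \<in> R \<Longrightarrow> ?x j = x j"
          using nin by auto
        have "I - {i} - S = R" by (simp add: R_def)
        then have "open_face (I - {i}) (\<lambda>j. ?x j - ?x i) S \<noteq> {} \<longleftrightarrow>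
          (\<exists>z. (v2 - v1) \<bullet> z = 0 \<and> (v3 - v1) \<bullet> z = 0 \<and> (v4 - v1) \<bullet> z = 0 \<and> (\<forall>j\<in>R. (x j - v1) \<bullet> z < 0))"
          unfolding open_face_def tight_flat_def abc(1) using val by auto
        also have "\<dots> \<longleftrightarrow> (\<forall>j\<in>R. ?\<nu> \<bullet> x j < ?h) \<or> (\<forall>j\<in>R. ?\<nu> \<bullet> x j > ?h)"
          by (rule vertex_event_iff[OF v R0])
        finally show ?thesis using sp x by simp
      qed
      have C: "?C \<in> sets (config_law R)"
      proof -
        have [measurable]: "(\<lambda>x. ?\<nu> \<bullet> x j) \<in> borel_measurable (config_law R)" if "j \<in> R" for j
          using that by (intro borel_measurable_inner borel_measurable_const measurable_compose[OF measurable_component_singleton])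
            (auto cong: measurable_cong_sets)
        show ?thesis using finR by measurable
      qed
      have "?A v1 v2 v3 v4 = (\<integral>\<^sup>+x. indicator ?C x \<partial>config_law R)"
        using iff by (intro nn_integral_cong) (auto split: split_indicator)
      also have "\<dots> = emeasure (config_law R) ?C" using C by simp
      also have "\<dots> = ?B v1 v2 v3 v4"
        by (rule emeasure_one_sided[OF finR R0]) (simp add: norm_join_last norm_plane_normal)
      finally show ?thesis .
    qed
    have ae: "AE v1 in sphere_law. AE v2 in sphere_law. AE v3 in sphere_law. AE v4 in sphere_law.
        proj_vol (split_last v1, split_last v2, split_last v3, split_last v4) \<noteq> 0"
    proof -
      have "AE y1 in sphere_law. AE v2 in sphere_law. AE v3 in sphere_law. AE v4 in sphere_law. proj_vol (y1, split_last v2, split_last v3, split_last v4) \<noteq> 0"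
      proof (rule eventually_mono[OF AE_proj_vol])
        fix y1 assume "AE y2 in sphere_law. AE y3 in sphere_law. AE y4 in sphere_law. proj_vol (y1, y2, y3, y4) \<noteq> 0"
        then have "AE y2 in sphere_law. AE v3 in sphere_law. AE v4 in sphere_law. proj_vol (y1, y2, split_last v3, split_last v4) \<noteq> 0"
        proof (rule eventually_mono)
          fix y2 assume "AE y3 in sphere_law. AE y4 in sphere_law. proj_vol (y1, y2, y3, y4) \<noteq> 0"
          then have "AE y3 in sphere_law. AE v4 in sphere_law. proj_vol (y1, y2, y3, split_last v4) \<noteq> 0"
            by (rule eventually_mono) (rule AE_split_last)
          then show "AE v3 in sphere_law. AE v4 in sphere_law. proj_vol (y1, y2, split_last v3, split_last v4) \<noteq> 0"
            by (rule AE_split_last)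
        qed
        then show "AE v2 in sphere_law. AE v3 in sphere_law. AE v4 in sphere_law. proj_vol (y1, split_last v2, split_last v3, split_last v4) \<noteq> 0"
          by (rule AE_split_last)
      qed
      then show ?thesis by (rule AE_split_last)
    qed
    show ?thesis
      by (rule nn_integral4_cong_AE) (use ae main in \<open>auto elim!: eventually_mono\<close>)
  qed
  \<comment> \<open>Transport from \<open>real^4\<close> to \<open>pt\<close>, one variable at a
    time from the innermost, since \<open>split_last\<close> preserves the spherical law.\<close>
  also have "\<dots> = nn_integral4 sphere_law (\<lambda>y1 y2 y3 y4. ennreal (cap_fraction (plane_height (y1, y2, y3, y4)) ^ card R + (1 - cap_fraction (plane_height (y1, y2, y3, y4))) ^ card R))"
  proof -
    interpret S: prob_space "sphere_law :: pt measure" by (rule prob_space_sphere_law)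
    define B where "B = (\<lambda>y1 y2 y3 y4. ennreal (cap_fraction (plane_height (y1, y2, y3, y4)) ^ card R + (1 - cap_fraction (plane_height (y1, y2, y3, y4))) ^ card R))"
    have cm: "cap_fraction \<in> borel_measurable borel" by (rule borel_measurable_continuous_onI[OF continuous_cap_fraction])
    have Bm[measurable (raw)]: "(\<lambda>x. B (f1 x) (f2 x) (f3 x) (f4 x)) \<in> borel_measurable M"
      if [measurable]: "f1 \<in> borel_measurable M" "f2 \<in> borel_measurable M" "f3 \<in> borel_measurable M" "f4 \<in> borel_measurable M" for M :: "'z measure" and f1 f2 f3 f4
    proof -
      have [measurable]: "(\<lambda>x. cap_fraction (plane_height (f1 x, f2 x, f3 x, f4 x))) \<in> borel_measurable M"
        by (rule measurable_compose[OF _ cm]) measurable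
      show ?thesis unfolding B_def by measurable
    qed
    have "nn_integral4 sphere_law (\<lambda>v1 v2 v3 v4. B (split_last v1) (split_last v2) (split_last v3) (split_last v4))
      = (\<integral>\<^sup>+v1. \<integral>\<^sup>+v2. \<integral>\<^sup>+v3. \<integral>\<^sup>+y4. B (split_last v1) (split_last v2) (split_last v3) y4 \<partial>sphere_law \<partial>sphere_law \<partial>sphere_law \<partial>sphere_law)"
      by (intro nn_integral_cong nn_integral_split_last) measurable
    also have "\<dots> = (\<integral>\<^sup>+v1. \<integral>\<^sup>+v2. \<integral>\<^sup>+y3. \<integral>\<^sup>+y4. B (split_last v1) (split_last v2) y3 y4 \<partial>sphere_law \<partial>sphere_law \<partial>sphere_law \<partial>sphere_law)"
      by (intro nn_integral_cong nn_integral_split_last[of "\<lambda>y3. \<integral>\<^sup>+y4. B _ _ y3 y4 \<partial>sphere_law"]) measurable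
    also have "\<dots> = (\<integral>\<^sup>+v1. \<integral>\<^sup>+y2. \<integral>\<^sup>+y3. \<integral>\<^sup>+y4. B (split_last v1) y2 y3 y4 \<partial>sphere_law \<partial>sphere_law \<partial>sphere_law \<partial>sphere_law)"
      by (intro nn_integral_cong nn_integral_split_last[of "\<lambda>y2. \<integral>\<^sup>+y3. \<integral>\<^sup>+y4. B _ y2 y3 y4 \<partial>sphere_law \<partial>sphere_law"]) measurable
    also have "\<dots> = nn_integral4 sphere_law B"
      by (intro nn_integral_split_last[of "\<lambda>y1. \<integral>\<^sup>+y2. \<integral>\<^sup>+y3. \<integral>\<^sup>+y4. B y1 y2 y3 y4 \<partial>sphere_law \<partial>sphere_law \<partial>sphere_law"]) measurable
    finally show ?thesis unfolding B_def .
  qed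
  also have "\<dots> = ennreal (256 / (35 * pi) * (1 / (2 * pi)) ^ card R * vertex_integral (card R))"
    using finR R0 by (intro nn_integral_caps_plane_height) (simp add: Suc_le_eq card_gt_0_iff)
  finally show ?thesis by (simp only: R_def)
qed

section \<open>The typical Voronoi cell\<close>

text \<open>\<open>arccos\<close> is decreasing on [-1, 1], where inner products of unit vectors
  lie. Comparing distances is thus comparing inner products, a linear condition on
  \<open>z\<close>.\<close>

lemma voronoi_cell_eq:
  fixes x :: "nat \<Rightarrow> 'a::euclidean_space"
  assumes x: "\<And>j. j \<in> {1..m} \<Longrightarrow> norm (x j) = 1" and i: "i \<in> {1..m}"
  shows "voronoi_cell m x i = normal_cone ({1..m} - {i}) (\<lambda>j. x j - x i) \<inter> sphere 0 1"
proof -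
  have "geodesic_dist (x i) z \<le> geodesic_dist (x j) z \<longleftrightarrow> (x j - x i) \<bullet> z \<le> 0" if z: "norm z = 1" and j: "j \<in> {1..m}" for z j
  proof -
    have "\<bar>x k \<bullet> z\<bar> \<le> 1" if "k \<in> {1..m}" for k
      using Cauchy_Schwarz_ineq2[of "x k" z] x[OF that] z by simp
    then show ?thesis using i j by (simp add: geodesic_dist_def arccos_le_mono inner_diff_left)
  qed
  then show ?thesis by (auto simp: voronoi_cell_def normal_cone_def)
qed

lemma inner_lt_1:
  fixes x y :: "'a::real_inner"
  assumes "norm x = 1" "norm y = 1" "x \<noteq> y"
  shows "x \<bullet> y < 1"
proof -
  have "0 < (norm (x - y))\<^sup>2" using assms by simp
  also have "\<dots> = 2 - 2 * (x \<bullet> y)"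
    using assms by (simp add: power2_norm_eq_inner inner_diff_left inner_diff_right inner_commute norm_eq_1)
  finally show ?thesis by simp
qed

lemma in_general_position_nonzero:
  fixes a :: "'i \<Rightarrow> 'a::euclidean_space"
  assumes "in_general_position J a" "j \<in> J"
  shows "a j \<noteq> 0"
proof -
  have "independent (a ` {j})"
    using assms DIM_positive[where 'a='a] unfolding in_general_position_def
    by (metis One_nat_def Suc_leI card.empty card_insert_disjoint empty_iff empty_subsetI finite.intros insert_subset)
  then show ?thesis by auto
qed

locale typical_voronoi_cell = prob_space M
  for M :: "'w measure" +
  fixes X :: "nat \<Rightarrow> 'w \<Rightarrow> real^4" and N :: "'w \<Rightarrow> nat" and R :: "real^4 \<Rightarrow> real^4 \<Rightarrow> real^4" and n :: nat
  assumes n: "n \<ge> 4"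
    and X: "\<And>i. i \<in> {1..n + 1} \<Longrightarrow> X i \<in> M \<rightarrow>\<^sub>M sphere_borel"
    and X_law: "\<And>i. i \<in> {1..n + 1} \<Longrightarrow> distr M sphere_borel (X i) = sphere_unif"
    and X_indep: "indep_vars (\<lambda>_. sphere_borel) X {1..n + 1}"
    and N: "N \<in> M \<rightarrow>\<^sub>M count_space {1..n + 1}"
    and N_law: "distr M (count_space {1..n + 1}) N = uniform_count_measure {1..n + 1}"
    and N_indep: "indep_set (sets (vimage_algebra (space M) N (count_space {1..n + 1})))
           (sets (vimage_algebra (space M) (\<lambda>\<omega>. \<lambda>i\<in>{1..n + 1}. X i \<omega>)
             (PiM {1..n + 1} (\<lambda>_. sphere_borel))))"
    and R: "pole_rotation R"
begin

abbreviation I :: "nat set" where "I \<equiv> {1..n + 1}"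

definition cell :: "nat \<Rightarrow> 'w \<Rightarrow> (real^4) set" where
  "cell i \<omega> = normal_cone (I - {i}) (\<lambda>j. X j \<omega> - X i \<omega>) \<inter> sphere 0 1"

definition vertex_at :: "nat \<Rightarrow> nat set \<Rightarrow> 'w set" where
  "vertex_at i S = {\<omega> \<in> space M. open_face (I - {i}) (\<lambda>j. X j \<omega> - X i \<omega>) S \<noteq> {}}"

lemma X_borel: "i \<in> I \<Longrightarrow> X i \<in> borel_measurable M"
  using measurable_compose[OF X measurable_restrict_space1[of "\<lambda>x. x" borel borel]] by simp

lemma norm_X: "i \<in> I \<Longrightarrow> \<omega> \<in> space M \<Longrightarrow> norm (X i \<omega>) = 1"
  using measurable_space[OF X] by (force simp: space_restrict_space)

lemma N_in: "\<omega> \<in> space M \<Longrightarrow> N \<omega> \<in> I"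
  using measurable_space[OF N] by simp

text \<open>The rotation to the pole does not change face numbers, so only the selected cell in its
  original position matters.\<close>

lemma f_num_typical_cell:
  assumes "\<omega> \<in> space M"
  shows "f_num k (typical_cell (n + 1) R X N \<omega>) = f_num k (cell (N \<omega>) \<omega>)"
proof -
  have "voronoi_cell (n + 1) (\<lambda>i. X i \<omega>) (N \<omega>) = cell (N \<omega>) \<omega>"
    unfolding cell_def using assms norm_X N_in by (intro voronoi_cell_eq) auto
  moreover have "orthogonal_transformation (R (X (N \<omega>) \<omega>))"
    using R norm_X[OF N_in[OF assms] assms] by (auto simp: pole_rotation_def)
  ultimately show ?thesis unfolding typical_cell_def cell_def
    by (simp add: f_num_orthogonal_image)
qed

lemma vertex_at_sets: "i \<in> I \<Longrightarrow> S \<subseteq> I - {i} \<Longrightarrow> vertex_at i S \<in> events"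
  unfolding vertex_at_def using X_borel by (intro sets_open_face borel_measurable_diff) auto

text \<open>Independence and the common marginal law make the joint law of the points a product, now
  over the ambient Borel sets.\<close>

lemma config_distr: "distr M (PiM I (\<lambda>_. borel)) (\<lambda>\<omega>. \<lambda>i\<in>I. X i \<omega>) = config_law I"
proof -
  have "indep_vars (\<lambda>_. borel) (\<lambda>i \<omega>. (\<lambda>x. x) (X i \<omega>)) I"
    using X_indep by (rule indep_vars_compose2) (rule measurable_restrict_space1, simp)
  then have "distr M (PiM I (\<lambda>_. borel)) (\<lambda>\<omega>. \<lambda>i\<in>I. X i \<omega>) = PiM I (\<lambda>i. distr M borel (X i))"
    using X_borel by (subst (asm) indep_vars_iff_distr_eq_PiM') auto
  also have "\<dots> = config_law I"
  proof (rule PiM_cong)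
    fix i assume i: "i \<in> I"
    have "sphere_law = distr (distr M sphere_borel (X i)) borel (\<lambda>x. x)"
      by (simp add: sphere_law_def X_law[OF i])
    also have "\<dots> = distr M borel (X i)"
      using X[OF i] by (subst distr_distr) (auto simp: comp_def intro: measurable_restrict_space1)
    finally show "distr M borel (X i) = sphere_law" by simp
  qed simp
  finally show ?thesis .
qed

lemma config_measurable: "(\<lambda>\<omega>. \<lambda>i\<in>I. X i \<omega>) \<in> M \<rightarrow>\<^sub>M PiM I (\<lambda>_. borel)"
  using X_borel by (intro measurable_restrict) auto

lemma open_face_restrict:
  assumes "i \<in> I" "S \<subseteq> I - {i}"
  shows "open_face (I - {i}) (\<lambda>j. (\<lambda>l\<in>I. x l) j - (\<lambda>l\<in>I. x l) i) S = open_face (I - {i}) (\<lambda>j. x j - x i :: real^4) S"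
  using assms unfolding open_face_def tight_flat_def by (auto simp: subset_iff)

lemma prob_vertex_at:
  assumes i: "i \<in> I" and S: "S \<subseteq> I - {i}" "card S = 3"
  shows "prob (vertex_at i S) = 256 / (35 * pi) * (1 / (2 * pi)) ^ (n - 3) * vertex_integral (n - 3)"
proof -
  let ?A = "{x \<in> space (config_law I). open_face (I - {i}) (\<lambda>j. x j - x i) S \<noteq> {}}"
  have A: "?A \<in> sets (PiM I (\<lambda>_. borel))"
  proof -
    have "?A \<in> sets (config_law I)" using i S measurable_config_diff[of _ I i] by (intro sets_open_face) auto
    also have "sets (config_law I) = sets (PiM I (\<lambda>_. borel))" by (intro sets_PiM_cong) auto
    finally show ?thesis .
  qed
  \<comment> \<open>Of the \<open>n + 1\<close> points the nucleus and three neighbours are removed.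
    The rest is nonempty because \<open>n\<close> is at least 4.\<close>
  have card: "card (I - {i} - S) = n - 3"
    using i S by (subst card_Diff_subset) (auto intro: finite_subset)
  then have ne: "I - {i} - S \<noteq> {}" using n by (metis card.empty diff_is_0_eq not_less_eq_eq numeral_3_eq_3 eval_nat_numeral(2) semiring_norm(26) semiring_norm(27))
  have sp: "(\<lambda>l\<in>I. X l \<omega>) \<in> space (config_law I)" for \<omega> by (simp add: space_PiM)
  have "vertex_at i S = (\<lambda>\<omega>. \<lambda>l\<in>I. X l \<omega>) -` ?A \<inter> space M"
    using sp unfolding vertex_at_def vimage_def by (auto simp only: open_face_restrict[OF i S(1)] mem_Collect_eq Int_iff)
  then have "emeasure M (vertex_at i S) = emeasure (distr M (PiM I (\<lambda>_. borel)) (\<lambda>\<omega>. \<lambda>l\<in>I. X l \<omega>)) ?A"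
    using emeasure_distr[OF config_measurable A] by simp
  also have "\<dots> = ennreal (256 / (35 * pi) * (1 / (2 * pi)) ^ (n - 3) * vertex_integral (n - 3))"
    unfolding config_distr using emeasure_vertex_event[of I i S, OF _ i S ne] unfolding card by simp
  finally have "ennreal (prob (vertex_at i S)) = ennreal (256 / (35 * pi) * (1 / (2 * pi)) ^ (n - 3) * vertex_integral (n - 3))"
    by (simp only: emeasure_eq_measure)
  moreover have "0 \<le> 256 / (35 * pi) * (1 / (2 * pi)) ^ (n - 3) * vertex_integral (n - 3)"
    by (intro mult_nonneg_nonneg vertex_integral_nonneg) simp_all
  ultimately show ?thesis by (simp only: ennreal_inj[OF measure_nonneg])
qed

lemma prob_N: "i \<in> I \<Longrightarrow> prob (N -` {i} \<inter> space M) = 1 / real (n + 1)"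
proof -
  assume i: "i \<in> I"
  have "prob (N -` {i} \<inter> space M) = measure (distr M (count_space I) N) {i}"
    using i by (intro measure_distr[OF N, symmetric]) auto
  also have "\<dots> = 1 / real (n + 1)" unfolding N_law using i by (subst measure_uniform_count_measure) auto
  finally show ?thesis .
qed

lemma prob_N_vertex_at:
  assumes i: "i \<in> I" and S: "S \<subseteq> I - {i}"
  shows "prob ((N -` {i} \<inter> space M) \<inter> vertex_at i S) = prob (N -` {i} \<inter> space M) * prob (vertex_at i S)"
proof (rule indep_setD[OF N_indep])
  show "N -` {i} \<inter> space M \<in> sets (vimage_algebra (space M) N (count_space I))"
    using i by (intro in_vimage_algebra) auto
  \<comment> \<open>Here the product is formed over \<open>sphere_borel\<close>, since this is the
    sigma-algebra for which the independence of \<open>N\<close> is given.\<close>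
  let ?P = "PiM I (\<lambda>_. sphere_borel) :: (nat \<Rightarrow> real^4) measure"
  let ?A = "{x \<in> space ?P. open_face (I - {i}) (\<lambda>j. x j - x i) S \<noteq> {}}"
  have comp: "(\<lambda>x. x j) \<in> ?P \<rightarrow>\<^sub>M borel" if "j \<in> I" for j
    using measurable_compose[OF measurable_component_singleton[OF that] measurable_restrict_space1[of "\<lambda>x. x" borel borel]] by simp
  have "?A \<in> sets ?P" using i S comp by (intro sets_open_face borel_measurable_diff) auto
  moreover have "vertex_at i S = (\<lambda>\<omega>. \<lambda>l\<in>I. X l \<omega>) -` ?A \<inter> space M"
  proof -
    have "(\<lambda>l\<in>I. X l \<omega>) \<in> space ?P" if "\<omega> \<in> space M" for \<omega>
      using that norm_X by (auto simp: space_PiM space_restrict_space)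
    then show ?thesis unfolding vertex_at_def vimage_def
      by (auto simp only: open_face_restrict[OF i S] mem_Collect_eq Int_iff)
  qed
  ultimately show "vertex_at i S \<in> sets (vimage_algebra (space M) (\<lambda>\<omega>. \<lambda>i\<in>I. X i \<omega>) ?P)"
    by (simp only: in_vimage_algebra)
qed

lemma AE_general: "AE \<omega> in M. \<forall>i\<in>I. in_general_position (I - {i}) (\<lambda>j. X j \<omega> - X i \<omega>)"
proof (rule AE_finite_allI)
  fix i assume i: "i \<in> I"
  have "AE x in distr M (PiM I (\<lambda>_. borel)) (\<lambda>\<omega>. \<lambda>i\<in>I. X i \<omega>). in_general_position (I - {i}) (\<lambda>j. x j - x i)"
    unfolding config_distr using i by (intro AE_general_position) auto
  then have "AE \<omega> in M. in_general_position (I - {i}) (\<lambda>j. (\<lambda>i\<in>I. X i \<omega>) j - (\<lambda>i\<in>I. X i \<omega>) i)"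
    by (rule AE_distrD[OF config_measurable])
  moreover have "in_general_position (I - {i}) (\<lambda>j. (\<lambda>i\<in>I. X i \<omega>) j - (\<lambda>i\<in>I. X i \<omega>) i) \<longleftrightarrow> in_general_position (I - {i}) (\<lambda>j. X j \<omega> - X i \<omega>)" for \<omega>
    unfolding in_general_position_def
  proof (intro all_cong1 imp_cong conj_cong refl)
    fix T assume T: "T \<subseteq> I - {i}"
    then have eq: "(\<lambda>i\<in>I. X i \<omega>) j - (\<lambda>i\<in>I. X i \<omega>) i = X j \<omega> - X i \<omega>" if "j \<in> T" for j using that i by auto
    show "inj_on (\<lambda>j. (\<lambda>i\<in>I. X i \<omega>) j - (\<lambda>i\<in>I. X i \<omega>) i) T = inj_on (\<lambda>j. X j \<omega> - X i \<omega>) T"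
      by (rule inj_on_cong) (rule eq)
    have "(\<lambda>j. (\<lambda>i\<in>I. X i \<omega>) j - (\<lambda>i\<in>I. X i \<omega>) i) ` T = (\<lambda>j. X j \<omega> - X i \<omega>) ` T"
      by (rule image_cong[OF refl]) (rule eq)
    then show "independent ((\<lambda>j. (\<lambda>i\<in>I. X i \<omega>) j - (\<lambda>i\<in>I. X i \<omega>) i) ` T) = independent ((\<lambda>j. X j \<omega> - X i \<omega>) ` T)" by simp
  qed
  ultimately show "AE \<omega> in M. in_general_position (I - {i}) (\<lambda>j. X j \<omega> - X i \<omega>)" by simp
qed simp

text \<open>The nucleus is an interior point of its own cell: its product with
  \<open>X j \<omega> - X i \<omega>\<close> is a cosine minus 1, negative as general position makes
  the points distinct.\<close>

lemma cell_relations: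
  assumes \<omega>: "\<omega> \<in> space M" and i: "i \<in> I" and g: "in_general_position (I - {i}) (\<lambda>j. X j \<omega> - X i \<omega>)"
  shows "2 * f_num 1 (cell i \<omega>) = 3 * f_num 0 (cell i \<omega>)" "2 * f_num 2 (cell i \<omega>) = f_num 0 (cell i \<omega>) + 4"
    "f_num 0 (cell i \<omega>) = card {S. S \<subseteq> I - {i} \<and> card S = 3 \<and> \<omega> \<in> vertex_at i S}"
proof -
  have x0: "(X j \<omega> - X i \<omega>) \<bullet> X i \<omega> < 0" if j: "j \<in> I - {i}" for j
  proof -
    have "X j \<omega> \<noteq> X i \<omega>" using in_general_position_nonzero[OF g j] by simp
    then have "X j \<omega> \<bullet> X i \<omega> < 1" using j i norm_X \<omega> by (intro inner_lt_1) auto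
    moreover have "X i \<omega> \<bullet> X i \<omega> = 1" using norm_X[OF i \<omega>] by (simp add: norm_eq_1)
    ultimately show ?thesis by (simp add: inner_diff_left)
  qed
  have card: "4 \<le> card (I - {i})" using i n by simp
  have dim4: "DIM(real^4) = 4" by simp
  note r = f_num_relations[OF dim4 _ card g x0]
  show "2 * f_num 1 (cell i \<omega>) = 3 * f_num 0 (cell i \<omega>)" "2 * f_num 2 (cell i \<omega>) = f_num 0 (cell i \<omega>) + 4"
    unfolding cell_def by (rule r; simp)+
  show "f_num 0 (cell i \<omega>) = card {S. S \<subseteq> I - {i} \<and> card S = 3 \<and> \<omega> \<in> vertex_at i S}"
    unfolding cell_def using \<omega> by (subst r(3)) (simp_all add: vertex_at_def)
qed

section \<open>Expected face numbers\<close>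

definition faces :: "nat \<Rightarrow> 'w \<Rightarrow> real" where
  "faces k \<omega> = real (f_num k (typical_cell (n + 1) R X N \<omega>))"

lemma faces_sum:
  assumes "\<omega> \<in> space M"
  shows "faces k \<omega> = (\<Sum>i\<in>I. indicator (N -` {i} \<inter> space M) \<omega> * real (f_num k (cell i \<omega>)))"
proof -
  have "(\<Sum>i\<in>I. indicator (N -` {i} \<inter> space M) \<omega> * real (f_num k (cell i \<omega>)))
    = (\<Sum>i\<in>I. if i = N \<omega> then real (f_num k (cell i \<omega>)) else 0)"
    using assms by (intro sum.cong) (auto split: split_indicator)
  also have "\<dots> = real (f_num k (cell (N \<omega>) \<omega>))" using N_in[OF assms] by (simp add: sum.delta')
  finally show ?thesis using f_num_typical_cell[OF assms] by (simp add: faces_def)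
qed

lemma N_event: "i \<in> I \<Longrightarrow> N -` {i} \<inter> space M \<in> events"
  using N by (intro measurable_sets) auto

lemma faces_measurable: "faces k \<in> borel_measurable M"
proof -
  have "(\<lambda>\<omega>. \<Sum>i\<in>I. indicator (N -` {i} \<inter> space M) \<omega> * real (f_num k (cell i \<omega>))) \<in> borel_measurable M"
    unfolding cell_def using N_event X_borel
    by (intro borel_measurable_sum borel_measurable_times borel_measurable_indicator measurable_f_num borel_measurable_diff) auto
  then show ?thesis by (subst measurable_cong[OF faces_sum])
qed

text \<open>Faces correspond to sets of tight constraints among the \<open>n\<close> available ones.
  The crude bound serves integrability only.\<close>

lemma faces_bound: "\<omega> \<in> space M \<Longrightarrow> \<bar>faces k \<omega>\<bar> \<le> 2 ^ n"
proof -
  assume \<omega>: "\<omega> \<in> space M"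
  have "f_num k (cell (N \<omega>) \<omega>) \<le> card (Pow (I - {N \<omega>}))"
    unfolding cell_def by (subst f_num_normal_cone) (auto intro!: card_mono)
  also have "\<dots> = 2 ^ n" using N_in[OF \<omega>] by (simp add: card_Pow)
  finally have "real (f_num k (cell (N \<omega>) \<omega>)) \<le> 2 ^ n" by (metis of_nat_le_iff of_nat_numeral of_nat_power)
  then show ?thesis using f_num_typical_cell[OF \<omega>] by (simp add: faces_def)
qed

lemma faces_integrable: "integrable M (faces k)"
  by (rule integrable_const_bound[where B = "2 ^ n"]) (auto intro: AE_I2 faces_bound faces_measurable)

lemma AE_faces:
  "AE \<omega> in M. faces 1 \<omega> = 3 / 2 * faces 0 \<omega> \<and> faces 2 \<omega> = 1 / 2 * faces 0 \<omega> + 2 \<and>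
     faces 0 \<omega> = (\<Sum>i\<in>I. \<Sum>S | S \<subseteq> I - {i} \<and> card S = 3. indicator ((N -` {i} \<inter> space M) \<inter> vertex_at i S) \<omega>)"
  using AE_general AE_space
proof eventually_elim
  case (elim \<omega>)
  have Ni: "N \<omega> \<in> I" using N_in elim(2) by blast
  note r = cell_relations[OF elim(2)]
  have g: "in_general_position (I - {i}) (\<lambda>j. X j \<omega> - X i \<omega>)" if "i \<in> I" for i using elim(1) that by blast
  have f: "faces k \<omega> = real (f_num k (cell (N \<omega>) \<omega>))" for k
    using f_num_typical_cell[OF elim(2)] by (simp add: faces_def)
  have "2 * faces 1 \<omega> = 3 * faces 0 \<omega>" "2 * faces 2 \<omega> = faces 0 \<omega> + 4"
    using r(1,2)[OF Ni g[OF Ni]] unfolding f by linarith+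
  then have 1: "faces 1 \<omega> = 3 / 2 * faces 0 \<omega>" "faces 2 \<omega> = 1 / 2 * faces 0 \<omega> + 2" by simp_all
  have "real (f_num 0 (cell i \<omega>)) = (\<Sum>S | S \<subseteq> I - {i} \<and> card S = 3. indicator (vertex_at i S) \<omega>)" if i: "i \<in> I" for i
  proof -
    have fin: "finite {S. S \<subseteq> I - {i} \<and> card S = 3}" by (rule finite_subset[of _ "Pow I"]) auto
    have "(\<Sum>S | S \<subseteq> I - {i} \<and> card S = 3. indicator (vertex_at i S) \<omega>)
        = (\<Sum>S | S \<subseteq> I - {i} \<and> card S = 3. if S \<in> {S. \<omega> \<in> vertex_at i S} then 1 else 0 :: real)"
      by (intro sum.cong) (auto simp: indicator_def)
    also have "\<dots> = real (card ({S. S \<subseteq> I - {i} \<and> card S = 3} \<inter> {S. \<omega> \<in> vertex_at i S}))"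
      using fin by (subst sum.If_cases) auto
    also have "{S. S \<subseteq> I - {i} \<and> card S = 3} \<inter> {S. \<omega> \<in> vertex_at i S} = {S. S \<subseteq> I - {i} \<and> card S = 3 \<and> \<omega> \<in> vertex_at i S}" by auto
    finally show ?thesis using r(3)[OF i g[OF i]] by simp
  qed
  then have "faces 0 \<omega> = (\<Sum>i\<in>I. indicator (N -` {i} \<inter> space M) \<omega> * (\<Sum>S | S \<subseteq> I - {i} \<and> card S = 3. indicator (vertex_at i S) \<omega>))"
    unfolding faces_sum[OF elim(2)] by (intro sum.cong) auto
  then show ?case using 1 by (simp add: sum_distrib_left indicator_inter_arith)
qed

text \<open>The mean number of vertices is a sum of probabilities over nuclei \<open>i\<close> and
  triples \<open>S\<close>. Independence of \<open>N\<close> splits each into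
  \<open>1 / (n + 1)\<close> times the vertex probability, the \<open>n + 1\<close> nuclei cancel
  the denominator, and each has \<open>n choose 3\<close> triples.\<close>

lemma expectation_faces_0:
  "expectation (faces 0) = real (n choose 3) * (256 / (35 * pi) * (1 / (2 * pi)) ^ (n - 3) * vertex_integral (n - 3))"
proof -
  let ?q = "256 / (35 * pi) * (1 / (2 * pi)) ^ (n - 3) * vertex_integral (n - 3)"
  let ?ev = "\<lambda>i S. (N -` {i} \<inter> space M) \<inter> vertex_at i S"
  have ev: "?ev i S \<in> events" if "i \<in> I" "S \<in> {S. S \<subseteq> I - {i} \<and> card S = 3}" for i S
    using that N_event vertex_at_sets by auto
  have "expectation (faces 0) = expectation (\<lambda>\<omega>. \<Sum>i\<in>I. \<Sum>S | S \<subseteq> I - {i} \<and> card S = 3. indicator (?ev i S) \<omega>)"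
    using ev AE_faces by (intro integral_cong_AE faces_measurable borel_measurable_sum borel_measurable_indicator) (auto elim!: eventually_mono)
  also have "\<dots> = (\<Sum>i\<in>I. \<Sum>S | S \<subseteq> I - {i} \<and> card S = 3. prob (?ev i S))"
  proof -
    have int: "integrable M (indicator (?ev i S) :: _ \<Rightarrow> real)" if "i \<in> I" "S \<in> {S. S \<subseteq> I - {i} \<and> card S = 3}" for i S
      by (rule integrable_const_bound[where B = 1])
        (use ev[OF that] in \<open>auto intro: borel_measurable_indicator AE_I2 simp: indicator_def\<close>)
    have "expectation (\<lambda>\<omega>. \<Sum>i\<in>I. \<Sum>S | S \<subseteq> I - {i} \<and> card S = 3. indicator (?ev i S) \<omega>)
      = (\<Sum>i\<in>I. expectation (\<lambda>\<omega>. \<Sum>S | S \<subseteq> I - {i} \<and> card S = 3. indicator (?ev i S) \<omega> :: real))"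
      by (rule Bochner_Integration.integral_sum, rule Bochner_Integration.integrable_sum) (rule int)
    also have "\<dots> = (\<Sum>i\<in>I. \<Sum>S | S \<subseteq> I - {i} \<and> card S = 3. expectation (indicator (?ev i S)))"
      by (rule sum.cong[OF refl], rule Bochner_Integration.integral_sum) (rule int)
    also have "\<dots> = (\<Sum>i\<in>I. \<Sum>S | S \<subseteq> I - {i} \<and> card S = 3. prob (?ev i S))"
    proof (intro sum.cong refl)
      fix i S assume "i \<in> I" "S \<in> {S. S \<subseteq> I - {i} \<and> card S = 3}"
      note ev[OF this]
      then show "expectation (indicator (?ev i S)) = prob (?ev i S)"
        by (subst Bochner_Integration.integral_indicator) (simp only: Int_absorb2[OF sets.sets_into_space])
    qed
    finally show ?thesis .
  qed
  also have "\<dots> = (\<Sum>i\<in>I. \<Sum>S | S \<subseteq> I - {i} \<and> card S = 3. 1 / real (n + 1) * ?q)"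
  proof (intro sum.cong refl)
    fix i S assume i: "i \<in> I" and S: "S \<in> {S. S \<subseteq> I - {i} \<and> card S = 3}"
    then show "prob (?ev i S) = 1 / real (n + 1) * ?q"
      using prob_N_vertex_at[OF i] prob_N[OF i] prob_vertex_at[OF i] by simp
  qed
  also have "\<dots> = (\<Sum>i\<in>I. real (n choose 3) * (1 / real (n + 1) * ?q))"
  proof (intro sum.cong refl)
    fix i assume i: "i \<in> I"
    have "card {S. S \<subseteq> I - {i} \<and> card S = 3} = n choose 3" using n_subsets[of "I - {i}" 3] i by simp
    then show "(\<Sum>S | S \<subseteq> I - {i} \<and> card S = 3. 1 / real (n + 1) * ?q) = real (n choose 3) * (1 / real (n + 1) * ?q)" by simp
  qed
  also have "\<dots> = real (n choose 3) * ?q" by simp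
  finally show ?thesis .
qed

lemma expectation_faces:
  "expectation (faces 1) = 3 / 2 * expectation (faces 0)"
  "expectation (faces 2) = 1 / 2 * expectation (faces 0) + 2"
proof -
  have "expectation (faces 1) = expectation (\<lambda>\<omega>. 3 / 2 * faces 0 \<omega>)"
    using AE_faces by (intro integral_cong_AE borel_measurable_times borel_measurable_const faces_measurable) (auto elim!: eventually_mono)
  then show "expectation (faces 1) = 3 / 2 * expectation (faces 0)" by simp
  have "expectation (faces 2) = expectation (\<lambda>\<omega>. 1 / 2 * faces 0 \<omega> + 2)"
    using AE_faces by (intro integral_cong_AE borel_measurable_add borel_measurable_times borel_measurable_const faces_measurable) (auto elim!: eventually_mono)
  also have "\<dots> = 1 / 2 * expectation (faces 0) + 2"
    using faces_integrable[of 0] by (subst Bochner_Integration.integral_add) (auto simp: prob_space)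
  finally show "expectation (faces 2) = 1 / 2 * expectation (faces 0) + 2" .
qed

end

theorem corollary3p8:
  fixes M :: "'w measure"
    and X :: "nat \<Rightarrow> 'w \<Rightarrow> real^4"
    and N :: "'w \<Rightarrow> nat"
    and R :: "real^4 \<Rightarrow> real^4 \<Rightarrow> real^4"
    and n :: nat
  defines "V \<equiv> typical_cell (n + 1) R X N"
  defines "E \<equiv> \<lambda>k. prob_space.expectation M (\<lambda>\<omega>. real (f_num k (V \<omega>)))"
  assumes "n \<ge> 4"
    and "prob_space M"
    and "\<And>i. i \<in> {1..n + 1} \<Longrightarrow> X i \<in> M \<rightarrow>\<^sub>M sphere_borel"
    and "\<And>i. i \<in> {1..n + 1} \<Longrightarrow> distr M sphere_borel (X i) = sphere_unif"
    and "prob_space.indep_vars M (\<lambda>_. sphere_borel) X {1..n + 1}"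
    and "N \<in> M \<rightarrow>\<^sub>M count_space {1..n + 1}"
    and "distr M (count_space {1..n + 1}) N = uniform_count_measure {1..n + 1}"
    and "prob_space.indep_set M
           (sets (vimage_algebra (space M) N (count_space {1..n + 1})))
           (sets (vimage_algebra (space M) (\<lambda>\<omega>. \<lambda>i\<in>{1..n + 1}. X i \<omega>)
             (PiM {1..n + 1} (\<lambda>_. sphere_borel))))"
    and "pole_rotation R"
  shows "E 0 = 256 / (35 * pi) * (1 / (2 * pi)) ^ (n - 3) * real (n choose 3) *
           integral {- pi / 2..pi / 2} (\<lambda>x. cos x ^ 8 * (2 * x + sin (2 * x) + pi) ^ (n - 3))
       \<and> E 1 = 3 / 2 * E 0
       \<and> E 2 = 1 / 2 * E 0 + 2"
proof -
  interpret prob_space M by fact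
  interpret typical_voronoi_cell M X N R n
    by unfold_locales (fact assms(3-))+
  have E: "E k = expectation (faces k)" for k
    by (simp add: E_def V_def faces_def[abs_def])
  show ?thesis
    unfolding E expectation_faces expectation_faces_0 vertex_integral_def by (simp add: mult_ac)
qed

end
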